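(* Let $q$ be a prime and assume the generalized Riemann hypothesis for Dirichlet $L$-functions modulo $q$. Then, for any fixed $t>0$, \[ \frac{1}{q-2}\sum_{\substack{\chi \ (\mathrm{mod}\ q) \\ \chi \ne \chi_0}} \ \underset{s=\frac{1}{2}}{\mathrm{ord}} \ L\!\left(s+ \frac{2 \pi i t }{\log q}\,,\,\chi\right) \ \le \ \frac{1}{2} \left(1+\left|\frac{\sin 4 \pi t }{4\pi t}\right|\right)^{-1} + O\!\left(\frac{1}{\log q}\right), \] where $\chi_0$ denotes the principal character modulo $q$. Consequently, for any $\varepsilon>0$, the proportion of primitive Dirichlet characters $\chi$ modulo $q$ for which $L\!\left( \frac{1}{2}+ \frac{2 \pi i t }{\log q},\chi\right) \ne 0$ is at least $1-\frac{1}{2} \left(1+\left|\frac{\sin 4 \pi t }{4\pi t}\right|\right)^{-1} - \varepsilon$ when $q$ is sufficiently large.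
   Context: $\mathrm{ord}_{s=s_0} L(s,\chi)$ denotes the order of vanishing of $L(s,\chi)$ at $s_0$ (zero if $L(s_0,\chi)\neq 0$). For $q$ prime, the non-principal characters modulo $q$ are exactly the $q-2$ primitive characters modulo $q$. *)

theory Defs
  imports "HOL-Complex_Analysis.Complex_Analysis"
begin

definition dirichlet_char :: "nat \<Rightarrow> (nat \<Rightarrow> complex) \<Rightarrow> bool" where
  "dirichlet_char q \<psi> \<longleftrightarrow> q > 0 \<and> (\<forall>n. \<psi> (n + q) = \<psi> n)
     \<and> (\<forall>m n. \<psi> (m * n) = \<psi> m * \<psi> n) \<and> \<psi> 1 = 1
     \<and> (\<forall>n. \<psi> n = 0 \<longleftrightarrow> \<not> coprime n q)"

definition principal_char :: "nat \<Rightarrow> nat \<Rightarrow> complex" where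
  "principal_char q n = (if coprime n q then 1 else 0)"

text \<open>The Dirichlet L-function: the (unique) analytic continuation of the Dirichlet series
  sum chi(n) n^(-s) from Re s > 1 to C (to C minus 1 for the principal character).\<close>
definition dirichlet_L :: "nat \<Rightarrow> (nat \<Rightarrow> complex) \<Rightarrow> complex \<Rightarrow> complex" where
  "dirichlet_L q \<psi> = (SOME f.
      f holomorphic_on (if \<psi> = principal_char q then - {1} else UNIV) \<and>
      (\<forall>s. Re s > 1 \<longrightarrow> f s = (\<Sum>n. \<psi> n / of_nat n powr s)))"

definition GRH_mod :: "nat \<Rightarrow> bool" where
  "GRH_mod q \<longleftrightarrow> (\<forall>\<psi>. dirichlet_char q \<psi> \<longrightarrow>
     (\<forall>s. 0 < Re s \<and> Re s < 1 \<and> dirichlet_L q \<psi> s = 0 \<longrightarrow> Re s = 1/2))"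

definition nonprincipal_chars :: "nat \<Rightarrow> (nat \<Rightarrow> complex) set" where
  "nonprincipal_chars q = {\<psi>. dirichlet_char q \<psi> \<and> \<psi> \<noteq> principal_char q}"

end

theory Submission
  imports Defs "HOL-Number_Theory.Number_Theory" "HOL-Probability.Probability" "HOL-Real_Asymp.Real_Asymp"
begin

text \<open>Write \<open>\<xi>\<close> for the completed \<open>L\<close>-function and \<open>\<gamma> = 2\<pi>t / log q\<close>. Under the generalized Riemann hypothesis
  \<open>Re (\<xi>' / \<xi>)\<close> is nonnegative on \<open>Re s > 1/2\<close>, and on the line \<open>Re s = 1/2 + h\<close> each zero contributes a
  Poisson kernel of width \<open>h\<close>. Integrate \<open>Re (\<xi>' / \<xi>)\<close> against \<open>\<phi>(y log q)\<close>, where the nonnegative function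
  \<open>\<phi>(x) = 2 (S(x - p) + \<sigma> S(x + p))\<^sup>2\<close>, \<open>S(x) = sin x / x\<close>, \<open>p = 2\<pi>t\<close>, \<open>\<sigma> = \<plusminus>1\<close>, has Fourier transform supported
  in \<open>[-2, 2]\<close>. Letting \<open>h\<close> tend to \<open>0\<close>, the mass at \<open>1/2 \<plusminus> i\<gamma>\<close> is bounded by the archimedean term plus a sum
  over prime powers \<open>n < q\<^sup>2\<close>, and orthogonality of characters makes the average of the latter \<open>O(1 / log q)\<close>.
  Since \<open>\<phi>(\<plusminus>p) = 2 (1 + \<sigma> b)\<^sup>2\<close> and \<open>\<integral>\<phi> = 4\<pi> (1 + \<sigma> b)\<close> with \<open>b = sin 4\<pi>t / 4\<pi>t\<close>, choosing \<open>\<sigma> = sgn b\<close> gives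
  the bound. The zeros at \<open>1/2 + i\<gamma>\<close> and \<open>1/2 - i\<gamma>\<close> have the same total multiplicity because complex conjugation
  permutes the characters.\<close>

section \<open>Dirichlet characters modulo a prime\<close>

text \<open>Positivity is not read off a product over zeros. The quotient
  \<open>xi (s - u) / xi (s + u)\<close> has modulus 1 on the critical line by the functional
  equation and at most 1 on \<open>Re s = 3\<close> once \<open>ln (q / pi)\<close> dominates, so
  Phragmen-Lindelof bounds it by 1 in between, and small \<open>u\<close> gives the sign of Re (xi'
  / xi). Contours then move only to the right, where no residue arises. Nonvanishing on
  \<open>Re s = 1\<close> has to be supplied, because \<open>GRH_mod\<close> speaks of the open
  strip. As \<open>dirichlet_L\<close> is a \<open>SOME\<close>, an entire continuation has to be
  exhibited; this is what the Mellin transforms are for. The length \<open>q\<^sup>2\<close> is the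
  limit of orthogonality: the weights \<open>n powr (-1/2)\<close> up to \<open>q\<^sup>2\<close>
  add up to about \<open>q\<close>, the number of characters. The Fourier transform vanishes
  linearly at the ends of its support, and this absorbs the logarithm in the trivial bound for the
  von Mangoldt function, so nothing about the distribution of primes enters. The sum inside the
  square combines the reproducing kernels at \<open>p\<close> and \<open>-p\<close> of the
  Paley-Wiener space; the quantity that matters is the ratio 2 pi / (1 + \<sigma> b) of the integral
  to the value at \<open>p\<close>.\<close>

lemma dirichlet_charD:
  assumes "dirichlet_char q \<psi>"
  shows "q > 0" "\<psi> (n + q) = \<psi> n" "\<psi> (m * n) = \<psi> m * \<psi> n" "\<psi> (Suc 0) = 1" "\<psi> 1 = 1"
    "\<psi> n = 0 \<longleftrightarrow> \<not> coprime n q"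
  using assms unfolding dirichlet_char_def One_nat_def by blast+

lemma dirichlet_char_add_mult:
  assumes "dirichlet_char q \<psi>"
  shows "\<psi> (n + k * q) = \<psi> n"
proof (induction k)
  case (Suc k)
  have "n + Suc k * q = (n + k * q) + q" by simp
  then show ?case using Suc dirichlet_charD(2)[OF assms] by metis
qed simp

lemma dirichlet_char_mod:
  assumes "dirichlet_char q \<psi>"
  shows "\<psi> (n mod q) = \<psi> n"
  using dirichlet_char_add_mult[OF assms, of "n mod q" "n div q"] by simp

lemma dirichlet_char_cong:
  assumes "dirichlet_char q \<psi>" "[m = n] (mod q)"
  shows "\<psi> m = \<psi> n"
  using assms dirichlet_char_mod unfolding cong_def by metis

lemma dirichlet_char_power:
  assumes "dirichlet_char q \<psi>"
  shows "\<psi> (n ^ k) = \<psi> n ^ k"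
  by (induction k) (use dirichlet_charD[OF assms] in auto)

lemma coprime_prime_iff: "prime (q::nat) \<Longrightarrow> coprime n q \<longleftrightarrow> \<not> q dvd n"
  by (metis coprime_absorb_right coprime_commute not_prime_unit prime_imp_coprime)

lemma dirichlet_char_power_eq_1:
  assumes "prime q" "dirichlet_char q \<psi>" "\<not> q dvd n"
  shows "\<psi> n ^ (q - 1) = 1"
proof -
  have "[n ^ (q - 1) = 1] (mod q)" using fermat_theorem assms by blast
  from dirichlet_char_cong[OF assms(2) this] show ?thesis
    using dirichlet_char_power[OF assms(2)] dirichlet_charD[OF assms(2)] by simp
qed

lemma norm_dirichlet_char:
  assumes "prime q" "dirichlet_char q \<psi>" "\<not> q dvd n"
  shows "cmod (\<psi> n) = 1"
proof -
  have "cmod (\<psi> n) ^ (q - 1) = 1"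
    using dirichlet_char_power_eq_1[OF assms] by (metis norm_one norm_power)
  moreover have "q - 1 > 0" using prime_gt_1_nat[OF assms(1)] by simp
  ultimately show ?thesis using power_eq_1_iff[of "cmod (\<psi> n)" "q - 1"] by auto
qed

lemma norm_dirichlet_char_le_1:
  assumes "prime q" "dirichlet_char q \<psi>"
  shows "cmod (\<psi> n) \<le> 1"
  using norm_dirichlet_char[OF assms, of n] dirichlet_charD(6)[OF assms(2), of n] coprime_prime_iff[OF assms(1), of n]
  by (cases "q dvd n") auto

lemma principal_char_eq:
  "prime q \<Longrightarrow> principal_char q n = (if q dvd n then 0 else 1)"
  by (simp add: principal_char_def coprime_prime_iff)

lemma dirichlet_char_principal: "prime q \<Longrightarrow> dirichlet_char q (principal_char q)"
  using prime_gt_1_nat[of q]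
  by (auto simp: dirichlet_char_def principal_char_eq coprime_prime_iff prime_dvd_mult_nat dvd_add_left_iff)

lemma dirichlet_char_cnj:
  "dirichlet_char q \<psi> \<Longrightarrow> dirichlet_char q (\<lambda>n. cnj (\<psi> n))"
  by (simp add: dirichlet_char_def)

lemma dirichlet_char_mult:
  "dirichlet_char q \<psi> \<Longrightarrow> dirichlet_char q \<theta> \<Longrightarrow> dirichlet_char q (\<lambda>n. \<psi> n * \<theta> n)"
  by (simp add: dirichlet_char_def)

lemma cnj_principal_char: "cnj (principal_char q n) = principal_char q n"
  by (simp add: principal_char_def)

lemma bij_betw_mult_mod_prime:
  assumes "prime (q::nat)" "\<not> q dvd b"
  shows "bij_betw (\<lambda>a. a * b mod q) {..<q} {..<q}"
proof -
  have "inj_on (\<lambda>a. a * b mod q) {..<q}"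
  proof (rule inj_onI)
    fix x y assume xy: "x \<in> {..<q}" "y \<in> {..<q}" "x * b mod q = y * b mod q"
    have "coprime b q" using assms coprime_prime_iff by blast
    then have "[x = y] (mod q)" using xy(3) cong_mult_rcancel_nat[of b q x y] by (simp add: cong_def)
    then show "x = y" using xy by (simp add: cong_def)
  qed
  moreover have "(\<lambda>a. a * b mod q) ` {..<q} \<subseteq> {..<q}"
    using prime_gt_0_nat[OF assms(1)] by auto
  ultimately show ?thesis
    by (simp add: bij_betw_def endo_inj_surj)
qed

locale nonprincipal_char =
  fixes q :: nat and \<psi> :: "nat \<Rightarrow> complex"
  assumes prime_q: "prime q" and char: "dirichlet_char q \<psi>" and nonprincipal: "\<psi> \<noteq> principal_char q"
begin

lemma q_gt_1: "q > 1" and q_pos: "q > 0"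
  using prime_gt_1_nat[OF prime_q] by auto

lemma char_0 [simp]: "\<psi> 0 = 0"
  using dirichlet_charD(6)[OF char, of 0] q_gt_1 by auto

lemma char_1 [simp]: "\<psi> (Suc 0) = 1"
  using dirichlet_charD[OF char] by simp

lemma char_mult: "\<psi> (m * n) = \<psi> m * \<psi> n"
  using dirichlet_charD[OF char] by simp

lemma norm_char_le: "cmod (\<psi> n) \<le> 1"
  by (rule norm_dirichlet_char_le_1[OF prime_q char])

lemma nonprincipal_char_cnj: "nonprincipal_char q (\<lambda>n. cnj (\<psi> n))"
proof
  show "(\<lambda>n. cnj (\<psi> n)) \<noteq> principal_char q"
    using nonprincipal cnj_principal_char by (metis complex_cnj_cnj ext)
qed (use prime_q dirichlet_char_cnj[OF char] in auto)

text \<open>Multiplication by a residue \<open>b\<close> with \<open>\<psi> b \<noteq> 1\<close>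
  permutes the residues and multiplies the sum by \<open>\<psi> b\<close>.\<close>

lemma sum_char_period: "(\<Sum>a<q. \<psi> a) = 0"
proof -
  obtain b where b: "\<psi> b \<noteq> principal_char q b" using nonprincipal by auto
  have nd: "\<not> q dvd b"
    using b dirichlet_charD(6)[OF char, of b] principal_char_eq[OF prime_q, of b]
      coprime_prime_iff[OF prime_q, of b] by auto
  have b1: "\<psi> b \<noteq> 1" using b nd principal_char_eq[OF prime_q, of b] by simp
  have "(\<Sum>a<q. \<psi> a) = (\<Sum>a<q. \<psi> (a * b mod q))"
    using sum.reindex_bij_betw[OF bij_betw_mult_mod_prime[OF prime_q nd], of \<psi>] by simp
  also have "\<dots> = \<psi> b * (\<Sum>a<q. \<psi> a)"
    by (simp add: dirichlet_char_mod[OF char] char_mult sum_distrib_left mult.commute)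
  finally have "(1 - \<psi> b) * (\<Sum>a<q. \<psi> a) = 0" by (simp add: algebra_simps)
  then show ?thesis using b1 by auto
qed

end

text \<open>Both the non-principal characters and the coefficients of \<open>(1 - p\<^bsup>1-s\<^esup>) \<zeta>(s)\<close> are
  periodic with mean zero.\<close>

locale periodic_mean_zero =
  fixes q :: nat and a :: "nat \<Rightarrow> complex"
  assumes period_pos: "q > 0" and periodic: "\<And>n. a (n + q) = a n" and mean_zero: "(\<Sum>n<q. a n) = 0"
    and a_0_bound: "\<And>n. cmod (a n) \<le> real q"
begin

lemma sum_shift_period: "(\<Sum>n<N + q. a n) = (\<Sum>n<N. a n)"
proof -
  have "(\<Sum>n<q + N. a n) = (\<Sum>n<q. a n) + (\<Sum>n<N. a (n + q))"
    by (induction N) (simp_all add: add.commute)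
  then show ?thesis using mean_zero periodic by (simp add: add.commute)
qed

lemma sum_mult_period: "(\<Sum>n<k * q. a n) = 0"
proof (induction k)
  case (Suc k) then show ?case using sum_shift_period[of "k * q"] by (simp add: add.commute)
qed simp

text \<open>Complete periods cancel. What survives is an incomplete one, with at most
  \<open>q\<close> terms of modulus at most \<open>q\<close>.\<close>

lemma partial_sum_bound: "cmod (\<Sum>n<N. a n) \<le> real q * real q"
proof -
  have "(\<Sum>n<r + k * q. a n) = (\<Sum>n<r. a n)" for r k
  proof (induction k)
    case (Suc k) then show ?case using sum_shift_period[of "r + k * q"] by (simp add: add_ac)
  qed simp
  from this[of "N mod q" "N div q"] have "(\<Sum>n<N. a n) = (\<Sum>n<N mod q. a n)" by simp
  also have "cmod \<dots> \<le> (\<Sum>n<N mod q. real q)"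
    by (rule sum_norm_le) (use a_0_bound in auto)
  also have "\<dots> = real (N mod q) * real q" by simp
  also have "\<dots> \<le> real q * real q"
    using period_pos by (intro mult_right_mono) (auto intro: less_imp_le)
  finally show ?thesis .
qed

end

lemma (in nonprincipal_char) periodic_mean_zero: "periodic_mean_zero q \<psi>"
proof
  show "cmod (\<psi> n) \<le> real q" for n
    using norm_char_le[of n] q_gt_1 by linarith
qed (use q_pos sum_char_period dirichlet_charD(2)[OF char] in auto)

section \<open>Counting characters by a primitive root, and orthogonality\<close>

lemma primroot_ex_power:
  assumes "prime q" "residue_primroot q g" "\<not> q dvd n"
  shows "\<exists>i. i < q - 1 \<and> [g ^ i = n] (mod q)"
proof -
  have q1: "q > 1" using assms prime_gt_1_nat by blast
  have "n mod q \<in> totatives q"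
    using assms(1,3) q1 coprime_prime_iff[OF assms(1), of "n mod q"]
    by (auto simp: totatives_def mod_greater_zero_iff_not_dvd dvd_mod_iff intro: less_imp_le)
  then have "n mod q \<in> (\<lambda>i. g ^ i mod q) ` {..<q - 1}"
    using residue_primroot_is_generator[OF q1 assms(2)] totient_prime[OF assms(1)] unfolding bij_betw_def by simp
  then show ?thesis by (auto simp: cong_def)
qed

text \<open>The character is built from the discrete logarithm to base \<open>g\<close>: it sends
  \<open>g ^ i\<close> to \<open>z ^ i\<close>.\<close>

lemma ex_dirichlet_char_primroot:
  assumes "prime q" "residue_primroot q g" "z ^ (q - 1) = (1::complex)"
  shows "\<exists>\<psi>. dirichlet_char q \<psi> \<and> \<psi> g = z"
proof -
  have q1: "q > 1" using assms prime_gt_1_nat by blast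
  have cop: "coprime q g" and ord: "ord q g = q - 1"
    using assms(1,2) by (auto simp: residue_primroot_def totient_prime)
  have z0: "z \<noteq> 0" using assms(3) q1 by (auto simp: zero_power)
  have powz: "z ^ i = z ^ j" if "[i = j] (mod q - 1)" for i j
  proof -
    have *: "z ^ k = z ^ (k mod (q - 1))" for k
    proof -
      have "z ^ k = z ^ ((q - 1) * (k div (q - 1)) + k mod (q - 1))" by simp
      also have "\<dots> = z ^ (k mod (q - 1))" unfolding power_add power_mult assms(3) by simp
      finally show ?thesis .
    qed
    show ?thesis using * that unfolding cong_def by metis
  qed
  define ind where "ind n = (SOME i. [g ^ i = n] (mod q))" for n
  have ind: "[g ^ ind n = n] (mod q)" if "\<not> q dvd n" for n
    unfolding ind_def using someI_ex[of "\<lambda>i. [g ^ i = n] (mod q)"] primroot_ex_power[OF assms(1,2) that] by blast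
  have expz: "z ^ i = z ^ j" if "[g ^ i = g ^ j] (mod q)" for i j
    using order_divides_expdiff[of q g i j] cop that powz ord by (simp add: coprime_commute)
  define \<psi> where "\<psi> n = (if q dvd n then 0 else z ^ ind n)" for n
  \<comment> \<open>The value is independent of the chosen index: exponents of \<open>g\<close> that
    give the same residue agree modulo \<open>q - 1\<close>, and
    \<open>z ^ (q - 1) = 1\<close>.\<close>
  have eq: "\<psi> n = z ^ i" if "\<not> q dvd n" "[g ^ i = n] (mod q)" for n i
    using that ind[of n] expz[of "ind n" i] unfolding \<psi>_def by (metis cong_sym cong_trans)
  have ndg: "\<not> q dvd g"
    using cop q1 coprime_absorb_left[of q g] by auto
  have "dirichlet_char q \<psi>"
    unfolding dirichlet_char_def
  proof (intro conjI allI)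
    show "q > 0" using q1 by simp
    show "\<psi> (n + q) = \<psi> n" for n
    proof (cases "q dvd n")
      case False
      then have "[g ^ ind n = n + q] (mod q)" using ind[of n] by (simp add: cong_def)
      with False show ?thesis using eq[of "n + q" "ind n"] by (simp add: \<psi>_def)
    qed (simp add: \<psi>_def)
    show "\<psi> (m * n) = \<psi> m * \<psi> n" for m n
    proof (cases "q dvd m \<or> q dvd n")
      case False
      then have "\<not> q dvd m * n" using assms(1) prime_dvd_mult_nat by blast
      moreover have "[g ^ (ind m + ind n) = m * n] (mod q)"
        using ind[of m] ind[of n] False by (simp add: power_add cong_mult)
      ultimately show ?thesis using eq[of "m * n" "ind m + ind n"] False by (simp add: \<psi>_def power_add)
    qed (auto simp: \<psi>_def)
    show "\<psi> 1 = 1" using eq[of 1 0] q1 by simp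
    show "(\<psi> n = 0) = (\<not> coprime n q)" for n
      using z0 coprime_prime_iff[OF assms(1), of n] by (simp add: \<psi>_def)
  qed
  moreover have "\<psi> g = z" using eq[of g 1] ndg by simp
  ultimately show ?thesis by blast
qed

lemma dirichlet_char_eqI_primroot:
  assumes "prime q" "residue_primroot q g" "dirichlet_char q \<psi>" "dirichlet_char q \<theta>" "\<psi> g = \<theta> g"
  shows "\<psi> = \<theta>"
proof
  fix n
  show "\<psi> n = \<theta> n"
  proof (cases "q dvd n")
    case True
    then show ?thesis using dirichlet_charD(6)[OF assms(3), of n] dirichlet_charD(6)[OF assms(4), of n]
        coprime_prime_iff[OF assms(1), of n] by auto
  next
    case False
    then obtain i where i: "[g ^ i = n] (mod q)" using primroot_ex_power[OF assms(1,2)] by blast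
    have "\<psi> n = \<psi> g ^ i" "\<theta> n = \<theta> g ^ i"
      using dirichlet_char_cong[OF assms(3) i] dirichlet_char_cong[OF assms(4) i]
        dirichlet_char_power[OF assms(3)] dirichlet_char_power[OF assms(4)] by metis+
    then show ?thesis using assms(5) by simp
  qed
qed

text \<open>A character is determined by its value at a primitive root, and every root of unity of
  order dividing \<open>q - 1\<close> occurs. This reduces the count of characters to the count of
  roots of unity.\<close>

lemma bij_betw_dirichlet_char_roots:
  assumes "prime q" "residue_primroot q g"
  shows "bij_betw (\<lambda>\<psi>. \<psi> g) {\<psi>. dirichlet_char q \<psi>} {z. z ^ (q - 1) = 1}"
  unfolding bij_betw_def
proof
  show "inj_on (\<lambda>\<psi>. \<psi> g) {\<psi>. dirichlet_char q \<psi>}"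
    using dirichlet_char_eqI_primroot[OF assms] by (auto intro!: inj_onI)
  have "\<not> q dvd g"
    using assms prime_gt_1_nat[of q] coprime_absorb_left[of q g] by (auto simp: residue_primroot_def)
  then show "(\<lambda>\<psi>. \<psi> g) ` {\<psi>. dirichlet_char q \<psi>} = {z. z ^ (q - 1) = 1}"
    using ex_dirichlet_char_primroot[OF assms] dirichlet_char_power_eq_1[OF assms(1)]
    by (force simp: image_iff)
qed

lemma
  assumes "prime q"
  shows finite_dirichlet_chars: "finite {\<psi>. dirichlet_char q \<psi>}"
    and card_dirichlet_chars: "card {\<psi>. dirichlet_char q \<psi>} = q - 1"
proof -
  obtain g where g: "residue_primroot q g" using prime_primitive_root_exists[OF _ assms] prime_gt_1_nat[OF assms] by blast
  have 1: "q - 1 > 0" using prime_gt_1_nat[OF assms] by simp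
  show "card {\<psi>. dirichlet_char q \<psi>} = q - 1"
    using bij_betw_same_card[OF bij_betw_dirichlet_char_roots[OF assms g]] card_roots_unity_eq[OF 1] by simp
  with 1 show "finite {\<psi>. dirichlet_char q \<psi>}" using card_ge_0_finite by force
qed

text \<open>If some character \<open>\<theta>\<close> has \<open>\<theta> n \<noteq> 1\<close>, then
  multiplication by \<open>\<theta>\<close> permutes the characters and multiplies the sum by
  \<open>\<theta> n\<close>, which forces the sum to vanish.\<close>

lemma sum_dirichlet_chars:
  assumes "prime q"
  shows "(\<Sum>\<psi> | dirichlet_char q \<psi>. \<psi> n) = (if [n = 1] (mod q) then of_nat (q - 1) else 0)"
proof (cases "[n = 1] (mod q)")
  case True
  have "\<psi> n = 1" if "dirichlet_char q \<psi>" for \<psi>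
    using dirichlet_char_cong[OF that True] dirichlet_charD[OF that] by simp
  then have "(\<Sum>\<psi> | dirichlet_char q \<psi>. \<psi> n) = (\<Sum>\<psi> | dirichlet_char q \<psi>. 1)"
    by (intro sum.cong) auto
  then show ?thesis using True card_dirichlet_chars[OF assms] by simp
next
  case False
  have q1: "q > 1" using prime_gt_1_nat[OF assms] by simp
  show ?thesis
  proof (cases "q dvd n")
    case True
    then have "\<psi> n = 0" if "dirichlet_char q \<psi>" for \<psi>
      using dirichlet_charD(6)[OF that] coprime_prime_iff[OF assms] by simp
    then have "(\<Sum>\<psi> | dirichlet_char q \<psi>. \<psi> n) = 0" by (intro sum.neutral) auto
    then show ?thesis using False by simp
  next
    case nd: False
    obtain g where g: "residue_primroot q g" using prime_primitive_root_exists[OF _ assms] q1 by blast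
    \<comment> \<open>A root of unity of exact order \<open>q - 1\<close>, so that the character
      with \<open>\<theta> g = z\<close> takes the value 1 only at residues congruent to 1.\<close>
    define z where "z = cis (2 * pi / real (q - 1))"
    have z: "z ^ (q - 1) = 1" using q1 by (simp add: z_def Complex.DeMoivre)
    obtain \<theta> where \<theta>: "dirichlet_char q \<theta>" "\<theta> g = z" using ex_dirichlet_char_primroot[OF assms g z] by blast
    obtain i where i: "[g ^ i = n] (mod q)" "i < q - 1"
      using primroot_ex_power[OF assms g nd] by blast
    have "i \<noteq> 0" using i(1) False by (metis cong_sym power_0)
    have "\<theta> n = z ^ i" using dirichlet_char_cong[OF \<theta>(1) i(1)] dirichlet_char_power[OF \<theta>(1)] \<theta>(2) by simp
    moreover have "z ^ i \<noteq> 1"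
    proof
      assume "z ^ i = 1"
      then have "cis (2 * pi * real i / real (q - 1)) = cis (2 * pi * real 0 / real (q - 1))"
        by (simp add: z_def Complex.DeMoivre mult_ac)
      moreover have "inj_on (\<lambda>k. cis (2 * pi * real k / real (q - 1))) {..<q - 1}"
        using Complex.bij_betw_roots_unity[of "q - 1"] q1 by (simp add: bij_betw_def)
      ultimately have "i = 0" using i(2) inj_onD[of _ "{..<q - 1}" i 0] by fastforce
      then show False using \<open>i \<noteq> 0\<close> by simp
    qed
    ultimately have ne: "\<theta> n \<noteq> 1" by simp
    let ?X = "{\<psi>. dirichlet_char q \<psi>}"
    let ?m = "\<lambda>\<psi> k. \<theta> k * \<psi> k"
    have inj: "inj_on ?m ?X"
    proof (rule inj_onI)
      fix \<psi>1 \<psi>2 assume A: "\<psi>1 \<in> ?X" "\<psi>2 \<in> ?X" "?m \<psi>1 = ?m \<psi>2"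
      have "\<theta> g \<noteq> 0" using \<theta>(2) by (simp add: z_def)
      then have "\<psi>1 g = \<psi>2 g" using fun_cong[OF A(3), of g] by simp
      then show "\<psi>1 = \<psi>2" using dirichlet_char_eqI_primroot[OF assms g] A by auto
    qed
    have "?m ` ?X = ?X"
      by (rule endo_inj_surj[OF finite_dirichlet_chars[OF assms] _ inj]) (use dirichlet_char_mult[OF \<theta>(1)] in auto)
    then have "(\<Sum>\<psi>\<in>?X. \<psi> n) = (\<Sum>\<psi>\<in>?X. ?m \<psi> n)"
      using sum.reindex[OF inj, of "\<lambda>\<psi>. \<psi> n"] by (simp add: o_def)
    also have "\<dots> = \<theta> n * (\<Sum>\<psi>\<in>?X. \<psi> n)" by (simp add: sum_distrib_left)
    finally have "(1 - \<theta> n) * (\<Sum>\<psi>\<in>?X. \<psi> n) = 0" by (simp add: algebra_simps)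
    then show ?thesis using ne False by auto
  qed
qed

lemma
  assumes "prime q"
  shows finite_nonprincipal_chars: "finite (nonprincipal_chars q)"
    and card_nonprincipal_chars: "card (nonprincipal_chars q) = q - 2"
    and sum_nonprincipal_chars:
      "(\<Sum>\<psi>\<in>nonprincipal_chars q. \<psi> n) = (if [n = 1] (mod q) then of_nat (q - 1) else 0) - principal_char q n"
proof -
  let ?X = "{\<psi>. dirichlet_char q \<psi>}"
  have eq: "nonprincipal_chars q = ?X - {principal_char q}" by (auto simp: nonprincipal_chars_def)
  show "finite (nonprincipal_chars q)" unfolding eq using finite_dirichlet_chars[OF assms] by simp
  show "card (nonprincipal_chars q) = q - 2" unfolding eq
    using card_dirichlet_chars[OF assms] dirichlet_char_principal[OF assms] by (simp add: card_Diff_singleton)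
  show "(\<Sum>\<psi>\<in>nonprincipal_chars q. \<psi> n) = (if [n = 1] (mod q) then of_nat (q - 1) else 0) - principal_char q n"
    unfolding eq using sum_diff1[OF finite_dirichlet_chars[OF assms], of "\<lambda>\<psi>. \<psi> n" "principal_char q"]
      sum_dirichlet_chars[OF assms, of n] dirichlet_char_principal[OF assms] by simp
qed

lemma nonprincipal_charsD: "prime q \<Longrightarrow> \<psi> \<in> nonprincipal_chars q \<Longrightarrow> nonprincipal_char q \<psi>"
  by unfold_locales (auto simp: nonprincipal_chars_def)

lemma (in nonprincipal_char) in_nonprincipal_chars: "\<psi> \<in> nonprincipal_chars q"
  using char nonprincipal by (simp add: nonprincipal_chars_def)

section \<open>Dirichlet series and the von Mangoldt function\<close>

text \<open>The reindexing \<open>n = d * k\<close> behind both Dirichlet convolution and Lambert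
  series.\<close>

lemma bij_betw_divisor_pairs:
  "bij_betw (\<lambda>(n,d). (d, n div d)) (Sigma {0<..} (\<lambda>n::nat. {d. d dvd n})) ({0<..} \<times> {0<..})"
proof (rule bij_betwI[where g = "\<lambda>(m,k). (m * k, m)"])
  show "(\<lambda>(n, d). (d, n div d)) \<in> Sigma {0<..} (\<lambda>n::nat. {d. d dvd n}) \<rightarrow> {0<..} \<times> {0<..}"
    by (auto intro: dvd_pos_nat elim!: dvdE)
qed auto

text \<open>Absolute convergence makes the double family of products summable, and the pairs
  \<open>(m, k)\<close> are then grouped by their product. The conditions at 0 restrict everything
  to positive indices, where this grouping is finite.\<close>

lemma dirichlet_convolution:
  fixes f g :: "nat \<Rightarrow> complex"
  assumes f: "summable (\<lambda>n. cmod (f n))" and g: "summable (\<lambda>n. cmod (g n))"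
    and 0: "f 0 = 0" "g 0 = 0"
  shows "(\<lambda>n. if n = 0 then 0 else (\<Sum>d | d dvd n. f d * g (n div d))) sums ((\<Sum>n. f n) * (\<Sum>n. g n))"
proof -
  define P where "P = ({0<..} :: nat set) \<times> ({0<..} :: nat set)"
  define D where "D = Sigma {0<..} (\<lambda>n::nat. {d. d dvd n})"
  define F where "F = (\<lambda>(m,k). f m * g k)"
  have hs: "(h has_sum (\<Sum>n. h n)) {0<..}" if "summable (\<lambda>n. cmod (h n))" "h 0 = 0" for h :: "nat \<Rightarrow> complex"
  proof -
    have "(h has_sum (\<Sum>n. h n)) UNIV"
      using norm_summable_imp_has_sum[OF that(1)] summable_sums[OF summable_norm_cancel[OF that(1)]] by blast
    then show ?thesis by (rule has_sum_cong_neutral[THEN iffD1, rotated -1]) (use that in auto)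
  qed
  have hsn: "(\<lambda>n. cmod (h n)) summable_on {0<..}" if "summable (\<lambda>n. cmod (h n))" for h :: "nat \<Rightarrow> complex"
    using norm_summable_imp_summable_on[of "\<lambda>n. cmod (h n)"] that summable_on_subset_banach by fastforce
  have "(\<lambda>(m,k). cmod (f m) * cmod (g k)) summable_on Sigma {0<..} (\<lambda>_. {0<..})"
  proof (rule summable_on_SigmaI[where g = "\<lambda>m. cmod (f m) * (\<Sum>\<^sub>\<infinity>k\<in>{0<..}. cmod (g k))"])
    show "((\<lambda>y. case (x, y) of (m, k) \<Rightarrow> cmod (f m) * cmod (g k)) has_sum
          cmod (f x) * (\<Sum>\<^sub>\<infinity>k\<in>{0<..}. cmod (g k))) {0<..}" for x
      using has_sum_cmult_right[OF has_sum_infsum[OF hsn[OF g]]] by simp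
    show "(\<lambda>m. cmod (f m) * (\<Sum>\<^sub>\<infinity>k\<in>{0<..}. cmod (g k))) summable_on {0<..}"
      by (intro summable_on_cmult_left hsn[OF f])
  qed auto
  then have abs: "(\<lambda>x. norm (F x)) summable_on P"
    unfolding P_def F_def by (simp add: case_prod_unfold norm_mult)
  then have sumF: "F summable_on P" by (rule abs_summable_summable)
  have hF: "(F has_sum ((\<Sum>n. f n) * (\<Sum>n. g n))) P"
    unfolding P_def
  proof (rule has_sum_SigmaI[where g = "\<lambda>m. f m * (\<Sum>n. g n)"])
    show "((\<lambda>y. F (x, y)) has_sum f x * (\<Sum>n. g n)) {0<..}" for x
      unfolding F_def using has_sum_cmult_right[OF hs[OF g 0(2)]] by simp
    show "((\<lambda>m. f m * (\<Sum>n. g n)) has_sum (\<Sum>n. f n) * (\<Sum>n. g n)) {0<..}"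
      by (rule has_sum_cmult_left[OF hs[OF f 0(1)]])
    show "F summable_on {0<..} \<times> {0<..}" using sumF by (simp add: P_def)
  qed
  have bij: "bij_betw (\<lambda>(n,d). (d, n div d)) D P"
    unfolding D_def P_def by (rule bij_betw_divisor_pairs)
  have "((\<lambda>x. F ((\<lambda>(n,d). (d, n div d)) x)) has_sum ((\<Sum>n. f n) * (\<Sum>n. g n))) D"
    using has_sum_reindex_bij_betw[OF bij, of F] hF by blast
  then have "((\<lambda>n. \<Sum>d | d dvd n. f d * g (n div d)) has_sum ((\<Sum>n. f n) * (\<Sum>n. g n))) {0<..}"
    unfolding D_def
  proof (rule has_sum_SigmaD)
    fix n :: nat assume "n \<in> {0<..}"
    then show "((\<lambda>y. F (case (n, y) of (n, d) \<Rightarrow> (d, n div d))) has_sum (\<Sum>d | d dvd n. f d * g (n div d))) {d. d dvd n}"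
      unfolding F_def by (intro has_sum_finiteI) auto
  qed
  then have "((\<lambda>n. if n = 0 then 0 else (\<Sum>d | d dvd n. f d * g (n div d))) has_sum ((\<Sum>n. f n) * (\<Sum>n. g n))) UNIV"
    by (rule has_sum_cong_neutral[THEN iffD1, rotated -1]) auto
  then show ?thesis by (rule has_sum_imp_sums)
qed

section \<open>Abel summation of Dirichlet series with periodic coefficients of mean zero\<close>

lemma norm_nat_powr:
  "n > 0 \<Longrightarrow> cmod (of_nat n powr s) = real n powr Re s"
  by (simp add: norm_powr_real_powr)

text \<open>The mean value inequality on the segment from \<open>n\<close> to \<open>n + 1\<close>;
  \<open>Re s > -1\<close> makes the modulus of the derivative largest at the left end. The extra
  factor \<open>1 / n\<close> is what gives convergence for all \<open>Re s > 0\<close>.\<close>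

lemma norm_powr_diff_le:
  assumes "n > 0" "Re s > -1"
  shows "cmod (of_nat n powr - s - of_nat (Suc n) powr - s) \<le> cmod s * real n powr (- Re s - 1)"
proof -
  let ?S = "closed_segment (of_real (real n) :: complex) (of_real (real (Suc n)))"
  have S: "\<exists>x. z = of_real x \<and> x \<ge> real n" if "z \<in> ?S" for z
    using that unfolding closed_segment_of_real by (auto simp: closed_segment_eq_real_ivl)
  have "cmod ((\<lambda>z. z powr - s) (of_real (real n)) - (\<lambda>z. z powr - s) (of_real (real (Suc n)))) \<le>
     (cmod s * real n powr (- Re s - 1)) * cmod (of_real (real n) - of_real (real (Suc n)) :: complex)"
  proof (rule field_differentiable_bound[where f' = "\<lambda>z. - s * z powr (- s - 1)" and S = ?S])
    fix z assume "z \<in> ?S"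
    then obtain x where x: "z = of_real x" "x \<ge> real n" using S by blast
    have x0: "x > 0" using x assms by simp
    then have "z \<notin> \<real>\<^sub>\<le>\<^sub>0" using x by (auto simp: complex_nonpos_Reals_iff)
    then show "((\<lambda>z. z powr - s) has_field_derivative - s * z powr (- s - 1)) (at z within ?S)"
      by (intro has_field_derivative_at_within[OF has_field_derivative_powr])
    have "cmod (z powr (- s - 1)) = x powr (- Re s - 1)"
      using x x0 by (simp add: norm_powr_real_powr)
    also have "\<dots> \<le> real n powr (- Re s - 1)"
      using x assms by (intro powr_mono2') auto
    finally show "cmod (- s * z powr (- s - 1)) \<le> cmod s * real n powr (- Re s - 1)"
      by (simp add: norm_mult mult_left_mono)
  qed auto
  also have "cmod (of_real (real n) - of_real (real (Suc n)) :: complex) = 1"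
    by (simp flip: of_real_diff)
  finally show ?thesis by simp
qed

text \<open>The Dirichlet series of \<open>a\<close> after summation by parts. With bounded partial
  sums of \<open>a\<close> it converges absolutely for \<open>Re s > 0\<close>, and it serves as the
  working form of the L-function in that half-plane.\<close>

definition abel_series :: "(nat \<Rightarrow> complex) \<Rightarrow> complex \<Rightarrow> complex" where
  "abel_series a s = (\<Sum>n. (\<Sum>k=1..Suc n. a k) * (of_nat (Suc n) powr - s - of_nat (Suc (Suc n)) powr - s))"

context periodic_mean_zero
begin

text \<open>The sums bounded by \<open>B\<close> start at 1: \<open>q * q\<close> is the bound for
  the sum from 0, and the second \<open>q\<close> pays for removing the term
  \<open>a 0\<close>.\<close>

definition B :: real where "B = real q * real q + real q"

lemma B_pos: "B > 0" using period_pos by (simp add: B_def add_pos_pos)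

lemma partial_sum_bound': "cmod (\<Sum>k=1..n. a k) \<le> B"
proof -
  have "(\<Sum>k<Suc n. a k) = a 0 + (\<Sum>k=1..n. a k)"
    by (simp add: lessThan_Suc_atMost sum.atMost_shift[symmetric] atMost_atLeast0 sum.atLeast_Suc_atMost)
  then have "(\<Sum>k=1..n. a k) = (\<Sum>k<Suc n. a k) - a 0" by simp
  also have "cmod \<dots> \<le> B" unfolding B_def
    using norm_triangle_ineq4[of "\<Sum>k<Suc n. a k" "a 0"] partial_sum_bound[of "Suc n"] a_0_bound[of 0] by linarith
  finally show ?thesis .
qed

lemma abel_term_bound:
  assumes "Re s \<ge> \<delta>" "\<delta> > 0"
  shows "cmod ((\<Sum>k=1..Suc n. a k) * (of_nat (Suc n) powr - s - of_nat (Suc (Suc n)) powr - s))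
     \<le> B * cmod s * real (Suc n) powr (- \<delta> - 1)"
proof -
  have "cmod (of_nat (Suc n) powr - s - of_nat (Suc (Suc n)) powr - s) \<le> cmod s * real (Suc n) powr (- Re s - 1)"
    using assms by (intro norm_powr_diff_le) auto
  also have "\<dots> \<le> cmod s * real (Suc n) powr (- \<delta> - 1)"
    using assms by (intro mult_left_mono powr_mono) auto
  finally show ?thesis unfolding norm_mult mult.assoc
    using partial_sum_bound'[of "Suc n"] B_pos by (intro mult_mono) auto
qed

lemma summable_Suc_powr: "\<delta> > 0 \<Longrightarrow> summable (\<lambda>n. real (Suc n) powr (- \<delta> - 1))"
  using summable_Suc_iff[of "\<lambda>n. real n powr (- \<delta> - 1)"] summable_real_powr_iff[of "- \<delta> - 1"] by simp

lemma abel_summable: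
  assumes "Re s > 0"
  shows "summable (\<lambda>n. cmod ((\<Sum>k=1..Suc n. a k) * (of_nat (Suc n) powr - s - of_nat (Suc (Suc n)) powr - s)))"
  by (rule summable_comparison_test[OF _ summable_mult[OF summable_Suc_powr[OF assms], of "B * cmod s"]])
     (use abel_term_bound[OF order_refl assms] in auto)

text \<open>Linear growth in \<open>cmod s\<close> is all that is used later, both as input to
  Borel-Caratheodory and as the a priori growth for Phragmen-Lindelof.\<close>

lemma abel_series_bound:
  assumes "\<delta> > 0"
  shows "\<exists>C>0. \<forall>s. Re s \<ge> \<delta> \<longrightarrow> cmod (abel_series a s) \<le> C * cmod s"
proof (intro exI conjI allI impI)
  let ?Z = "\<Sum>n. real (Suc n) powr (- \<delta> - 1)"
  have "?Z > 0" using summable_Suc_powr[OF assms] by (intro suminf_pos) auto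
  then show "B * ?Z > 0" using B_pos by simp
  fix s assume s: "Re s \<ge> \<delta>"
  have "cmod (abel_series a s) \<le> (\<Sum>n. cmod ((\<Sum>k=1..Suc n. a k) * (of_nat (Suc n) powr - s - of_nat (Suc (Suc n)) powr - s)))"
    unfolding abel_series_def by (rule summable_norm[OF abel_summable]) (use s assms in auto)
  also have "\<dots> \<le> (\<Sum>n. B * cmod s * real (Suc n) powr (- \<delta> - 1))"
    by (intro suminf_le abel_term_bound s assms abel_summable summable_mult summable_Suc_powr) (use s assms in auto)
  also have "\<dots> = B * ?Z * cmod s" using suminf_mult[OF summable_Suc_powr[OF assms]] by simp
  finally show "cmod (abel_series a s) \<le> B * ?Z * cmod s" .
qed

lemma abel_series_holomorphic: "abel_series a holomorphic_on {s. Re s > 0}"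
proof (rule holomorphic_uniform_sequence[where f = "\<lambda>N s. \<Sum>n<N. (\<Sum>k=1..Suc n. a k) *
     (of_nat (Suc n) powr - s - of_nat (Suc (Suc n)) powr - s)"])
  show "open {s. Re s > 0}" by (rule open_halfspace_Re_gt)
  fix z :: complex assume z: "z \<in> {s. Re s > 0}"
  define d where "d = Re z / 2"
  have d: "d > 0" using z by (simp add: d_def)
  have cb: "Re s \<ge> d \<and> cmod s \<le> cmod z + d" if "s \<in> cball z d" for s
  proof -
    have "cmod (z - s) \<le> d" using that by (simp add: dist_norm)
    then show ?thesis using abs_Re_le_cmod[of "z - s"] norm_triangle_sub[of s z]
      by (auto simp: d_def norm_minus_commute)
  qed
  have "uniform_limit (cball z d) (\<lambda>N s. \<Sum>n<N. (\<Sum>k=1..Suc n. a k) *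
     (of_nat (Suc n) powr - s - of_nat (Suc (Suc n)) powr - s)) (abel_series a) sequentially"
    unfolding abel_series_def
  proof (rule Weierstrass_m_test[where M = "\<lambda>n. B * (cmod z + d) * real (Suc n) powr (- d - 1)"])
    fix n s assume s: "s \<in> cball z d"
    have "B * cmod s * real (Suc n) powr (- d - 1) \<le> B * (cmod z + d) * real (Suc n) powr (- d - 1)"
      using cb[OF s] B_pos by (intro mult_right_mono mult_left_mono) auto
    with abel_term_bound[of d s n] cb[OF s] d
    show "cmod ((\<Sum>k=1..Suc n. a k) * (of_nat (Suc n) powr - s - of_nat (Suc (Suc n)) powr - s))
      \<le> B * (cmod z + d) * real (Suc n) powr (- d - 1)" by linarith
  qed (intro summable_mult summable_Suc_powr d)
  then show "\<exists>d>0. cball z d \<subseteq> {s. Re s > 0} \<and> uniform_limit (cball z d) (\<lambda>N s. \<Sum>n<N. (\<Sum>k=1..Suc n. a k) *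
     (of_nat (Suc n) powr - s - of_nat (Suc (Suc n)) powr - s)) (abel_series a) sequentially"
    using d cb by (intro exI[of _ d] conjI) force+
qed (intro holomorphic_intros; auto)

text \<open>Summation by parts for arbitrary weights \<open>u\<close>. The weights to come are
  powers, exponentials, the kernels \<open>K\<close> and the differences \<open>b\<close> in the
  proof that \<open>L 1\<close> does not vanish.\<close>

lemma abel_series_partial:
  "(\<Sum>k=1..Suc N. a k * u k) = (\<Sum>n<N. (\<Sum>k=1..Suc n. a k) * (u (Suc n) - u (Suc (Suc n)))) +
      (\<Sum>k=1..Suc N. a k) * (u (Suc N) :: complex)"
  by (induction N) (simp_all add: algebra_simps)

lemma abel_series_sums:
  assumes "Re s > 0"
  shows "(\<lambda>n. a n / of_nat n powr s) sums abel_series a s"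
proof -
  let ?u = "\<lambda>n. of_nat n powr - s :: complex"
  have 1: "(\<lambda>N. \<Sum>n<N. (\<Sum>k=1..Suc n. a k) * (?u (Suc n) - ?u (Suc (Suc n)))) \<longlonglongrightarrow> abel_series a s"
    using summable_LIMSEQ[OF summable_norm_cancel[OF abel_summable[OF assms]]] unfolding abel_series_def .
  have 2: "(\<lambda>N. (\<Sum>k=1..Suc N. a k) * ?u (Suc N)) \<longlonglongrightarrow> 0"
  proof (rule Lim_null_comparison)
    show "\<forall>\<^sub>F N in sequentially. cmod ((\<Sum>k=1..Suc N. a k) * ?u (Suc N)) \<le> B * real (Suc N) powr (- Re s)"
    proof (rule always_eventually, rule allI)
      fix N
      have "cmod (?u (Suc N)) = real (Suc N) powr (- Re s)" using norm_nat_powr[of "Suc N" "-s"] by simp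
      then show "cmod ((\<Sum>k=1..Suc N. a k) * ?u (Suc N)) \<le> B * real (Suc N) powr (- Re s)"
        unfolding norm_mult using partial_sum_bound'[of "Suc N"] B_pos by (intro mult_mono) auto
    qed
    have "(\<lambda>N. B * real (Suc N) powr (- Re s)) \<longlonglongrightarrow> B * 0"
      using assms by (intro tendsto_mult tendsto_const tendsto_neg_powr
          filterlim_compose[OF filterlim_real_sequentially filterlim_Suc]) auto
    then show "(\<lambda>N. B * real (Suc N) powr (- Re s)) \<longlonglongrightarrow> 0" by simp
  qed
  have "(\<lambda>N. \<Sum>k=1..Suc N. a k * ?u k) \<longlonglongrightarrow> abel_series a s"
    using tendsto_add[OF 1 2] by (simp only: abel_series_partial add_0_right)
  moreover have "(\<Sum>k=1..Suc N. a k * ?u k) = (\<Sum>k<Suc (Suc N). a k / of_nat k powr s)" for N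
  proof -
    have "(\<Sum>k<Suc (Suc N). a k / of_nat k powr s) = (\<Sum>k=1..Suc N. a k / of_nat k powr s)"
      by (simp add: lessThan_Suc_atMost atMost_atLeast0 sum.atLeast_Suc_atMost del: sum.atMost_Suc sum.op_ivl_Suc)
    then show ?thesis by (simp add: powr_minus field_simps)
  qed
  ultimately have "(\<lambda>N. \<Sum>k<Suc (Suc N). a k / of_nat k powr s) \<longlonglongrightarrow> abel_series a s" by simp
  then show ?thesis unfolding sums_def by (subst (asm) filterlim_sequentially_Suc, subst (asm) filterlim_sequentially_Suc)
qed

end

lemma abel_series_cnj: "abel_series (\<lambda>n. cnj (a n)) s = cnj (abel_series a (cnj s))" if "periodic_mean_zero q a" "Re s > 0" for s
proof -
  interpret periodic_mean_zero q a by fact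
  have "(\<lambda>n. a n / of_nat n powr (cnj s)) sums abel_series a (cnj s)"
    using that by (intro abel_series_sums) auto
  then have "(\<lambda>n. cnj (a n / of_nat n powr (cnj s))) sums cnj (abel_series a (cnj s))"
    by (subst sums_cnj)
  moreover have "cnj (a n / of_nat n powr (cnj s)) = cnj (a n) / of_nat n powr s" for n
    by (cases "n = 0") (simp_all add: cnj_powr complex_nonpos_Reals_iff)
  ultimately have 1: "(\<lambda>n. cnj (a n) / of_nat n powr s) sums cnj (abel_series a (cnj s))" by (simp only:)
  interpret c: periodic_mean_zero q "\<lambda>n. cnj (a n)"
    using period_pos periodic mean_zero a_0_bound by unfold_locales (auto simp flip: cnj_sum)
  show ?thesis using sums_unique2[OF c.abel_series_sums[OF that(2)] 1] .
qed

section \<open>Absolutely convergent series with completely multiplicative coefficients\<close>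

lemma summable_log_powr:
  assumes "c > 1"
  shows "summable (\<lambda>n. ln (real n) * real n powr - c)"
proof (rule summable_comparison_test_ev[OF _ summable_mult])
  \<comment> \<open>Half of the excess \<open>c - 1\<close> pays for the logarithm, the other half
    keeps the series convergent.\<close>
  define e where "e = (c - 1) / 2"
  have e: "e > 0" using assms by (simp add: e_def)
  show "summable (\<lambda>n. real n powr (e - c))" using assms by (subst summable_real_powr_iff) (simp add: e_def field_simps)
  show "\<forall>\<^sub>F n in sequentially. norm (ln (real n) * real n powr - c) \<le> (1/e) * real n powr (e - c)"
    using eventually_ge_at_top[of 1]
  proof eventually_elim
    case (elim n)
    have "ln (real n) * real n powr - c \<le> (real n powr e / e) * real n powr - c"
      using elim e by (intro mult_right_mono ln_powr_bound) auto
    also have "\<dots> = (1/e) * real n powr (e - c)" by (simp add: powr_diff powr_minus field_simps)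
    finally show ?case using elim by simp
  qed
qed

definition dser :: "(nat \<Rightarrow> complex) \<Rightarrow> complex \<Rightarrow> complex" where
  "dser f s = (\<Sum>n. f n / of_nat n powr s)"

text \<open>The common ground of a non-principal character, its square and the constant coefficients
  \<open>zone\<close> of zeta, so that the three series of the 3-4-1 inequality are treated
  alike.\<close>

locale comp_mult =
  fixes \<psi> :: "nat \<Rightarrow> complex"
  assumes multiplicative: "\<psi> (m * n) = \<psi> m * \<psi> n" and one [simp]: "\<psi> (Suc 0) = 1"
    and zero [simp]: "\<psi> 0 = 0" and norm_le: "cmod (\<psi> n) \<le> 1"
begin

lemma norm_term: "cmod (\<psi> n / of_nat n powr s) \<le> real n powr - Re s"
proof (cases "n = 0")
  case False
  then have "cmod (\<psi> n / of_nat n powr s) = cmod (\<psi> n) * real n powr - Re s"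
    by (simp add: norm_divide norm_nat_powr powr_minus field_simps)
  also have "\<dots> \<le> 1 * real n powr - Re s" by (intro mult_right_mono norm_le) auto
  finally show ?thesis by simp
qed simp

lemma summable_norm_term: "Re s > 1 \<Longrightarrow> summable (\<lambda>n. cmod (\<psi> n / of_nat n powr s))"
  by (rule summable_comparison_test[of _ "\<lambda>n. real n powr - Re s"]) (use norm_term summable_real_powr_iff[of "- Re s"] in auto)

lemma dser_sums: "Re s > 1 \<Longrightarrow> (\<lambda>n. \<psi> n / of_nat n powr s) sums dser \<psi> s"
  unfolding dser_def by (rule summable_sums[OF summable_norm_cancel[OF summable_norm_term]])

lemma norm_mangoldt_term: "cmod (mangoldt n * \<psi> n / of_nat n powr s) \<le> ln (real n) * real n powr - Re s"
proof (cases "n = 0")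
  case False
  have "cmod (mangoldt n * \<psi> n / of_nat n powr s) = mangoldt n * cmod (\<psi> n / of_nat n powr s)"
    by (simp add: norm_mult norm_divide)
  also have "\<dots> \<le> ln (real n) * real n powr - Re s"
    using False by (intro mult_mono mangoldt_le norm_term) (auto simp: mangoldt_nonneg)
  finally show ?thesis .
qed simp

lemma summable_norm_mangoldt_term: "Re s > 1 \<Longrightarrow> summable (\<lambda>n. cmod (mangoldt n * \<psi> n / of_nat n powr s))"
  by (rule summable_comparison_test[OF _ summable_log_powr[of "Re s"]]) (use norm_mangoldt_term in auto)

text \<open>Minus the logarithmic derivative of \<open>dser \<psi>\<close>; the sign is absorbed so
  that the coefficients are those of the von Mangoldt function.\<close>

definition Dlog :: "complex \<Rightarrow> complex" where
  "Dlog s = (\<Sum>n. mangoldt n * \<psi> n / of_nat n powr s)"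

lemma Dlog_sums: "Re s > 1 \<Longrightarrow> (\<lambda>n. mangoldt n * \<psi> n / of_nat n powr s) sums Dlog s"
  unfolding Dlog_def by (rule summable_sums[OF summable_norm_cancel[OF summable_norm_mangoldt_term]])

text \<open>The sum of \<open>mangoldt d\<close> over the divisors of \<open>n\<close> is
  \<open>ln n\<close>, and complete multiplicativity lets \<open>\<psi> n / n powr s\<close> factor
  out of every term of the convolution.\<close>

lemma Dlog_mult_dser:
  assumes "Re s > 1"
  shows "(\<lambda>n. of_real (ln (real n)) * \<psi> n / of_nat n powr s) sums (Dlog s * dser \<psi> s)"
proof -
  have "(\<lambda>n. if n = 0 then 0 else (\<Sum>d | d dvd n. (mangoldt d * \<psi> d / of_nat d powr s) *
      (\<psi> (n div d) / of_nat (n div d) powr s))) sums (Dlog s * dser \<psi> s)"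
    unfolding Dlog_def dser_def
    by (rule dirichlet_convolution[OF summable_norm_mangoldt_term summable_norm_term]) (use assms in auto)
  moreover have "(if n = 0 then 0 else (\<Sum>d | d dvd n. (mangoldt d * \<psi> d / of_nat d powr s) *
      (\<psi> (n div d) / of_nat (n div d) powr s))) = of_real (ln (real n)) * \<psi> n / of_nat n powr s" for n
  proof (cases "n = 0")
    case False
    have "(\<Sum>d | d dvd n. (mangoldt d * \<psi> d / of_nat d powr s) * (\<psi> (n div d) / of_nat (n div d) powr s))
      = (\<Sum>d | d dvd n. mangoldt d * (\<psi> n / of_nat n powr s))"
    proof (rule sum.cong)
      fix d assume "d \<in> {d. d dvd n}"
      then obtain k where k: "n = d * k" by auto
      with False have "d > 0" "k > 0" by auto
      moreover have "of_nat n powr s = of_nat d powr s * of_nat k powr s"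
        unfolding k of_nat_mult by (rule powr_times_real) auto
      ultimately show "(mangoldt d * \<psi> d / of_nat d powr s) * (\<psi> (n div d) / of_nat (n div d) powr s) =
        mangoldt d * (\<psi> n / of_nat n powr s)" using k by (simp add: multiplicative)
    qed simp
    also have "\<dots> = of_real (ln (real n)) * (\<psi> n / of_nat n powr s)"
      unfolding sum_distrib_right[symmetric] using mangoldt_sum[of n, where 'a = complex] False by simp
    finally show ?thesis using False by simp
  qed simp
  ultimately show ?thesis by simp
qed

text \<open>The termwise derivative has coefficients \<open>- ln n * \<psi> n\<close>, which the
  convolution identity recognises as a product. Stated without a quotient, it is available before
  \<open>dser\<close> is known not to vanish.\<close>

lemma dser_has_derivative:
  assumes "Re s > 1"
  shows "(dser \<psi> has_field_derivative - Dlog s * dser \<psi> s) (at s)"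
proof -
  define c where "c = (1 + Re s) / 2"
  have c: "c > 1" "c < Re s" using assms by (auto simp: c_def)
  obtain g g' where gg: "\<forall>x \<in> {s. Re s > c}. ((\<lambda>n. \<psi> n / of_nat n powr x) sums g x) \<and>
     ((\<lambda>n. - of_real (ln (real n)) * \<psi> n / of_nat n powr x) sums g' x) \<and> (g has_field_derivative g' x) (at x)"
  proof (rule series_and_derivative_comparison[where S = "{s. Re s > c}" and h = "\<lambda>n. real n powr - c"])
    show "open {s. Re s > c}" by (rule open_halfspace_Re_gt)
    show "summable (\<lambda>n. real n powr - c)" using c by (subst summable_real_powr_iff) auto
    show "((\<lambda>x. \<psi> n / of_nat n powr x) has_field_derivative - of_real (ln (real n)) * \<psi> n / of_nat n powr x) (at x)" for n x
    proof (cases "n = 0")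
      case False
      then show ?thesis by (auto intro!: derivative_eq_intros simp: Ln_of_nat field_simps power2_eq_square)
    qed simp
    show "\<forall>\<^sub>F n in sequentially. \<forall>x\<in>{s. Re s > c}. cmod (\<psi> n / of_nat n powr x) \<le> real n powr - c"
      using eventually_gt_at_top[of 0]
    proof (eventually_elim, safe)
      fix n :: nat and x assume "n > 0" "Re x > c"
      then have "real n powr - Re x \<le> real n powr - c" by (intro powr_mono) auto
      then show "cmod (\<psi> n / of_nat n powr x) \<le> real n powr - c" using norm_term[of n x] by linarith
    qed
  qed blast
  have s: "s \<in> {s. Re s > c}" using c by simp
  have gL: "g x = dser \<psi> x" if "x \<in> {s. Re s > c}" for x
  proof -
    have "(\<lambda>n. \<psi> n / of_nat n powr x) sums g x" using gg that by blast
    moreover have "(\<lambda>n. \<psi> n / of_nat n powr x) sums dser \<psi> x" using dser_sums that c by simp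
    ultimately show ?thesis by (rule sums_unique2)
  qed
  have "(g has_field_derivative g' s) (at s)" using gg s by blast
  then have "(dser \<psi> has_field_derivative g' s) (at s)"
    by (rule has_field_derivative_transform_within_open[OF _ open_halfspace_Re_gt]) (use s gL in auto)
  moreover have "g' s = - Dlog s * dser \<psi> s"
  proof -
    have "(\<lambda>n. - (of_real (ln (real n)) * \<psi> n / of_nat n powr s)) sums g' s" using gg s by simp
    from sums_unique2[OF this sums_minus[OF Dlog_mult_dser[OF assms]]] show ?thesis by simp
  qed
  ultimately show ?thesis by simp
qed

lemma Dlog_holomorphic: "Dlog holomorphic_on {s. Re s > 1}"
proof (rule holomorphic_uniform_sequence[where f = "\<lambda>N s. \<Sum>n<N. mangoldt n * \<psi> n / of_nat n powr s"])
  show "open {s. Re s > 1}" by (rule open_halfspace_Re_gt)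
  show "(\<lambda>s. \<Sum>n<N. mangoldt n * \<psi> n / of_nat n powr s) holomorphic_on {s. Re s > 1}" for N
  proof (intro holomorphic_on_sum)
    fix n show "(\<lambda>s. mangoldt n * \<psi> n / of_nat n powr s) holomorphic_on {s. Re s > 1}"
      by (cases "n = 0") (auto intro!: holomorphic_intros)
  qed
  fix z :: complex assume z: "z \<in> {s. Re s > 1}"
  define d where "d = (Re z - 1) / 2"
  have d: "d > 0" using z by (simp add: d_def)
  have cb: "Re s \<ge> 1 + d" if "s \<in> cball z d" for s
  proof -
    have "cmod (z - s) \<le> d" using that by (simp add: dist_norm)
    then show ?thesis using abs_Re_le_cmod[of "z - s"] by (simp add: d_def abs_le_iff field_simps)
  qed
  have "uniform_limit (cball z d) (\<lambda>N s. \<Sum>n<N. mangoldt n * \<psi> n / of_nat n powr s) Dlog sequentially"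
    unfolding Dlog_def
  proof (rule Weierstrass_m_test[OF _ summable_log_powr[of "1 + d"]])
    fix n s assume s: "s \<in> cball z d"
    have "real n powr - Re s \<le> real n powr - (1 + d)"
      using cb[OF s] by (cases "n = 0") (auto intro!: powr_mono)
    then have "ln (real n) * real n powr - Re s \<le> ln (real n) * real n powr - (1 + d)"
      by (cases "n = 0") (auto intro!: mult_left_mono)
    then show "cmod (mangoldt n * \<psi> n / of_nat n powr s) \<le> ln (real n) * real n powr - (1 + d)"
      using norm_mangoldt_term[of n s] by linarith
  qed (use d in auto)
  then show "\<exists>d>0. cball z d \<subseteq> {s. Re s > 1} \<and> uniform_limit (cball z d) (\<lambda>N s. \<Sum>n<N. mangoldt n * \<psi> n / of_nat n powr s) Dlog sequentially"
    using d cb by (intro exI[of _ d] conjI) force+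
qed

text \<open>For \<open>n \<ge> 2\<close> the excess of \<open>Re s\<close> over 2 is estimated at
  \<open>n = 2\<close>, the worst case, and the remaining \<open>n powr -2\<close> is
  summed.\<close>

lemma norm_dser_minus_1_le:
  assumes "Re s \<ge> 2"
  shows "cmod (dser \<psi> s - 1) \<le> 2 powr (2 - Re s) * (\<Sum>n. real n powr -2)"
proof -
  have sumZ: "summable (\<lambda>n. real n powr -2)" by (subst summable_real_powr_iff) auto
  let ?t = "\<lambda>n. \<psi> n / of_nat n powr s - (if n = 1 then 1 else 0)"
  have t: "cmod (?t n) \<le> 2 powr (2 - Re s) * real n powr -2" for n
  proof (cases "n \<le> 1")
    case True
    then have "n = 0 \<or> n = Suc 0" by auto
    then show ?thesis by auto
  next
    case False
    have "real n powr (2 - Re s) \<le> 2 powr (2 - Re s)" using False assms by (intro powr_mono2') auto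
    then have "real n powr - Re s \<le> 2 powr (2 - Re s) * real n powr -2"
      using False by (simp add: powr_diff powr_minus field_simps)
    then show ?thesis using norm_term[of n s] False by simp
  qed
  have sums: "?t sums (dser \<psi> s - 1)"
    using assms by (intro sums_diff dser_sums) (auto intro: sums_single)
  have sumn: "summable (\<lambda>n. cmod (?t n))"
    by (rule summable_comparison_test[OF _ summable_mult[OF sumZ, of "2 powr (2 - Re s)"]]) (use t in auto)
  have "cmod (dser \<psi> s - 1) \<le> (\<Sum>n. cmod (?t n))" using summable_norm[OF sumn] sums by (simp add: sums_iff)
  also have "\<dots> \<le> (\<Sum>n. 2 powr (2 - Re s) * real n powr -2)"
    by (intro suminf_le t sumn summable_mult sumZ)
  also have "\<dots> = 2 powr (2 - Re s) * (\<Sum>n. real n powr -2)" by (rule suminf_mult[OF sumZ])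
  finally show ?thesis .
qed

text \<open>Supplies an absolute lower bound at real part 4, the anchor from which all lower bounds
  for \<open>L\<close> further left are propagated.\<close>

lemma norm_dser_ge_half:
  assumes "Re s \<ge> 4"
  shows "cmod (dser \<psi> s) \<ge> 1/2"
proof -
  have "(\<lambda>n. real (Suc n) powr -2) sums (pi\<^sup>2 / 6)"
    using inverse_squares_sums by (simp add: powr_minus powr_numeral inverse_eq_divide)
  then have "(\<lambda>n. real n powr -2) sums (pi\<^sup>2 / 6)"
    using sums_Suc_iff[of "\<lambda>n. real n powr -2" "pi\<^sup>2 / 6"] by simp
  then have "(\<Sum>n. real n powr -2) = pi\<^sup>2 / 6" by (simp add: sums_iff)
  also have "\<dots> \<le> 2"
  proof -
    have "pi\<^sup>2 \<le> (3.2)\<^sup>2" using pi_approx by (intro power_mono) auto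
    then show ?thesis by (simp add: power2_eq_square)
  qed
  finally have Z: "(\<Sum>n. real n powr -2) \<le> 2" .
  have "2 powr (2 - Re s) \<le> 2 powr (-2 :: real)" using assms by (intro powr_mono) auto
  then have p: "2 powr (2 - Re s) \<le> 1/4" by (simp add: powr_minus powr_numeral)
  have "cmod (dser \<psi> s - 1) \<le> 1/4 * 2"
  proof (rule order_trans[OF norm_dser_minus_1_le])
    show "2 powr (2 - Re s) * (\<Sum>n. real n powr - 2) \<le> 1/4 * 2"
      by (intro mult_mono p Z suminf_nonneg) (auto simp: summable_real_powr_iff)
  qed (use assms in simp)
  then show ?thesis using norm_triangle_ineq2[of 1 "1 - dser \<psi> s"] by (simp add: norm_minus_commute)
qed

lemma ex_dser_nonzero: "\<exists>s. Re s > 1 \<and> dser \<psi> s \<noteq> 0"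
  by (rule exI[of _ 4]) (use norm_dser_ge_half[of 4] in auto)

text \<open>With a primitive \<open>E\<close> of \<open>Dlog\<close>, the product
  \<open>dser \<psi> x * exp (E x)\<close> has derivative 0. It is therefore constant, and the
  constant is nonzero because \<open>dser\<close> is nonzero at one point.\<close>

lemma dser_nonzero:
  assumes "Re s > 1"
  shows "dser \<psi> s \<noteq> 0"
proof -
  let ?S = "{s. Re s > 1}"
  have S: "convex ?S" "open ?S" by (rule convex_halfspace_Re_gt, rule open_halfspace_Re_gt)
  obtain E where E: "\<And>x. x \<in> ?S \<Longrightarrow> (E has_field_derivative Dlog x) (at x)"
    using holomorphic_convex_primitive'[OF S Dlog_holomorphic] S by (metis at_within_open)
  have "((\<lambda>x. dser \<psi> x * exp (E x)) has_field_derivative 0) (at x within ?S)" if "x \<in> ?S" for x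
    using that by (auto intro!: derivative_eq_intros E[THEN has_field_derivative_at_within]
       dser_has_derivative[THEN has_field_derivative_at_within] simp: algebra_simps)
  from has_field_derivative_zero_constant[OF S(1) this]
  obtain c where c: "\<And>x. x \<in> ?S \<Longrightarrow> dser \<psi> x * exp (E x) = c" by blast
  obtain s0 where "Re s0 > 1" "dser \<psi> s0 \<noteq> 0" using ex_dser_nonzero by blast
  then have "c \<noteq> 0" using c[of s0] by auto
  then show ?thesis using c[of s] assms by auto
qed

end

section \<open>The L-series of a non-principal character\<close>

context nonprincipal_char
begin

sublocale periodic_mean_zero q \<psi> by (rule periodic_mean_zero)

sublocale comp_mult \<psi>
  by unfold_locales (use char_mult norm_char_le in auto)

abbreviation L :: "complex \<Rightarrow> complex" where "L \<equiv> abel_series \<psi>"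

lemma L_sums: "Re s > 0 \<Longrightarrow> (\<lambda>n. \<psi> n / of_nat n powr s) sums L s"
  by (rule abel_series_sums)

lemma L_eq_dser: "Re s > 1 \<Longrightarrow> L s = dser \<psi> s"
  using sums_unique2[OF L_sums dser_sums] by simp

lemma L_nonzero_Re_gt_1: "Re s > 1 \<Longrightarrow> L s \<noteq> 0"
  using dser_nonzero L_eq_dser by simp

lemma ex_L_nonzero: "\<exists>s. Re s > 1 \<and> L s \<noteq> 0"
  by (rule exI[of _ 2]) (use L_nonzero_Re_gt_1 in auto)

lemma L_has_derivative:
  assumes "Re s > 1"
  shows "(L has_field_derivative - Dlog s * L s) (at s)"
  unfolding L_eq_dser[OF assms]
  by (rule has_field_derivative_transform_within_open[OF dser_has_derivative[OF assms] open_halfspace_Re_gt[of 1]])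
     (use assms L_eq_dser in auto)

lemma deriv_L_over_L:
  assumes "Re s > 1"
  shows "deriv L s / L s = - Dlog s"
  using DERIV_imp_deriv[OF L_has_derivative[OF assms]] L_nonzero_Re_gt_1[OF assms] by simp

end

section \<open>The functional equation\<close>

text \<open>The logarithmic derivative of the reflection formula for Gamma, obtained by
  differentiating \<open>Gamma z * Gamma (1 - z)\<close> in two ways.\<close>

lemma Digamma_reflection:
  fixes z :: complex
  assumes z: "z \<notin> \<int>"
  shows "Digamma (1 - z) - Digamma z = of_real pi * cot (of_real pi * z)"
proof -
  have z1: "z \<notin> \<int>\<^sub>\<le>\<^sub>0" "1 - z \<notin> \<int>\<^sub>\<le>\<^sub>0"
    using z nonpos_Ints_subset_Ints Ints_diff[OF Ints_1, of "1 - z"] by auto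
  have sn: "sin (of_real pi * z) \<noteq> 0" using z sin_eq_0[of "of_real pi * z"]
    by (auto simp: Ints_def mult.commute)
  have 1: "((\<lambda>z. Gamma z * Gamma (1 - z)) has_field_derivative
     Gamma z * Gamma (1 - z) * (Digamma z - Digamma (1 - z))) (at z)"
    using z1 by (auto intro!: derivative_eq_intros simp: algebra_simps)
  have 2: "((\<lambda>z. of_real pi / sin (of_real pi * z)) has_field_derivative
     - (of_real pi * of_real pi * cos (of_real pi * z)) / (sin (of_real pi * z))\<^sup>2) (at z)"
    using sn by (auto intro!: derivative_eq_intros simp: power2_eq_square)
  have "Gamma z * Gamma (1 - z) * (Digamma z - Digamma (1 - z)) =
     - (of_real pi * of_real pi * cos (of_real pi * z)) / (sin (of_real pi * z))\<^sup>2"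
    using DERIV_unique[OF 1] 2 by (simp add: Gamma_reflection_complex)
  then have eq: "of_real pi / sin (of_real pi * z) * (Digamma z - Digamma (1 - z)) +
     of_real pi * of_real pi * cos (of_real pi * z) / (sin (of_real pi * z))\<^sup>2 = 0"
    unfolding Gamma_reflection_complex by simp
  have "of_real pi * (sin (of_real pi * z) * (Digamma z - Digamma (1 - z)) + of_real pi * cos (of_real pi * z)) =
    (of_real pi / sin (of_real pi * z) * (Digamma z - Digamma (1 - z)) +
     of_real pi * of_real pi * cos (of_real pi * z) / (sin (of_real pi * z))\<^sup>2) * (sin (of_real pi * z))\<^sup>2"
    using sn by (simp add: field_simps power2_eq_square)
  then have "of_real pi * (sin (of_real pi * z) * (Digamma z - Digamma (1 - z)) + of_real pi * cos (of_real pi * z)) = 0"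
    unfolding eq by simp
  then have "sin (of_real pi * z) * (Digamma z - Digamma (1 - z)) + of_real pi * cos (of_real pi * z) = 0"
    by simp
  then show ?thesis using sn by (simp add: cot_def field_simps)
qed

text \<open>The difference of the limit formulas for \<open>Digamma (1 - z)\<close> and
  \<open>Digamma z\<close>: the logarithms cancel and the reciprocals pair up.\<close>

lemma cot_partial_fractions:
  fixes z :: complex
  assumes z: "z \<notin> \<int>"
  shows "(\<lambda>m. \<Sum>n<m. 1 / (z + of_nat n) + 1 / (z - of_nat (Suc n))) \<longlonglongrightarrow> of_real pi * cot (of_real pi * z)"
proof -
  have "z \<noteq> 0" "1 - z \<noteq> 0" using z by auto
  from tendsto_diff[OF Digamma_LIMSEQ[OF this(2)] Digamma_LIMSEQ[OF this(1)]]
  have "(\<lambda>m. (\<Sum>n<m. inverse (z + of_nat n)) - (\<Sum>n<m. inverse (1 - z + of_nat n))) \<longlonglongrightarrow> of_real pi * cot (of_real pi * z)"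
    unfolding Digamma_reflection[OF z] by (simp add: algebra_simps)
  moreover have "(\<Sum>n<m. inverse (z + of_nat n)) - (\<Sum>n<m. inverse (1 - z + of_nat n)) =
     (\<Sum>n<m. 1 / (z + of_nat n) + 1 / (z - of_nat (Suc n)))" for m
  proof -
    have "- inverse (1 - z + of_nat n) = 1 / (z - of_nat (Suc n))" for n
      by (subst inverse_minus_eq[symmetric]) (simp add: inverse_eq_divide algebra_simps)
    then have "inverse (z + of_nat n) - inverse (1 - z + of_nat n) = 1 / (z + of_nat n) + 1 / (z - of_nat (Suc n))" for n
      unfolding diff_conv_add_uminus[of "inverse (z + of_nat n)"] by (simp only: inverse_eq_divide[of "z + of_nat n"])
    then show ?thesis unfolding sum_subtractf[symmetric] by (simp only:)
  qed
  ultimately show ?thesis by (simp only:)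
qed

text \<open>The cotangent expansion rotated by \<open>z = \<i> * w / (2 * pi)\<close>. The pole of
  index \<open>n\<close> is paired with that of index \<open>-(n + 1)\<close>, which is the pairing
  that cuts the poles into complete blocks of residues modulo \<open>q\<close> later on. The
  expansion takes the place of Poisson summation in the functional equation.\<close>

lemma exp_partial_fractions:
  fixes w :: complex
  assumes w: "exp w \<noteq> 1"
  shows "(\<lambda>m. \<Sum>n<m. 1 / (w - 2 * of_real pi * \<i> * of_nat n) + 1 / (w + 2 * of_real pi * \<i> * of_nat (Suc n)))
    \<longlonglongrightarrow> 1/2 + 1 / (exp w - 1)"
proof -
  define z where "z = \<i> * w / (2 * of_real pi)"
  have wz: "w = - (2 * of_real pi * \<i> * z)" by (simp add: z_def)
  have z: "z \<notin> \<int>"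
  proof
    assume "z \<in> \<int>"
    then obtain k where "z = of_int k" by (elim Ints_cases)
    then have "exp w = 1" unfolding exp_eq_1 wz by (auto intro!: exI[of _ "-k"])
    with w show False by simp
  qed
  have "(\<lambda>m. \<i> / (2 * of_real pi) * (\<Sum>n<m. 1 / (z + of_nat n) + 1 / (z - of_nat (Suc n)))) \<longlonglongrightarrow>
     \<i> / (2 * of_real pi) * (of_real pi * cot (of_real pi * z))"
    by (intro tendsto_mult_left cot_partial_fractions z)
  moreover have "\<i> / (2 * of_real pi) * (\<Sum>n<m. 1 / (z + of_nat n) + 1 / (z - of_nat (Suc n))) =
     (\<Sum>n<m. 1 / (w - 2 * of_real pi * \<i> * of_nat n) + 1 / (w + 2 * of_real pi * \<i> * of_nat (Suc n)))" for m
  proof -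
    have *: "\<i> / (2 * of_real pi) * (1 / (z + x)) = 1 / (w - 2 * of_real pi * \<i> * x)" for x
    proof -
      have "w - 2 * of_real pi * \<i> * x = - (2 * of_real pi * \<i> * (z + x))" by (simp add: wz algebra_simps)
      then show ?thesis by (simp only:) (cases "z + x = 0"; simp add: divide_simps)
    qed
    have "\<i> / (2 * of_real pi) * (1 / (z + of_nat n)) = 1 / (w - 2 * of_real pi * \<i> * of_nat n)"
      "\<i> / (2 * of_real pi) * (1 / (z - of_nat (Suc n))) = 1 / (w + 2 * of_real pi * \<i> * of_nat (Suc n))" for n
      using *[of "of_nat n"] *[of "- of_nat (Suc n)"] by (simp_all only: mult_minus_right diff_minus_eq_add add_uminus_conv_diff)
    then show ?thesis unfolding sum_distrib_left distrib_left by (simp only:)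
  qed
  moreover have "\<i> / (2 * of_real pi) * (of_real pi * cot (of_real pi * z)) = 1/2 + 1 / (exp w - 1)"
  proof -
    define e where "e = exp (w / 2)"
    have e0: "e \<noteq> 0" by (simp add: e_def)
    have ee: "exp w = e * e" unfolding e_def exp_add[symmetric] by simp
    have pz: "of_real pi * z = \<i> * w / 2" by (simp add: z_def)
    have "exp (\<i> * (of_real pi * z)) = inverse e" "exp (- (\<i> * (of_real pi * z))) = e"
      unfolding pz e_def by (simp_all add: exp_minus[symmetric] algebra_simps)
    then have "cot (of_real pi * z) = ((inverse e + e) / 2) / ((inverse e - e) / (2 * \<i>))"
      unfolding cot_def cos_exp_eq sin_exp_eq by simp
    also have "\<dots> = \<i> * (e * e + 1) / (1 - e * e)"
    proof -
      have i: "inverse e + e = (e * e + 1) / e" "inverse e - e = (1 - e * e) / e"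
        using e0 by (simp_all add: field_simps)
      have "- (A / (\<i> * C)) = \<i> * A / C" for A C :: complex by (cases "C = 0") (simp_all add: divide_simps)
      then show ?thesis unfolding i using e0 by simp
    qed
    finally have c: "cot (of_real pi * z) = \<i> * (e * e + 1) / (1 - e * e)" .
    have "e * e \<noteq> 1" using w ee by simp
    then show ?thesis unfolding ee c by (simp add: divide_simps) (simp add: algebra_simps)
  qed
  ultimately show ?thesis by (simp only:)
qed

section \<open>Gamma and Beta integrals on the half-line\<close>

lemma has_bochner_integral_nonneg_HK:
  fixes f :: "real \<Rightarrow> real"
  assumes [measurable]: "f \<in> borel_measurable borel" "A \<in> sets borel"
    and "\<And>x. x \<in> A \<Longrightarrow> 0 \<le> f x" and I: "(f has_integral I) A"
  shows "has_bochner_integral lborel (\<lambda>x. indicator A x * f x) I"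
proof (rule has_bochner_integral_nn_integral)
  show "0 \<le> I" using has_integral_nonneg[OF I] assms by auto
  show "(\<integral>\<^sup>+ x. ennreal (indicator A x * f x) \<partial>lborel) = ennreal I"
    using nn_integral_has_integral_lebesgue[OF assms(3) I] by simp
qed (use assms in \<open>auto simp: indicator_def\<close>)

lemma Gamma_has_bochner_integral:
  assumes "s > (0::real)" "c > 0"
  shows "has_bochner_integral lborel (\<lambda>x. indicator {0<..} x * (x powr (s - 1) * exp (- (c * x)))) (Gamma s * c powr - s)"
proof -
  have "has_bochner_integral lborel (\<lambda>x. indicator {0..} x * (x powr (s - 1) / exp x)) (Gamma s)"
    using Gamma_integral_real[OF assms(1)] by (intro has_bochner_integral_nonneg_HK) auto
  moreover have "indicator {0..} x * (x powr (s - 1) / exp x) = indicator {0<..} x * (x powr (s - 1) / exp x)" for x :: real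
    by (cases "x = 0") (auto simp: indicator_def)
  ultimately have "has_bochner_integral lborel (\<lambda>x. indicator {0<..} x * (x powr (s - 1) / exp x)) (Gamma s)"
    by (simp only:)
  then have "has_bochner_integral lborel (\<lambda>x. indicator {0<..} (0 + c * x) * ((0 + c * x) powr (s - 1) / exp (0 + c * x))) (Gamma s /\<^sub>R \<bar>c\<bar>)"
    using assms by (subst (asm) lborel_has_bochner_integral_real_affine_iff[of c _ _ 0]) auto
  then have "has_bochner_integral lborel (\<lambda>x. c powr (1 - s) * (indicator {0<..} (0 + c * x) * ((0 + c * x) powr (s - 1) / exp (0 + c * x)))) (c powr (1 - s) * (Gamma s /\<^sub>R \<bar>c\<bar>))"
    by (intro has_bochner_integral_mult_right) auto
  moreover have "c powr (1 - s) * (indicator {0<..} (0 + c * x) * ((0 + c * x) powr (s - 1) / exp (0 + c * x))) =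
     indicator {0<..} x * (x powr (s - 1) * exp (- (c * x)))" for x
  proof (cases "x > 0")
    case True
    have "c powr (1 - s) * c powr (s - 1) = 1" using assms by (simp flip: powr_add)
    then show ?thesis using True assms by (simp add: powr_mult exp_minus field_simps)
  qed (use assms in \<open>auto simp: indicator_def zero_less_mult_iff\<close>)
  moreover have "c powr (1 - s) * (Gamma s /\<^sub>R \<bar>c\<bar>) = Gamma s * c powr - s"
    using assms by (simp add: powr_diff powr_minus field_simps)
  ultimately show ?thesis by (simp only:)
qed

text \<open>The substitution \<open>y = sqrt (x / (1 - x))\<close> carries the unit interval to the
  half-line and the Beta integral to this one; since \<open>(1 + r) / 2 + (1 - r) / 2 = 1\<close>,
  the denominator of the Beta function is 1.\<close>

lemma Beta_has_integral_line:
  assumes r: "-1 < r" "r < (1::real)"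
  shows "((\<lambda>y. 2 * y powr r / (1 + y\<^sup>2)) has_integral (Gamma ((1 + r) / 2) * Gamma ((1 - r) / 2))) {0<..}"
proof -
  define g where "g = (\<lambda>x::real. sqrt (x / (1 - x)))"
  define g' where "g' = (\<lambda>x::real. inverse (sqrt (x / (1 - x))) / 2 * (1 / (1 - x)\<^sup>2))"
  define f where "f = (\<lambda>y::real. 2 * y powr r / (1 + y\<^sup>2))"
  let ?S = "{0<..<1::real}"
  define b where "b = Gamma ((1 + r) / 2) * Gamma ((1 - r) / 2)"
  have der: "(g has_field_derivative g' x) (at x within ?S)" if "x \<in> ?S" for x
    using that unfolding g_def g'_def
    by (auto intro!: derivative_eq_intros simp: power2_eq_square field_simps)
  have g2: "(g x)\<^sup>2 = x / (1 - x)" if "x \<in> ?S" for x using that by (simp add: g_def)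
  have inj: "inj_on g ?S"
  proof (rule inj_onI)
    fix x y assume xy: "x \<in> ?S" "y \<in> ?S" "g x = g y"
    then have "x / (1 - x) = y / (1 - y)" using g2 by metis
    then show "x = y" using xy by (simp add: field_simps)
  qed
  have img: "g ` ?S = {0<..}"
  proof safe
    fix y :: real assume y: "y > 0"
    have p: "1 + y\<^sup>2 > 0" by (simp add: add_pos_nonneg)
    have "y\<^sup>2 / (1 + y\<^sup>2) / (1 - y\<^sup>2 / (1 + y\<^sup>2)) = y\<^sup>2" using p by (simp add: field_simps)
    then have "g (y\<^sup>2 / (1 + y\<^sup>2)) = y" unfolding g_def using y by simp
    moreover have "y\<^sup>2 / (1 + y\<^sup>2) \<in> ?S" using y p by (simp add: field_simps)
    ultimately show "y \<in> g ` ?S" by (metis imageI)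
  qed (simp add: g_def)
  have eq: "\<bar>g' x\<bar> * f (g x) = x powr ((1 + r) / 2 - 1) * (1 - x) powr ((1 - r) / 2 - 1)" if x: "x \<in> ?S" for x
  proof -
    define u where "u = x / (1 - x)"
    have u: "u > 0" "1 + u = 1 / (1 - x)" using x by (auto simp: u_def field_simps)
    have gp: "g x = u powr (1/2)" unfolding g_def u_def[symmetric] using u by (simp add: powr_half_sqrt)
    have 1: "f (g x) = 2 * u powr (r/2) * (1 - x)"
      unfolding f_def g2[OF x] u_def[symmetric] using u by (simp add: gp powr_powr)
    have 2: "\<bar>g' x\<bar> = u powr (- 1/2) / 2 / (1 - x)\<^sup>2"
      unfolding g'_def u_def[symmetric] using u x by (simp add: powr_half_sqrt[symmetric] powr_minus[symmetric])
    have "\<bar>g' x\<bar> * f (g x) = (u powr (- 1/2) * u powr (r/2)) / (1 - x)"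
    proof -
      have *: "p / 2 / X\<^sup>2 * (2 * q * X) = p * q / X" if "X \<noteq> 0" for p q X :: real
        using that by (simp add: power2_eq_square)
      show ?thesis unfolding 1 2 using *[of "1 - x"] x by simp
    qed
    also have "\<dots> = u powr ((r - 1) / 2) / (1 - x)" by (simp flip: powr_add add: field_simps)
    also have "\<dots> = x powr ((r - 1) / 2) * ((1 - x) powr (- ((r - 1) / 2)) * (1 - x) powr -1)"
      unfolding u_def using x by (simp add: powr_divide powr_minus field_simps)
    also have "(1 - x) powr (- ((r - 1) / 2)) * (1 - x) powr -1 = (1 - x) powr ((1 - r) / 2 - 1)"
      unfolding powr_add[symmetric] by (simp add: field_simps)
    finally show ?thesis by (simp add: field_simps)
  qed
  have ab: "(1 + r) / 2 > 0" "(1 - r) / 2 > 0" using r by auto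
  have B: "((\<lambda>t. t powr ((1 + r) / 2 - 1) * (1 - t) powr ((1 - r) / 2 - 1)) has_integral b) ?S"
  proof -
    have "Beta ((1 + r) / 2) ((1 - r) / 2) = b"
      unfolding Beta_def b_def by (simp add: add_divide_distrib[symmetric])
    then show ?thesis using has_integral_Beta_real[OF ab] by (simp add: has_integral_Icc_iff_Ioo)
  qed
  have B': "((\<lambda>x. \<bar>g' x\<bar> * f (g x)) has_integral b) ?S"
    by (rule has_integral_eq[OF _ B]) (use eq in auto)
  have "(\<lambda>x. \<bar>g' x\<bar> * f (g x)) absolutely_integrable_on ?S"
    by (rule nonnegative_absolutely_integrable_1) (use B' in \<open>auto simp: f_def has_integral_integrable\<close>)
  then have "f absolutely_integrable_on (g ` ?S) \<and> integral (g ` ?S) f = b"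
    using has_absolute_integral_change_of_variables_1'[OF _ der inj, of f b] B' by (auto simp: has_integral_iff)
  then have "(f has_integral b) {0<..}"
    unfolding img has_integral_iff using absolutely_integrable_on_def by auto
  then show ?thesis by (simp add: f_def b_def)
qed

text \<open>Here \<open>c\<close> will be the height of the poles of \<open>K\<close>. The exponents
  that occur are \<open>r = s\<close> for even characters, and \<open>r = s - 1\<close> for odd ones
  and for the dominating functions; both lie between -1 and 1 when \<open>0 < s < 1\<close>.\<close>

lemma Beta_has_bochner_integral:
  assumes r: "-1 < r" "r < (1::real)" and c: "c > 0"
  shows "has_bochner_integral lborel (\<lambda>x. indicator {0<..} x * (2 * x powr r / (x\<^sup>2 + c\<^sup>2)))
     (c powr (r - 1) * (Gamma ((1 + r) / 2) * Gamma ((1 - r) / 2)))"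
proof -
  define b where "b = Gamma ((1 + r) / 2) * Gamma ((1 - r) / 2)"
  have "has_bochner_integral lborel (\<lambda>x. indicator {0<..} x * (2 * x powr r / (1 + x\<^sup>2))) b"
    using Beta_has_integral_line[OF r] unfolding b_def by (intro has_bochner_integral_nonneg_HK) auto
  then have "has_bochner_integral lborel (\<lambda>x. indicator {0<..} (0 + inverse c * x) * (2 * (0 + inverse c * x) powr r / (1 + (0 + inverse c * x)\<^sup>2))) (b /\<^sub>R \<bar>inverse c\<bar>)"
    using c by (subst (asm) lborel_has_bochner_integral_real_affine_iff[of "inverse c" _ _ 0]) auto
  then have "has_bochner_integral lborel (\<lambda>x. c powr (r - 2) * (indicator {0<..} (0 + inverse c * x) * (2 * (0 + inverse c * x) powr r / (1 + (0 + inverse c * x)\<^sup>2)))) (c powr (r - 2) * (b /\<^sub>R \<bar>inverse c\<bar>))"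
    by (intro has_bochner_integral_mult_right) auto
  moreover have "c powr (r - 2) * (indicator {0<..} (0 + inverse c * x) * (2 * (0 + inverse c * x) powr r / (1 + (0 + inverse c * x)\<^sup>2))) =
     indicator {0<..} x * (2 * x powr r / (x\<^sup>2 + c\<^sup>2))" for x
  proof (cases "x > 0")
    case True
    have "inverse c * x = x / c" by (simp add: field_simps)
    then have 1: "(inverse c * x) powr r = x powr r / c powr r" using c True by (simp add: powr_divide)
    have 2: "c powr (r - 2) = c powr r / c\<^sup>2" using c by (simp add: powr_diff)
    have 3: "1 + (inverse c * x)\<^sup>2 = (x\<^sup>2 + c\<^sup>2) / c\<^sup>2" using c by (simp add: field_simps)
    have "P / Q * (2 * (X / P) / (R / Q)) = 2 * X / R" if "P \<noteq> 0" "Q \<noteq> 0" for P Q X R :: real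
      using that by simp
    from this[of "c powr r" "c\<^sup>2" "x powr r" "x\<^sup>2 + c\<^sup>2"] show ?thesis
      unfolding add_0 1 2 3 using True c by simp
  qed (use c in \<open>auto simp: indicator_def zero_less_mult_iff\<close>)
  moreover have "c powr (r - 2) * (b /\<^sub>R \<bar>inverse c\<bar>) = c powr (r - 1) * b"
    using c by (simp add: powr_diff power2_eq_square field_simps)
  ultimately show ?thesis by (simp only: b_def)
qed

text \<open>Abel summation makes the termwise Mellin transform absolutely convergent.\<close>

lemma integral_abel_sum:
  fixes T :: "nat \<Rightarrow> complex" and k :: "nat \<Rightarrow> real \<Rightarrow> complex"
  assumes T: "\<And>n. cmod (T n) \<le> C"
    and k: "\<And>n. has_bochner_integral lborel (k n) (I n)"
    and d: "\<And>n x. cmod (k n x - k (Suc n) x) \<le> D n x"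
    and D: "\<And>n. has_bochner_integral lborel (D n) (J n)" and J: "summable J"
    and sD: "\<And>x. summable (\<lambda>n. D n x)"
    and f: "\<And>x. (\<lambda>n. T n * (k n x - k (Suc n) x)) sums f x"
  shows "(\<lambda>n. T n * (I n - I (Suc n))) sums (\<integral>x. f x \<partial>lborel)"
proof -
  let ?d = "\<lambda>n x. T n * (k n x - k (Suc n) x)"
  have C0: "C \<ge> 0" using T[of 0] norm_ge_zero order_trans by blast
  have hb: "has_bochner_integral lborel (?d n) (T n * (I n - I (Suc n)))" for n
    by (intro has_bochner_integral_mult_right has_bochner_integral_diff k)
  have nd: "cmod (?d n x) \<le> C * D n x" for n x
    unfolding norm_mult using T[of n] d[of n x] C0 by (intro mult_mono) auto
  have intd: "integrable lborel (?d n)" for n using hb has_bochner_integral_iff by blast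
  have "(\<lambda>n. integral\<^sup>L lborel (?d n)) sums (\<integral>x. (\<Sum>n. ?d n x) \<partial>lborel)"
  proof (rule sums_integral)
    show "integrable lborel (?d n)" for n by (rule intd)
    show "AE x in lborel. summable (\<lambda>n. norm (?d n x))"
      by (intro AE_I2 summable_comparison_test[OF _ summable_mult[OF sD, of C]]) (use nd in auto)
    show "summable (\<lambda>n. \<integral>x. norm (?d n x) \<partial>lborel)"
    proof (rule summable_comparison_test[OF _ summable_mult[OF J, of C]], rule exI, safe)
      fix n
      have "(\<integral>x. norm (?d n x) \<partial>lborel) \<le> (\<integral>x. C * D n x \<partial>lborel)"
        using nd integrable_norm[OF intd[of n]] integrable_mult_right[of C lborel "D n"] D[of n]
        by (intro integral_mono) (auto simp: has_bochner_integral_iff)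
      also have "\<dots> = C * J n" using D[of n] by (simp add: has_bochner_integral_iff)
      finally show "norm (\<integral>x. norm (?d n x) \<partial>lborel) \<le> C * J n" by simp
    qed
  qed
  moreover have "(\<Sum>n. ?d n x) = f x" for x using f by (simp add: sums_iff)
  moreover have "integral\<^sup>L lborel (?d n) = T n * (I n - I (Suc n))" for n
    using hb has_bochner_integral_iff by blast
  ultimately show ?thesis by (simp only:)
qed

section \<open>The Gauss sum and the poles of the exponential generating function\<close>

context nonprincipal_char
begin

abbreviation \<psi>c :: "nat \<Rightarrow> complex" where "\<psi>c \<equiv> \<lambda>n. cnj (\<psi> n)"

interpretation cj: nonprincipal_char q \<psi>c by (rule nonprincipal_char_cnj)

definition \<alpha> :: real where "\<alpha> = 2 * pi / real q"

lemma \<alpha>_pos: "\<alpha> > 0" using q_pos by (simp add: \<alpha>_def)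

definition gauss :: complex where "gauss = (\<Sum>a<q. \<psi>c a * cis (\<alpha> * real a))"

lemma cis_mod: "cis (\<alpha> * real (n mod q)) = cis (\<alpha> * real n)"
proof -
  have "real n = real q * real (n div q) + real (n mod q)" by (metis mult_div_mod_eq of_nat_add of_nat_mult)
  then have "\<alpha> * real n = 2 * pi * real (n div q) + \<alpha> * real (n mod q)"
    using q_pos by (simp add: \<alpha>_def field_simps)
  then show ?thesis by (simp flip: cis_mult add: cis_multiple_2pi)
qed

text \<open>For \<open>n\<close> prime to \<open>q\<close> this is the substitution of
  \<open>a * n\<close> for \<open>a\<close> in the Gauss sum; for \<open>q\<close> dividing
  \<open>n\<close> both sides vanish. It turns the coefficients \<open>\<psi> n\<close> into
  additive characters, which geometric series can sum.\<close>

lemma gauss_char: "\<psi> n * gauss = (\<Sum>a<q. \<psi>c a * cis (\<alpha> * real (a * n)))"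
proof (cases "q dvd n")
  case True
  then have "\<psi> n = 0" using dirichlet_charD(6)[OF char] coprime_prime_iff[OF prime_q] by simp
  moreover have "cis (\<alpha> * real (a * n)) = 1" for a
    using cis_mod[of "a * n"] True by simp
  ultimately show ?thesis using cj.sum_char_period by simp
next
  case False
  have n1: "\<psi> n * \<psi>c n = 1"
    using norm_dirichlet_char[OF prime_q char False] by (simp add: complex_mult_cnj cmod_power2[symmetric] flip: of_real_power)
  have "gauss = (\<Sum>a<q. \<psi>c (a * n mod q) * cis (\<alpha> * real (a * n mod q)))"
    unfolding gauss_def
    by (rule sum.reindex_bij_betw[OF bij_betw_mult_mod_prime[OF prime_q False], symmetric])
  also have "\<dots> = (\<Sum>a<q. \<psi>c n * (\<psi>c a * cis (\<alpha> * real (a * n))))"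
    by (simp only: cis_mod dirichlet_char_mod[OF char] char_mult complex_cnj_mult mult_ac)
  finally have "\<psi> n * gauss = (\<psi> n * \<psi>c n) * (\<Sum>a<q. \<psi>c a * cis (\<alpha> * real (a * n)))"
    by (simp add: sum_distrib_left mult.assoc)
  then show ?thesis by (simp add: n1)
qed

text \<open>The value of the character at -1, written with the representative \<open>q - 1\<close>
  because the arguments are natural numbers. It decides between even and odd characters.\<close>

definition eps :: complex where "eps = \<psi> (q - 1)"

lemma eps_cases: "eps = 1 \<or> eps = -1"
proof -
  have "[(q - 1) * (q - 1) = 1] (mod q)"
  proof -
    obtain r where r: "q = Suc r" using q_pos by (cases q) auto
    have "int ((q - 1) * (q - 1)) = 1 + int q * (int q - 2)" by (simp add: r algebra_simps)
    then have "[int ((q - 1) * (q - 1)) = int 1] (mod int q)" by (simp add: cong_def)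
    then show ?thesis using cong_int_iff by blast
  qed
  from dirichlet_char_cong[OF char this] have "eps * eps = 1" by (simp add: eps_def char_mult)
  then have "(eps - 1) * (eps + 1) = 0" by (simp add: algebra_simps)
  then show ?thesis by (auto simp: eq_neg_iff_add_eq_0)
qed

lemma char_neg:
  assumes "q dvd a + j"
  shows "\<psi>c a = eps * \<psi>c j"
proof -
  have "[(q - 1) * j = a] (mod q)"
  proof -
    obtain k where k: "a + j = q * k" using assms by auto
    obtain r where r: "q = Suc r" using q_pos by (cases q) auto
    have 1: "int ((q - 1) * j) = int q * int j - int j" by (simp add: r algebra_simps)
    have 2: "int j = int q * int k - int a" using k by (metis add_diff_cancel_left' of_nat_add of_nat_mult)
    have "int ((q - 1) * j) = int a + int q * (int j - int k)" unfolding 1 using 2 by (simp add: algebra_simps)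
    then have "[int ((q - 1) * j) = int a] (mod int q)" by (simp add: cong_def)
    then show ?thesis using cong_int_iff by blast
  qed
  from dirichlet_char_cong[OF char this] have "\<psi> a = eps * \<psi> j" by (simp add: eps_def char_mult)
  then show ?thesis using eps_cases by auto
qed

text \<open>The exponential generating function, whose Mellin transform is
  \<open>Gamma s * L s\<close>.\<close>

definition F :: "real \<Rightarrow> complex" where "F x = (\<Sum>n. \<psi> n * exp (- of_real (real n * x)))"

lemma F_sums:
  assumes "x > 0"
  shows "(\<lambda>n. \<psi> n * exp (- of_real (real n * x))) sums F x"
  unfolding F_def
proof (rule summable_sums, rule summable_norm_cancel, rule summable_comparison_test)
  show "\<exists>N. \<forall>n\<ge>N. norm (cmod (\<psi> n * exp (- of_real (real n * x)))) \<le> exp (- x) ^ n"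
  proof (intro exI allI impI)
    fix n
    have "cmod (exp (- of_real (real n * x))) = exp (- x) ^ n"
      by (simp add: exp_of_nat_mult[symmetric] norm_exp_eq_Re)
    then show "norm (cmod (\<psi> n * exp (- of_real (real n * x)))) \<le> exp (- x) ^ n"
      using norm_char_le[of n] by (simp add: norm_mult mult_left_le_one_le)
  qed
  show "summable (\<lambda>n. exp (- x) ^ n)" using assms by (intro summable_geometric) auto
qed

text \<open>The joint contribution of the poles at \<open>\<plusminus> \<i> * \<alpha> * j\<close>;
  the pole below the axis belongs to the residue \<open>-j\<close>, whence the factor
  \<open>eps\<close>.\<close>

definition K :: "nat \<Rightarrow> real \<Rightarrow> complex" where
  "K j x = 1 / (of_real x - \<i> * of_real (\<alpha> * real j)) + eps / (of_real x + \<i> * of_real (\<alpha> * real j))"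

text \<open>After \<open>gauss_char\<close> the series splits over the residues \<open>a\<close>
  into geometric series with ratio of modulus below 1.\<close>

lemma gauss_F_eq:
  assumes x: "x > 0"
  shows "gauss * F x = (\<Sum>a<q. \<psi>c a * (1/2 + 1 / (exp (of_real x - \<i> * of_real (\<alpha> * real a)) - 1)))"
proof -
  define w where "w a = of_real x - \<i> * of_real (\<alpha> * real a)" for a
  have nw: "cmod (exp (- w a)) < 1" for a using x by (simp add: w_def norm_exp_eq_Re)
  have "(\<lambda>n. gauss * (\<psi> n * exp (- of_real (real n * x)))) sums (gauss * F x)"
    by (intro sums_mult F_sums x)
  moreover have "gauss * (\<psi> n * exp (- of_real (real n * x))) = (\<Sum>a<q. \<psi>c a * exp (- w a) ^ n)" for n
  proof -
    have "cis (\<alpha> * real (a * n)) * exp (- of_real (real n * x)) = exp (- w a) ^ n" for a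
      unfolding cis_conv_exp exp_of_nat_mult[symmetric] exp_add[symmetric] w_def by (simp add: algebra_simps)
    then have "(\<Sum>a<q. \<psi>c a * exp (- w a) ^ n) = (\<Sum>a<q. \<psi>c a * cis (\<alpha> * real (a * n))) * exp (- of_real (real n * x))"
      by (simp only: sum_distrib_right mult.assoc)
    also have "\<dots> = gauss * (\<psi> n * exp (- of_real (real n * x)))" unfolding gauss_char[symmetric] by simp
    finally show ?thesis by simp
  qed
  ultimately have "(\<lambda>n. \<Sum>a<q. \<psi>c a * exp (- w a) ^ n) sums (gauss * F x)" by (simp only:)
  moreover have "(\<lambda>n. \<Sum>a<q. \<psi>c a * exp (- w a) ^ n) sums (\<Sum>a<q. \<psi>c a * (1 / (1 - exp (- w a))))"
    by (intro sums_sum sums_mult geometric_sums nw)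
  ultimately have "gauss * F x = (\<Sum>a<q. \<psi>c a * (1 / (1 - exp (- w a))))"
    by (rule sums_unique2)
  \<comment> \<open>The sum of a geometric series is rewritten around the odd function
    \<open>1/2 + 1 / (exp w - 1)\<close>, for which partial fractions are at hand; the constant 1/2
    left over is killed by the mean zero of \<open>\<psi>c\<close>.\<close>
  also have "\<dots> = (\<Sum>a<q. \<psi>c a * (1/2) + \<psi>c a * (1/2 + 1 / (exp (w a) - 1)))"
  proof (intro sum.cong refl)
    fix a
    have "exp (w a) \<noteq> 1" using nw[of a] by (auto simp: exp_minus)
    then have "1 / (1 - exp (- w a)) = 1/2 + (1/2 + 1 / (exp (w a) - 1))"
      unfolding exp_minus by (simp add: field_simps)
    then show "\<psi>c a * (1 / (1 - exp (- w a))) = \<psi>c a * (1/2) + \<psi>c a * (1/2 + 1 / (exp (w a) - 1))"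
      by (simp only: distrib_left)
  qed
  also have "\<dots> = (\<Sum>a<q. \<psi>c a) * (1/2) + (\<Sum>a<q. \<psi>c a * (1/2 + 1 / (exp (w a) - 1)))"
    by (simp add: sum.distrib sum_distrib_right)
  finally show ?thesis using cj.sum_char_period by (simp add: w_def)
qed

text \<open>In the block \<open>n\<close> the residue \<open>a\<close> contributes a pole of index
  \<open>n * q + a\<close> and one of index \<open>-(n * q + (q - a))\<close>. The second kind is
  reassigned by \<open>a \<mapsto> q - a\<close>, at the price of \<open>eps\<close>, and both kinds
  then run through the same block of indices \<open>j\<close>.\<close>

lemma sum_K_period:
  "(\<Sum>a<q. \<psi>c a * (\<Sum>n<M. 1 / (of_real x - \<i> * of_real (\<alpha> * real a) - 2 * of_real pi * \<i> * of_nat n) +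
      1 / (of_real x - \<i> * of_real (\<alpha> * real a) + 2 * of_real pi * \<i> * of_nat (Suc n)))) = (\<Sum>j<M * q. \<psi>c j * K j x)"
proof (induction M)
  case (Suc M)
  let ?A = "\<lambda>a n. 1 / (of_real x - \<i> * of_real (\<alpha> * real a) - 2 * of_real pi * \<i> * of_nat n) :: complex"
  let ?B = "\<lambda>a n. 1 / (of_real x - \<i> * of_real (\<alpha> * real a) + 2 * of_real pi * \<i> * of_nat (Suc n)) :: complex"
  have aq: "2 * complex_of_real pi = of_real \<alpha> * of_nat q" using q_pos by (simp add: \<alpha>_def)
  have A: "?A a M = 1 / (of_real x - \<i> * of_real (\<alpha> * real (M * q + a)))" for a
    unfolding aq by (simp add: algebra_simps)
  have B: "?B a M = 1 / (of_real x + \<i> * of_real (\<alpha> * real (M * q + (q - a))))" if "a \<le> q" for a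
    unfolding aq using that by (simp add: algebra_simps of_nat_diff)
  have per: "\<psi>c (M * q + j) = \<psi>c j" for j
    using dirichlet_char_add_mult[OF char, of j M] by (simp add: add.commute)
  have sb: "(\<Sum>a<q. \<psi>c a * ?B a M) = (\<Sum>j<q. \<psi>c j * (eps / (of_real x + \<i> * of_real (\<alpha> * real (M * q + j)))))"
  proof -
    \<comment> \<open>The residue 0 is set aside, where \<open>\<psi>c\<close> vanishes; only then
      does \<open>q - a\<close> stay within the range.\<close>
    have "(\<Sum>a<q. \<psi>c a * ?B a M) = (\<Sum>a\<in>{1..<q}. \<psi>c a * ?B a M)"
      using q_pos by (intro sum.mono_neutral_right) (auto simp: not_less_eq_eq le_Suc_eq less_Suc_eq_0_disj Suc_le_eq)
    also have "\<dots> = (\<Sum>j\<in>{1..<q}. \<psi>c j * (eps / (of_real x + \<i> * of_real (\<alpha> * real (M * q + j)))))"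
    proof (rule sum.reindex_bij_witness[of _ "\<lambda>j. q - j" "\<lambda>a. q - a"])
      fix a assume a: "a \<in> {1..<q}"
      then have "\<psi>c a = eps * \<psi>c (q - a)" by (intro char_neg) auto
      then show "\<psi>c (q - a) * (eps / (of_real x + \<i> * of_real (\<alpha> * real (M * q + (q - a))))) = \<psi>c a * ?B a M"
        using a by (subst B) auto
    qed auto
    also have "\<dots> = (\<Sum>j<q. \<psi>c j * (eps / (of_real x + \<i> * of_real (\<alpha> * real (M * q + j)))))"
      using q_pos by (intro sum.mono_neutral_left) (auto simp: not_less_eq_eq le_Suc_eq less_Suc_eq_0_disj Suc_le_eq)
    finally show ?thesis .
  qed
  have split: "(\<Sum>j<Suc M * q. f j) = (\<Sum>j<M * q. f j) + (\<Sum>j<q. f (M * q + j))" for f :: "nat \<Rightarrow> complex"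
  proof -
    have "(\<Sum>j<N + k. f j) = (\<Sum>j<N. f j) + (\<Sum>j<k. f (N + j))" for N k
      by (induction k) (auto simp: add.assoc)
    from this[of "M * q" q] show ?thesis by (simp add: add.commute)
  qed
  have "(\<Sum>a<q. \<psi>c a * (\<Sum>n<Suc M. ?A a n + ?B a n)) = (\<Sum>a<q. \<psi>c a * (\<Sum>n<M. ?A a n + ?B a n)) + (\<Sum>a<q. \<psi>c a * ?A a M) + (\<Sum>a<q. \<psi>c a * ?B a M)"
    by (simp only: sum.lessThan_Suc distrib_left sum.distrib add_ac)
  also have "\<dots> = (\<Sum>j<M * q. \<psi>c j * K j x) + (\<Sum>j<q. \<psi>c (M * q + j) * K (M * q + j) x)"
    unfolding Suc.IH sb unfolding A per K_def by (simp only: distrib_left sum.distrib add.assoc)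
  also have "\<dots> = (\<Sum>j<Suc M * q. \<psi>c j * K j x)" using split[of "\<lambda>j. \<psi>c j * K j x"] by simp
  finally show ?case .
qed simp

text \<open>Consecutive kernels differ by a quantity summable over \<open>n\<close>, whereas the
  kernels themselves decay only like \<open>1 / n\<close>. This is why the expansion of
  \<open>F\<close> is integrated in its Abel-summed form. The auxiliary sign \<open>s\<close> treats
  the two poles together.\<close>

lemma norm_K_diff:
  assumes "x > 0"
  shows "cmod (K n x - K (Suc n) x) \<le> 2 * \<alpha> / (x\<^sup>2 + (\<alpha> * real n)\<^sup>2)"
proof -
  have *: "cmod (1 / (of_real x + \<i> * of_real (s * (\<alpha> * real n))) - 1 / (of_real x + \<i> * of_real (s * (\<alpha> * real (Suc n)))))
      \<le> \<alpha> / (x\<^sup>2 + (\<alpha> * real n)\<^sup>2)" if s: "\<bar>s\<bar> = 1" for s :: real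
  proof -
    let ?u = "\<lambda>n. of_real x + \<i> * of_real (s * (\<alpha> * real n)) :: complex"
    have nz: "?u k \<noteq> 0" for k using assms by (auto simp: complex_eq_iff)
    have s2: "s\<^sup>2 = 1" using s by (metis abs_power2 power2_abs power_one)
    have n2: "cmod (?u k) = sqrt (x\<^sup>2 + (\<alpha> * real k)\<^sup>2)" for k
      by (simp add: cmod_def power_mult_distrib s2)
    have "1 / ?u n - 1 / ?u (Suc n) = (\<i> * of_real (s * \<alpha>)) / (?u n * ?u (Suc n))"
      using nz[of n] nz[of "Suc n"] by (simp add: divide_simps) (simp add: algebra_simps)
    then have "cmod (1 / ?u n - 1 / ?u (Suc n)) = \<alpha> / (cmod (?u n) * cmod (?u (Suc n)))"
      using s \<alpha>_pos by (simp add: norm_divide norm_mult abs_mult)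
    also have "\<dots> \<le> \<alpha> / (cmod (?u n) * cmod (?u n))"
    proof (rule divide_left_mono)
      have "cmod (?u n) \<le> cmod (?u (Suc n))" unfolding n2 using \<alpha>_pos
        by (intro real_sqrt_le_mono add_left_mono power_mono mult_left_mono) auto
      then show "cmod (?u n) * cmod (?u n) \<le> cmod (?u n) * cmod (?u (Suc n))" by (intro mult_left_mono) auto
      show "0 < (cmod (?u n) * cmod (?u (Suc n))) * (cmod (?u n) * cmod (?u n))"
        using nz[of n] nz[of "Suc n"] by (intro mult_pos_pos) (simp_all only: zero_less_norm_iff not_False_eq_True)
    qed (use \<alpha>_pos in auto)
    also have "cmod (?u n) * cmod (?u n) = x\<^sup>2 + (\<alpha> * real n)\<^sup>2" unfolding n2 by simp
    finally show ?thesis .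
  qed
  have ne: "cmod eps = 1" using eps_cases by auto
  let ?e = "1 / (of_real x + \<i> * of_real (\<alpha> * real n)) - 1 / (of_real x + \<i> * of_real (\<alpha> * real (Suc n)))"
  have "K n x - K (Suc n) x = (1 / (of_real x + \<i> * of_real (-1 * (\<alpha> * real n))) - 1 / (of_real x + \<i> * of_real (-1 * (\<alpha> * real (Suc n))))) + eps * ?e"
    unfolding K_def by (simp add: algebra_simps diff_divide_distrib)
  also have "cmod \<dots> \<le> \<alpha> / (x\<^sup>2 + (\<alpha> * real n)\<^sup>2) + cmod eps * cmod ?e"
    by (rule order_trans[OF norm_triangle_ineq]) (use *[of "-1"] in \<open>simp add: norm_mult\<close>)
  also have "\<dots> \<le> \<alpha> / (x\<^sup>2 + (\<alpha> * real n)\<^sup>2) + \<alpha> / (x\<^sup>2 + (\<alpha> * real n)\<^sup>2)"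
    using *[of 1] ne by simp
  finally show ?thesis by simp
qed

lemma summable_inverse_squares: "c > 0 \<Longrightarrow> summable (\<lambda>n. C / (x\<^sup>2 + (c * real (Suc n))\<^sup>2))"
proof (rule summable_comparison_test)
  assume c: "c > 0"
  show "\<exists>N. \<forall>n\<ge>N. norm (C / (x\<^sup>2 + (c * real (Suc n))\<^sup>2)) \<le> (\<bar>C\<bar> / c\<^sup>2) * (1 / real (Suc n) ^ 2)"
  proof (intro exI allI impI)
    fix n
    have "\<bar>C\<bar> / (x\<^sup>2 + (c * real (Suc n))\<^sup>2) \<le> \<bar>C\<bar> / (c * real (Suc n))\<^sup>2"
      using c by (intro divide_left_mono mult_pos_pos) (auto simp: add_nonneg_pos)
    then show "norm (C / (x\<^sup>2 + (c * real (Suc n))\<^sup>2)) \<le> (\<bar>C\<bar> / c\<^sup>2) * (1 / real (Suc n) ^ 2)"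
      by (simp add: power_mult_distrib abs_of_nonneg)
  qed
  have "summable (\<lambda>n. 1 / real (Suc n) ^ 2)"
    using summable_Suc_iff[of "\<lambda>n. inverse (real n ^ 2)"] inverse_power_summable[of 2, where 'a = real] by (simp add: inverse_eq_divide)
  then show "summable (\<lambda>n. (\<bar>C\<bar> / c\<^sup>2) * (1 / real (Suc n) ^ 2))" by (rule summable_mult)
qed

text \<open>The Abel-summed series converges absolutely, so its sum can be computed along the
  subsequence of complete periods, where it agrees with the partial fractions.\<close>

lemma gauss_F_abel:
  assumes x: "x > 0"
  shows "(\<lambda>n. (\<Sum>k=1..Suc n. \<psi>c k) * (K (Suc n) x - K (Suc (Suc n)) x)) sums (gauss * F x)"
proof -
  let ?t = "\<lambda>n. (\<Sum>k=1..Suc n. \<psi>c k) * (K (Suc n) x - K (Suc (Suc n)) x)"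
  have "summable ?t"
  proof (rule summable_norm_cancel, rule summable_comparison_test[OF _ summable_mult[OF summable_inverse_squares[OF \<alpha>_pos, of "2 * \<alpha>" x], of B]], intro exI allI impI)
    fix n
    show "norm (cmod (?t n)) \<le> B * (2 * \<alpha> / (x\<^sup>2 + (\<alpha> * real (Suc n))\<^sup>2))"
      using cj.partial_sum_bound'[of "Suc n"] norm_K_diff[OF x, of "Suc n"] B_pos
      unfolding norm_mult real_norm_def abs_mult abs_norm_cancel by (intro mult_mono) auto
  qed
  then have 1: "(\<lambda>N. \<Sum>n<N. ?t n) \<longlonglongrightarrow> (\<Sum>n. ?t n)" by (rule summable_LIMSEQ)
  have fl: "filterlim (\<lambda>M. Suc M * q - 1) sequentially sequentially"
  proof (rule filterlim_at_top_mono[OF filterlim_ident], rule always_eventually, rule allI)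
    fix M show "M \<le> Suc M * q - 1" using q_pos by (cases q) auto
  qed
  have 2: "(\<lambda>M. \<Sum>n<Suc M * q - 1. ?t n) \<longlonglongrightarrow> (\<Sum>n. ?t n)"
    by (rule filterlim_compose[OF 1 fl])
  have ew: "exp (of_real x - \<i> * of_real (\<alpha> * real a)) \<noteq> (1::complex)" for a
  proof
    assume "exp (of_real x - \<i> * of_real (\<alpha> * real a)) = (1::complex)"
    then have "cmod (exp (of_real x - \<i> * of_real (\<alpha> * real a))) = 1" by simp
    then show False using x by (simp add: norm_exp_eq_Re)
  qed
  have 3: "(\<lambda>M. \<Sum>j<M * q. \<psi>c j * K j x) \<longlonglongrightarrow> gauss * F x"
    unfolding gauss_F_eq[OF x] sum_K_period[symmetric]
    by (intro tendsto_sum tendsto_mult_left exp_partial_fractions ew)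
  \<comment> \<open>At \<open>Suc N = Suc M * q\<close> the partial sum of \<open>\<psi>c\<close>
    runs over complete periods and is 0, so the boundary term of the summation by parts disappears.
    The last index may be dropped since \<open>\<psi>c\<close> vanishes there.\<close>
  have 4: "(\<Sum>n<Suc M * q - 1. ?t n) = (\<Sum>j<Suc M * q. \<psi>c j * K j x)" for M
  proof -
    define N where "N = Suc M * q - 1"
    have N: "Suc N = Suc M * q" using q_pos by (simp add: N_def)
    have z: "\<psi>c (Suc N) = 0" unfolding N using dirichlet_char_add_mult[OF char, of 0 "Suc M"] by simp
    have s: "(\<Sum>k=1..Suc N. f k) = (\<Sum>j<Suc N. f j)" if "f 0 = 0" "f (Suc N) = 0" for f :: "nat \<Rightarrow> complex"
    proof -
      have "(\<Sum>k=1..Suc N. f k) = (\<Sum>j\<le>Suc N. f j)"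
        using that by (intro sum.mono_neutral_left) (auto simp: not_less_eq_eq)
      then show ?thesis using that by (simp add: lessThan_Suc_atMost)
    qed
    have T0: "(\<Sum>k=1..Suc N. \<psi>c k) = 0"
      using s[of \<psi>c] z cj.sum_mult_period[of "Suc M"] unfolding N by simp
    have "(\<Sum>k=1..Suc N. \<psi>c k * K k x) = (\<Sum>n<N. ?t n)"
      unfolding cj.abel_series_partial T0 by simp
    moreover have "(\<Sum>k=1..Suc N. \<psi>c k * K k x) = (\<Sum>j<Suc N. \<psi>c j * K j x)" using z by (intro s) auto
    ultimately show ?thesis unfolding N N_def[symmetric] by simp
  qed
  have "(\<lambda>M. \<Sum>j<Suc M * q. \<psi>c j * K j x) \<longlonglongrightarrow> gauss * F x"
    using 3 by (subst filterlim_sequentially_Suc)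
  then have "(\<Sum>n. ?t n) = gauss * F x" using LIMSEQ_unique 2 unfolding 4 by blast
  then show ?thesis using summable_sums[OF \<open>summable ?t\<close>] by simp
qed

lemma F_abel:
  assumes x: "x > 0"
  shows "(\<lambda>n. (\<Sum>k=1..Suc n. \<psi> k) * (exp (- of_real (real (Suc n) * x)) - exp (- of_real (real (Suc (Suc n)) * x)))) sums F x"
proof -
  let ?u = "\<lambda>n. exp (- of_real (real n * x)) :: complex"
  have nu: "cmod (?u n) = exp (- x) ^ n" for n by (simp add: exp_of_nat_mult[symmetric] norm_exp_eq_Re)
  have "(\<lambda>N. \<Sum>k<Suc (Suc N). \<psi> k * ?u k) \<longlonglongrightarrow> F x"
    using F_sums[OF x] unfolding sums_def by (subst filterlim_sequentially_Suc, subst filterlim_sequentially_Suc)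
  moreover have "(\<Sum>k<Suc (Suc N). \<psi> k * ?u k) = (\<Sum>k=1..Suc N. \<psi> k * ?u k)" for N
    unfolding lessThan_Suc_atMost by (intro sum.mono_neutral_right) (auto simp: not_less_eq_eq)
  ultimately have 1: "(\<lambda>N. \<Sum>k=1..Suc N. \<psi> k * ?u k) \<longlonglongrightarrow> F x" by (simp only:)
  have 2: "(\<lambda>N. (\<Sum>k=1..Suc N. \<psi> k) * ?u (Suc N)) \<longlonglongrightarrow> 0"
  proof (rule Lim_null_comparison)
    show "\<forall>\<^sub>F N in sequentially. cmod ((\<Sum>k=1..Suc N. \<psi> k) * ?u (Suc N)) \<le> B * exp (- x) ^ Suc N"
    proof (rule always_eventually, rule allI)
      fix N show "cmod ((\<Sum>k=1..Suc N. \<psi> k) * ?u (Suc N)) \<le> B * exp (- x) ^ Suc N"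
        unfolding norm_mult nu by (intro mult_right_mono partial_sum_bound') auto
    qed
    have "(\<lambda>N. B * exp (- x) ^ Suc N) \<longlonglongrightarrow> B * 0"
      using x by (intro tendsto_mult tendsto_const LIMSEQ_Suc LIMSEQ_power_zero) auto
    then show "(\<lambda>N. B * exp (- x) ^ Suc N) \<longlonglongrightarrow> 0" by simp
  qed
  show ?thesis unfolding sums_def using tendsto_diff[OF 1 2] unfolding abel_series_partial by simp
qed

end

section \<open>Two Mellin transforms of \<open>F\<close>\<close>

context nonprincipal_char
begin

interpretation cj: nonprincipal_char q \<psi>c by (rule nonprincipal_char_cnj)

text \<open>The exponentials decrease in \<open>n\<close>, so each difference is its own dominating
  function, and the integrals of these telescope.\<close>

lemma mellin_F:
  fixes s :: real
  assumes s: "s > 0"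
  shows "(\<integral>x. of_real (indicator {0<..} x * x powr (s - 1)) * F x \<partial>lborel) = of_real (Gamma s) * L (of_real s)"
proof -
  let ?k = "\<lambda>n x. complex_of_real (indicator {0<..} x * (x powr (s - 1) * exp (- (real (Suc n) * x))))"
  let ?I = "\<lambda>n. complex_of_real (Gamma s * real (Suc n) powr - s)"
  let ?T = "\<lambda>n. \<Sum>k=1..Suc n. \<psi> k"
  have 1: "(\<lambda>n. ?T n * (?I n - ?I (Suc n))) sums (\<integral>x. of_real (indicator {0<..} x * x powr (s - 1)) * F x \<partial>lborel)"
  proof (rule integral_abel_sum[where k = ?k and C = B and
        D = "\<lambda>n x. indicator {0<..} x * (x powr (s - 1) * exp (- (real (Suc n) * x))) -
               indicator {0<..} x * (x powr (s - 1) * exp (- (real (Suc (Suc n)) * x)))"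
        and J = "\<lambda>n. Gamma s * real (Suc n) powr - s - Gamma s * real (Suc (Suc n)) powr - s"])
    show "cmod (?T n) \<le> B" for n by (rule partial_sum_bound')
    show "has_bochner_integral lborel (?k n) (?I n)" for n
      by (intro has_bochner_integral_of_real Gamma_has_bochner_integral s) auto
    show "has_bochner_integral lborel (\<lambda>x. indicator {0<..} x * (x powr (s - 1) * exp (- (real (Suc n) * x))) -
               indicator {0<..} x * (x powr (s - 1) * exp (- (real (Suc (Suc n)) * x))))
               (Gamma s * real (Suc n) powr - s - Gamma s * real (Suc (Suc n)) powr - s)" for n
      by (intro has_bochner_integral_diff Gamma_has_bochner_integral s) auto
    have "exp (- (real (Suc (Suc n)) * x)) \<le> exp (- (real (Suc n) * x))" if "x > 0" for n x using that by simp
    then have "indicator {0<..} x * (x powr (s - 1) * exp (- (real (Suc (Suc n)) * x))) \<le> indicator {0<..} x * (x powr (s - 1) * exp (- (real (Suc n) * x)))" for n x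
      by (cases "x > 0") (auto intro!: mult_left_mono simp: indicator_def)
    then show "cmod (?k n x - ?k (Suc n) x) \<le> indicator {0<..} x * (x powr (s - 1) * exp (- (real (Suc n) * x))) -
               indicator {0<..} x * (x powr (s - 1) * exp (- (real (Suc (Suc n)) * x)))" for n x
      unfolding of_real_diff[symmetric] norm_of_real by (simp only: abs_of_nonneg diff_ge_0_iff_ge order_refl)
    have l0: "(\<lambda>n. Gamma s * real (Suc n) powr - s) \<longlonglongrightarrow> 0"
      using s by real_asymp
    show "summable (\<lambda>n. Gamma s * real (Suc n) powr - s - Gamma s * real (Suc (Suc n)) powr - s)"
      using telescope_summable'[OF l0] by simp
    show "summable (\<lambda>n. indicator {0<..} x * (x powr (s - 1) * exp (- (real (Suc n) * x))) -
               indicator {0<..} x * (x powr (s - 1) * exp (- (real (Suc (Suc n)) * x))))" for x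
    proof (cases "x > 0")
      case True
      have "(\<lambda>n. indicator {0<..} x * (x powr (s - 1) * exp (- (real (Suc n) * x)))) \<longlonglongrightarrow> 0"
        using True by real_asymp
      from telescope_summable'[OF this] show ?thesis by simp
    qed (simp add: indicator_def)
    show "(\<lambda>n. ?T n * (?k n x - ?k (Suc n) x)) sums (of_real (indicator {0<..} x * x powr (s - 1)) * F x)" for x
    proof (cases "x > 0")
      case True
      have "(\<lambda>n. of_real (x powr (s - 1)) * (?T n * (exp (- of_real (real (Suc n) * x)) - exp (- of_real (real (Suc (Suc n)) * x))))) sums
          (of_real (x powr (s - 1)) * F x)"
        by (intro sums_mult F_abel True)
      moreover have "of_real (x powr (s - 1)) * (?T n * (exp (- of_real (real (Suc n) * x)) - exp (- of_real (real (Suc (Suc n)) * x)))) =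
         ?T n * (?k n x - ?k (Suc n) x)" for n
        using True by (simp add: exp_of_real[symmetric] algebra_simps)
      ultimately have "(\<lambda>n. ?T n * (?k n x - ?k (Suc n) x)) sums (of_real (x powr (s - 1)) * F x)" by (simp only:)
      then show ?thesis using True by simp
    qed (simp add: indicator_def)
  qed
  have "(\<lambda>n. of_real (Gamma s) * (?T n * (of_nat (Suc n) powr - of_real s - of_nat (Suc (Suc n)) powr - of_real s))) sums
     (of_real (Gamma s) * L (of_real s))"
    unfolding abel_series_def
    by (intro sums_mult summable_sums summable_norm_cancel[OF abel_summable]) (use s in auto)
  moreover have "of_real (Gamma s) * (?T n * (of_nat (Suc n) powr - of_real s - of_nat (Suc (Suc n)) powr - of_real s)) =
      ?T n * (?I n - ?I (Suc n))" for n
  proof -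
    have "complex_of_nat k powr - of_real s = of_real (real k powr - s)" for k
      using powr_of_real[of "real k" "-s"] by simp
    then show ?thesis by (simp only: of_real_mult) (simp only: algebra_simps)
  qed
  ultimately have "(\<lambda>n. ?T n * (?I n - ?I (Suc n))) sums (of_real (Gamma s) * L (of_real s))" by (simp only:)
  from sums_unique2[OF 1 this] show ?thesis .
qed

text \<open>The Mellin transform of \<open>K j\<close> without its power of
  \<open>\<alpha> * j\<close>. For even characters \<open>K j x\<close> is
  \<open>2 x / (x\<^sup>2 + c\<^sup>2)\<close>, for odd ones
  \<open>2 \<i> c / (x\<^sup>2 + c\<^sup>2)\<close>, with \<open>c = \<alpha> * j\<close>; hence the
  two cases.\<close>

definition kfac :: "real \<Rightarrow> complex" where
  "kfac s = (if eps = 1 then of_real (Gamma ((1 + s) / 2) * Gamma ((1 - s) / 2))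
             else \<i> * of_real (Gamma (s / 2) * Gamma (1 - s / 2)))"

lemma mellin_K:
  assumes s: "0 < s" "s < (1::real)" and j: "j > 0"
  shows "has_bochner_integral lborel (\<lambda>x. of_real (indicator {0<..} x * x powr (s - 1)) * K j x)
     (kfac s * of_real ((\<alpha> * real j) powr (s - 1)))"
proof -
  define c where "c = \<alpha> * real j"
  have c: "c > 0" using \<alpha>_pos j by (simp add: c_def)
  have nz: "complex_of_real x - \<i> * of_real c \<noteq> 0" "complex_of_real x + \<i> * of_real c \<noteq> 0" "x\<^sup>2 + c\<^sup>2 \<noteq> 0" for x
    using c by (auto simp: complex_eq_iff add_nonneg_eq_0_iff)
  have pr: "(complex_of_real x - \<i> * of_real c) * (of_real x + \<i> * of_real c) = of_real (x\<^sup>2 + c\<^sup>2)" for x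
    by (simp add: algebra_simps power2_eq_square)
  show ?thesis
  proof (cases "eps = 1")
    case True
    have "has_bochner_integral lborel (\<lambda>x. of_real (indicator {0<..} x * (2 * x powr s / (x\<^sup>2 + c\<^sup>2))))
        (complex_of_real (c powr (s - 1) * (Gamma ((1 + s) / 2) * Gamma ((1 - s) / 2))))"
      using s c by (intro has_bochner_integral_of_real Beta_has_bochner_integral) auto
    moreover have "of_real (indicator {0<..} x * (2 * x powr s / (x\<^sup>2 + c\<^sup>2))) =
       of_real (indicator {0<..} x * x powr (s - 1)) * K j x" for x
    proof (cases "x > 0")
      case T: True
      have "K j x = 2 * of_real x / ((complex_of_real x - \<i> * of_real c) * (of_real x + \<i> * of_real c))"
        unfolding K_def c_def[symmetric] True using nz[of x] by (simp add: divide_simps)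
      then have "K j x = of_real (2 * x / (x\<^sup>2 + c\<^sup>2))" unfolding pr by simp
      moreover have "x powr s = x powr (s - 1) * x" using T by (simp add: powr_diff)
      ultimately show ?thesis using T by simp
    qed (simp add: indicator_def)
    ultimately show ?thesis using True by (simp only: kfac_def c_def mult.commute[of "_ powr _"] of_real_mult simp_thms if_True)
  next
    case False
    then have e: "eps = -1" using eps_cases by blast
    have "has_bochner_integral lborel (\<lambda>x. of_real (indicator {0<..} x * (2 * x powr (s - 1) / (x\<^sup>2 + c\<^sup>2))))
        (complex_of_real (c powr ((s - 1) - 1) * (Gamma ((1 + (s - 1)) / 2) * Gamma ((1 - (s - 1)) / 2))))"
      using s c by (intro has_bochner_integral_of_real Beta_has_bochner_integral) auto
    then have "has_bochner_integral lborel (\<lambda>x. (\<i> * of_real c) * of_real (indicator {0<..} x * (2 * x powr (s - 1) / (x\<^sup>2 + c\<^sup>2))))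
        ((\<i> * of_real c) * complex_of_real (c powr ((s - 1) - 1) * (Gamma ((1 + (s - 1)) / 2) * Gamma ((1 - (s - 1)) / 2))))"
      by (intro has_bochner_integral_mult_right) auto
    moreover have "(\<i> * of_real c) * of_real (indicator {0<..} x * (2 * x powr (s - 1) / (x\<^sup>2 + c\<^sup>2))) =
       of_real (indicator {0<..} x * x powr (s - 1)) * K j x" for x
    proof (cases "x > 0")
      case T: True
      have "K j x = 2 * \<i> * of_real c / ((complex_of_real x - \<i> * of_real c) * (of_real x + \<i> * of_real c))"
        unfolding K_def c_def[symmetric] e using nz[of x] by (simp add: divide_simps)
      then have "K j x = 2 * \<i> * of_real c / of_real (x\<^sup>2 + c\<^sup>2)" unfolding pr by simp
      then show ?thesis using T by simp
    qed (simp add: indicator_def)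
    moreover have "(\<i> * of_real c) * complex_of_real (c powr ((s - 1) - 1) * (Gamma ((1 + (s - 1)) / 2) * Gamma ((1 - (s - 1)) / 2)))
       = kfac s * of_real (c powr (s - 1))"
    proof -
      have "c powr (s - 1) = c * c powr ((s - 1) - 1)" using c by (simp add: powr_diff power2_eq_square)
      moreover have "(1 - (s - 1)) / 2 = 1 - s / 2" "(1 + (s - 1)) / 2 = s / 2" by (simp_all add: field_simps)
      ultimately show ?thesis using False by (simp add: kfac_def diff_divide_distrib)
    qed
    ultimately show ?thesis by (simp only: c_def)
  qed
qed

text \<open>Termwise transformation of the pole expansion produces powers
  \<open>j powr (s - 1)\<close> with coefficients \<open>\<psi>c j\<close>, that is, the conjugate
  L-series at \<open>1 - s\<close>. The dominating integrals are of size
  \<open>n powr (s - 2)\<close>, summable because \<open>s < 1\<close>.\<close>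

lemma mellin_gauss_F:
  fixes s :: real
  assumes s: "0 < s" "s < 1"
  shows "(\<integral>x. of_real (indicator {0<..} x * x powr (s - 1)) * (gauss * F x) \<partial>lborel) =
     kfac s * of_real (\<alpha> powr (s - 1)) * abel_series \<psi>c (of_real (1 - s))"
proof -
  let ?k = "\<lambda>n x. of_real (indicator {0<..} x * x powr (s - 1)) * K (Suc n) x"
  let ?I = "\<lambda>n. kfac s * of_real ((\<alpha> * real (Suc n)) powr (s - 1))"
  let ?T = "\<lambda>n. \<Sum>k=1..Suc n. \<psi>c k"
  have b: "\<alpha> * real (Suc n) > 0" for n using \<alpha>_pos by simp
  have 1: "(\<lambda>n. ?T n * (?I n - ?I (Suc n))) sums (\<integral>x. of_real (indicator {0<..} x * x powr (s - 1)) * (gauss * F x) \<partial>lborel)"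
  proof (rule integral_abel_sum[where k = ?k and C = B and
        D = "\<lambda>n x. \<alpha> * (indicator {0<..} x * (2 * x powr (s - 1) / (x\<^sup>2 + (\<alpha> * real (Suc n))\<^sup>2)))"
        and J = "\<lambda>n. \<alpha> * ((\<alpha> * real (Suc n)) powr ((s - 1) - 1) * (Gamma ((1 + (s - 1)) / 2) * Gamma ((1 - (s - 1)) / 2)))"])
    show "cmod (?T n) \<le> B" for n by (rule cj.partial_sum_bound')
    show "has_bochner_integral lborel (?k n) (?I n)" for n by (intro mellin_K s) auto
    show "has_bochner_integral lborel (\<lambda>x. \<alpha> * (indicator {0<..} x * (2 * x powr (s - 1) / (x\<^sup>2 + (\<alpha> * real (Suc n))\<^sup>2))))
      (\<alpha> * ((\<alpha> * real (Suc n)) powr ((s - 1) - 1) * (Gamma ((1 + (s - 1)) / 2) * Gamma ((1 - (s - 1)) / 2))))" for n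
      using s b[of n] by (intro has_bochner_integral_mult_right Beta_has_bochner_integral) auto
    show "cmod (?k n x - ?k (Suc n) x) \<le> \<alpha> * (indicator {0<..} x * (2 * x powr (s - 1) / (x\<^sup>2 + (\<alpha> * real (Suc n))\<^sup>2)))" for n x
    proof (cases "x > 0")
      case True
      have "cmod (?k n x - ?k (Suc n) x) = x powr (s - 1) * cmod (K (Suc n) x - K (Suc (Suc n)) x)"
        using True by (simp add: norm_mult flip: right_diff_distrib)
      also have "\<dots> \<le> x powr (s - 1) * (2 * \<alpha> / (x\<^sup>2 + (\<alpha> * real (Suc n))\<^sup>2))"
        by (intro mult_left_mono norm_K_diff True) auto
      finally show ?thesis using True by (simp add: mult_ac)
    qed (simp add: indicator_def)
    have "summable (\<lambda>n. real (Suc n) powr (s - 2))"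
      using summable_Suc_iff[of "\<lambda>n. real n powr (s - 2)"] summable_real_powr_iff[of "s - 2"] s by simp
    then have "summable (\<lambda>n. (\<alpha> * (\<alpha> powr ((s - 1) - 1) * (Gamma ((1 + (s - 1)) / 2) * Gamma ((1 - (s - 1)) / 2)))) * real (Suc n) powr (s - 2))"
      by (rule summable_mult)
    moreover have "(\<alpha> * real (Suc n)) powr ((s - 1) - 1) = \<alpha> powr ((s - 1) - 1) * real (Suc n) powr (s - 2)" for n
      using \<alpha>_pos by (simp add: powr_mult)
    ultimately show "summable (\<lambda>n. \<alpha> * ((\<alpha> * real (Suc n)) powr ((s - 1) - 1) * (Gamma ((1 + (s - 1)) / 2) * Gamma ((1 - (s - 1)) / 2))))"
      by (simp only: mult_ac)
    show "summable (\<lambda>n. \<alpha> * (indicator {0<..} x * (2 * x powr (s - 1) / (x\<^sup>2 + (\<alpha> * real (Suc n))\<^sup>2))))" for x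
      using summable_mult[OF summable_inverse_squares[OF \<alpha>_pos, of "2 * x powr (s - 1)" x], of "\<alpha> * indicator {0<..} x"]
      by (simp only: mult.assoc)
    show "(\<lambda>n. ?T n * (?k n x - ?k (Suc n) x)) sums (of_real (indicator {0<..} x * x powr (s - 1)) * (gauss * F x))" for x
    proof (cases "x > 0")
      case True
      have "(\<lambda>n. of_real (x powr (s - 1)) * (?T n * (K (Suc n) x - K (Suc (Suc n)) x))) sums
          (of_real (x powr (s - 1)) * (gauss * F x))"
        by (intro sums_mult gauss_F_abel True)
      moreover have "of_real (x powr (s - 1)) * (?T n * (K (Suc n) x - K (Suc (Suc n)) x)) =
         ?T n * (?k n x - ?k (Suc n) x)" for n
        using True by (simp add: algebra_simps)
      ultimately have "(\<lambda>n. ?T n * (?k n x - ?k (Suc n) x)) sums (of_real (x powr (s - 1)) * (gauss * F x))" by (simp only:)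
      then show ?thesis using True by simp
    qed (simp add: indicator_def)
  qed
  let ?c = "kfac s * of_real (\<alpha> powr (s - 1))"
  have "(\<lambda>n. ?c * (?T n * (of_nat (Suc n) powr - of_real (1 - s) - of_nat (Suc (Suc n)) powr - of_real (1 - s)))) sums
     (?c * abel_series \<psi>c (of_real (1 - s)))"
    unfolding abel_series_def
    by (intro sums_mult summable_sums summable_norm_cancel[OF cj.abel_summable]) (use s in auto)
  moreover have "?c * (?T n * (of_nat (Suc n) powr - of_real (1 - s) - of_nat (Suc (Suc n)) powr - of_real (1 - s))) =
      ?T n * (?I n - ?I (Suc n))" for n
  proof -
    have "complex_of_nat k powr - of_real (1 - s) = of_real (real k powr (s - 1))" for k
      using powr_of_real[of "real k" "s - 1"] by simp
    moreover have "(\<alpha> * real k) powr (s - 1) = \<alpha> powr (s - 1) * real k powr (s - 1)" for k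
      using \<alpha>_pos by (simp add: powr_mult)
    ultimately show ?thesis by (simp only: of_real_mult) (simp only: algebra_simps)
  qed
  ultimately have "(\<lambda>n. ?T n * (?I n - ?I (Suc n))) sums (?c * abel_series \<psi>c (of_real (1 - s)))" by (simp only:)
  from sums_unique2[OF 1 this] show ?thesis .
qed

text \<open>The functional equation in asymmetric form, by evaluating one Mellin integral from the
  exponential series and from the pole expansion.\<close>

lemma functional_equation_real:
  fixes s :: real
  assumes "0 < s" "s < 1"
  shows "gauss * (of_real (Gamma s) * L (of_real s)) =
     kfac s * of_real (\<alpha> powr (s - 1)) * abel_series \<psi>c (of_real (1 - s))"
proof -
  have "(\<integral>x. of_real (indicator {0<..} x * x powr (s - 1)) * (gauss * F x) \<partial>lborel) =
    (\<integral>x. gauss * (of_real (indicator {0<..} x * x powr (s - 1)) * F x) \<partial>lborel)"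
    by (simp add: mult_ac)
  also have "\<dots> = gauss * (\<integral>x. of_real (indicator {0<..} x * x powr (s - 1)) * F x \<partial>lborel)"
    by (rule integral_mult_right_zero)
  finally show ?thesis using mellin_gauss_F[OF assms] mellin_F[of s] assms by simp
qed

end

text \<open>The archimedean factor of the completed L-function with parity \<open>a\<close>. The
  customary constant \<open>(q / pi) powr (a / 2)\<close> is left out, since it would occur on both
  sides of the functional equation. Writing the power by \<open>exp\<close> and a real logarithm
  keeps it visibly entire.\<close>

definition gammafac :: "nat \<Rightarrow> real \<Rightarrow> complex \<Rightarrow> complex" where
  "gammafac q a s = exp (s / 2 * of_real (ln (real q / pi))) * Gamma ((s + of_real a) / 2)"

lemma Re_pos_not_nonpos_Int: "Re z > 0 \<Longrightarrow> z \<notin> \<int>\<^sub>\<le>\<^sub>0"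
  by (auto elim!: nonpos_Ints_cases)

lemma gammafac_nonzero: "a \<ge> 0 \<Longrightarrow> Re s > 0 \<Longrightarrow> gammafac q a s \<noteq> 0"
  using Re_pos_not_nonpos_Int[of "(s + of_real a) / 2"] by (auto simp: gammafac_def Gamma_eq_zero_iff)

lemma holomorphic_flip:
  "f holomorphic_on {s. Re s > 0} \<Longrightarrow> (\<lambda>s. f (1 - s)) holomorphic_on {s. Re s < 1}"
  by (rule holomorphic_on_compose_gen[of "\<lambda>s. 1 - s", unfolded o_def]) (auto intro!: holomorphic_intros)

lemma gammafac_holomorphic:
  assumes "a \<ge> 0" "A \<subseteq> {s. Re s > 0}"
  shows "gammafac q a holomorphic_on A"
proof -
  have "(s + of_real a) / 2 \<notin> \<int>\<^sub>\<le>\<^sub>0" if "s \<in> A" for s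
    using assms that by (intro Re_pos_not_nonpos_Int) (auto intro: add_pos_nonneg)
  then show ?thesis unfolding gammafac_def by (intro holomorphic_intros) auto
qed

lemma gammafac_cnj: "gammafac q a (cnj s) = cnj (gammafac q a s)"
  unfolding gammafac_def by (simp add: exp_cnj cnj_Gamma)

section \<open>The symmetric functional equation and analytic continuation\<close>

context nonprincipal_char
begin

interpretation cj: nonprincipal_char q \<psi>c by (rule nonprincipal_char_cnj)

abbreviation Lc :: "complex \<Rightarrow> complex" where "Lc \<equiv> abel_series \<psi>c"

definition par :: real where "par = (if eps = 1 then 0 else 1)"
definition kap :: complex where "kap = (if eps = 1 then 1 else \<i>)"

lemma par_cases: "par = 0 \<or> par = 1" and par_nonneg: "par \<ge> 0" and par_le: "par \<le> 1"
  by (auto simp: par_def)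

lemma cmod_kap: "cmod kap = 1" by (simp add: kap_def)

text \<open>Legendre duplication splits \<open>Gamma s\<close> into \<open>A * A'\<close>, where
  \<open>A\<close> belongs to the parity of the character. The other factor \<open>A'\<close> also
  occurs in \<open>kfac\<close> and cancels.\<close>

lemma functional_equation_01:
  fixes s :: real
  assumes s: "0 < s" "s < 1"
  shows "gauss * gammafac q par (of_real s) * L (of_real s) =
    kap * of_real (sqrt (real q)) * gammafac q par (1 - of_real s) * Lc (1 - of_real s)"
proof -
  define A A' C where "A = Gamma ((s + par) / 2)" and "A' = Gamma ((1 + s - par) / 2)" and "C = Gamma ((1 - s + par) / 2)"
  have pos: "A > 0" "A' > 0" "C > 0"
    unfolding A_def A'_def C_def using s par_cases by (auto intro!: Gamma_real_pos)
  have AA: "A * A' = 2 powr (1 - s) * sqrt pi * Gamma s"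
  proof -
    have ni: "complex_of_real x \<notin> \<int>\<^sub>\<le>\<^sub>0" if "x > 0" for x
      using that by (intro Re_pos_not_nonpos_Int) auto
    have "Gamma (complex_of_real (s/2)) * Gamma (complex_of_real (s/2) + 1/2) =
       exp ((1 - 2 * complex_of_real (s/2)) * of_real (ln 2)) * of_real (sqrt pi) * Gamma (2 * complex_of_real (s/2))"
      using ni[of "s/2"] ni[of "s/2 + 1/2"] s by (intro Gamma_legendre_duplication) auto
    moreover have "complex_of_real (s/2) + 1/2 = of_real ((1 + s)/2)" "2 * complex_of_real (s/2) = of_real s"
      "(1 - 2 * complex_of_real (s/2)) * of_real (ln 2) = of_real ((1 - s) * ln 2)"
      by (simp_all add: field_simps)
    ultimately have "complex_of_real (Gamma (s/2) * Gamma ((1 + s)/2)) = of_real (exp ((1 - s) * ln 2) * sqrt pi * Gamma s)"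
      by (simp only: Gamma_complex_of_real exp_of_real of_real_mult[symmetric])
    then have "Gamma (s/2) * Gamma ((1 + s)/2) = 2 powr (1 - s) * sqrt pi * Gamma s"
      unfolding of_real_eq_iff by (simp add: powr_def)
    then show ?thesis using par_cases by (auto simp: A_def A'_def add.commute mult.commute)
  qed
  have kf: "kfac s = kap * of_real (A' * C)"
    unfolding kfac_def kap_def A'_def C_def par_def by (auto simp: diff_divide_distrib add_divide_distrib)
  have s1: "complex_of_real (1 - s) = 1 - of_real s" by simp
  have "of_real A' * (gauss * of_real A * L (of_real s)) = of_real (2 powr (1 - s) * sqrt pi) * (gauss * (of_real (Gamma s) * L (of_real s)))"
    using arg_cong[OF AA, of complex_of_real] by (simp add: mult_ac)
  also have "\<dots> = of_real A' * (kap * of_real (2 powr (1 - s) * sqrt pi * \<alpha> powr (s - 1) * C) * Lc (1 - of_real s))"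
    unfolding functional_equation_real[OF s] kf s1 by (simp add: mult_ac)
  finally have eq: "gauss * of_real A * L (of_real s) = kap * of_real (2 powr (1 - s) * sqrt pi * \<alpha> powr (s - 1) * C) * Lc (1 - of_real s)"
    using pos by simp
  define Q where "Q = real q / pi"
  have Q: "Q > 0" using q_pos by (simp add: Q_def)
  have gr: "gammafac q par (of_real x) = of_real (Q powr (x/2) * Gamma ((x + par) / 2))" for x
  proof -
    have "complex_of_real x / 2 * of_real (ln Q) = of_real (x / 2 * ln Q)"
      "(complex_of_real x + of_real par) / 2 = of_real ((x + par) / 2)" by simp_all
    then show ?thesis unfolding gammafac_def Q_def[symmetric] using Q
      by (simp only: exp_of_real Gamma_complex_of_real of_real_mult[symmetric]) (simp add: powr_def)
  qed
  have g1: "gammafac q par (of_real s) = of_real (Q powr (s/2) * A)"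
    by (simp only: gr A_def)
  have g2: "gammafac q par (1 - of_real s) = of_real (Q powr ((1 - s)/2) * C)"
    using gr[of "1 - s"] by (simp only: C_def of_real_diff of_real_1)
  \<comment> \<open>Collecting constants: \<open>2 / \<alpha> = q / pi = Q\<close>, so the powers of
    2 from duplication and of \<open>\<alpha>\<close> from the transform of \<open>K\<close> combine
    to a power of \<open>Q\<close>.\<close>
  have "Q powr (s/2) * (2 powr (1 - s) * sqrt pi * \<alpha> powr (s - 1)) = sqrt (real q) * Q powr ((1 - s)/2)"
  proof -
    have "2 powr (1 - s) * \<alpha> powr (s - 1) = Q powr (1 - s)"
    proof -
      have "\<alpha> powr (s - 1) = (1/\<alpha>) powr (1 - s)" using \<alpha>_pos by (simp add: powr_divide powr_diff)
      then have "2 powr (1 - s) * \<alpha> powr (s - 1) = (2 * (1/\<alpha>)) powr (1 - s)"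
        using \<alpha>_pos by (subst powr_mult) auto
      also have "2 * (1/\<alpha>) = Q" using q_pos by (simp add: \<alpha>_def Q_def field_simps)
      finally show ?thesis .
    qed
    moreover have "sqrt (real q) = sqrt pi * Q powr (1/2)"
      using Q by (simp add: powr_half_sqrt real_sqrt_mult[symmetric] Q_def)
    moreover have "Q powr (s/2) * Q powr (1 - s) = Q powr (1/2) * Q powr ((1 - s)/2)"
      unfolding powr_add[symmetric] by (simp add: field_simps)
    ultimately show ?thesis by (simp add: mult_ac)
  qed
  then have cr: "complex_of_real (Q powr (s/2)) * of_real (2 powr (1 - s) * sqrt pi * \<alpha> powr (s - 1)) = of_real (sqrt (real q) * Q powr ((1 - s)/2))"
    by (simp only: of_real_mult[symmetric])
  have "gauss * gammafac q par (of_real s) * L (of_real s) = of_real (Q powr (s/2)) * (gauss * of_real A * L (of_real s))"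
    unfolding g1 by (simp add: mult_ac)
  also have "\<dots> = kap * (of_real (Q powr (s/2)) * of_real (2 powr (1 - s) * sqrt pi * \<alpha> powr (s - 1))) * of_real C * Lc (1 - of_real s)"
    unfolding eq by (simp add: mult_ac)
  also have "\<dots> = kap * of_real (sqrt (real q)) * gammafac q par (1 - of_real s) * Lc (1 - of_real s)"
    unfolding cr g2 by (simp add: mult_ac)
  finally show ?thesis .
qed

lemma Lc_flip_holomorphic: "(\<lambda>s. Lc (1 - s)) holomorphic_on {s. Re s < 1}"
  by (rule holomorphic_flip[OF cj.abel_series_holomorphic])

lemma gammafac_flip_holomorphic: "(\<lambda>s. gammafac q par (1 - s)) holomorphic_on {s. Re s < 1}"
  by (rule holomorphic_flip[OF gammafac_holomorphic[OF par_nonneg order_refl]])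

text \<open>Both sides are holomorphic in the strip and agree on the real segment, which accumulates
  at 1/2.\<close>

lemma functional_equation:
  assumes "0 < Re s" "Re s < 1"
  shows "gauss * gammafac q par s * L s = kap * of_real (sqrt (real q)) * gammafac q par (1 - s) * Lc (1 - s)"
proof -
  let ?S = "{s. 0 < Re s} \<inter> {s. Re s < 1}"
  let ?f = "\<lambda>s. gauss * gammafac q par s * L s - kap * of_real (sqrt (real q)) * gammafac q par (1 - s) * Lc (1 - s)"
  have hol: "?f holomorphic_on ?S"
    by (intro holomorphic_intros gammafac_holomorphic[OF par_nonneg] holomorphic_on_subset[OF abel_series_holomorphic]
         holomorphic_on_subset[OF Lc_flip_holomorphic] holomorphic_on_subset[OF gammafac_flip_holomorphic]) auto
  have lim: "(1/2 :: complex) islimpt of_real ` {0<..<1}"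
  proof -
    have "\<exists>x\<in>complex_of_real ` {0<..<1}. x \<noteq> 1/2 \<and> dist x (1/2) < e" if "e > 0" for e
    proof (intro bexI conjI)
      define d where "d = min (e/2) (1/4)"
      have d: "0 < d" "d < e" "d \<le> 1/4" using that by (auto simp: d_def)
      have eq: "complex_of_real (1/2 + d) - 1/2 = of_real d" by simp
      show "complex_of_real (1/2 + d) \<noteq> 1/2" using d eq by auto
      show "dist (complex_of_real (1/2 + d)) (1/2) < e" unfolding dist_norm eq using d by simp
      show "complex_of_real (1/2 + d) \<in> of_real ` {0<..<1}" using d by (intro imageI) auto
    qed
    then show ?thesis unfolding islimpt_approachable by blast
  qed
  have "?f s = 0"
  proof (rule analytic_continuation[OF hol, where U = "of_real ` {0<..<1}" and \<xi> = "1/2"])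
    show "open ?S" by (intro open_Int open_halfspace_Re_gt open_halfspace_Re_lt)
    show "connected ?S" by (intro convex_connected convex_Int convex_halfspace_Re_gt convex_halfspace_Re_lt)
    fix z :: complex assume "z \<in> of_real ` {0<..<1}"
    then obtain r where "z = of_real r" "0 < r" "r < 1" by auto
    then show "?f z = 0" using functional_equation_01[of r] by simp
  qed (use assms lim in auto)
  then show ?thesis by simp
qed

text \<open>A vanishing Gauss sum would make the conjugate L-series vanish in the strip by the
  functional equation, hence in the whole half-plane, contradicting \<open>cj.ex_L_nonzero\<close>.
  This yields what is needed without evaluating the modulus of the Gauss sum.\<close>

lemma gauss_nonzero: "gauss \<noteq> 0"
proof
  assume g: "gauss = 0"
  have z: "Lc s = 0" if "0 < Re s" "Re s < 1" for s
    using functional_equation[of "1 - s"] that g gammafac_nonzero[OF par_nonneg, of s] cmod_kap q_pos by auto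
  have "Lc s = 0" if "Re s > 0" for s
  proof (rule analytic_continuation_open[of "{s. 0 < Re s} \<inter> {s. Re s < 1}" "{s. Re s > 0}" Lc "\<lambda>_. 0"])
    show "open ({s. 0 < Re s} \<inter> {s. Re s < 1})" "open {s. Re s > 0}"
      by (intro open_Int open_halfspace_Re_gt open_halfspace_Re_lt)+
    have "1/2 \<in> {s. 0 < Re s} \<inter> {s. Re s < 1}" by simp
    then show "{s. 0 < Re s} \<inter> {s. Re s < 1} \<noteq> {}" by blast
    show "connected {s. Re s > 0}" by (intro convex_connected convex_halfspace_Re_gt)
  qed (use that z cj.abel_series_holomorphic in auto)
  then show False using cj.ex_L_nonzero by auto
qed

text \<open>To the left, the functional equation is solved for \<open>L\<close>; dividing by the
  Gamma factor means multiplying by the entire function \<open>rGamma\<close>, so no pole appears.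
  The two expressions agree on the strip and glue.\<close>

lemma L_continuation:
  "\<exists>f. f holomorphic_on UNIV \<and> (\<forall>s. Re s > 0 \<longrightarrow> f s = L s)"
proof -
  define R where "R s = kap * of_real (sqrt (real q)) / gauss * gammafac q par (1 - s) * Lc (1 - s) *
    (exp (- (s / 2 * of_real (ln (real q / pi)))) * rGamma ((s + of_real par) / 2))" for s
  define f where "f s = (if Re s > 0 then L s else R s)" for s
  have R: "R holomorphic_on {s. Re s < 1}" unfolding R_def
    by (intro holomorphic_intros Lc_flip_holomorphic gammafac_flip_holomorphic) auto
  have RL: "R s = L s" if "0 < Re s" "Re s < 1" for s
  proof -
    have "gammafac q par s * (exp (- (s / 2 * of_real (ln (real q / pi)))) * rGamma ((s + of_real par) / 2)) = 1"
      using gammafac_nonzero[OF par_nonneg that(1), of q]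
      by (simp add: gammafac_def rGamma_inverse_Gamma exp_minus field_simps)
    then have "L s = gauss * gammafac q par s * L s / gauss * (exp (- (s / 2 * of_real (ln (real q / pi)))) * rGamma ((s + of_real par) / 2))"
      using gauss_nonzero by (simp add: mult_ac)
    then show ?thesis unfolding functional_equation[OF that] R_def by simp
  qed
  have "f holomorphic_on {s. Re s > 0} \<union> {s. Re s < 1}"
  proof (rule holomorphic_on_Un)
    show "f holomorphic_on {s. Re s > 0}"
      by (rule holomorphic_transform[OF abel_series_holomorphic]) (simp add: f_def)
    show "f holomorphic_on {s. Re s < 1}"
      by (rule holomorphic_transform[OF R]) (use RL in \<open>auto simp: f_def\<close>)
  qed (auto intro: open_halfspace_Re_gt open_halfspace_Re_lt)
  moreover have "{s. Re s > 0} \<union> {s. Re s < 1} = UNIV" by auto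
  ultimately show ?thesis by (intro exI[of _ f]) (auto simp: f_def)
qed

text \<open>The continuation just found is a witness for the \<open>SOME\<close> in the definition;
  without one the chosen function would be arbitrary.\<close>

lemma dirichlet_L_spec:
  "dirichlet_L q \<psi> holomorphic_on UNIV \<and> (\<forall>s. Re s > 1 \<longrightarrow> dirichlet_L q \<psi> s = (\<Sum>n. \<psi> n / of_nat n powr s))"
proof -
  let ?P = "\<lambda>f. f holomorphic_on (if \<psi> = principal_char q then - {1} else UNIV) \<and>
      (\<forall>s. Re s > 1 \<longrightarrow> f s = (\<Sum>n. \<psi> n / of_nat n powr s))"
  have "\<exists>f. ?P f"
  proof -
    obtain f where f: "f holomorphic_on UNIV" "\<And>s. Re s > 0 \<Longrightarrow> f s = L s" using L_continuation by blast
    have "f s = (\<Sum>n. \<psi> n / of_nat n powr s)" if "Re s > 1" for s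
      using L_sums[of s] f(2)[of s] that by (simp add: sums_iff)
    then show ?thesis using f(1) nonprincipal by auto
  qed
  then have "?P (dirichlet_L q \<psi>)" unfolding dirichlet_L_def by (rule someI_ex)
  then show ?thesis using nonprincipal by simp
qed

lemma dirichlet_L_holomorphic: "dirichlet_L q \<psi> holomorphic_on UNIV"
  using dirichlet_L_spec by blast

lemma dirichlet_L_eq:
  assumes s: "Re s > 0"
  shows "dirichlet_L q \<psi> s = L s"
proof (rule analytic_continuation_open[of "{s. Re s > 1}" "{s. Re s > 0}" "dirichlet_L q \<psi>" L])
  show "{s. Re s > 1} \<noteq> {}" by (auto intro!: exI[of _ 2])
  show "dirichlet_L q \<psi> z = L z" if "z \<in> {s. Re s > 1}" for z
    using dirichlet_L_spec L_sums[of z] that by (simp add: sums_iff)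
qed (use s holomorphic_on_subset[OF dirichlet_L_holomorphic] abel_series_holomorphic in
    \<open>auto intro: open_halfspace_Re_gt convex_connected convex_halfspace_Re_gt\<close>)

end

section \<open>Non-vanishing on the line of absolute convergence\<close>

text \<open>Factor \<open>f w = g w * (w - z) ^ n\<close> with \<open>g\<close> zero-free near
  \<open>z\<close> and differentiate. The case of a nonzero value is included, with order 0.\<close>

lemma log_deriv_local:
  fixes f :: "complex \<Rightarrow> complex"
  assumes "f holomorphic_on S" "open S" "connected S" "z \<in> S" "\<exists>w\<in>S. f w \<noteq> 0"
  shows "zorder f z \<ge> 0 \<and> (\<exists>r>0. \<exists>h. ball z r \<subseteq> S \<and> h holomorphic_on ball z r \<and>
     (\<forall>w\<in>ball z r - {z}. f w \<noteq> 0 \<and> deriv f w / f w = of_int (zorder f z) / (w - z) + h w))"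
proof -
  define n g where "n = nat (zorder f z)" and "g = zor_poly f z"
  have z0: "zorder f z \<ge> 0" using zorder_exist_zero[OF assms] by (auto split: if_splits)
  obtain r where r: "r > 0" "cball z r \<subseteq> S" "g holomorphic_on cball z r"
    "\<And>w. w \<in> cball z r \<Longrightarrow> f w = g w * (w - z) ^ n \<and> g w \<noteq> 0"
    using zorder_exist_zero[OF assms] unfolding n_def g_def by blast
  have gh: "g holomorphic_on ball z r" using r(3) holomorphic_on_subset ball_subset_cball by blast
  define h where "h w = deriv g w / g w" for w
  have hh: "h holomorphic_on ball z r" unfolding h_def
    using r(4) by (intro holomorphic_on_divide holomorphic_deriv gh) auto
  have "f w \<noteq> 0 \<and> deriv f w / f w = of_int (zorder f z) / (w - z) + h w" if w: "w \<in> ball z r - {z}" for w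
  proof -
    have wb: "w \<in> ball z r" and wz: "w - z \<noteq> 0" using w by auto
    have gw: "g w \<noteq> 0" and fw: "f w = g w * (w - z) ^ n" using r(4)[of w] wb by auto
    have dg: "(g has_field_derivative deriv g w) (at w)"
      using gh wb by (meson holomorphic_derivI open_ball)
    have "((\<lambda>w. g w * (w - z) ^ n) has_field_derivative (deriv g w * (w - z) ^ n + g w * (of_nat n * (w - z) ^ (n - 1)))) (at w)"
      by (auto intro!: derivative_eq_intros dg)
    then have "(f has_field_derivative (deriv g w * (w - z) ^ n + g w * (of_nat n * (w - z) ^ (n - 1)))) (at w)"
      by (rule has_field_derivative_transform_within_open[OF _ open_ball wb]) (use r(4) in auto)
    then have "deriv f w = deriv g w * (w - z) ^ n + g w * (of_nat n * (w - z) ^ (n - 1))" by (rule DERIV_imp_deriv)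
    moreover have "of_nat n * (w - z) ^ (n - 1) = of_nat n * (w - z) ^ n / (w - z)"
      using wz by (cases n) auto
    ultimately have dfw: "deriv f w = deriv g w * (w - z) ^ n + g w * (of_nat n * (w - z) ^ n / (w - z))" by (simp only:)
    have "deriv f w / f w = of_nat n / (w - z) + h w"
    proof -
      have "(a * P + b * (k * P / W)) / (b * P) = k / W + a / b" if "P \<noteq> 0" "b \<noteq> 0" "W \<noteq> 0" for a b k P W :: complex
        using that by (simp add: field_simps)
      then show ?thesis unfolding h_def fw dfw using gw wz by simp
    qed
    moreover have "of_int (zorder f z) = (of_nat n :: complex)" using z0 by (simp add: n_def)
    ultimately show ?thesis using fw gw wz by simp
  qed
  then show ?thesis using z0 r hh ball_subset_cball[of z r] by blast
qed

text \<open>Approaching \<open>z\<close> horizontally from the right isolates the order: the regular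
  part is bounded and is multiplied by \<open>x\<close>, which tends to 0.\<close>

lemma log_deriv_limit:
  fixes f :: "complex \<Rightarrow> complex"
  assumes "f holomorphic_on S" "open S" "connected S" "z \<in> S" "\<exists>w\<in>S. f w \<noteq> 0"
  shows "((\<lambda>x. x * Re (deriv f (z + of_real x) / f (z + of_real x))) \<longlongrightarrow> of_int (zorder f z)) (at_right 0)"
proof -
  obtain r h where r: "r > 0" "h holomorphic_on ball z r"
     "\<And>w. w \<in> ball z r - {z} \<Longrightarrow> deriv f w / f w = of_int (zorder f z) / (w - z) + h w"
    using log_deriv_local[OF assms] by blast
  have "isCont h z" using r holomorphic_on_imp_continuous_on[OF r(2)] by (simp add: continuous_on_eq_continuous_at)
  then have "((\<lambda>x. h (z + of_real x)) \<longlongrightarrow> h (z + of_real 0)) (at_right (0::real))"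
    by (intro isCont_tendsto_compose[where g = h] tendsto_intros) (simp_all add: isCont_def)
  then have "((\<lambda>x. of_int (zorder f z) + x * Re (h (z + of_real x))) \<longlongrightarrow> of_int (zorder f z) + 0 * Re (h (z + of_real 0))) (at_right (0::real))"
    by (intro tendsto_intros)
  moreover have "\<forall>\<^sub>F x in at_right (0::real). of_int (zorder f z) + x * Re (h (z + of_real x)) = x * Re (deriv f (z + of_real x) / f (z + of_real x))"
    using eventually_at_right_real[OF r(1)]
  proof eventually_elim
    case (elim x)
    then have "z + of_real x \<in> ball z r - {z}" by (auto simp: dist_norm)
    then have "deriv f (z + of_real x) / f (z + of_real x) = of_real (of_int (zorder f z) / x) + h (z + of_real x)"
      using r(3)[of "z + of_real x"] by simp
    then show ?case using elim by (simp add: distrib_left)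
  qed
  ultimately show ?thesis by (simp add: Lim_transform_eventually)
qed

lemma bounded_smult_limit:
  assumes "isCont g (z::complex)"
  shows "((\<lambda>x. x * Re (g (z + of_real x))) \<longlongrightarrow> 0) (at_right (0::real))"
proof -
  have "((\<lambda>x. g (z + of_real x)) \<longlongrightarrow> g (z + of_real 0)) (at_right (0::real))"
    using assms by (intro isCont_tendsto_compose[where g = g] tendsto_intros) (simp_all add: isCont_def)
  then have "((\<lambda>x. x * Re (g (z + of_real x))) \<longlongrightarrow> 0 * Re (g (z + of_real 0))) (at_right (0::real))"
    by (intro tendsto_intros)
  then show ?thesis by simp
qed

section \<open>The zeta function near the line of absolute convergence\<close>

definition zone :: "nat \<Rightarrow> complex" where "zone n = (if n = 0 then 0 else 1)"

interpretation zone: comp_mult zone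
  by unfold_locales (auto simp: zone_def)

definition eta_coeff :: "nat \<Rightarrow> nat \<Rightarrow> complex" where
  "eta_coeff p n = (if p dvd n then 1 - of_nat p else 1)"

lemma eta_periodic:
  assumes "p \<ge> 2"
  shows "periodic_mean_zero p (eta_coeff p)"
proof
  show "p > 0" using assms by simp
  show "eta_coeff p (n + p) = eta_coeff p n" for n by (simp add: eta_coeff_def)
  have "(\<Sum>n<p. eta_coeff p n) = (\<Sum>n\<in>insert 0 {1..<p}. eta_coeff p n)"
    using assms by (intro sum.cong) auto
  also have "\<dots> = (1 - of_nat p) + (\<Sum>n=1..<p. 1)"
    by (subst sum.insert) (auto simp: eta_coeff_def nat_dvd_not_less intro!: sum.cong)
  also have "\<dots> = 0" using assms by (simp add: of_nat_diff)
  finally show "(\<Sum>n<p. eta_coeff p n) = 0" .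
  show "cmod (eta_coeff p n) \<le> real p" for n
  proof -
    have "1 - complex_of_nat p = of_real (1 - real p)" by simp
    then have "cmod (1 - complex_of_nat p) = real p - 1" using assms by (simp only: norm_of_real)
    then show ?thesis using assms by (simp add: eta_coeff_def)
  qed
qed

lemma eta_eq_zeta:
  assumes p: "p \<ge> 2" and s: "Re s > 1"
  shows "abel_series (eta_coeff p) s = (1 - of_nat p powr (1 - s)) * dser zone s"
proof -
  interpret periodic_mean_zero p "eta_coeff p" by (rule eta_periodic[OF p])
  let ?t = "\<lambda>n. zone n / of_nat n powr s"
  have 1: "?t sums dser zone s" by (rule zone.dser_sums[OF s])
  have "(\<lambda>n. (of_nat p powr (1 - s)) * ?t n) sums ((of_nat p powr (1 - s)) * dser zone s)"
    by (rule sums_mult[OF 1])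
  moreover have "(of_nat p powr (1 - s)) * ?t n = of_nat p * ?t (n * p)" for n
  proof (cases "n = 0")
    case False
    have "of_nat (n * p) powr s = of_nat n powr s * (of_nat p powr s :: complex)"
      unfolding of_nat_mult by (rule powr_times_real) auto
    then show ?thesis using False p by (simp add: zone_def powr_diff)
  qed (simp add: zone_def)
  ultimately have "(\<lambda>n. of_nat p * ?t (n * p)) sums ((of_nat p powr (1 - s)) * dser zone s)" by (simp only:)
  moreover have "(\<lambda>n. (\<lambda>m. if p dvd m then of_nat p * ?t m else 0) (n * p)) sums S \<longleftrightarrow>
      (\<lambda>m. if p dvd m then of_nat p * ?t m else 0) sums S" for S
    using p by (intro sums_mono_reindex) (auto simp: strict_mono_def image_iff elim!: dvdE)
  ultimately have 2: "(\<lambda>m. if p dvd m then of_nat p * ?t m else 0) sums ((of_nat p powr (1 - s)) * dser zone s)"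
    by simp
  have "(\<lambda>n. ?t n - (if p dvd n then of_nat p * ?t n else 0)) sums (dser zone s - of_nat p powr (1 - s) * dser zone s)"
    by (rule sums_diff[OF 1 2])
  moreover have "?t n - (if p dvd n then of_nat p * ?t n else 0) = eta_coeff p n / of_nat n powr s" for n
    by (simp add: eta_coeff_def zone_def diff_divide_distrib)
  ultimately have "(\<lambda>n. eta_coeff p n / of_nat n powr s) sums (dser zone s - of_nat p powr (1 - s) * dser zone s)"
    by (simp only:)
  moreover have "(\<lambda>n. eta_coeff p n / of_nat n powr s) sums abel_series (eta_coeff p) s"
    using s by (intro abel_series_sums) auto
  ultimately show ?thesis using sums_unique2 by (simp add: left_diff_distrib)
qed

lemma two_three_not_both:
  assumes "\<tau> \<noteq> 0"
  shows "\<exists>p::nat. p \<ge> 2 \<and> of_nat p powr (\<i> * of_real \<tau>) \<noteq> (1::complex)"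
proof (rule ccontr)
  assume "\<not> ?thesis"
  then have "of_nat p powr (\<i> * of_real \<tau>) = (1::complex)" if "p \<ge> 2" for p :: nat using that by blast
  then have e: "\<exists>k::int. \<tau> * ln (real p) = 2 * pi * of_int k" if "p \<ge> 2" for p :: nat
  proof -
    have "exp (\<i> * of_real (\<tau> * ln (real p))) = 1"
      using \<open>\<And>p. p \<ge> 2 \<Longrightarrow> _ p\<close>[OF that] that by (simp add: powr_def Ln_of_nat mult.assoc)
    then have "cis (\<tau> * ln (real p)) = 1" by (simp add: cis_conv_exp)
    then have "cos (\<tau> * ln (real p)) = 1" by (metis cis.simps(1) one_complex.simps(1))
    then show ?thesis using cos_one_2pi_int[of "\<tau> * ln (real p)"] by (metis mult.commute mult.left_commute)
  qed
  obtain k l :: int where kl: "\<tau> * ln 2 = 2 * pi * of_int k" "\<tau> * ln 3 = 2 * pi * of_int l"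
    using e[of 2] e[of 3] by auto
  have "\<tau> * ln (real 3) * of_int k = \<tau> * ln (real 2) * of_int l" using kl by simp
  then have eq: "ln 3 * real_of_int k = ln 2 * real_of_int l" using assms by (simp add: mult.assoc)
  have k0: "k \<noteq> 0" using kl(1) assms by auto
  define a b where "a = nat \<bar>k\<bar>" and "b = nat \<bar>l\<bar>"
  have "\<bar>ln 3 * real_of_int k\<bar> = \<bar>ln 2 * real_of_int l\<bar>" using eq by simp
  then have "ln 3 * real a = ln 2 * real b" by (simp add: abs_mult a_def b_def)
  then have "ln ((3::real) ^ a) = ln (2 ^ b)" by (simp add: ln_realpow mult.commute)
  then have "(3::real) ^ a = 2 ^ b" by simp
  then have "real (3 ^ a) = real (2 ^ b)" by simp
  then have n: "(3::nat) ^ a = 2 ^ b" by (simp only: of_nat_eq_iff)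
  have "a > 0" using k0 by (simp add: a_def)
  have "odd ((3::nat) ^ a)" by simp
  then have "b = 0" using n by (cases b) auto
  then show False using n \<open>a > 0\<close> by simp
qed

text \<open>Zeta is the quotient \<open>A / w\<close> of functions holomorphic to the right of 0.
  Zeros of \<open>A\<close> only lower the limit, and zeros of \<open>w\<close> stand for poles of
  zeta; so the limit is at most 1 at the point 1 and at most 0 elsewhere on the line.\<close>

lemma zeta_log_deriv_limit:
  "\<exists>l. l \<le> (if \<tau> = 0 then 1 else 0) \<and>
     ((\<lambda>x. x * Re (zone.Dlog (1 + \<i> * of_real \<tau> + of_real x))) \<longlongrightarrow> l) (at_right 0)"
proof -
  obtain p :: nat where p: "p \<ge> 2" "\<tau> \<noteq> 0 \<Longrightarrow> of_nat p powr (\<i> * of_real \<tau>) \<noteq> (1::complex)"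
    using two_three_not_both[of \<tau>] by (cases "\<tau> = 0") auto
  interpret periodic_mean_zero p "eta_coeff p" by (rule eta_periodic[OF p(1)])
  define A where "A = abel_series (eta_coeff p)"
  define w where "w = (\<lambda>s::complex. 1 - of_nat p powr (1 - s))"
  let ?z = "1 + \<i> * of_real \<tau>"
  have wh: "w holomorphic_on S" for S unfolding w_def using p by (intro holomorphic_intros) auto
  have Ah: "A holomorphic_on {s. Re s > 0}" unfolding A_def by (rule abel_series_holomorphic)
  have A: "A s = w s * dser zone s" if "Re s > 1" for s
    unfolding A_def w_def by (rule eta_eq_zeta[OF p(1) that])
  have wn: "w s \<noteq> 0" if "Re s > 1" for s
  proof
    assume "w s = 0"
    then have "cmod (of_nat p powr (1 - s)) = 1" by (simp add: w_def)
    then have "real p powr (1 - Re s) = 1" using p norm_nat_powr[of p "1 - s"] by simp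
    moreover have "real p powr (1 - Re s) < real p powr 0" using p that by (intro powr_less_mono) auto
    ultimately show False using p by simp
  qed
  have An: "A s \<noteq> 0" if "Re s > 1" for s using A[OF that] wn[OF that] zone.dser_nonzero[OF that] by simp
  have D: "zone.Dlog s = deriv w s / w s - deriv A s / A s" if s: "Re s > 1" for s
  proof -
    have dw: "(w has_field_derivative deriv w s) (at s)" using wh[of UNIV] by (meson UNIV_I holomorphic_derivI open_UNIV)
    have "((\<lambda>s. w s * dser zone s) has_field_derivative (deriv w s * dser zone s + (- zone.Dlog s * dser zone s) * w s)) (at s)"
      by (rule DERIV_mult[OF dw zone.dser_has_derivative[OF s]])
    then have "(A has_field_derivative (deriv w s * dser zone s + (- zone.Dlog s * dser zone s) * w s)) (at s)"
      by (rule has_field_derivative_transform_within_open[OF _ open_halfspace_Re_gt[of 1]]) (use s A in auto)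
    then have "deriv A s = deriv w s * dser zone s + (- zone.Dlog s * dser zone s) * w s" by (rule DERIV_imp_deriv)
    then show ?thesis unfolding A[OF s] using wn[OF s] zone.dser_nonzero[OF s] by (simp add: field_simps)
  qed
  have S: "open {s. Re s > 0}" "connected {s. Re s > 0}"
    by (rule open_halfspace_Re_gt, intro convex_connected convex_halfspace_Re_gt)
  have limA: "((\<lambda>x. x * Re (deriv A (?z + of_real x) / A (?z + of_real x))) \<longlongrightarrow> of_int (zorder A ?z)) (at_right 0)"
    by (rule log_deriv_limit[OF Ah S]) (use An[of 2] in \<open>auto intro!: exI[of _ 2]\<close>)
  have zA: "zorder A ?z \<ge> 0"
    using log_deriv_local[OF Ah S, of ?z] An[of 2] by force
  \<comment> \<open>At \<open>\<tau> = 0\<close> the factor \<open>w\<close> has a simple zero, with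
    derivative \<open>ln p\<close>; for other \<open>\<tau>\<close> the choice of \<open>p\<close>
    makes \<open>w\<close> nonzero, and its logarithmic derivative stays bounded.\<close>
  have limw: "\<exists>l. l \<le> (if \<tau> = 0 then 1 else 0) \<and> ((\<lambda>x. x * Re (deriv w (?z + of_real x) / w (?z + of_real x))) \<longlongrightarrow> l) (at_right (0::real))"
  proof (cases "\<tau> = 0")
    case True
    have "((\<lambda>x. x * Re (deriv w (?z + of_real x) / w (?z + of_real x))) \<longlongrightarrow> of_int (zorder w ?z)) (at_right (0::real))"
      by (rule log_deriv_limit[OF wh open_UNIV connected_UNIV]) (use wn[of 2] in \<open>auto intro!: exI[of _ 2]\<close>)
    moreover have "zorder w ?z = 1"
    proof (rule zorder_zero_eqI')
      have "(w has_field_derivative of_real (ln (real p))) (at 1)"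
      proof -
        have "w = (\<lambda>s. 1 - exp ((1 - s) * of_real (ln (real p))))"
          using p(1) by (simp add: w_def powr_def Ln_of_nat fun_eq_iff)
        then show ?thesis by (simp only:) (auto intro!: derivative_eq_intros)
      qed
      then have d: "deriv w 1 = of_real (ln (real p))" by (rule DERIV_imp_deriv)
      show "(deriv ^^ nat 1) w ?z \<noteq> 0" using True d p by simp
      show "(deriv ^^ i) w ?z = 0" if "i < nat 1" for i using that True p by (simp add: w_def)
    qed (use wh[of UNIV] in \<open>auto simp: analytic_on_def intro!: exI[of _ 1] holomorphic_on_subset[OF wh[of UNIV]]\<close>)
    ultimately show ?thesis using True by (intro exI[of _ 1]) auto
  next
    case False
    have "w ?z \<noteq> 0"
    proof
      assume "w ?z = 0"
      then have "of_nat p powr (- (\<i> * of_real \<tau>)) = (1::complex)" by (simp add: w_def)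
      then show False using p(2)[OF False] by (simp add: powr_minus)
    qed
    then have "isCont (\<lambda>s. deriv w s / w s) ?z"
      using holomorphic_on_imp_continuous_on[OF wh[of UNIV]] holomorphic_on_imp_continuous_on[OF holomorphic_deriv[OF wh[of UNIV]]]
      by (intro continuous_intros) (auto simp: continuous_on_eq_continuous_at)
    from bounded_smult_limit[OF this] show ?thesis using False by (intro exI[of _ 0]) simp
  qed
  then obtain l where l: "l \<le> (if \<tau> = 0 then 1 else 0)"
    "((\<lambda>x. x * Re (deriv w (?z + of_real x) / w (?z + of_real x))) \<longlongrightarrow> l) (at_right (0::real))" by blast
  have "((\<lambda>x. x * Re (deriv w (?z + of_real x) / w (?z + of_real x)) - x * Re (deriv A (?z + of_real x) / A (?z + of_real x)))
     \<longlongrightarrow> l - of_int (zorder A ?z)) (at_right (0::real))"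
    by (rule tendsto_diff[OF l(2) limA])
  moreover have "\<forall>\<^sub>F x in at_right (0::real). x * Re (deriv w (?z + of_real x) / w (?z + of_real x)) - x * Re (deriv A (?z + of_real x) / A (?z + of_real x))
      = x * Re (zone.Dlog (?z + of_real x))"
    using eventually_at_right_less[of 0]
  proof eventually_elim
    case (elim x)
    then show ?case using D[of "?z + of_real x"] by (simp add: right_diff_distrib)
  qed
  ultimately have "((\<lambda>x. x * Re (zone.Dlog (?z + of_real x))) \<longlongrightarrow> l - of_int (zorder A ?z)) (at_right (0::real))"
    by (rule Lim_transform_eventually)
  then show ?thesis using l(1) zA by (intro exI[of _ "l - of_int (zorder A ?z)"]) auto
qed

text \<open>On the unit circle the expression is \<open>2 * (1 + Re z)\<^sup>2\<close>. The
  alternative \<open>z = 0\<close> belongs to multiples of the modulus, where \<open>v\<close> may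
  be any number in the unit disc and 3 alone suffices.\<close>

lemma three_four_one:
  assumes "cmod z \<le> 1"  "cmod z = 1 \<Longrightarrow> v = z\<^sup>2" "cmod z \<noteq> 1 \<Longrightarrow> z = 0" "cmod v \<le> 1"
  shows "3 + 4 * Re z + Re v \<ge> 0"
proof (cases "cmod z = 1")
  case True
  then have "v = z\<^sup>2" "(Re z)\<^sup>2 + (Im z)\<^sup>2 = 1" using assms by (auto simp: cmod_power2[symmetric])
  then have "3 + 4 * Re z + Re v = 2 * (1 + Re z)\<^sup>2" by (simp add: power2_eq_square algebra_simps)
  then show ?thesis by simp
next
  case False
  then show ?thesis using assms abs_Re_le_cmod[of v] by auto
qed

section \<open>The 3-4-1 argument for L-functions\<close>

context nonprincipal_char
begin

lemma log_deriv_limit_line_1: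
  "((\<lambda>x. x * Re (Dlog (1 + \<i> * of_real \<tau> + of_real x))) \<longlongrightarrow> - of_int (zorder L (1 + \<i> * of_real \<tau>))) (at_right 0)"
proof -
  have S: "open {s. Re s > 0}" "connected {s. Re s > 0}"
    by (rule open_halfspace_Re_gt, intro convex_connected convex_halfspace_Re_gt)
  let ?z = "1 + \<i> * of_real \<tau>"
  have "((\<lambda>x. - (x * Re (deriv L (?z + of_real x) / L (?z + of_real x)))) \<longlongrightarrow> - of_int (zorder L ?z)) (at_right 0)"
    by (intro tendsto_minus log_deriv_limit[OF abel_series_holomorphic S]) (use L_nonzero_Re_gt_1[of 2] in \<open>auto intro!: exI[of _ 2]\<close>)
  moreover have "\<forall>\<^sub>F x in at_right (0::real). - (x * Re (deriv L (?z + of_real x) / L (?z + of_real x))) = x * Re (Dlog (?z + of_real x))"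
    using eventually_at_right_less[of 0]
  proof eventually_elim
    case (elim x)
    then show ?case using deriv_L_over_L[of "?z + of_real x"] by simp
  qed
  ultimately show ?thesis by (rule Lim_transform_eventually)
qed

lemma zorder_line_1: "zorder L (1 + \<i> * of_real \<tau>) \<ge> 0" "L (1 + \<i> * of_real \<tau>) = 0 \<Longrightarrow> zorder L (1 + \<i> * of_real \<tau>) > 0"
proof -
  have S: "open {s. Re s > 0}" "connected {s. Re s > 0}"
    by (rule open_halfspace_Re_gt, intro convex_connected convex_halfspace_Re_gt)
  have "if L (1 + \<i> * of_real \<tau>) = 0 then zorder L (1 + \<i> * of_real \<tau>) > 0 else zorder L (1 + \<i> * of_real \<tau>) = 0"
    using zorder_exist_zero[OF abel_series_holomorphic S, of "1 + \<i> * of_real \<tau>"] L_nonzero_Re_gt_1[of 2] by force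
  then show "zorder L (1 + \<i> * of_real \<tau>) \<ge> 0" "L (1 + \<i> * of_real \<tau>) = 0 \<Longrightarrow> zorder L (1 + \<i> * of_real \<tau>) > 0"
    by (auto split: if_splits)
qed

text \<open>Agreement of \<open>\<theta>\<close> with the squared character is required only off the
  multiples of \<open>q\<close>, so that \<open>zone\<close> itself can stand in for the principal
  character when the square is principal.\<close>

lemma three_four_one_sum:
  assumes \<theta>: "comp_mult \<theta>" "\<And>n. \<not> q dvd n \<Longrightarrow> \<theta> n = (\<psi> n)\<^sup>2" and x: "x > 0"
  shows "3 * Re (zone.Dlog (1 + \<i> * of_real 0 + of_real x)) + 4 * Re (Dlog (1 + \<i> * of_real \<tau> + of_real x)) +
     Re (comp_mult.Dlog \<theta> (1 + \<i> * of_real (2 * \<tau>) + of_real x)) \<ge> 0"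
proof -
  interpret t: comp_mult \<theta> by fact
  let ?a = "1 + \<i> * of_real 0 + of_real x" and ?b = "1 + \<i> * of_real \<tau> + of_real x" and ?c = "1 + \<i> * of_real (2 * \<tau>) + of_real x"
  have sums: "(\<lambda>n. 3 * Re (mangoldt n * zone n / of_nat n powr ?a) + 4 * Re (mangoldt n * \<psi> n / of_nat n powr ?b) + Re (mangoldt n * \<theta> n / of_nat n powr ?c))
    sums (3 * Re (zone.Dlog ?a) + 4 * Re (Dlog ?b) + Re (t.Dlog ?c))"
    using x by (intro sums_add sums_mult sums_Re zone.Dlog_sums Dlog_sums t.Dlog_sums) auto
  have nonneg: "3 * Re (mangoldt n * zone n / of_nat n powr ?a) + 4 * Re (mangoldt n * \<psi> n / of_nat n powr ?b) + Re (mangoldt n * \<theta> n / of_nat n powr ?c) \<ge> 0" for n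
  proof (cases "n = 0")
    case False
    define z where "z = \<psi> n * of_nat n powr (- (\<i> * of_real \<tau>))"
    define v where "v = \<theta> n * of_nat n powr (- (\<i> * of_real (2 * \<tau>)))"
    define m where "m = mangoldt n * real n powr - (1 + x)"
    have m: "m \<ge> 0" by (simp add: m_def mangoldt_nonneg)
    have pw: "1 / of_nat n powr (1 + \<i> * of_real y + of_real x) = of_real (real n powr - (1 + x)) * of_nat n powr (- (\<i> * of_real y))" for y
    proof -
      have "1 / of_nat n powr (1 + \<i> * of_real y + of_real x) = of_nat n powr (- of_real (1 + x) + (- (\<i> * of_real y)))"
        unfolding powr_minus_divide[symmetric] by (simp add: algebra_simps)
      also have "\<dots> = of_nat n powr (- of_real (1 + x)) * of_nat n powr (- (\<i> * of_real y))" by (rule powr_add)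
      also have "of_nat n powr (- of_real (1 + x)) = complex_of_real (real n powr - (1 + x))"
        using powr_of_real[of "real n" "- (1 + x)"] by simp
      finally show ?thesis .
    qed
    have mr: "mangoldt n = complex_of_real (mangoldt n)" by simp
    have e: "Re (mangoldt n * u / of_nat n powr (1 + \<i> * of_real y + of_real x)) = m * Re (u * of_nat n powr (- (\<i> * of_real y)))" for u y
    proof -
      have "mangoldt n * u / of_nat n powr (1 + \<i> * of_real y + of_real x) =
          complex_of_real (mangoldt n) * u * (1 / of_nat n powr (1 + \<i> * of_real y + of_real x))" by simp
      also have "\<dots> = of_real m * (u * of_nat n powr (- (\<i> * of_real y)))"
        unfolding pw m_def by (simp add: mult_ac)
      finally show ?thesis by simp
    qed
    have "3 * Re (mangoldt n * zone n / of_nat n powr ?a) + 4 * Re (mangoldt n * \<psi> n / of_nat n powr ?b) + Re (mangoldt n * \<theta> n / of_nat n powr ?c)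
      = m * (3 + 4 * Re z + Re v)"
      unfolding e z_def[symmetric] v_def[symmetric] using False by (simp add: zone_def distrib_left)
    moreover have "3 + 4 * Re z + Re v \<ge> 0"
    proof (rule three_four_one)
      have np: "cmod (of_nat n powr (- (\<i> * of_real y))) = 1" for y using False norm_nat_powr[of n "- (\<i> * of_real y)"] by simp
      show "cmod z \<le> 1" using np[of \<tau>] norm_le[of n] by (simp add: z_def norm_mult)
      show "cmod v \<le> 1" using np[of "2 * \<tau>"] t.norm_le[of n] unfolding v_def norm_mult by simp
      have cz: "cmod z = cmod (\<psi> n)" using np[of \<tau>] by (simp add: z_def norm_mult)
      have qz: "\<psi> n = 0 \<longleftrightarrow> q dvd n" using dirichlet_charD(6)[OF char] coprime_prime_iff[OF prime_q] by simp
      show "z = 0" if "cmod z \<noteq> 1" using that cz norm_dirichlet_char[OF prime_q char, of n] qz by (auto simp: z_def)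
      show "v = z\<^sup>2" if "cmod z = 1"
      proof -
        have "\<not> q dvd n" using that cz qz by auto
        then have "\<theta> n = (\<psi> n)\<^sup>2" by (rule \<theta>(2))
        moreover have "of_nat n powr (- (\<i> * of_real (2 * \<tau>))) = (of_nat n powr (- (\<i> * of_real \<tau>)))\<^sup>2"
          unfolding power2_eq_square powr_add[symmetric] by (simp add: algebra_simps)
        ultimately show ?thesis unfolding v_def z_def by (simp add: power_mult_distrib)
      qed
    qed
    ultimately show ?thesis using m by simp
  qed simp
  show ?thesis by (rule sums_le[OF nonneg sums_zero sums])
qed

text \<open>Multiplied by \<open>x\<close> and taken to the limit, the inequality would read
  \<open>3 * 1 - 4 * 1 + 0 \<ge> 0\<close> at best if there were a zero. The last 0 needs the third
  function to have no pole at \<open>1 + 2 \<i> \<tau>\<close>, which is where the excluded case, a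
  real character at the point 1, comes from.\<close>

lemma L_line_1_nonzero_generic:
  assumes "(\<lambda>n. (\<psi> n)\<^sup>2) \<noteq> principal_char q \<or> \<tau> \<noteq> 0"
  shows "L (1 + \<i> * of_real \<tau>) \<noteq> 0"
proof
  assume "L (1 + \<i> * of_real \<tau>) = 0"
  then have m: "zorder L (1 + \<i> * of_real \<tau>) \<ge> 1" using zorder_line_1(2)[of \<tau>] by simp
  obtain \<theta> l where \<theta>: "comp_mult \<theta>" "\<And>n. \<not> q dvd n \<Longrightarrow> \<theta> n = (\<psi> n)\<^sup>2" "l \<le> 0"
    "((\<lambda>x. x * Re (comp_mult.Dlog \<theta> (1 + \<i> * of_real (2 * \<tau>) + of_real x))) \<longlongrightarrow> l) (at_right 0)"
  proof (cases "(\<lambda>n. (\<psi> n)\<^sup>2) = principal_char q")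
    case True
    then have "2 * \<tau> \<noteq> 0" using assms by simp
    then obtain l where l: "l \<le> 0" "((\<lambda>x. x * Re (zone.Dlog (1 + \<i> * of_real (2 * \<tau>) + of_real x))) \<longlongrightarrow> l) (at_right 0)"
      using zeta_log_deriv_limit[of "2 * \<tau>"] by auto
    have "zone n = (\<psi> n)\<^sup>2" if "\<not> q dvd n" for n
      using fun_cong[OF True, of n] that by (cases "n = 0") (auto simp: principal_char_eq[OF prime_q] zone_def)
    then show ?thesis using that[OF zone.comp_mult_axioms _ l] by blast
  next
    case False
    then interpret sq: nonprincipal_char q "\<lambda>n. (\<psi> n)\<^sup>2"
      using dirichlet_char_mult[OF char char] prime_q by unfold_locales (simp_all add: power2_eq_square)
    show ?thesis
      by (rule that[OF sq.comp_mult_axioms _ _ sq.log_deriv_limit_line_1]) (use sq.zorder_line_1(1)[of "2 * \<tau>"] in auto)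
  qed
  obtain l1 where l1: "l1 \<le> 1" "((\<lambda>x. x * Re (zone.Dlog (1 + \<i> * of_real 0 + of_real x))) \<longlongrightarrow> l1) (at_right 0)"
    using zeta_log_deriv_limit[of 0] by auto
  let ?g = "\<lambda>x. 3 * (x * Re (zone.Dlog (1 + \<i> * of_real 0 + of_real x))) + 4 * (x * Re (Dlog (1 + \<i> * of_real \<tau> + of_real x))) +
      x * Re (comp_mult.Dlog \<theta> (1 + \<i> * of_real (2 * \<tau>) + of_real x))"
  have "(?g \<longlongrightarrow> 3 * l1 + 4 * (- of_int (zorder L (1 + \<i> * of_real \<tau>))) + l) (at_right 0)"
    by (intro tendsto_add tendsto_mult_left l1 log_deriv_limit_line_1 \<theta>)
  moreover have "\<forall>\<^sub>F x in at_right (0::real). ?g x \<ge> 0"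
    using eventually_at_right_less[of 0]
  proof eventually_elim
    case (elim x)
    then have "x * (3 * Re (zone.Dlog (1 + \<i> * of_real 0 + of_real x)) + 4 * Re (Dlog (1 + \<i> * of_real \<tau> + of_real x)) +
     Re (comp_mult.Dlog \<theta> (1 + \<i> * of_real (2 * \<tau>) + of_real x))) \<ge> 0"
      using three_four_one_sum[OF \<theta>(1,2) elim, of \<tau>] by (intro mult_nonneg_nonneg) auto
    then show ?case by (simp only: distrib_left mult_ac)
  qed
  ultimately have "3 * l1 + 4 * (- of_int (zorder L (1 + \<i> * of_real \<tau>))) + l \<ge> 0"
    by (rule tendsto_lowerbound) simp
  then show False using m l1(1) \<theta>(3) by linarith
qed

end

section \<open>Real characters at the point 1\<close>

lemma sum_divisors_primepow_mult:
  fixes c :: "nat \<Rightarrow> real"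
  assumes p: "prime p" "\<not> p dvd m" "m > 0" and mult: "\<And>m n. c (m * n) = c m * c n"
  shows "(\<Sum>d | d dvd p ^ k * m. c d) = (\<Sum>j\<le>k. c (p ^ j)) * (\<Sum>d | d dvd m. c d)"
proof -
  have bij: "bij_betw (\<lambda>(j,d). p ^ j * d) ({..k} \<times> {d. d dvd m}) {d. d dvd p ^ k * m}"
    unfolding bij_betw_def
  proof
    show "inj_on (\<lambda>(j,d). p ^ j * d) ({..k} \<times> {d. d dvd m})"
    proof (rule inj_onI, clarify)
      fix j d j' d' assume A: "d dvd m" "d' dvd m" "p ^ j * d = p ^ j' * d'"
      have nd: "\<not> p dvd d" "\<not> p dvd d'" using A p dvd_trans by blast+
      have "multiplicity p (p ^ j * d) = j" "multiplicity p (p ^ j' * d') = j'"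
        using nd p(1) by (auto intro!: multiplicity_eqI simp: prime_elem_multiplicity_mult_distrib)
      then show "j = j' \<and> d = d'" using A(3) p(1) by auto
    qed
    show "(\<lambda>(j,d). p ^ j * d) ` ({..k} \<times> {d. d dvd m}) = {d. d dvd p ^ k * m}"
    proof safe
      fix j d assume "j \<le> k" "d dvd m"
      then show "p ^ j * d dvd p ^ k * m" by (intro mult_dvd_mono le_imp_power_dvd)
    next
      fix d assume "d dvd p ^ k * m"
      then obtain a b where ab: "d = a * b" "a dvd p ^ k" "b dvd m" using division_decomp by blast
      then obtain j where "j \<le> k" "a = p ^ j" using divides_primepow_nat[OF p(1)] by blast
      then show "d \<in> (\<lambda>(j,d). p ^ j * d) ` ({..k} \<times> {d. d dvd m})" using ab by force
    qed
  qed
  have "(\<Sum>d | d dvd p ^ k * m. c d) = (\<Sum>(j,d)\<in>{..k} \<times> {d. d dvd m}. c (p ^ j) * c d)"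
    using sum.reindex_bij_betw[OF bij, of c] by (simp add: mult case_prod_unfold)
  also have "\<dots> = (\<Sum>j\<le>k. c (p ^ j)) * (\<Sum>d | d dvd m. c d)"
    by (simp add: sum_product sum.cartesian_product)
  finally show ?thesis .
qed

text \<open>The divisor sum is multiplicative, and at a prime power it is a sum of powers of -1, 0
  or 1, nonnegative in every case and at least 1 for even exponents. The induction splits off one
  prime.\<close>

lemma real_char_divisor_sum:
  fixes c :: "nat \<Rightarrow> real"
  assumes mult: "\<And>m n. c (m * n) = c m * c n" and c1: "c 1 = 1" and vals: "\<And>n. c n \<in> {-1, 0, 1}"
  shows "n > 0 \<Longrightarrow> (\<Sum>d | d dvd n. c d) \<ge> 0 \<and> ((\<exists>r. n = r\<^sup>2) \<longrightarrow> (\<Sum>d | d dvd n. c d) \<ge> 1)"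
proof (induction n rule: less_induct)
  case (less n)
  show ?case
  proof (cases "n = 1")
    case True
    then show ?thesis using c1 by simp
  next
    case False
    obtain p where p: "prime p" "p dvd n" using False prime_factor_nat by blast
    define k where "k = multiplicity p n"
    obtain m where m: "n = p ^ k * m" "\<not> p dvd m"
      using multiplicity_decompose'[of n p] less.prems p(1) unfolding k_def by (metis not_prime_unit not_gr0)
    have m0: "m > 0" using m less.prems by (cases m) auto
    have k0: "k > 0" using m p by (cases k) auto
    have "m < n"
    proof -
      have "p ^ k > 1" using p(1) k0 prime_gt_1_nat one_less_power by blast
      then show ?thesis using m(1) m0 by simp
    qed
    then have IH: "(\<Sum>d | d dvd m. c d) \<ge> 0" "(\<exists>r. m = r\<^sup>2) \<Longrightarrow> (\<Sum>d | d dvd m. c d) \<ge> 1"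
      using less.IH[of m] m0 by auto
    have sp: "(\<Sum>d | d dvd n. c d) = (\<Sum>j\<le>k. c (p ^ j)) * (\<Sum>d | d dvd m. c d)"
      unfolding m(1) by (rule sum_divisors_primepow_mult[OF p(1) m(2) m0 mult])
    have cp: "c (p ^ j) = c p ^ j" for j by (induction j) (use c1 mult in auto)
    have S: "(\<Sum>j\<le>k. c (p ^ j)) \<ge> 0 \<and> (even k \<longrightarrow> (\<Sum>j\<le>k. c (p ^ j)) \<ge> 1)"
    proof -
      consider "c p = -1" | "c p = 0" | "c p = 1" using vals[of p] by auto
      then show ?thesis
      proof cases
        case 1
        have "(\<Sum>j\<le>k. (-1::real) ^ j) = (if even k then 1 else 0)" for k by (induction k) auto
        then show ?thesis unfolding cp 1 by simp
      next
        case 2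
        have "(\<Sum>j\<le>k. (0::real) ^ j) = 1" for k by (induction k) auto
        then show ?thesis unfolding cp 2 by simp
      next
        case 3
        then show ?thesis unfolding cp by simp
      qed
    qed
    have "(\<Sum>d | d dvd n. c d) \<ge> 1" if sq: "\<exists>r. n = r\<^sup>2"
    proof -
      obtain r where r: "n = r\<^sup>2" using sq by blast
      have r0: "r > 0" using r less.prems by (cases r) auto
      define e where "e = multiplicity p r"
      have k2: "k = 2 * e" unfolding k_def e_def r using p(1) r0 by (simp add: prime_elem_multiplicity_power_distrib)
      then have ev: "even k" by simp
      obtain t where t: "r = p ^ e * t" using multiplicity_dvd[of p r] unfolding e_def by blast
      have "p ^ k * m = (p ^ e * t)\<^sup>2" using m(1) r t by simp
      then have "p ^ k * m = p ^ k * t\<^sup>2" by (simp add: k2 power_mult_distrib power_even_eq)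
      then have "m = t\<^sup>2" using p(1) by auto
      then have "(\<Sum>d | d dvd m. c d) \<ge> 1" using IH(2) by blast
      then show ?thesis unfolding sp using S ev mult_mono[of 1 "\<Sum>j\<le>k. c (p ^ j)" 1 "\<Sum>d | d dvd m. c d"] by simp
    qed
    then show ?thesis using sp S IH(1) by simp
  qed
qed

text \<open>Expand \<open>x ^ d / (1 - x ^ d)\<close> as a geometric series and collect the terms
  with \<open>d * k = n\<close>.\<close>

lemma lambert_series:
  fixes c :: "nat \<Rightarrow> real"
  assumes c: "\<And>n. \<bar>c n\<bar> \<le> 1" and x: "0 < x" "x < (1::real)"
  shows "((\<lambda>n. (\<Sum>d | d dvd n. c d) * x ^ n) has_sum S) {0<..} \<longleftrightarrow> ((\<lambda>d. c d * (x ^ d / (1 - x ^ d))) has_sum S) {0<..}"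
    and "(\<lambda>d. c d * (x ^ d / (1 - x ^ d))) summable_on {0<..}"
proof -
  define F where "F = (\<lambda>(d,k). c d * x ^ (d * k))"
  have xd: "x ^ d < 1" "x ^ d > 0" "x ^ d \<le> x" if "d > 0" for d
    using x that by (auto simp: power_less_one_iff intro: power_decreasing[of 1 d x, simplified])
  have geo: "((\<lambda>k. a * x ^ (d * k)) has_sum (a * (x ^ d / (1 - x ^ d)))) {0<..}" if "d > 0" for d a
  proof -
    have "(\<lambda>k. (x ^ d) ^ Suc k) sums (x ^ d * (1 / (1 - x ^ d)))"
      unfolding power_Suc using xd[OF that] by (intro sums_mult geometric_sums) auto
    then have "((\<lambda>k. (x ^ d) ^ Suc k) has_sum (x ^ d / (1 - x ^ d))) UNIV"
      using x by (intro sums_nonneg_imp_has_sum) auto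
    then have "((\<lambda>k. (x ^ d) ^ k) has_sum (x ^ d / (1 - x ^ d))) (Suc ` UNIV)"
      by (subst has_sum_reindex) (auto simp: o_def)
    also have "Suc ` UNIV = {0<..}" by (metis greaterThan_0)
    finally show ?thesis unfolding power_mult by (rule has_sum_cmult_right)
  qed
  have "(\<lambda>(d,k). x ^ (d * k)) summable_on Sigma {0<..} (\<lambda>_. {0<..})"
  proof (rule summable_on_SigmaI[where g = "\<lambda>d. x ^ d / (1 - x ^ d)"])
    show "((\<lambda>k. case (d, k) of (d, k) \<Rightarrow> x ^ (d * k)) has_sum x ^ d / (1 - x ^ d)) {0<..}" if "d \<in> {0<..}" for d
      using geo[of d 1] that by simp
    show "(\<lambda>d. x ^ d / (1 - x ^ d)) summable_on {0<..}"
    proof (rule summable_on_comparison_test[where f = "\<lambda>d. (1 / (1 - x)) * x ^ d"])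
      have "summable (\<lambda>d. norm (x ^ d))" using x by (simp add: power_abs summable_geometric)
      then have "(\<lambda>d. x ^ d) summable_on UNIV" by (rule norm_summable_imp_summable_on)
      then show "(\<lambda>d. (1 / (1 - x)) * x ^ d) summable_on {0<..}"
        by (intro summable_on_cmult_right) (rule summable_on_subset_banach, auto)
      show "x ^ d / (1 - x ^ d) \<le> (1 / (1 - x)) * x ^ d" if "d \<in> {0<..}" for d
        using xd[of d] that x by (simp add: frac_le)
    qed (use xd x in \<open>auto simp: less_imp_le\<close>)
  qed (use x in auto)
  then have "(\<lambda>z. norm (F z)) summable_on ({0<..} \<times> {0<..})"
  proof (rule summable_on_comparison_test)
    show "norm (F z) \<le> (case z of (d, k) \<Rightarrow> x ^ (d * k))" if "z \<in> {0<..} \<times> {0<..}" for z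
      using c[of "fst z"] x by (auto simp: F_def case_prod_unfold abs_mult mult_left_le_one_le)
  qed simp
  then have sF: "F summable_on ({0<..} \<times> {0<..})" by (rule abs_summable_summable)
  have inner: "((\<lambda>k. F (d, k)) has_sum (c d * (x ^ d / (1 - x ^ d)))) {0<..}" if "d \<in> {0<..}" for d
    using geo[of d "c d"] that by (simp add: F_def)
  show "(\<lambda>d. c d * (x ^ d / (1 - x ^ d))) summable_on {0<..}"
    using has_sum_SigmaD[OF has_sum_infsum[OF sF] inner] summable_on_def by blast
  have 1: "((\<lambda>d. c d * (x ^ d / (1 - x ^ d))) has_sum S) {0<..} \<longleftrightarrow> (F has_sum S) ({0<..} \<times> {0<..})"
    using has_sum_SigmaD[OF _ inner, where S = S] has_sum_SigmaI[OF inner _ sF, of S] by blast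
  let ?h = "\<lambda>(n,d). (d, n div d)"
  have b: "(F has_sum S) ({0<..} \<times> {0<..}) \<longleftrightarrow> ((\<lambda>z. F (?h z)) has_sum S) (Sigma {0<..} (\<lambda>n. {d. d dvd n}))" for S
    using has_sum_reindex_bij_betw[OF bij_betw_divisor_pairs, of F S] by blast
  have sF': "(\<lambda>z. F (?h z)) summable_on (Sigma {0<..} (\<lambda>n. {d. d dvd n}))"
    using sF b unfolding summable_on_def by blast
  have inner': "((\<lambda>d. F (?h (n, d))) has_sum ((\<Sum>d | d dvd n. c d) * x ^ n)) {d. d dvd n}" if "n \<in> {0<..}" for n
    unfolding F_def using that by (intro has_sum_finiteI) (auto simp: sum_distrib_right)
  have 2: "((\<lambda>n. (\<Sum>d | d dvd n. c d) * x ^ n) has_sum S) {0<..} \<longleftrightarrow> ((\<lambda>z. F (?h z)) has_sum S) (Sigma {0<..} (\<lambda>n. {d. d dvd n}))"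
    using has_sum_SigmaD[OF _ inner', where S = S] has_sum_SigmaI[OF inner' _ sF', of S] by blast
  show "((\<lambda>n. (\<Sum>d | d dvd n. c d) * x ^ n) has_sum S) {0<..} \<longleftrightarrow> ((\<lambda>d. c d * (x ^ d / (1 - x ^ d))) has_sum S) {0<..}"
    using 1 2 b by blast
qed

context nonprincipal_char
begin

text \<open>If \<open>L 1 = 0\<close>, the generating function of the divisor sums stays bounded as
  \<open>x\<close> approaches 1, since its singular part is \<open>L 1 / (1 - x)\<close>. But its
  coefficients are nonnegative and at least 1 at squares, so it must be unbounded.\<close>

lemma L_1_nonzero_real:
  assumes sq: "(\<lambda>n. (\<psi> n)\<^sup>2) = principal_char q"
  shows "L 1 \<noteq> 0"
proof
  assume L1: "L 1 = 0"
  define c where "c n = Re (\<psi> n)" for n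
  have val: "\<psi> n = 1 \<or> \<psi> n = -1 \<or> \<psi> n = 0" for n
    using fun_cong[OF sq, of n] by (auto simp: principal_char_def power2_eq_1_iff split: if_splits)
  have cv: "c n \<in> {-1, 0, 1}" for n using val[of n] by (auto simp: c_def)
  have c_abs: "\<bar>c n\<bar> \<le> 1" for n using cv[of n] by auto
  have cm: "c (m * n) = c m * c n" for m n using val[of m] val[of n] by (auto simp: c_def char_mult)
  have c1: "c 1 = 1" by (simp add: c_def)
  have c_of: "\<psi> n = of_real (c n)" for n using val[of n] by (auto simp: c_def)
  define a where "a n = (\<Sum>d | d dvd n. c d)" for n
  have a: "a n \<ge> 0" "(\<exists>r. n = r\<^sup>2) \<Longrightarrow> a n \<ge> 1" if "n > 0" for n
    using real_char_divisor_sum[of c n, OF cm c1 cv that] by (auto simp: a_def)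
  have sum0: "(\<lambda>n. c n / real n) sums 0"
  proof -
    have "(\<lambda>n. Re (\<psi> n / of_nat n powr 1)) sums Re (L 1)" by (intro sums_Re L_sums) simp
    moreover have "Re (\<psi> n / of_nat n powr 1) = c n / real n" for n by (cases "n = 0") (simp_all add: c_of)
    ultimately have "(\<lambda>n. c n / real n) sums Re (L 1)" by (simp only:)
    then show ?thesis using L1 by simp
  qed
  have G_bound: "infsum (\<lambda>n. a n * x ^ n) {0<..} \<le> B \<and> (\<lambda>n. a n * x ^ n) summable_on {0<..}" if x: "0 < x" "x < 1" for x :: real
  proof -
    \<comment> \<open>The Lambert weight subtracted from its leading behaviour near
      \<open>x = 1\<close>. Because the sum of \<open>c n / n\<close> is 0, replacing the weight by
      \<open>b\<close> only changes the sign of the series.\<close>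
    define b where "b n = 1 / (real n * (1 - x)) - x ^ n / (1 - x ^ n)" for n
    have gs: "(1 - x ^ n) = (1 - x) * (\<Sum>j<n. x ^ j)" for n using one_diff_power_eq[of x n] .
    have xn: "x ^ n < 1" if "n > 0" for n using x that by (simp add: power_less_one_iff)
    \<comment> \<open>Arithmetic against geometric mean for the terms \<open>j\<close> and
      \<open>n - 1 - j\<close>, whose product is always \<open>x ^ (n - 1)\<close>.\<close>
    have AG: "(\<Sum>j<n. x ^ j)\<^sup>2 \<ge> (real n)\<^sup>2 * x ^ (n - 1)" for n
    proof -
      have "(\<Sum>j<n. x ^ j) = (\<Sum>j<n. x ^ (n - Suc j))" using sum.nat_diff_reindex[of "\<lambda>j. x ^ j" n] by simp
      then have "2 * (\<Sum>j<n. x ^ j) = (\<Sum>j<n. x ^ j + x ^ (n - Suc j))" by (simp add: sum.distrib)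
      also have "\<dots> \<ge> (\<Sum>j<n. 2 * sqrt (x ^ (n - 1)))"
      proof (rule sum_mono)
        fix j assume j: "j \<in> {..<n}"
        then have "j + (n - Suc j) = n - 1" by auto
        then have "x ^ (n - 1) = x ^ j * x ^ (n - Suc j)" by (metis power_add)
        then show "2 * sqrt (x ^ (n - 1)) \<le> x ^ j + x ^ (n - Suc j)"
          using arith_geo_mean_sqrt[of "x ^ j" "x ^ (n - Suc j)"] x by simp
      qed
      finally have "(\<Sum>j<n. x ^ j) \<ge> real n * sqrt (x ^ (n - 1))" by simp
      then have "(\<Sum>j<n. x ^ j)\<^sup>2 \<ge> (real n * sqrt (x ^ (n - 1)))\<^sup>2" using x by (intro power_mono) auto
      then show ?thesis using x by (simp add: power_mult_distrib)
    qed
    \<comment> \<open>Up to the factor \<open>1 / (1 - x)\<close>, the difference is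
      \<open>1 / (m * (m + 1)) - x ^ m / (P m * P (m + 1))\<close>, and \<open>AG\<close> for
      \<open>m\<close> and \<open>m + 1\<close> bounds the product of the geometric sums from
      below.\<close>
    have dec: "b (Suc n) \<ge> b (Suc (Suc n))" for n
    proof -
      define m where "m = Suc n"
      define P where "P k = (\<Sum>j<k. x ^ j)" for k
      have Ppos: "P k > 0" if "k > 0" for k unfolding P_def using x that by (intro sum_pos) auto
      have P1: "P (Suc m) = P m + x ^ m" by (simp add: P_def)
      have Pp: "P m * P (Suc m) \<ge> real m * real (Suc m) * x ^ m"
      proof (rule power2_le_imp_le)
        have "(P m)\<^sup>2 \<ge> (real m)\<^sup>2 * x ^ (m - 1)" "(P (Suc m))\<^sup>2 \<ge> (real (Suc m))\<^sup>2 * x ^ m"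
          using AG[of m] AG[of "Suc m"] by (simp_all add: P_def)
        moreover have "x ^ (m - 1) \<ge> x ^ m" using x by (intro power_decreasing) auto
        ultimately have "(P m)\<^sup>2 \<ge> (real m)\<^sup>2 * x ^ m"
          by (meson mult_left_mono order_trans zero_le_power2)
        then have "((real m)\<^sup>2 * x ^ m) * ((real (Suc m))\<^sup>2 * x ^ m) \<le> (P m)\<^sup>2 * (P (Suc m))\<^sup>2"
          using \<open>(P (Suc m))\<^sup>2 \<ge> _\<close> x by (intro mult_mono) auto
        then show "(real m * real (Suc m) * x ^ m)\<^sup>2 \<le> (P m * P (Suc m))\<^sup>2"
          by (simp only: power_mult_distrib power2_eq_square mult_ac)
        show "0 \<le> P m * P (Suc m)" using Ppos[of m] Ppos[of "Suc m"] by (simp add: m_def)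
      qed
      have bm: "b k = (1 / real k - x ^ k / P k) / (1 - x)" if "k > 0" for k
        unfolding b_def gs P_def[symmetric] by (simp add: diff_divide_distrib mult.commute)
      have "(1 / real m - x ^ m / P m) - (1 / real (Suc m) - x ^ Suc m / P (Suc m)) =
         1 / (real m * real (Suc m)) - x ^ m / (P m * P (Suc m))"
      proof -
        have "x ^ m / P m - x ^ Suc m / P (Suc m) = x ^ m * (P (Suc m) - x * P m) / (P m * P (Suc m))"
          using Ppos[of m] Ppos[of "Suc m"] by (simp add: m_def field_simps)
        also have "P (Suc m) - x * P m = 1"
          using gs[of m] unfolding P1 P_def[symmetric] by (simp add: algebra_simps)
        finally have "x ^ m / P m - x ^ Suc m / P (Suc m) = x ^ m / (P m * P (Suc m))" by simp
        moreover have "1 / real m - 1 / real (Suc m) = 1 / (real m * real (Suc m))" by (simp add: m_def field_simps)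
        ultimately show ?thesis by linarith
      qed
      also have "\<dots> \<ge> 0"
      proof -
        have "x ^ m * (real m * real (Suc m)) \<le> 1 * (P m * P (Suc m))" using Pp by (simp add: mult_ac)
        moreover have "X / U \<le> 1 / V" if "X * V \<le> 1 * U" "U > 0" "V > 0" for X U V :: real
          using that by (simp add: field_simps)
        moreover have "P m * P (Suc m) > 0" "real m * real (Suc m) > 0"
          using Ppos[of m] Ppos[of "Suc m"] by (simp_all add: m_def)
        ultimately show ?thesis by (simp only: diff_ge_0_iff_ge)
      qed
      finally have "(1 / real (Suc m) - x ^ Suc m / P (Suc m)) \<le> (1 / real m - x ^ m / P m)" by simp
      then have "(1 / real (Suc m) - x ^ Suc m / P (Suc m)) / (1 - x) \<le> (1 / real m - x ^ m / P m) / (1 - x)"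
        using x by (intro divide_right_mono) auto
      then show ?thesis using bm[of m] bm[of "Suc m"] by (simp only: m_def zero_less_Suc)
    qed
    have b_nonneg: "b (Suc n) \<ge> 0" for n
    proof -
      have "real (Suc n) * x ^ Suc n \<le> (\<Sum>j<Suc n. x ^ j)"
        using sum_mono[of "{..<Suc n}" "\<lambda>_. x ^ Suc n" "\<lambda>j. x ^ j"] x by (simp add: power_decreasing del: power_Suc sum.lessThan_Suc)
      then have "(1 - x) * (real (Suc n) * x ^ Suc n) \<le> 1 - x ^ Suc n" unfolding gs[of "Suc n"] using x by (intro mult_left_mono) auto
      then have "x ^ Suc n / (1 - x ^ Suc n) \<le> 1 / (real (Suc n) * (1 - x))"
        using xn[of "Suc n"] x by (simp add: divide_simps mult_ac del: power_Suc of_nat_Suc)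
      then show ?thesis by (simp add: b_def)
    qed
    have b1: "b 1 = 1" using x by (simp add: b_def field_simps)
    \<comment> \<open>Decreasing nonnegative weights against coefficients with bounded partial sums:
      the variation of \<open>b\<close> telescopes to \<open>b 1 = 1\<close>, so the bound
      \<open>B\<close> does not depend on \<open>x\<close>.\<close>
    have part: "\<bar>\<Sum>k=1..Suc N. c k * b k\<bar> \<le> B" for N
    proof -
      have "(\<Sum>k=1..Suc N. \<psi> k * of_real (b k)) = (\<Sum>n<N. (\<Sum>k=1..Suc n. \<psi> k) * (of_real (b (Suc n)) - of_real (b (Suc (Suc n))))) + (\<Sum>k=1..Suc N. \<psi> k) * of_real (b (Suc N))"
        by (rule abel_series_partial)
      also have "cmod \<dots> \<le> (\<Sum>n<N. B * (b (Suc n) - b (Suc (Suc n)))) + B * b (Suc N)"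
      proof (intro order_trans[OF norm_triangle_ineq] add_mono sum_norm_le)
        show "cmod ((\<Sum>k=1..Suc n. \<psi> k) * (of_real (b (Suc n)) - of_real (b (Suc (Suc n))))) \<le> B * (b (Suc n) - b (Suc (Suc n)))" for n
          unfolding norm_mult of_real_diff[symmetric] norm_of_real using dec[of n] partial_sum_bound'[of "Suc n"] B_pos by (intro mult_mono) auto
        show "cmod ((\<Sum>k=1..Suc N. \<psi> k) * of_real (b (Suc N))) \<le> B * b (Suc N)"
          unfolding norm_mult norm_of_real using b_nonneg[of N] partial_sum_bound'[of "Suc N"] B_pos by (intro mult_mono) auto
      qed
      also have "\<dots> = B * b 1" by (induction N) (simp_all add: algebra_simps)
      finally have "cmod (\<Sum>k=1..Suc N. \<psi> k * of_real (b k)) \<le> B" by (simp only: b1 mult_1_right)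
      moreover have "(\<Sum>k=1..Suc N. \<psi> k * of_real (b k)) = of_real (\<Sum>k=1..Suc N. c k * b k)" by (simp add: c_of)
      ultimately show ?thesis by (simp only: norm_of_real)
    qed
    have sm: "(\<lambda>d. c d * (x ^ d / (1 - x ^ d))) summable_on {0<..}" by (rule lambert_series(2)[of c x, OF c_abs x])
    define S where "S = infsum (\<lambda>d. c d * (x ^ d / (1 - x ^ d))) {0<..}"
    have hs: "((\<lambda>d. c d * (x ^ d / (1 - x ^ d))) has_sum S) {0<..}" unfolding S_def by (rule has_sum_infsum[OF sm])
    then have "((\<lambda>d. c d * (x ^ d / (1 - x ^ d))) has_sum S) UNIV"
      by (rule has_sum_cong_neutral[THEN iffD1, rotated -1]) (auto simp: c_def)
    then have s1: "(\<lambda>d. c d * (x ^ d / (1 - x ^ d))) sums S" by (rule has_sum_imp_sums)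
    have "(\<lambda>d. (1 / (1 - x)) * (c d / real d) - c d * (x ^ d / (1 - x ^ d))) sums ((1 / (1 - x)) * 0 - S)"
      by (intro sums_diff sums_mult sum0 s1)
    moreover have "(1 / (1 - x)) * (c d / real d) - c d * (x ^ d / (1 - x ^ d)) = c d * b d" for d
      by (simp add: b_def algebra_simps)
    ultimately have "(\<lambda>d. c d * b d) sums (- S)" by simp
    then have "(\<lambda>N. \<Sum>k<Suc (Suc N). c k * b k) \<longlonglongrightarrow> - S"
      unfolding sums_def by (subst filterlim_sequentially_Suc, subst filterlim_sequentially_Suc)
    moreover have "(\<Sum>k<Suc (Suc N). c k * b k) = (\<Sum>k=1..Suc N. c k * b k)" for N
      unfolding lessThan_Suc_atMost by (intro sum.mono_neutral_right) (auto simp: not_less_eq_eq c_def)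
    ultimately have "(\<lambda>N. \<Sum>k=1..Suc N. c k * b k) \<longlonglongrightarrow> - S" by (simp only:)
    moreover have "- B \<le> (\<Sum>k=1..Suc N. c k * b k)" for N using part[of N] by (simp only: abs_le_iff) linarith
    ultimately have "- S \<ge> - B" by (intro LIMSEQ_le_const) blast+
    moreover have "((\<lambda>n. a n * x ^ n) has_sum S) {0<..}"
      unfolding a_def using lambert_series(1)[of c x S, OF c_abs x] hs by blast
    ultimately show ?thesis using infsumI summable_on_def by fastforce
  qed
  obtain M :: nat where M: "real M > 2 * B" using reals_Archimedean2 by blast
  have M0: "M > 0" using M B_pos by (cases M) auto
  \<comment> \<open>Chosen so that \<open>x ^ (M\<^sup>2) = 1/2\<close>; then each of the first
    \<open>M\<close> squares contributes at least 1/2, and \<open>M / 2 > B\<close>.\<close>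
  define x :: real where "x = root (M\<^sup>2) (1/2)"
  have xM: "x ^ (M\<^sup>2) = 1/2" unfolding x_def using M0 by simp
  have x: "0 < x" "x < 1" unfolding x_def using M0 by (auto simp: real_root_lt_1_iff)
  have "(\<Sum>m=1..M. x ^ (m\<^sup>2)) \<ge> (\<Sum>m=1..M. 1/2)"
  proof (rule sum_mono)
    fix m assume "m \<in> {1..M}"
    then have "x ^ (M\<^sup>2) \<le> x ^ (m\<^sup>2)" using x by (intro power_decreasing power_mono) auto
    then show "1/2 \<le> x ^ (m\<^sup>2)" using xM by simp
  qed
  also have "(\<Sum>m=1..M. x ^ (m\<^sup>2)) = (\<Sum>n\<in>(\<lambda>m. m\<^sup>2) ` {1..M}. x ^ n)"
    by (subst sum.reindex) (auto simp: inj_on_def)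
  also have "\<dots> \<le> (\<Sum>n\<in>(\<lambda>m. m\<^sup>2) ` {1..M}. a n * x ^ n)"
    using a(2) x by (intro sum_mono) (auto simp: mult_le_cancel_right1)
  also have "\<dots> \<le> infsum (\<lambda>n. a n * x ^ n) {0<..}"
    using G_bound[OF x] a(1) x by (intro finite_sum_le_infsum) auto
  also have "\<dots> \<le> B" using G_bound[OF x] by simp
  finally show False using M by simp
qed

theorem L_line_1_nonzero:
  assumes "Re s = 1"
  shows "L s \<noteq> 0"
proof -
  have s: "s = 1 + \<i> * of_real (Im s)" using assms by (simp add: complex_eq_iff)
  show ?thesis
  proof (cases "(\<lambda>n. (\<psi> n)\<^sup>2) \<noteq> principal_char q \<or> Im s \<noteq> 0")
    case True
    then show ?thesis using L_line_1_nonzero_generic[of "Im s"] s by metis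
  next
    case False
    then have "s = 1" using s by simp
    then show ?thesis using L_1_nonzero_real False by simp
  qed
qed

end

section \<open>Complex-analytic tools\<close>

text \<open>The Moebius map \<open>g / (2 M - g)\<close> takes the half-plane of real part below
  \<open>M\<close> into the unit disc and fixes 0, so the Schwarz lemma applies; solving for
  \<open>g\<close> gives the bound.\<close>

lemma Borel_Caratheodory:
  assumes f: "f holomorphic_on ball z R" and f0: "f z = 0" and R: "0 < r" "r < R" and M: "M > 0"
    and Re: "\<And>w. w \<in> ball z R \<Longrightarrow> Re (f w) < M" and w: "cmod (w - z) \<le> r"
  shows "cmod (f w) \<le> 2 * M * r / (R - r)"
proof -
  define g where "g \<xi> = f (z + of_real R * \<xi>)" for \<xi>
  define \<phi> where "\<phi> \<xi> = g \<xi> / (2 * of_real M - g \<xi>)" for \<xi>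
  have R0: "R > 0" using R by simp
  have inb: "z + of_real R * \<xi> \<in> ball z R" if "cmod \<xi> < 1" for \<xi>
    using that R0 by (simp add: dist_norm norm_mult)
  have gh: "g holomorphic_on ball 0 1" unfolding g_def
    by (rule holomorphic_on_compose_gen[OF _ f, unfolded o_def]) (use inb in \<open>auto intro!: holomorphic_intros simp: dist_norm norm_mult\<close>)
  have gr: "Re (g \<xi>) < M" if "cmod \<xi> < 1" for \<xi> unfolding g_def by (rule Re[OF inb[OF that]])
  have den: "2 * of_real M - g \<xi> \<noteq> 0" if "cmod \<xi> < 1" for \<xi>
    using gr[OF that] M by (auto simp: complex_eq_iff)
  have \<phi>h: "\<phi> holomorphic_on ball 0 1" unfolding \<phi>_def using den by (intro holomorphic_intros gh) auto
  have \<phi>1: "cmod (\<phi> \<xi>) < 1" if "cmod \<xi> < 1" for \<xi>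
  proof -
    have "(cmod (g \<xi>))\<^sup>2 < (cmod (2 * of_real M - g \<xi>))\<^sup>2"
    proof -
      have "M * Re (g \<xi>) < M * M" using gr[OF that] M by simp
      then show ?thesis unfolding cmod_power2 by (simp add: power2_eq_square algebra_simps)
    qed
    then have "cmod (g \<xi>) < cmod (2 * of_real M - g \<xi>)" by (rule power2_less_imp_less) simp
    then show ?thesis using den[OF that] by (simp add: \<phi>_def norm_divide)
  qed
  define \<xi> where "\<xi> = (w - z) / of_real R"
  have \<xi>: "cmod \<xi> \<le> r / R" using w R0 by (simp add: \<xi>_def norm_divide divide_right_mono)
  have rR: "r / R < 1" using R by simp
  then have \<xi>1: "cmod \<xi> < 1" using \<xi> by simp
  have S: "cmod (\<phi> \<xi>) \<le> cmod \<xi>"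
    by (rule Schwarz_Lemma(1)[OF \<phi>h _ \<phi>1 \<xi>1]) (simp add: \<phi>_def g_def f0)
  then have S': "cmod (\<phi> \<xi>) \<le> r / R" using \<xi> by simp
  have fw: "f w = g \<xi>" using R0 by (simp add: g_def \<xi>_def)
  have n1: "1 + \<phi> \<xi> \<noteq> 0" using \<phi>1[OF \<xi>1] by (metis add_eq_0_iff less_irrefl norm_minus_cancel norm_one)
  have "g \<xi> * (1 + \<phi> \<xi>) = 2 * of_real M * \<phi> \<xi>" unfolding \<phi>_def using den[OF \<xi>1] by (simp add: field_simps)
  then have "cmod (g \<xi>) * cmod (1 + \<phi> \<xi>) = 2 * M * cmod (\<phi> \<xi>)"
    using M by (metis abs_of_pos norm_mult norm_numeral norm_of_real)
  moreover have "cmod (1 + \<phi> \<xi>) \<ge> 1 - r / R"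
    using norm_triangle_ineq2[of 1 "- \<phi> \<xi>"] S' by simp
  ultimately have "cmod (g \<xi>) * (1 - r / R) \<le> 2 * M * (r / R)"
    using S' M rR by (smt (verit) mult_left_mono norm_ge_zero)
  then have "R * (cmod (g \<xi>) * (1 - r / R)) \<le> R * (2 * M * (r / R))" using R0 by (intro mult_left_mono) auto
  then have "cmod (g \<xi>) * (R - r) \<le> 2 * M * r" using R0 by (simp add: algebra_simps)
  then show ?thesis unfolding fw using R by (simp add: pos_le_divide_eq)
qed

text \<open>A branch of the logarithm, encoded by a primitive \<open>E\<close> of the logarithmic
  derivative and the relation of values of \<open>f\<close> at two points.\<close>

lemma holomorphic_log_primitive:
  fixes f :: "complex \<Rightarrow> complex"
  assumes S: "convex S" "open S" and f: "f holomorphic_on S" and nz: "\<And>z. z \<in> S \<Longrightarrow> f z \<noteq> 0"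
  shows "\<exists>E. E holomorphic_on S \<and> (\<forall>z\<in>S. (E has_field_derivative deriv f z / f z) (at z)) \<and>
     (\<forall>a\<in>S. \<forall>b\<in>S. f a = f b * exp (E a - E b))"
proof -
  have "(\<lambda>z. deriv f z / f z) holomorphic_on S"
    by (intro holomorphic_on_divide holomorphic_deriv f S nz)
  then obtain E where E0: "\<And>x. x \<in> S \<Longrightarrow> (E has_field_derivative deriv f x / f x) (at x within S)"
    using holomorphic_convex_primitive'[OF S] by blast
  then have E: "(E has_field_derivative deriv f x / f x) (at x)" if "x \<in> S" for x
    using that at_within_open[OF that S(2)] by metis
  have "((\<lambda>x. f x * exp (- E x)) has_field_derivative 0) (at x within S)" if "x \<in> S" for x
  proof -
    have "(f has_field_derivative deriv f x) (at x within S)"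
      using holomorphic_derivI[OF f S(2) that] has_field_derivative_at_within by blast
    then show ?thesis using E0[OF that] nz[OF that] by (auto intro!: derivative_eq_intros)
  qed
  from has_field_derivative_zero_constant[OF S(1) this]
  obtain c where c: "\<And>x. x \<in> S \<Longrightarrow> f x * exp (- E x) = c" by blast
  have "f a = f b * exp (E a - E b)" if "a \<in> S" "b \<in> S" for a b
  proof -
    have "f a = (f a * exp (- E a)) * exp (E a)" by (simp add: exp_minus)
    also have "\<dots> = (f b * exp (- E b)) * exp (E a)" using c that by simp
    finally show ?thesis by (simp add: exp_diff exp_minus field_simps)
  qed
  moreover have "E holomorphic_on S" using E S(2) holomorphic_on_open by blast
  ultimately show ?thesis using E by blast
qed

lemma norm_ratio_bound:
  fixes f :: "complex \<Rightarrow> complex"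
  assumes S: "convex S" "open S" and f: "f holomorphic_on S" and nz: "\<And>z. z \<in> S \<Longrightarrow> f z \<noteq> 0"
    and ab: "a \<in> S" "b \<in> S" and B: "\<And>w. w \<in> closed_segment a b \<Longrightarrow> cmod (deriv f w / f w) \<le> B"
  shows "cmod (f a) \<le> cmod (f b) * exp (B * cmod (a - b))"
proof -
  obtain E where E: "\<forall>z\<in>S. (E has_field_derivative deriv f z / f z) (at z)" "\<forall>a\<in>S. \<forall>b\<in>S. f a = f b * exp (E a - E b)"
    using holomorphic_log_primitive[OF S f nz] by blast
  have sub: "closed_segment a b \<subseteq> S" using ab S(1) by (simp add: closed_segment_subset)
  have "cmod (E a - E b) \<le> B * cmod (a - b)"
  proof (rule field_differentiable_bound[of "closed_segment a b" E "\<lambda>w. deriv f w / f w"])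
    fix z assume "z \<in> closed_segment a b"
    then show "(E has_field_derivative deriv f z / f z) (at z within closed_segment a b)"
      using E(1) sub has_field_derivative_at_within by blast
  qed (use B in auto)
  then have "Re (E a - E b) \<le> B * cmod (a - b)" using complex_Re_le_cmod order_trans by blast
  moreover have "f a = f b * exp (E a - E b)" using E(2) ab by blast
  ultimately show ?thesis by (simp add: norm_mult norm_exp_eq_Re mult_left_mono)
qed

text \<open>The multiplier \<open>exp (\<delta> * s\<^sup>2)\<close> decays like
  \<open>exp (- \<delta> * (Im s)\<^sup>2)\<close> and beats growth of exponential type; the maximum
  principle on a tall rectangle is followed by letting \<open>\<delta>\<close> tend to 0.\<close>

lemma phragmen_lindelof_strip:
  fixes f :: "complex \<Rightarrow> complex"
  assumes ab: "0 \<le> a" "a \<le> b" and f: "f holomorphic_on S" "{s. a \<le> Re s \<and> Re s \<le> b} \<subseteq> S" "open S"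
    and bd: "\<And>s. Re s = a \<or> Re s = b \<Longrightarrow> cmod (f s) \<le> 1"
    and gr: "\<And>s. a \<le> Re s \<Longrightarrow> Re s \<le> b \<Longrightarrow> cmod (f s) \<le> C * exp (C * \<bar>Im s\<bar>)"
    and s: "a \<le> Re s" "Re s \<le> b"
  shows "cmod (f s) \<le> 1"
proof -
  have nE: "cmod (exp (of_real \<delta> * w\<^sup>2)) = exp (\<delta> * ((Re w)\<^sup>2 - (Im w)\<^sup>2))" for \<delta> w
    by (simp add: norm_exp_eq_Re power2_eq_square)
  have main: "cmod (f s) * exp (\<delta> * ((Re s)\<^sup>2 - (Im s)\<^sup>2)) \<le> exp (\<delta> * b\<^sup>2)" if \<delta>: "\<delta> > 0" for \<delta> :: real
  proof -
    have "((\<lambda>T. C * exp (C * T + \<delta> * b\<^sup>2 - \<delta> * T\<^sup>2)) \<longlongrightarrow> 0) at_top"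
      using \<delta> by real_asymp
    moreover have "C * exp (C * T + \<delta> * b\<^sup>2 - \<delta> * T\<^sup>2) = C * exp (C * T) * exp (\<delta> * (b\<^sup>2 - T\<^sup>2))" for T
      by (simp add: exp_add[symmetric] algebra_simps)
    ultimately have "((\<lambda>T. C * exp (C * T) * exp (\<delta> * (b\<^sup>2 - T\<^sup>2))) \<longlongrightarrow> 0) at_top" by (simp only:)
    then have "\<forall>\<^sub>F T in at_top. C * exp (C * T) * exp (\<delta> * (b\<^sup>2 - T\<^sup>2)) < exp (\<delta> * b\<^sup>2)"
      by (rule order_tendstoD) simp
    then have "\<forall>\<^sub>F T in at_top. C * exp (C * T) * exp (\<delta> * (b\<^sup>2 - T\<^sup>2)) < exp (\<delta> * b\<^sup>2) \<and> T > \<bar>Im s\<bar>"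
      using eventually_gt_at_top[of "\<bar>Im s\<bar>"] by eventually_elim auto
    then obtain T where T: "C * exp (C * T) * exp (\<delta> * (b\<^sup>2 - T\<^sup>2)) < exp (\<delta> * b\<^sup>2)" "T > \<bar>Im s\<bar>"
      using eventually_happens'[OF trivial_limit_at_top_linorder] by blast
    let ?R = "cbox (Complex a (-T)) (Complex b T)"
    have Rin: "w \<in> ?R \<longleftrightarrow> a \<le> Re w \<and> Re w \<le> b \<and> -T \<le> Im w \<and> Im w \<le> T" for w
      by (auto simp: in_cbox_complex_iff)
    have RS: "?R \<subseteq> S" using f(2) Rin by auto
    have hol: "(\<lambda>w. f w * exp (of_real \<delta> * w\<^sup>2)) holomorphic_on S" by (intro holomorphic_intros f)
    have "cmod (f s * exp (of_real \<delta> * s\<^sup>2)) \<le> exp (\<delta> * b\<^sup>2)"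
    proof (rule maximum_modulus_frontier[of "\<lambda>w. f w * exp (of_real \<delta> * w\<^sup>2)" ?R])
      show "(\<lambda>w. f w * exp (of_real \<delta> * w\<^sup>2)) holomorphic_on interior ?R"
        using hol RS interior_subset holomorphic_on_subset by blast
      show "continuous_on (closure ?R) (\<lambda>w. f w * exp (of_real \<delta> * w\<^sup>2))"
        using holomorphic_on_imp_continuous_on[OF holomorphic_on_subset[OF hol RS]] by simp
      show "s \<in> ?R" using s T(2) unfolding Rin by auto
      fix w assume "w \<in> frontier ?R"
      then have w: "w \<in> ?R" "w \<notin> box (Complex a (-T)) (Complex b T)"
        by (auto simp: frontier_cbox)
      then have c: "Re w = a \<or> Re w = b \<or> \<bar>Im w\<bar> = T" unfolding Rin by (auto simp: in_box_complex_iff)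
      have rb: "(Re w)\<^sup>2 \<le> b\<^sup>2" using w(1) ab unfolding Rin by (intro power_mono) auto
      show "cmod (f w * exp (of_real \<delta> * w\<^sup>2)) \<le> exp (\<delta> * b\<^sup>2)"
      proof (cases "Re w = a \<or> Re w = b")
        case True
        have "cmod (f w) * exp (\<delta> * ((Re w)\<^sup>2 - (Im w)\<^sup>2)) \<le> 1 * exp (\<delta> * b\<^sup>2)"
        proof (intro mult_mono)
          have "(Re w)\<^sup>2 - (Im w)\<^sup>2 \<le> b\<^sup>2" using rb zero_le_power2[of "Im w"] by linarith
          then show "exp (\<delta> * ((Re w)\<^sup>2 - (Im w)\<^sup>2)) \<le> exp (\<delta> * b\<^sup>2)" using \<delta> by simp
        qed (use bd[OF True] in auto)
        then show ?thesis by (simp only: norm_mult nE mult_1_left)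
      next
        case False
        then have i: "\<bar>Im w\<bar> = T" using c by simp
        then have i2: "(Im w)\<^sup>2 = T\<^sup>2" by (metis power2_abs)
        have "cmod (f w) * exp (\<delta> * ((Re w)\<^sup>2 - (Im w)\<^sup>2)) \<le> (C * exp (C * T)) * exp (\<delta> * (b\<^sup>2 - T\<^sup>2))"
          using gr[of w] w(1) rb \<delta> i i2 norm_ge_zero[of "f w"] unfolding Rin
          by (intro mult_mono) (auto intro: order_trans[OF norm_ge_zero])
        then show ?thesis using T(1) unfolding norm_mult nE by linarith
      qed
    qed simp
    then show ?thesis by (simp only: norm_mult nE mult_1_left)
  qed
  have "((\<lambda>\<delta>. cmod (f s) * exp (\<delta> * ((Re s)\<^sup>2 - (Im s)\<^sup>2))) \<longlongrightarrow> cmod (f s) * exp (0 * ((Re s)\<^sup>2 - (Im s)\<^sup>2))) (at_right 0)"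
    by (intro tendsto_intros)
  moreover have "((\<lambda>\<delta>. exp (\<delta> * b\<^sup>2)) \<longlongrightarrow> exp (0 * b\<^sup>2)) (at_right (0::real))" by (intro tendsto_intros)
  moreover have "\<forall>\<^sub>F \<delta> in at_right (0::real). cmod (f s) * exp (\<delta> * ((Re s)\<^sup>2 - (Im s)\<^sup>2)) \<le> exp (\<delta> * b\<^sup>2)"
    using eventually_at_right_less[of 0] by eventually_elim (rule main)
  ultimately have "cmod (f s) * exp (0 * ((Re s)\<^sup>2 - (Im s)\<^sup>2)) \<le> exp (0 * b\<^sup>2)"
    by (intro tendsto_le[OF _ _ _ \<open>\<forall>\<^sub>F \<delta> in at_right (0::real). _ \<delta>\<close>]) auto
  then show ?thesis by simp
qed

text \<open>The true growth is logarithmic. A square root suffices, because it is weighed against a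
  test function of inverse-square decay, and it comes termwise from the defining series.\<close>

lemma Digamma_bound:
  assumes \<delta>: "\<delta> > 0"
  shows "\<exists>C>0. \<forall>z. Re z \<ge> \<delta> \<longrightarrow> cmod (Digamma z) \<le> C * (1 + sqrt (cmod z))"
proof -
  define Z where "Z = (\<Sum>k. real (Suc k) powr (-(3/2)))"
  have sZ: "summable (\<lambda>k. real (Suc k) powr (-(3/2)))"
    using summable_Suc_iff[of "\<lambda>k. real k powr (-(3/2))"] summable_real_powr_iff[of "-(3/2)"] by simp
  have Z0: "Z \<ge> 0" unfolding Z_def by (intro suminf_nonneg sZ) auto
  define C where "C = 1 + (1 + 1/\<delta>) + Z * (1 + 1 / sqrt \<delta>)"
  have "cmod (Digamma z) \<le> C * (1 + sqrt (cmod z))" if z: "Re z \<ge> \<delta>" for z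
  proof -
    have cz: "cmod z \<ge> \<delta>" using z complex_Re_le_cmod[of z] by linarith
    have z0: "z \<noteq> 0" using cz \<delta> by auto
    let ?t = "\<lambda>k. inverse (of_nat (Suc k)) - inverse (z + of_nat k) :: complex"
    have tk: "cmod (?t (Suc k)) \<le> (sqrt (cmod z) + 1 / sqrt \<delta>) * real (Suc k) powr (-(3/2))" for k
    proof -
      define n where "n = Suc k"
      have n: "n > 0" by (simp add: n_def)
      have zn: "z + of_nat n \<noteq> 0" using z \<delta> by (auto simp: complex_eq_iff)
      have "(cmod (z + of_nat n))\<^sup>2 = (cmod z)\<^sup>2 + 2 * real n * Re z + (real n)\<^sup>2"
        unfolding cmod_power2 by (simp add: power2_eq_square algebra_simps)
      also have "\<dots> \<ge> (cmod z)\<^sup>2 + (real n)\<^sup>2" using z \<delta> by simp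
      finally have "(cmod (z + of_nat n))\<^sup>2 \<ge> (cmod z)\<^sup>2 + (real n)\<^sup>2" .
      moreover have "(cmod z)\<^sup>2 + (real n)\<^sup>2 \<ge> cmod z * real n"
      proof -
        have "0 \<le> cmod z * real n" by simp
        then show ?thesis using sum_squares_bound[of "cmod z" "real n"] by linarith
      qed
      \<comment> \<open>Splitting the denominator into equal powers of \<open>cmod z\<close> and
        \<open>n\<close> leaves a factor \<open>sqrt (cmod z)\<close> and the summable
        \<open>n powr (-3/2)\<close>.\<close>
      ultimately have "(cmod (z + of_nat n))\<^sup>2 \<ge> cmod z * real n" by linarith
      then have "cmod (z + of_nat n) \<ge> sqrt (cmod z * real n)"
        using real_sqrt_le_mono by fastforce
      then have zs: "cmod (z + of_nat n) \<ge> sqrt (cmod z) * sqrt (real n)" by (simp add: real_sqrt_mult)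
      have pos: "sqrt (cmod z) * sqrt (real n) > 0" using z0 n by simp
      have "?t n = (z - 1) / (of_nat (Suc n) * (z + of_nat n))"
        using zn by (simp add: field_simps del: of_nat_Suc) (simp add: algebra_simps)
      then have "cmod (?t n) = cmod (z - 1) / (real (Suc n) * cmod (z + of_nat n))"
        by (simp add: norm_divide norm_mult del: of_nat_Suc)
      also have "\<dots> \<le> (cmod z + 1) / (real n * (sqrt (cmod z) * sqrt (real n)))"
        using zs pos n norm_triangle_ineq4[of z 1] by (intro frac_le mult_mono mult_pos_pos) auto
      also have "\<dots> = (sqrt (cmod z) + 1 / sqrt (cmod z)) / (real n * sqrt (real n))"
        using z0 n by (simp add: field_simps)
      also have "real n * sqrt (real n) = real n powr (3/2)"
      proof -
        have "real n powr (3/2) = real n powr (1 + 1/2)" by simp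
        also have "\<dots> = real n powr 1 * real n powr (1/2)" by (rule powr_add)
        finally show ?thesis using n by (simp add: powr_half_sqrt)
      qed
      also have "(sqrt (cmod z) + 1 / sqrt (cmod z)) / real n powr (3/2) = (sqrt (cmod z) + 1 / sqrt (cmod z)) * real n powr (-(3/2))"
        by (simp add: powr_minus field_simps)
      also have "\<dots> \<le> (sqrt (cmod z) + 1 / sqrt \<delta>) * real n powr (-(3/2))"
        using cz \<delta> z0 by (intro mult_right_mono add_left_mono divide_left_mono mult_pos_pos) auto
      finally show ?thesis by (simp add: n_def)
    qed
    have sn: "summable (\<lambda>k. cmod (?t (Suc k)))"
      by (rule summable_comparison_test[OF _ summable_mult[OF sZ, of "sqrt (cmod z) + 1 / sqrt \<delta>"]]) (use tk in auto)
    have "Digamma z = (?t 0 + (\<Sum>k. ?t (Suc k))) - euler_mascheroni"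
      unfolding Digamma_def using suminf_split_head[OF summable_Digamma[OF z0]] by simp
    also have "cmod \<dots> \<le> cmod (?t 0) + (\<Sum>k. cmod (?t (Suc k))) + cmod (euler_mascheroni :: complex)"
      using norm_triangle_ineq4[of "?t 0 + (\<Sum>k. ?t (Suc k))" euler_mascheroni] norm_triangle_ineq[of "?t 0" "\<Sum>k. ?t (Suc k)"]
        summable_norm[OF sn] by linarith
    also have "cmod (?t 0) \<le> 1 + 1 / \<delta>"
    proof -
      have "cmod (?t 0) \<le> 1 + 1 / cmod z" using norm_triangle_ineq4[of 1 "inverse z"] by (simp add: norm_divide inverse_eq_divide)
      also have "\<dots> \<le> 1 + 1 / \<delta>" using cz \<delta> by (simp add: frac_le)
      finally show ?thesis .
    qed
    also have "(\<Sum>k. cmod (?t (Suc k))) \<le> (\<Sum>k. (sqrt (cmod z) + 1 / sqrt \<delta>) * real (Suc k) powr (-(3/2)))"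
      by (intro suminf_le tk sn summable_mult sZ)
    also have "\<dots> = (sqrt (cmod z) + 1 / sqrt \<delta>) * Z" unfolding Z_def by (rule suminf_mult[OF sZ])
    also have "cmod (euler_mascheroni :: complex) \<le> 1"
    proof -
      have "cmod (euler_mascheroni :: complex) = \<bar>euler_mascheroni\<bar>"
        by (metis norm_of_real of_real_euler_mascheroni)
      then show ?thesis using euler_mascheroni_pos euler_mascheroni_less_13_over_22 by simp
    qed
    finally have "cmod (Digamma z) \<le> (1 + 1/\<delta>) + (sqrt (cmod z) + 1 / sqrt \<delta>) * Z + 1" by simp
    also have "\<dots> \<le> C * (1 + sqrt (cmod z))"
      unfolding C_def using Z0 \<delta> by (simp add: algebra_simps)
    finally show ?thesis .
  qed
  moreover have "C > 0" unfolding C_def using Z0 \<delta> by (simp add: add_pos_nonneg)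
  ultimately show ?thesis by blast
qed

text \<open>For \<open>Re z \<ge> 1\<close> every term of the series has nonnegative real part since
  \<open>cmod (z + k) \<ge> k + 1\<close>; what remains is minus the Euler constant, which exceeds
  -1.\<close>

lemma Re_Digamma_ge:
  assumes z: "Re z \<ge> 1"
  shows "Re (Digamma z) \<ge> -1"
proof -
  have z0: "z \<noteq> 0" using z by auto
  have "Re (inverse (of_nat (Suc k)) - inverse (z + of_nat k)) \<ge> 0" for k
  proof -
    have p: "Re (z + of_nat k) > 0" using z by simp
    have "Re (inverse (z + of_nat k)) \<le> cmod (inverse (z + of_nat k))" by (rule complex_Re_le_cmod)
    also have "\<dots> = inverse (cmod (z + of_nat k))" by (rule norm_inverse)
    also have "\<dots> \<le> inverse (real (Suc k))"
    proof (rule le_imp_inverse_le)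
      show "real (Suc k) \<le> cmod (z + of_nat k)" using z complex_Re_le_cmod[of "z + of_nat k"] by simp
    qed simp
    also have "inverse (real (Suc k)) = Re (inverse (of_nat (Suc k)))" by (metis Re_complex_of_real of_real_inverse of_real_of_nat_eq)
    finally show ?thesis by simp
  qed
  then have "0 \<le> (\<Sum>k. Re (inverse (of_nat (Suc k)) - inverse (z + of_nat k)))"
    using summable_Re[OF summable_Digamma[OF z0]] by (intro suminf_nonneg) auto
  then have "0 \<le> Re (\<Sum>k. inverse (of_nat (Suc k)) - inverse (z + of_nat k))"
    using sums_Re[OF summable_sums[OF summable_Digamma[OF z0]]] by (simp add: sums_iff)
  moreover have "Re (euler_mascheroni :: complex) = euler_mascheroni" by (metis Re_complex_of_real of_real_euler_mascheroni)
  ultimately show ?thesis unfolding Digamma_def using euler_mascheroni_less_13_over_22 by simp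
qed

lemma gammafac_log_deriv:
  assumes "a \<ge> 0" "Re s > 0" "q > 0"
  shows "deriv (gammafac q a) s / gammafac q a s = of_real (ln (real q / pi)) / 2 + Digamma ((s + of_real a) / 2) / 2"
proof -
  have ni: "(s + of_real a) / 2 \<notin> \<int>\<^sub>\<le>\<^sub>0" using assms by (intro Re_pos_not_nonpos_Int) auto
  then have G: "Gamma ((s + of_real a) / 2) \<noteq> 0" by (simp add: Gamma_eq_zero_iff)
  let ?l = "of_real (ln (real q / pi)) :: complex"
  have d: "((\<lambda>s. exp (s / 2 * ?l) * Gamma ((s + of_real a) / 2)) has_field_derivative
     exp (s / 2 * ?l) * (?l / 2) * Gamma ((s + of_real a) / 2) + (Gamma ((s + of_real a) / 2) * Digamma ((s + of_real a) / 2)) / 2 * exp (s / 2 * ?l)) (at s)"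
    using ni by (auto intro!: derivative_eq_intros)
  have "gammafac q a = (\<lambda>s. exp (s / 2 * ?l) * Gamma ((s + of_real a) / 2))" by (simp add: gammafac_def fun_eq_iff)
  then have "deriv (gammafac q a) s = exp (s / 2 * ?l) * (?l / 2) * Gamma ((s + of_real a) / 2) + (Gamma ((s + of_real a) / 2) * Digamma ((s + of_real a) / 2)) / 2 * exp (s / 2 * ?l)"
    using DERIV_imp_deriv[OF d] by simp
  then show ?thesis unfolding gammafac_def using G by (simp add: field_simps)
qed

section \<open>Positivity of the logarithmic derivative\<close>

lemma convex_open_half_plane: "convex {s. Re s > c}" "open {s. Re s > c}" "connected {s. Re s > c}"
  by (rule convex_halfspace_Re_gt, rule open_halfspace_Re_gt, intro convex_connected convex_halfspace_Re_gt)

text \<open>A bound for the logarithmic derivative of every L-function on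
  \<open>Re s \<ge> 2\<close>. It enters the lower bound on \<open>q\<close> from which positivity
  is available.\<close>

definition logsum :: real where "logsum = (\<Sum>n. ln (real n) * real n powr -2)"

lemma logsum_nonneg: "logsum \<ge> 0"
  unfolding logsum_def
proof (intro suminf_nonneg summable_log_powr)
  show "0 \<le> ln (real n) * real n powr -2" for n by (cases "n = 0") auto
qed simp

lemma (in comp_mult) norm_Dlog_le:
  assumes "Re s \<ge> 2"
  shows "cmod (Dlog s) \<le> logsum"
proof -
  have t: "cmod (mangoldt n * \<psi> n / of_nat n powr s) \<le> ln (real n) * real n powr -2" for n
  proof (cases "n = 0")
    case False
    then have "ln (real n) * real n powr - Re s \<le> ln (real n) * real n powr -2"
      using assms by (intro mult_left_mono powr_mono) auto
    then show ?thesis using norm_mangoldt_term[of n s] by linarith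
  qed simp
  have sn: "summable (\<lambda>n. cmod (mangoldt n * \<psi> n / of_nat n powr s))"
    using assms by (intro summable_norm_mangoldt_term) auto
  have "cmod (Dlog s) \<le> (\<Sum>n. cmod (mangoldt n * \<psi> n / of_nat n powr s))"
    unfolding Dlog_def by (rule summable_norm[OF sn])
  also have "\<dots> \<le> logsum" unfolding logsum_def
    by (intro suminf_le t sn summable_log_powr) auto
  finally show ?thesis .
qed

locale grh_char = nonprincipal_char +
  assumes grh: "\<And>s. 0 < Re s \<Longrightarrow> Re s < 1 \<Longrightarrow> abel_series \<psi> s = 0 \<Longrightarrow> Re s = 1/2"
begin

text \<open>Three regions with three reasons: the hypothesis inside the strip, the 3-4-1 argument
  and the real case on its right edge, the exponential formula beyond.\<close>

lemma L_nonzero: "Re s > 1/2 \<Longrightarrow> L s \<noteq> 0"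
  using grh[of s] L_line_1_nonzero[of s] L_nonzero_Re_gt_1[of s] by (cases "Re s < 1"; cases "Re s = 1") auto

lemma L_holomorphic: "A \<subseteq> {s. Re s > 0} \<Longrightarrow> L holomorphic_on A"
  using abel_series_holomorphic holomorphic_on_subset by blast

text \<open>Borel-Caratheodory for the logarithm of \<open>L\<close> in a disc about
  \<open>4 + \<i> * t\<close> that stays in the zero-free half-plane, followed by Cauchy's
  inequality. The loss of \<open>1 / h\<^sup>2\<close> is harmless, as \<open>h\<close> is fixed
  whenever the bound is used.\<close>

lemma L_log_deriv_bound:
  assumes h: "0 < h" "h < 1/2"
  shows "\<exists>C>0. \<forall>s. 1/2 + h \<le> Re s \<and> Re s \<le> 4 \<longrightarrow> cmod (deriv L s / L s) \<le> C * sqrt (1 + \<bar>Im s\<bar>)"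
proof -
  let ?S = "{s. Re s > 1/2}"
  obtain C0 where C0: "C0 > 0" "\<And>s. Re s \<ge> 1/2 \<Longrightarrow> cmod (L s) \<le> C0 * cmod s"
    using abel_series_bound[of "1/2"] by auto
  define C1 where "C1 = max C0 1"
  have C1: "C1 \<ge> 1" "\<And>s. Re s \<ge> 1/2 \<Longrightarrow> cmod (L s) \<le> C1 * cmod s"
  proof -
    show "C1 \<ge> 1" by (simp add: C1_def)
    fix s assume "Re s \<ge> 1/2"
    then have "cmod (L s) \<le> C0 * cmod s" by (rule C0)
    also have "\<dots> \<le> C1 * cmod s" by (intro mult_right_mono) (auto simp: C1_def)
    finally show "cmod (L s) \<le> C1 * cmod s" .
  qed
  have LS: "L holomorphic_on ?S" by (intro L_holomorphic) auto
  obtain E where E: "E holomorphic_on ?S" "\<And>z. z \<in> ?S \<Longrightarrow> (E has_field_derivative deriv L z / L z) (at z)"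
    "\<And>a b. a \<in> ?S \<Longrightarrow> b \<in> ?S \<Longrightarrow> L a = L b * exp (E a - E b)"
    using holomorphic_log_primitive[OF convex_open_half_plane(1,2) LS] L_nonzero by blast
  define C where "C = (112 / h\<^sup>2) * (8 * sqrt C1 + 1)"
  have Cpos: "C > 0" unfolding C_def using h C1 by (intro mult_pos_pos add_nonneg_pos) auto
  have "cmod (deriv L s / L s) \<le> C * sqrt (1 + \<bar>Im s\<bar>)" if s: "1/2 + h \<le> Re s" "Re s \<le> 4" for s
  proof -
    define t where "t = Im s"
    define z0 where "z0 = Complex 4 t"
    \<comment> \<open>The disc of radius \<open>R\<close> reaches the line \<open>1/2 + h/2\<close>,
      the one of radius \<open>r\<close> the line \<open>1/2 + 3 h / 4\<close>; every admissible
      \<open>s\<close> then keeps a distance \<open>h/4\<close> for Cauchy's inequality, and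
      \<open>R - r = h/4\<close> as well.\<close>
    define R where "R = 7/2 - h/2"
    define r where "r = 7/2 - 3 * h / 4"
    define M where "M = ln (2 * C1 * (8 + \<bar>t\<bar>)) + 1"
    define f where "f w = E w - E z0" for w
    have z0S: "z0 \<in> ?S" by (simp add: z0_def)
    have bS: "ball z0 R \<subseteq> ?S"
    proof
      fix w assume "w \<in> ball z0 R"
      then have "cmod (z0 - w) < R" by (simp add: dist_norm)
      then have "\<bar>Re (z0 - w)\<bar> < R" using abs_Re_le_cmod[of "z0 - w"] by linarith
      then show "w \<in> ?S" using h by (simp add: z0_def R_def)
    qed
    have big: "2 * C1 * (8 + \<bar>t\<bar>) \<ge> 1" using C1(1) mult_mono[of 1 "2 * C1" 1 "8 + \<bar>t\<bar>"] by simp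
    have M: "M > 0" unfolding M_def using big by (simp add: add_nonneg_pos)
    have fh: "f holomorphic_on ball z0 R" unfolding f_def
      by (intro holomorphic_intros holomorphic_on_subset[OF E(1) bS])
    have Ref: "Re (f w) < M" if w: "w \<in> ball z0 R" for w
    proof -
      have wS: "w \<in> ?S" using bS w by blast
      have "cmod (L w) = cmod (L z0) * exp (Re (f w))"
        using arg_cong[OF E(3)[OF wS z0S], of cmod] by (simp add: norm_mult norm_exp_eq_Re f_def)
      moreover have "cmod (L z0) \<ge> 1/2" using norm_dser_ge_half[of z0] L_eq_dser[of z0] by (simp add: z0_def)
      ultimately have "1/2 * exp (Re (f w)) \<le> cmod (L w)" by (metis exp_ge_zero mult_right_mono)
      also have "\<dots> \<le> C1 * cmod w" using wS by (intro C1) auto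
      also have "\<dots> \<le> C1 * (8 + \<bar>t\<bar>)"
      proof (intro mult_left_mono)
        have "cmod w \<le> cmod z0 + cmod (z0 - w)" using norm_triangle_ineq3[of w z0] norm_triangle_sub[of w z0] by (simp add: norm_minus_commute)
        also have "cmod (z0 - w) \<le> 7/2" using w h by (simp add: dist_norm R_def)
        also have "cmod z0 \<le> 4 + \<bar>t\<bar>" using cmod_le[of z0] by (simp add: z0_def)
        finally show "cmod w \<le> 8 + \<bar>t\<bar>" by simp
      qed (use C1 in auto)
      finally have "exp (Re (f w)) \<le> 2 * C1 * (8 + \<bar>t\<bar>)" by simp
      then have "Re (f w) \<le> ln (2 * C1 * (8 + \<bar>t\<bar>))" using big by (simp add: ln_ge_iff)
      then show ?thesis by (simp add: M_def)
    qed
    have rR: "0 < r" "r < R" "R - r = h / 4" "r \<le> 7/2" using h by (auto simp: r_def R_def field_simps)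
    have fb: "cmod (f w) \<le> 28 * M / h" if "cmod (w - z0) \<le> r" for w
    proof -
      have "cmod (f w) \<le> 2 * M * r / (R - r)"
        by (rule Borel_Caratheodory[OF fh _ rR(1,2) M Ref that]) (auto simp: f_def)
      also have "\<dots> \<le> 2 * M * (7/2) / (h/4)"
        unfolding rR(3) using M h rR by (intro divide_right_mono mult_left_mono) auto
      finally show ?thesis by (simp add: field_simps)
    qed
    have sS: "s \<in> ?S" using s h by simp
    have sz: "cmod (s - z0) \<le> 7/2 - h"
    proof -
      have "s - z0 = of_real (Re s - 4)" by (simp add: complex_eq_iff z0_def t_def)
      then show ?thesis using s by (simp only: norm_of_real)
    qed
    have sub: "cmod (w - z0) \<le> r" if "cmod (s - w) \<le> h/4" for w
    proof -
      have "cmod (w - z0) \<le> cmod (w - s) + cmod (s - z0)" using norm_triangle_ineq[of "w - s" "s - z0"] by simp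
      also have "cmod (w - s) \<le> h/4" using that by (simp add: norm_minus_commute)
      also note sz
      finally show ?thesis by (simp add: r_def)
    qed
    have cb: "cball s (h/4) \<subseteq> ball z0 R" using sub rR by (force simp: dist_norm norm_minus_commute)
    have "cmod ((deriv ^^ 1) f s) \<le> fact 1 * (28 * M / h) / (h/4) ^ 1"
    proof (rule Cauchy_inequality)
      show "f holomorphic_on ball s (h/4)" using holomorphic_on_subset[OF fh] cb ball_subset_cball by blast
      show "continuous_on (cball s (h/4)) f" using holomorphic_on_imp_continuous_on[OF holomorphic_on_subset[OF fh cb]] .
      show "cmod (f x) \<le> 28 * M / h" if "cmod (s - x) = h/4" for x using that by (intro fb sub) simp
    qed (use h in auto)
    moreover have "deriv f s = deriv L s / L s"
    proof (rule DERIV_imp_deriv)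
      show "(f has_field_derivative deriv L s / L s) (at s)"
        unfolding f_def using E(2)[OF sS] by (auto intro!: derivative_eq_intros)
    qed
    ultimately have 1: "cmod (deriv L s / L s) \<le> 112 / h\<^sup>2 * M" using h by (simp add: field_simps power2_eq_square)
    \<comment> \<open>The logarithm is traded for a square root by
      \<open>ln x \<le> 2 * sqrt x\<close>, to match the shape of the Digamma bound.\<close>
    have "M \<le> (8 * sqrt C1 + 1) * sqrt (1 + \<bar>t\<bar>)"
    proof -
      have "ln (2 * C1 * (8 + \<bar>t\<bar>)) \<le> (2 * C1 * (8 + \<bar>t\<bar>)) powr (1/2) / (1/2)"
        using big by (intro ln_powr_bound) auto
      also have "\<dots> = 2 * sqrt (2 * C1 * (8 + \<bar>t\<bar>))" using big by (simp add: powr_half_sqrt)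
      also have "\<dots> \<le> 2 * sqrt (16 * C1 * (1 + \<bar>t\<bar>))"
      proof -
        have "2 * C1 * (8 + \<bar>t\<bar>) \<le> 2 * C1 * (8 * (1 + \<bar>t\<bar>))" using C1(1) by (intro mult_left_mono) auto
        also have "2 * C1 * (8 * (1 + \<bar>t\<bar>)) = 16 * C1 * (1 + \<bar>t\<bar>)" by simp
        finally show ?thesis by (intro mult_left_mono real_sqrt_le_mono) auto
      qed
      also have "\<dots> = 8 * sqrt C1 * sqrt (1 + \<bar>t\<bar>)" by (simp add: real_sqrt_mult)
      finally have "ln (2 * C1 * (8 + \<bar>t\<bar>)) \<le> 8 * sqrt C1 * sqrt (1 + \<bar>t\<bar>)" .
      moreover have "1 \<le> sqrt (1 + \<bar>t\<bar>)" by simp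
      ultimately show ?thesis unfolding M_def distrib_right mult_1_left by (rule add_mono)
    qed
    then have "112 / h\<^sup>2 * M \<le> 112 / h\<^sup>2 * ((8 * sqrt C1 + 1) * sqrt (1 + \<bar>t\<bar>))" using h by (intro mult_left_mono) auto
    with 1 have "cmod (deriv L s / L s) \<le> 112 / h\<^sup>2 * ((8 * sqrt C1 + 1) * sqrt (1 + \<bar>t\<bar>))" by (rule order_trans)
    then show ?thesis by (simp only: C_def t_def mult.assoc)
  qed
  then show ?thesis using Cpos by blast
qed

section \<open>The completed L-function and its modulus left and right of the critical line\<close>

definition xi :: "complex \<Rightarrow> complex" where "xi s = gammafac q par s * L s"

lemma xi_holomorphic: "A \<subseteq> {s. Re s > 0} \<Longrightarrow> xi holomorphic_on A"
  unfolding xi_def by (intro holomorphic_intros gammafac_holomorphic[OF par_nonneg] L_holomorphic)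

lemma xi_nonzero: "Re s > 1/2 \<Longrightarrow> xi s \<noteq> 0"
  using L_nonzero[of s] gammafac_nonzero[OF par_nonneg, of s q] by (simp add: xi_def)

lemma xi_log_primitive:
  "\<exists>E. (\<forall>z\<in>{s. Re s > 1/2}. (E has_field_derivative deriv xi z / xi z) (at z)) \<and>
     (\<forall>a\<in>{s. Re s > 1/2}. \<forall>b\<in>{s. Re s > 1/2}. xi a = xi b * exp (E a - E b))"
proof -
  have "xi holomorphic_on {s. Re s > 1/2}" by (intro xi_holomorphic) auto
  from holomorphic_log_primitive[OF convex_open_half_plane(1,2) this] show ?thesis
    using xi_nonzero by blast
qed

lemma xi_log_deriv:
  assumes "Re s > 1/2"
  shows "deriv xi s / xi s = of_real (ln (real q / pi)) / 2 + Digamma ((s + of_real par) / 2) / 2 + deriv L s / L s"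
proof -
  have g: "(gammafac q par has_field_derivative deriv (gammafac q par) s) (at s)"
    using holomorphic_derivI[OF gammafac_holomorphic[OF par_nonneg order_refl] open_halfspace_Re_gt, of s] assms by simp
  have l: "(L has_field_derivative deriv L s) (at s)"
    using holomorphic_derivI[OF abel_series_holomorphic open_halfspace_Re_gt, of s] assms by simp
  have "(xi has_field_derivative (deriv (gammafac q par) s * L s + deriv L s * gammafac q par s)) (at s)"
    unfolding xi_def by (rule DERIV_mult[OF g l])
  then have "deriv xi s = deriv (gammafac q par) s * L s + deriv L s * gammafac q par s" by (rule DERIV_imp_deriv)
  then have "deriv xi s / xi s = deriv (gammafac q par) s / gammafac q par s + deriv L s / L s"
    using L_nonzero[OF assms] gammafac_nonzero[OF par_nonneg, of s q] assms unfolding xi_def by (simp add: field_simps)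
  then show ?thesis using gammafac_log_deriv[OF par_nonneg, of s q] assms q_pos by simp
qed

text \<open>The functional equation with conjugation takes the character back to itself, up to the
  constant \<open>sqrt q / cmod gauss\<close>.\<close>

lemma xi_reflect:
  assumes "0 < Re s" "Re s < 1"
  shows "cmod (xi s) = cmod (xi (1 - cnj s))"
proof -
  define c where "c = sqrt (real q) / cmod gauss"
  have c0: "c > 0" using gauss_nonzero q_pos by (simp add: c_def)
  have eq: "cmod (xi s) = c * cmod (xi (1 - cnj s))" if s: "0 < Re s" "Re s < 1" for s
  proof -
    have "Lc (1 - s) = cnj (L (cnj (1 - s)))" using s by (intro abel_series_cnj[OF periodic_mean_zero]) simp
    moreover have "gammafac q par (1 - s) = cnj (gammafac q par (1 - cnj s))" by (simp flip: gammafac_cnj)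
    ultimately have "cmod (gammafac q par (1 - s) * Lc (1 - s)) = cmod (xi (1 - cnj s))"
      by (simp add: xi_def norm_mult)
    moreover have "cmod gauss * cmod (xi s) = sqrt (real q) * cmod (gammafac q par (1 - s) * Lc (1 - s))"
      using arg_cong[OF functional_equation[OF s], of cmod] cmod_kap by (simp add: xi_def norm_mult mult.assoc)
    ultimately show ?thesis using gauss_nonzero by (simp add: c_def field_simps)
  qed
  \<comment> \<open>Reflecting twice, from 3/4 to 1/4 and back, shows that the square of the
    constant is 1; the modulus of the Gauss sum follows instead of being an input.\<close>
  have "cmod (xi (3/4)) = c * (c * cmod (xi (3/4)))" using eq[of "3/4"] eq[of "1/4"] by simp
  moreover have "cmod (xi (3/4)) \<noteq> 0" using xi_nonzero[of "3/4"] by simp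
  ultimately have "c * c = 1" by simp
  then have "c = 1" using c0 by (simp add: square_eq_1_iff)
  then show ?thesis using eq[OF assms] by simp
qed

text \<open>Only the quotient is bounded: the exponential decay of the Gamma factors cancels in it,
  and their ratio is controlled by integrating \<open>Digamma\<close> over a short segment. The
  restriction \<open>u \<le> 1/4\<close> keeps the shifted points at real part at least 1/4.\<close>

lemma xi_growth:
  assumes u: "0 < u" "u \<le> 1/4"
  shows "\<exists>C. \<forall>s. 1/2 \<le> Re s \<longrightarrow> Re s \<le> 3 \<longrightarrow> cmod (xi (s - of_real u) / xi (s + of_real u)) \<le> C * exp (C * \<bar>Im s\<bar>)"
proof -
  obtain C1 where C1: "C1 > 0" "\<And>s. Re s \<ge> 1/4 \<Longrightarrow> cmod (L s) \<le> C1 * cmod s"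
    using abel_series_bound[of "1/4"] by auto
  obtain C2 where C2: "C2 > 0" "\<And>s. 1/2 + u \<le> Re s \<Longrightarrow> Re s \<le> 4 \<Longrightarrow> cmod (deriv L s / L s) \<le> C2 * sqrt (1 + \<bar>Im s\<bar>)"
    using L_log_deriv_bound[of u] u by auto
  obtain C3 where C3: "C3 > 0" "\<And>z. Re z \<ge> 1/8 \<Longrightarrow> cmod (Digamma z) \<le> C3 * (1 + sqrt (cmod z))"
    using Digamma_bound[of "1/8"] by auto
  define C4 where "C4 = \<bar>ln (real q / pi)\<bar> + 6 * C3"
  have C4: "C4 > 0" using C3 by (simp add: C4_def add_nonneg_pos)
  define C where "C = max (4 * C1 * 2 * exp (4 * C2) * exp C4) (1 + 4 * C2 + C4)"
  have "cmod (xi (s - of_real u) / xi (s + of_real u)) \<le> C * exp (C * \<bar>Im s\<bar>)" if s: "1/2 \<le> Re s" "Re s \<le> 3" for s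
  proof -
    define t where "t = \<bar>Im s\<bar>"
    have t0: "t \<ge> 0" by (simp add: t_def)
    have st: "sqrt (1 + t) \<le> 1 + t" using t0 by (simp add: real_le_lsqrt power2_eq_square)
    have 1: "cmod (L (s - of_real u)) \<le> 4 * C1 * exp t"
    proof -
      have "cmod (L (s - of_real u)) \<le> C1 * cmod (s - of_real u)" using s u by (intro C1) auto
      also have "cmod (s - of_real u) \<le> \<bar>Re s - u\<bar> + t" using cmod_le[of "s - of_real u"] by (simp add: t_def)
      also have "\<dots> \<le> 4 * (1 + t)" using s u t0 by simp
      also have "\<dots> \<le> 4 * exp t" by (intro mult_left_mono exp_ge_add_one_self) auto
      finally show ?thesis using C1 by (simp add: mult_left_mono)
    qed
    \<comment> \<open>A lower bound for \<open>L\<close> is carried horizontally from real part 4,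
      where \<open>cmod (L b) \<ge> 1/2\<close>, by the bound on its logarithmic derivative.\<close>
    have 2: "1 / cmod (L (s + of_real u)) \<le> 2 * exp (4 * C2 * (1 + t))"
    proof -
      define b where "b = Complex 4 (Im s)"
      have "cmod (L b) \<le> cmod (L (s + of_real u)) * exp (C2 * (1 + t) * cmod (b - (s + of_real u)))"
      proof (rule norm_ratio_bound[OF convex_open_half_plane(1,2)[of "1/2"]])
        show "L holomorphic_on {s. Re s > 1/2}" by (intro L_holomorphic) auto
        show "b \<in> {s. Re s > 1/2}" "s + of_real u \<in> {s. Re s > 1/2}" using s u by (auto simp: b_def)
        fix w assume "w \<in> closed_segment b (s + of_real u)"
        then obtain v where v: "0 \<le> v" "v \<le> 1" "w = (1 - v) *\<^sub>R b + v *\<^sub>R (s + of_real u)" by (auto simp: closed_segment_def)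
        have Im: "Im w = Im s"
        proof -
          have "Im w = (1 - v) * Im s + v * Im s" unfolding v(3) by (simp add: b_def)
          then show ?thesis by (simp add: algebra_simps)
        qed
        have Re: "Re w = (1 - v) * 4 + v * (Re s + u)" using v(3) by (simp add: b_def)
        have "Re w \<le> 4" unfolding Re using v s u mult_left_mono[of "Re s + u" 4 v] by (simp add: algebra_simps)
        moreover have "1/2 + u \<le> Re w"
        proof -
          have "v * (Re s + u) \<ge> v * (1/2 + u)" using v s u by (intro mult_left_mono) auto
          moreover have "(1 - v) * 4 \<ge> (1 - v) * (1/2 + u)" using v s u by (intro mult_left_mono) auto
          ultimately have "(1 - v) * 4 + v * (Re s + u) \<ge> (1 - v) * (1/2 + u) + v * (1/2 + u)" by (rule add_mono[rotated])
          also have "(1 - v) * (1/2 + u) + v * (1/2 + u) = 1/2 + u" unfolding distrib_right[symmetric] by simp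
          finally have "1/2 + u \<le> (1 - v) * 4 + v * (Re s + u)" .
          then show ?thesis unfolding Re .
        qed
        ultimately have "cmod (deriv L w / L w) \<le> C2 * sqrt (1 + t)" using C2(2)[of w] Im by (simp add: t_def)
        also have "\<dots> \<le> C2 * (1 + t)" using st C2 by simp
        finally show "cmod (deriv L w / L w) \<le> C2 * (1 + t)" .
      qed (use L_nonzero in auto)
      moreover have "cmod (L b) \<ge> 1/2" using norm_dser_ge_half[of b] L_eq_dser[of b] by (simp add: b_def)
      moreover have "exp (C2 * (1 + t) * cmod (b - (s + of_real u))) \<le> exp (4 * C2 * (1 + t))"
      proof -
        have "b - (s + of_real u) = of_real (4 - Re s - u)" by (simp add: complex_eq_iff b_def)
        then have "cmod (b - (s + of_real u)) \<le> 4" using s u by (simp only: norm_of_real)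
        then have "C2 * (1 + t) * cmod (b - (s + of_real u)) \<le> C2 * (1 + t) * 4" using C2 t0 by (intro mult_left_mono) auto
        also have "C2 * (1 + t) * 4 = 4 * C2 * (1 + t)" by simp
        finally show ?thesis by simp
      qed
      ultimately have "1/2 \<le> cmod (L (s + of_real u)) * exp (4 * C2 * (1 + t))"
        by (smt (verit) mult_left_mono norm_ge_zero)
      moreover have "cmod (L (s + of_real u)) > 0" using L_nonzero[of "s + of_real u"] s u by simp
      ultimately show ?thesis by (simp add: field_simps)
    qed
    have 3: "cmod (gammafac q par (s - of_real u)) \<le> cmod (gammafac q par (s + of_real u)) * exp (C4 * (1 + t))"
    proof -
      have "cmod (gammafac q par (s - of_real u)) \<le> cmod (gammafac q par (s + of_real u)) *
          exp (C4 * (1 + t) * cmod ((s - of_real u) - (s + of_real u)))"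
      proof (rule norm_ratio_bound[OF convex_open_half_plane(1,2)[of 0]])
        show "gammafac q par holomorphic_on {s. Re s > 0}" by (rule gammafac_holomorphic[OF par_nonneg order_refl])
        show "s - of_real u \<in> {s. Re s > 0}" "s + of_real u \<in> {s. Re s > 0}" using s u by auto
        fix w assume "w \<in> closed_segment (s - of_real u) (s + of_real u)"
        then obtain v where v: "0 \<le> v" "v \<le> 1" "w = (1 - v) *\<^sub>R (s - of_real u) + v *\<^sub>R (s + of_real u)" by (auto simp: closed_segment_def)
        have w: "w = s + of_real ((2 * v - 1) * u)" unfolding v(3) by (simp add: complex_eq_iff algebra_simps)
        have "\<bar>(2 * v - 1) * u\<bar> \<le> 1 * u" unfolding abs_mult using v u by (intro mult_mono) auto
        then have ab: "\<bar>(2 * v - 1) * u\<bar> \<le> 1/4" using u by simp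
        have Rw: "Re w \<ge> 1/4" "Re w \<le> 4" "\<bar>Im w\<bar> = t" using ab s by (auto simp: w t_def abs_le_iff)
        define z where "z = (w + of_real par) / 2"
        have "Re z \<ge> 1/8" using Rw par_nonneg by (simp add: z_def)
        then have "cmod (Digamma z) \<le> C3 * (1 + sqrt (cmod z))" by (rule C3)
        moreover have "sqrt (cmod z) \<le> 3 + t"
        proof -
          have "cmod z \<le> \<bar>Re z\<bar> + \<bar>Im z\<bar>" by (rule cmod_le)
          also have "\<dots> = (Re w + par) / 2 + t / 2" using Rw par_nonneg by (simp add: z_def)
          also have "\<dots> \<le> 3 + t" using Rw(2) par_le t0 by argo
          also have "\<dots> \<le> (3 + t)\<^sup>2" using t0 by (simp add: power2_eq_square algebra_simps)
          finally show ?thesis using t0 by (simp add: real_le_lsqrt)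
        qed
        then have "1 + sqrt (cmod z) \<le> 4 * (1 + t)" using t0 by argo
        then have "C3 * (1 + sqrt (cmod z)) \<le> C3 * (4 * (1 + t))" using C3(1) by (intro mult_left_mono) auto
        ultimately have D: "cmod (Digamma z) \<le> C3 * (4 * (1 + t))" by (rule order_trans)
        have "cmod (of_real (ln (real q / pi)) / 2 + Digamma z / 2) \<le> cmod (complex_of_real (ln (real q / pi)) / 2) + cmod (Digamma z / 2)"
          by (rule norm_triangle_ineq)
        also have "\<dots> = \<bar>ln (real q / pi)\<bar> / 2 + cmod (Digamma z) / 2" by (simp add: norm_divide)
        also have "\<dots> \<le> \<bar>ln (real q / pi)\<bar> * (1 + t) + 6 * C3 * (1 + t)"
        proof (rule add_mono)
          have "0 \<le> \<bar>ln (real q / pi)\<bar> * t" using t0 by simp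
          then show "\<bar>ln (real q / pi)\<bar> / 2 \<le> \<bar>ln (real q / pi)\<bar> * (1 + t)" by (simp add: distrib_left)
          have "0 \<le> C3 * (1 + t)" using C3(1) t0 by simp
          then show "cmod (Digamma z) / 2 \<le> 6 * C3 * (1 + t)" using D by argo
        qed
        also have "\<dots> = C4 * (1 + t)" by (simp add: C4_def distrib_right)
        finally show "cmod (deriv (gammafac q par) w / gammafac q par w) \<le> C4 * (1 + t)"
          using gammafac_log_deriv[OF par_nonneg, of w q] Rw q_pos by (simp add: z_def)
      qed (use gammafac_nonzero[OF par_nonneg] in auto)
      also have "\<dots> \<le> cmod (gammafac q par (s + of_real u)) * exp (C4 * (1 + t) * 1)"
      proof -
        have "(s - of_real u) - (s + of_real u) = of_real (- 2 * u)" by simp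
        then have "cmod ((s - of_real u) - (s + of_real u)) \<le> 1" using u by (simp only: norm_of_real)
        then have "C4 * (1 + t) * cmod ((s - of_real u) - (s + of_real u)) \<le> C4 * (1 + t) * 1"
          using C4 t0 by (intro mult_left_mono) auto
        then show ?thesis by (intro mult_left_mono) auto
      qed
      finally show ?thesis by simp
    qed
    have g0: "cmod (gammafac q par (s + of_real u)) > 0" using gammafac_nonzero[OF par_nonneg, of "s + of_real u" q] s u by simp
    have l0: "cmod (L (s + of_real u)) > 0" using L_nonzero[of "s + of_real u"] s u by simp
    have "cmod (xi (s - of_real u) / xi (s + of_real u)) =
       (cmod (gammafac q par (s - of_real u)) / cmod (gammafac q par (s + of_real u))) * cmod (L (s - of_real u)) * (1 / cmod (L (s + of_real u)))"
      by (simp add: xi_def norm_mult norm_divide)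
    also have "\<dots> \<le> exp (C4 * (1 + t)) * (4 * C1 * exp t) * (2 * exp (4 * C2 * (1 + t)))"
      using 1 2 3 g0 l0 C1 by (intro mult_mono) (auto simp: field_simps)
    also have "\<dots> = (4 * C1 * 2 * exp (4 * C2) * exp C4) * exp ((1 + 4 * C2 + C4) * t)"
      by (simp add: exp_add[symmetric] algebra_simps)
    also have "\<dots> \<le> C * exp (C * t)"
      using C1 C2 C4 t0 by (intro mult_mono) (auto simp: C_def mult_right_mono)
    finally show ?thesis by (simp add: t_def)
  qed
  then show ?thesis by blast
qed

text \<open>The conductor term \<open>ln (q / pi) / 2\<close> outweighs the worst case
  \<open>-1/2\<close> of the Digamma term and \<open>- logsum\<close> of the L-function; the
  hypothesis on \<open>q\<close> is exactly this balance.\<close>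

lemma xi_log_deriv_nonneg_right:
  assumes q: "ln (real q / pi) \<ge> 1 + 2 * logsum" and s: "Re s \<ge> 2"
  shows "Re (deriv xi s / xi s) \<ge> 0"
proof -
  have "Re (Digamma ((s + of_real par) / 2)) \<ge> -1" using s par_nonneg by (intro Re_Digamma_ge) simp
  moreover have "cmod (deriv L s / L s) \<le> logsum" using deriv_L_over_L[of s] norm_Dlog_le[of s] s by simp
  then have "Re (deriv L s / L s) \<ge> - logsum" using abs_Re_le_cmod[of "deriv L s / L s"] by linarith
  ultimately show ?thesis using xi_log_deriv[of s] s q by simp
qed

text \<open>Phragmen-Lindelof on \<open>1/2 \<le> Re s \<le> 3\<close>. On the left edge the two
  points are reflections of each other; on the right edge \<open>cmod (xi (s + x))\<close> is
  nondecreasing in \<open>x\<close>. The denominator has no zeros by the Riemann hypothesis.\<close>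

lemma xi_quotient_bound:
  assumes q: "ln (real q / pi) \<ge> 1 + 2 * logsum" and u: "0 < u" "u \<le> 1/4" and s: "1/2 \<le> Re s" "Re s \<le> 3"
  shows "cmod (xi (s - of_real u) / xi (s + of_real u)) \<le> 1"
proof -
  let ?f = "\<lambda>s. xi (s - of_real u) / xi (s + of_real u)"
  let ?S = "{s. Re s > 1/2 - u}"
  obtain C where C: "\<And>s. 1/2 \<le> Re s \<Longrightarrow> Re s \<le> 3 \<Longrightarrow> cmod (?f s) \<le> C * exp (C * \<bar>Im s\<bar>)"
    using xi_growth[OF u] by blast
  show ?thesis
  proof (rule phragmen_lindelof_strip[where f = ?f and S = ?S and C = C and a = "1/2" and b = 3])
    have "(\<lambda>s. xi (s - of_real u)) holomorphic_on ?S"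
      by (rule holomorphic_on_compose_gen[OF _ xi_holomorphic[OF order_refl], unfolded o_def]) (use u in \<open>auto intro!: holomorphic_intros\<close>)
    moreover have "(\<lambda>s. xi (s + of_real u)) holomorphic_on ?S"
      by (rule holomorphic_on_compose_gen[OF _ xi_holomorphic[OF order_refl], unfolded o_def]) (use u in \<open>auto intro!: holomorphic_intros\<close>)
    moreover have "xi (s + of_real u) \<noteq> 0" if "s \<in> ?S" for s using that by (intro xi_nonzero) simp
    ultimately show "?f holomorphic_on ?S" by (intro holomorphic_intros)
    show "open ?S" by (rule open_halfspace_Re_gt)
    show "{s. 1/2 \<le> Re s \<and> Re s \<le> 3} \<subseteq> ?S" using u by auto
    fix s assume s: "Re s = 1/2 \<or> Re s = 3"
    show "cmod (?f s) \<le> 1"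
    proof (cases "Re s = 1/2")
      case True
      have "1 - cnj (s - of_real u) = s + of_real u" using True by (simp add: complex_eq_iff)
      moreover have "cmod (xi (s - of_real u)) = cmod (xi (1 - cnj (s - of_real u)))"
        by (rule xi_reflect) (use True u in auto)
      ultimately have "cmod (xi (s - of_real u)) = cmod (xi (s + of_real u))" by (simp only:)
      then show ?thesis by (simp add: norm_divide)
    next
      case False
      then have s3: "Re s = 3" using s by simp
      let ?S = "{s. Re s > 1/2}"
      obtain E where E: "\<And>z. z \<in> ?S \<Longrightarrow> (E has_field_derivative deriv xi z / xi z) (at z)"
        "\<And>a b. a \<in> ?S \<Longrightarrow> b \<in> ?S \<Longrightarrow> xi a = xi b * exp (E a - E b)"
        using xi_log_primitive by blast
      have "Re (E (s + of_real (- u))) \<le> Re (E (s + of_real u))"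
      proof (rule DERIV_nonneg_imp_nondecreasing[where f = "\<lambda>x. Re (E (s + of_real x))"])
        fix x assume x: "- u \<le> x" "x \<le> u"
        have "((\<lambda>x. E (s + of_real x)) has_vector_derivative deriv xi (s + of_real x) / xi (s + of_real x)) (at x)"
        proof -
          have "((\<lambda>x. s + complex_of_real x) has_vector_derivative 1) (at x)" by (auto intro!: derivative_eq_intros)
          moreover have "(E has_field_derivative deriv xi (s + of_real x) / xi (s + of_real x)) (at (s + of_real x))"
            using x u s3 by (intro E) simp
          ultimately show ?thesis using field_vector_diff_chain_at[of "\<lambda>x. s + complex_of_real x" 1 x E] by (simp add: o_def)
        qed
        then have "((\<lambda>x. Re (E (s + of_real x))) has_real_derivative Re (deriv xi (s + of_real x) / xi (s + of_real x))) (at x)"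
          unfolding has_real_derivative_iff_has_vector_derivative using bounded_linear.has_vector_derivative[OF bounded_linear_Re] by blast
        moreover have "Re (deriv xi (s + of_real x) / xi (s + of_real x)) \<ge> 0"
          using x u s3 by (intro xi_log_deriv_nonneg_right[OF q]) simp
        ultimately show "\<exists>y. ((\<lambda>x. Re (E (s + of_real x))) has_real_derivative y) (at x) \<and> y \<ge> 0" by blast
      qed (use u in simp)
      then have "Re (E (s - of_real u) - E (s + of_real u)) \<le> 0" by simp
      moreover have "xi (s - of_real u) = xi (s + of_real u) * exp (E (s - of_real u) - E (s + of_real u))"
        using s3 u by (intro E) auto
      moreover have "xi (s + of_real u) \<noteq> 0" using s3 u by (intro xi_nonzero) simp
      ultimately show ?thesis by (simp add: norm_mult norm_divide norm_exp_eq_Re)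
    qed
  qed (use C s in auto)
qed

text \<open>The derivative at \<open>x = 0\<close> of
  \<open>ln (cmod (xi (s + x))) - ln (cmod (xi (s - x)))\<close> is twice the real part in question.
  If it were negative, the quotient bound would fail for small positive \<open>x\<close>.\<close>

theorem xi_log_deriv_nonneg:
  assumes q: "ln (real q / pi) \<ge> 1 + 2 * logsum" and s: "1/2 < Re s" "Re s \<le> 3"
  shows "Re (deriv xi s / xi s) \<ge> 0"
proof (rule ccontr)
  assume neg: "\<not> ?thesis"
  let ?S = "{s. Re s > 1/2}"
  obtain E where E: "\<And>z. z \<in> ?S \<Longrightarrow> (E has_field_derivative deriv xi z / xi z) (at z)"
    "\<And>a b. a \<in> ?S \<Longrightarrow> b \<in> ?S \<Longrightarrow> xi a = xi b * exp (E a - E b)"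
    using xi_log_primitive by blast
  define g where "g x = Re (E (s + of_real x)) - Re (E (s - of_real x))" for x :: real
  have Es: "(E has_field_derivative deriv xi s / xi s) (at s)" using s by (intro E) simp
  have d1: "((\<lambda>x. Re (E (s + of_real x))) has_real_derivative Re (deriv xi s / xi s)) (at 0)"
  proof -
    have "((\<lambda>x. s + complex_of_real x) has_vector_derivative 1) (at 0)" by (auto intro!: derivative_eq_intros)
    then have "((\<lambda>x. E (s + of_real x)) has_vector_derivative deriv xi s / xi s) (at 0)"
      using field_vector_diff_chain_at[of "\<lambda>x. s + complex_of_real x" 1 0 E] Es by (simp add: o_def)
    then show ?thesis
      unfolding has_real_derivative_iff_has_vector_derivative using bounded_linear.has_vector_derivative[OF bounded_linear_Re] by blast
  qed
  have d2: "((\<lambda>x. Re (E (s - of_real x))) has_real_derivative - Re (deriv xi s / xi s)) (at 0)"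
  proof -
    have "((\<lambda>x. s - complex_of_real x) has_vector_derivative -1) (at 0)" by (auto intro!: derivative_eq_intros)
    then have "((\<lambda>x. E (s - of_real x)) has_vector_derivative - (deriv xi s / xi s)) (at 0)"
      using field_vector_diff_chain_at[of "\<lambda>x. s - complex_of_real x" "-1" 0 E] Es by (simp add: o_def)
    then have "((\<lambda>x. Re (E (s - of_real x))) has_vector_derivative Re (- (deriv xi s / xi s))) (at 0)"
      using bounded_linear.has_vector_derivative[OF bounded_linear_Re] by blast
    then show ?thesis unfolding has_real_derivative_iff_has_vector_derivative by simp
  qed
  have "(g has_real_derivative (Re (deriv xi s / xi s) - - Re (deriv xi s / xi s))) (at 0)"
    unfolding g_def by (rule DERIV_diff[OF d1 d2])
  moreover have "Re (deriv xi s / xi s) - - Re (deriv xi s / xi s) < 0" using neg by simp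
  ultimately obtain d where d: "d > 0" "\<And>x. 0 < x \<Longrightarrow> x < d \<Longrightarrow> g (0 + x) < g 0"
    using DERIV_neg_dec_right by blast
  \<comment> \<open>Small enough for the local decrease, for \<open>u \<le> 1/4\<close> in the
    quotient bound, and for \<open>s - x\<close> to stay right of the critical line.\<close>
  define x where "x = min (d/2) (min (1/4) ((Re s - 1/2) / 2))"
  have x: "0 < x" "x < d" "x \<le> 1/4" "x < Re s - 1/2" using d s by (auto simp: x_def min_def)
  have "Re (E (s + of_real x)) < Re (E (s - of_real x))" using d(2)[of x] x by (simp add: g_def)
  moreover have "xi (s - of_real x) = xi (s + of_real x) * exp (E (s - of_real x) - E (s + of_real x))"
    using x s by (intro E) auto
  moreover have "xi (s + of_real x) \<noteq> 0" using x s by (intro xi_nonzero) simp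
  ultimately have "cmod (xi (s - of_real x) / xi (s + of_real x)) > 1"
    by (simp add: norm_mult norm_divide norm_exp_eq_Re)
  then show False using xi_quotient_bound[OF q x(1,3), of s] s by simp
qed

end

section \<open>The test function and its Fourier transform\<close>

text \<open>The exponent -3/2 is square-root growth of logarithmic derivatives times inverse-square
  decay of the test function, and it is still integrable.\<close>

definition decay :: "real \<Rightarrow> real" where "decay y = (1 + \<bar>y\<bar>) powr (-(3/2))"

lemma decay_nonneg: "decay y \<ge> 0" and decay_pos: "decay y > 0"
  by (auto simp: decay_def)

lemma decay_measurable [measurable]: "decay \<in> borel_measurable borel"
  unfolding decay_def by measurable

lemma integrable_decay: "integrable lborel decay"
proof -
  have "(\<integral>\<^sup>+x. ennreal ((1 + x) powr (-(3/2))) * indicator {0..} x \<partial>lborel) = ennreal (0 - (-2 * (1 + 0) powr (-(1/2))))"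
  proof (rule nn_integral_FTC_atLeast)
    show "((\<lambda>x. -2 * (1 + x) powr (-(1/2))) has_real_derivative (1 + x) powr (-(3/2))) (at x)" if "0 \<le> x" for x :: real
      using that by (auto intro!: derivative_eq_intros simp: powr_diff[symmetric])
    show "((\<lambda>x::real. -2 * (1 + x) powr (-(1/2))) \<longlongrightarrow> 0) at_top" by real_asymp
  qed auto
  then have nn: "(\<integral>\<^sup>+x. ennreal (indicator {0..} x * (1 + x) powr (-(3/2))) \<partial>lborel) = ennreal 2"
    by (simp add: ennreal_mult'' ennreal_indicator mult.commute)
  have 1: "integrable lborel (\<lambda>x::real. indicator {0..} x * (1 + x) powr (-(3/2)))"
    by (rule integrableI_nonneg) (use nn in \<open>auto simp: indicator_def\<close>)
  have 2: "integrable lborel (\<lambda>x::real. indicator {0..} (0 + (-1) * x) * (1 + (0 + (-1) * x)) powr (-(3/2)))"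
    by (rule lborel_integrable_real_affine[OF 1]) simp
  show ?thesis
  proof (rule Bochner_Integration.integrable_bound[OF Bochner_Integration.integrable_add[OF 1 2]])
    show "AE x in lborel. norm (decay x) \<le> norm (indicator {0..} x * (1 + x) powr (-(3/2)) + indicator {0..} (0 + (-1) * x) * (1 + (0 + (-1) * x)) powr (-(3/2)) :: real)"
      by (rule AE_I2) (auto simp: decay_def indicator_def abs_if)
  qed simp
qed

lemma decay_tendsto: "(\<lambda>n. decay (real n)) \<longlonglongrightarrow> 0" "(\<lambda>n. decay (- real n)) \<longlonglongrightarrow> 0"
  unfolding decay_def by real_asymp+

lemma inverse_square_le_decay: "inverse ((1 + \<bar>x\<bar>)\<^sup>2) \<le> decay x"
proof -
  have "inverse ((1 + \<bar>x\<bar>)\<^sup>2) = (1 + \<bar>x\<bar>) powr (-2)" by (simp add: powr_minus powr_numeral)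
  also have "\<dots> \<le> decay x" unfolding decay_def by (intro powr_mono) auto
  finally show ?thesis .
qed

lemma sqrt_times_inverse_square: "sqrt (1 + \<bar>x\<bar>) * inverse ((1 + \<bar>x\<bar>)\<^sup>2) = decay x"
proof -
  have "sqrt (1 + \<bar>x\<bar>) * inverse ((1 + \<bar>x\<bar>)\<^sup>2) = (1 + \<bar>x\<bar>) powr (1/2) * (1 + \<bar>x\<bar>) powr (-2)"
    by (simp add: powr_half_sqrt powr_minus powr_numeral)
  also have "\<dots> = decay x" unfolding decay_def powr_add[symmetric] by simp
  finally show ?thesis .
qed

text \<open>Cauchy's theorem by a primitive \<open>G\<close> on the convex domain: truncated
  vertical integrals are differences of values of \<open>G\<close>, and two lines differ by the
  increments of \<open>G\<close> along the horizontal sides, which tend to 0 by the decay.\<close>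

lemma vertical_line_shift:
  fixes f :: "complex \<Rightarrow> complex"
  assumes S: "open S" "convex S" and f: "f holomorphic_on S" and ab: "a \<le> b"
    and sub: "\<And>s. a \<le> Re s \<Longrightarrow> Re s \<le> b \<Longrightarrow> s \<in> S"
    and bound: "\<And>s. a \<le> Re s \<Longrightarrow> Re s \<le> b \<Longrightarrow> cmod (f s) \<le> C * decay (Im s)"
  shows "(\<integral>y. f (of_real a + \<i> * of_real y) \<partial>lborel) = (\<integral>y. f (of_real b + \<i> * of_real y) \<partial>lborel)"
    and "\<And>c. a \<le> c \<Longrightarrow> c \<le> b \<Longrightarrow> integrable lborel (\<lambda>y. f (of_real c + \<i> * of_real y))"
proof -
  have C0: "C \<ge> 0"
    using order_trans[OF norm_ge_zero bound[of "of_real a"]] ab decay_pos[of 0] by (simp add: zero_le_mult_iff)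
  obtain G where G0: "\<And>x. x \<in> S \<Longrightarrow> (G has_field_derivative f x) (at x within S)"
    using holomorphic_convex_primitive'[OF S(2,1) f] by blast
  have G: "(G has_field_derivative f x) (at x)" if "x \<in> S" for x
    using G0[OF that] at_within_open[OF that S(1)] by metis
  have cont: "continuous_on UNIV (\<lambda>y. f (of_real c + \<i> * of_real y))" if "a \<le> c" "c \<le> b" for c
    by (rule continuous_on_compose2[OF holomorphic_on_imp_continuous_on[OF f]]) (use sub that in \<open>auto intro!: continuous_intros\<close>)
  have meas: "(\<lambda>y. f (of_real c + \<i> * of_real y)) \<in> borel_measurable borel" if "a \<le> c" "c \<le> b" for c
    using borel_measurable_continuous_onI[OF cont[OF that]] by simp
  have nb: "cmod (f (of_real c + \<i> * of_real y)) \<le> C * decay y" if "a \<le> c" "c \<le> b" for c y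
    using bound[of "of_real c + \<i> * of_real y"] that by simp
  have intD: "integrable lborel (\<lambda>y. C * decay y)" using integrable_decay by simp
  show int: "integrable lborel (\<lambda>y. f (of_real c + \<i> * of_real y))" if "a \<le> c" "c \<le> b" for c
    by (rule Bochner_Integration.integrable_bound[OF intD]) (use meas[OF that] nb[OF that] C0 decay_nonneg in \<open>auto intro!: AE_I2\<close>)
  define H where "H c n = (G (of_real c + \<i> * of_real (real n)) - G (of_real c + \<i> * of_real (- real n))) / \<i>" for c n
  have lim: "(\<lambda>n. H c n) \<longlonglongrightarrow> (\<integral>y. f (of_real c + \<i> * of_real y) \<partial>lborel)" if c: "a \<le> c" "c \<le> b" for c
  proof -
    have "(\<lambda>n. \<integral>y. indicator {- real n..real n} y *\<^sub>R f (of_real c + \<i> * of_real y) \<partial>lborel) \<longlonglongrightarrow> (\<integral>y. f (of_real c + \<i> * of_real y) \<partial>lborel)"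
    proof (rule integral_dominated_convergence[where w = "\<lambda>y. C * decay y"])
      show "AE y in lborel. (\<lambda>n. indicator {- real n..real n} y *\<^sub>R f (of_real c + \<i> * of_real y)) \<longlonglongrightarrow> f (of_real c + \<i> * of_real y)"
      proof (rule AE_I2)
        fix y :: real
        obtain N :: nat where N: "real N \<ge> \<bar>y\<bar>" using real_arch_simple by blast
        have "\<forall>\<^sub>F n in sequentially. f (of_real c + \<i> * of_real y) = indicator {- real n..real n} y *\<^sub>R f (of_real c + \<i> * of_real y)"
          using eventually_ge_at_top[of N]
        proof eventually_elim
          case (elim n)
          then have "real n \<ge> \<bar>y\<bar>" using N by (meson of_nat_le_iff order_trans)
          then have "y \<in> {- real n..real n}" by auto
          then show ?case by simp
        qed
        then show "(\<lambda>n. indicator {- real n..real n} y *\<^sub>R f (of_real c + \<i> * of_real y)) \<longlonglongrightarrow> f (of_real c + \<i> * of_real y)"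
          by (rule Lim_transform_eventually[OF tendsto_const])
      qed
      show "AE y in lborel. norm (indicator {- real n..real n} y *\<^sub>R f (of_real c + \<i> * of_real y)) \<le> C * decay y" for n
        using nb[OF c] C0 decay_nonneg by (intro AE_I2) (auto simp: indicator_def)
    qed (use meas[OF c] intD in auto)
    moreover have "(\<integral>y. indicator {- real n..real n} y *\<^sub>R f (of_real c + \<i> * of_real y) \<partial>lborel) = H c n" for n
    proof -
      have "((\<lambda>y. f (of_real c + \<i> * of_real y)) has_integral (G (of_real c + \<i> * of_real (real n)) / \<i> - G (of_real c + \<i> * of_real (- real n)) / \<i>)) {- real n..real n}"
      proof (rule fundamental_theorem_of_calculus)
        fix y assume "y \<in> {- real n..real n}"
        have "((\<lambda>y. of_real c + \<i> * complex_of_real y) has_vector_derivative \<i>) (at y)"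
          by (auto intro!: derivative_eq_intros)
        moreover have "(G has_field_derivative f (of_real c + \<i> * of_real y)) (at (of_real c + \<i> * of_real y))"
          using c by (intro G sub) auto
        ultimately have "((\<lambda>y. G (of_real c + \<i> * of_real y)) has_vector_derivative \<i> * f (of_real c + \<i> * of_real y)) (at y)"
          using field_vector_diff_chain_at[of "\<lambda>y. of_real c + \<i> * complex_of_real y" \<i> y G] by (simp add: o_def)
        then have "((\<lambda>y. G (of_real c + \<i> * of_real y) / \<i>) has_vector_derivative (\<i> * f (of_real c + \<i> * of_real y)) / \<i>) (at y)"
          by (rule has_vector_derivative_divide)
        then show "((\<lambda>y. G (of_real c + \<i> * of_real y) / \<i>) has_vector_derivative f (of_real c + \<i> * of_real y)) (at y within {- real n..real n})"
          by (simp add: has_vector_derivative_at_within)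
      qed simp
      moreover have "set_integrable lborel {- real n..real n} (\<lambda>y. f (of_real c + \<i> * of_real y))"
        using cont[OF c] by (intro borel_integrable_atLeastAtMost') (auto intro: continuous_on_subset)
      ultimately show ?thesis
        using set_borel_integral_eq_integral(2)[of "{- real n..real n}" "\<lambda>y. f (of_real c + \<i> * of_real y)"]
        by (simp add: set_lebesgue_integral_def H_def diff_divide_distrib integral_unique algebra_simps)
    qed
    ultimately show ?thesis by simp
  qed
  have hor: "cmod (G (of_real b + \<i> * of_real y) - G (of_real a + \<i> * of_real y)) \<le> C * decay y * (b - a)" for y
  proof -
    let ?A = "of_real a + \<i> * of_real y :: complex" and ?B = "of_real b + \<i> * of_real y :: complex"
    have seg: "a \<le> Re w \<and> Re w \<le> b \<and> Im w = y" if "w \<in> closed_segment ?A ?B" for w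
    proof -
      obtain u where u: "0 \<le> u" "u \<le> 1" "w = (1 - u) *\<^sub>R ?A + u *\<^sub>R ?B" using \<open>w \<in> _\<close> by (auto simp: closed_segment_def)
      have R: "Re w = (1 - u) * a + u * b" and I: "Im w = (1 - u) * y + u * y" using u(3) by auto
      have "u * a \<le> u * b" "(1 - u) * a \<le> (1 - u) * b" using u ab by (auto intro!: mult_left_mono)
      then have "a \<le> Re w" "Re w \<le> b" unfolding R by (auto simp: algebra_simps)
      moreover have "Im w = y" unfolding I by (simp add: algebra_simps)
      ultimately show ?thesis by simp
    qed
    have "cmod (G ?B - G ?A) \<le> C * decay y * cmod (?B - ?A)"
    proof (rule field_differentiable_bound[of "closed_segment ?A ?B" G f])
      fix w assume w: "w \<in> closed_segment ?A ?B"
      show "(G has_field_derivative f w) (at w within closed_segment ?A ?B)"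
        using G[of w] sub seg[OF w] has_field_derivative_at_within by blast
      show "cmod (f w) \<le> C * decay y" using bound[of w] seg[OF w] by auto
    qed auto
    moreover have "?B - ?A = of_real (b - a)" by simp
    ultimately show ?thesis using ab by (simp only: norm_of_real abs_of_nonneg diff_ge_0_iff_ge)
  qed
  have "(\<lambda>n. H b n - H a n) \<longlonglongrightarrow> 0"
  proof (rule Lim_null_comparison)
    show "\<forall>\<^sub>F n in sequentially. cmod (H b n - H a n) \<le> C * decay (real n) * (b - a) + C * decay (- real n) * (b - a)"
    proof (rule always_eventually, rule allI)
      fix n
      let ?g = "\<lambda>y. G (of_real b + \<i> * of_real y) - G (of_real a + \<i> * of_real y)"
      have "H b n - H a n = (?g (real n) - ?g (- real n)) / \<i>" unfolding H_def diff_divide_distrib[symmetric] by (simp add: algebra_simps)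
      then have "cmod (H b n - H a n) = cmod (?g (real n) - ?g (- real n))" by (simp only: norm_divide norm_ii div_by_1)
      also have "\<dots> \<le> cmod (?g (real n)) + cmod (?g (- real n))" by (rule norm_triangle_ineq4)
      also have "\<dots> \<le> C * decay (real n) * (b - a) + C * decay (- real n) * (b - a)" by (intro add_mono hor)
      finally show "cmod (H b n - H a n) \<le> C * decay (real n) * (b - a) + C * decay (- real n) * (b - a)" .
    qed
    have "(\<lambda>n. C * decay (real n) * (b - a) + C * decay (- real n) * (b - a)) \<longlonglongrightarrow> C * 0 * (b - a) + C * 0 * (b - a)"
      by (intro tendsto_intros decay_tendsto)
    then show "(\<lambda>n. C * decay (real n) * (b - a) + C * decay (- real n) * (b - a)) \<longlonglongrightarrow> 0" by simp
  qed
  moreover have "(\<lambda>n. H b n - H a n) \<longlonglongrightarrow> (\<integral>y. f (of_real b + \<i> * of_real y) \<partial>lborel) - (\<integral>y. f (of_real a + \<i> * of_real y) \<partial>lborel)"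
    using ab by (intro tendsto_diff lim) auto
  ultimately have "(\<integral>y. f (of_real b + \<i> * of_real y) \<partial>lborel) - (\<integral>y. f (of_real a + \<i> * of_real y) \<partial>lborel) = 0"
    using LIMSEQ_unique by blast
  then show "(\<integral>y. f (of_real a + \<i> * of_real y) \<partial>lborel) = (\<integral>y. f (of_real b + \<i> * of_real y) \<partial>lborel)" by simp
qed

section \<open>The sinc function and the entire function \<open>Phi\<close>\<close>

definition snc :: "complex \<Rightarrow> complex" where "snc z = (if z = 0 then 1 else sin z / z)"

lemma snc_holomorphic: "snc holomorphic_on A"
proof -
  have "((\<lambda>z. sin z / z) \<longlongrightarrow> 1) (at (0::complex))"
    using DERIV_sin[of "0::complex"] unfolding has_field_derivative_iff by simp
  then have "(snc \<longlongrightarrow> 1) (at 0)"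
    by (rule Lim_transform_eventually) (auto simp: eventually_at_filter snc_def)
  then have lim0: "(snc \<longlongrightarrow> snc 0) (at 0)" by (simp add: snc_def)
  have hol: "snc holomorphic_on - {0}"
  proof (rule holomorphic_transform[of "\<lambda>z. sin z / z"])
    show "(\<lambda>z. sin z / z) holomorphic_on - {0}" by (intro holomorphic_intros) auto
  qed (auto simp: snc_def)
  have "continuous_on UNIV snc"
  proof (subst continuous_on_eq_continuous_at)
    show "\<forall>z\<in>UNIV. isCont snc z"
    proof
      fix z show "isCont snc z"
      proof (cases "z = 0")
        case True then show ?thesis using lim0 by (simp add: isCont_def)
      next
        case False
        then show ?thesis using holomorphic_on_imp_continuous_on[OF hol] by (simp add: continuous_on_eq_continuous_at open_Compl)
      qed
    qed
  qed simp
  then have "snc holomorphic_on UNIV"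
    by (rule no_isolated_singularity[where K = "{0}"]) (use hol in \<open>auto simp: Compl_eq_Diff_UNIV\<close>)
  then show ?thesis using holomorphic_on_subset by blast
qed

lemma norm_sin_cos_le: "cmod (sin z) \<le> exp \<bar>Im z\<bar>" "cmod (cos z) \<le> exp \<bar>Im z\<bar>"
proof -
  have e: "cmod (exp (\<i> * z)) \<le> exp \<bar>Im z\<bar>" "cmod (exp (- (\<i> * z))) \<le> exp \<bar>Im z\<bar>" by (auto simp: norm_exp_eq_Re)
  have "cmod (exp (\<i> * z) - exp (- (\<i> * z))) \<le> 2 * exp \<bar>Im z\<bar>"
    using norm_triangle_ineq4[of "exp (\<i> * z)" "exp (- (\<i> * z))"] e by linarith
  then show "cmod (sin z) \<le> exp \<bar>Im z\<bar>" unfolding sin_exp_eq by (simp add: norm_divide norm_mult)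
  have "cmod (exp (\<i> * z) + exp (- (\<i> * z))) \<le> 2 * exp \<bar>Im z\<bar>"
    using norm_triangle_ineq[of "exp (\<i> * z)" "exp (- (\<i> * z))"] e by linarith
  then show "cmod (cos z) \<le> exp \<bar>Im z\<bar>" unfolding cos_exp_eq by (simp add: norm_divide norm_mult)
qed

text \<open>The sum of two bounds for the sine, one by \<open>exp \<bar>Im z\<bar>\<close> and one
  by the same times \<open>cmod z\<close>; together they give the factor
  \<open>1 / (1 + cmod z)\<close> uniformly across 0.\<close>

lemma norm_snc_le: "cmod (snc z) \<le> 2 * exp \<bar>Im z\<bar> / (1 + cmod z)"
proof (cases "z = 0")
  case False
  have "cmod (sin z - sin 0) \<le> exp \<bar>Im z\<bar> * cmod (z - 0)"
  proof (rule field_differentiable_bound[of "closed_segment 0 z" sin cos])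
    fix w assume "w \<in> closed_segment 0 z"
    then obtain u where u: "0 \<le> u" "u \<le> 1" "w = u *\<^sub>R z" by (auto simp: closed_segment_def)
    have "\<bar>Im w\<bar> = u * \<bar>Im z\<bar>" using u by (simp add: abs_mult)
    also have "\<dots> \<le> 1 * \<bar>Im z\<bar>" using u by (intro mult_right_mono) auto
    finally show "cmod (cos w) \<le> exp \<bar>Im z\<bar>" using norm_sin_cos_le(2)[of w] by (smt (verit) exp_le_cancel_iff mult_1)
  qed (auto intro: DERIV_sin has_field_derivative_at_within)
  then have 1: "cmod (sin z) \<le> exp \<bar>Im z\<bar> * cmod z" by simp
  have "cmod (sin z) * (1 + cmod z) = cmod (sin z) + cmod (sin z) * cmod z" by (simp add: distrib_left)
  also have "\<dots> \<le> exp \<bar>Im z\<bar> * cmod z + exp \<bar>Im z\<bar> * cmod z"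
    by (intro add_mono 1 mult_right_mono norm_sin_cos_le) auto
  finally have "cmod (sin z) * (1 + cmod z) \<le> 2 * exp \<bar>Im z\<bar> * cmod z" by (simp add: mult_ac)
  moreover have a: "1 + cmod z > 0" by (auto intro: add_pos_nonneg)
  ultimately have "cmod (sin z) \<le> 2 * exp \<bar>Im z\<bar> * cmod z / (1 + cmod z)" using pos_le_divide_eq[OF a] by blast
  then have "cmod (sin z) / cmod z \<le> 2 * exp \<bar>Im z\<bar> / (1 + cmod z)" using False by (simp add: pos_divide_le_eq)
  then show ?thesis using False by (simp add: snc_def norm_divide)
qed (simp add: snc_def)

locale test_function =
  fixes p \<sigma> :: real
  assumes p_pos: "p > 0" and \<sigma>: "\<sigma> = 1 \<or> \<sigma> = -1"
begin

definition Phi :: "complex \<Rightarrow> complex" where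
  "Phi z = 2 * (snc (z - of_real p) + of_real \<sigma> * snc (z + of_real p))\<^sup>2"

text \<open>The inverse Fourier transform of \<open>phi\<close> in the normalisation without
  \<open>2 * pi\<close>. The triangle times the cosine comes from the two squared sinc functions at
  \<open>\<plusminus> p\<close>, the sine term from their cross product.\<close>

definition W :: "real \<Rightarrow> real" where
  "W v = (if \<bar>v\<bar> < 2 then (2 - \<bar>v\<bar>) * cos (p * v) + \<sigma> * sin (p * (2 - \<bar>v\<bar>)) / p else 0)"

lemma Phi_holomorphic: "Phi holomorphic_on A"
proof -
  have "(\<lambda>z. snc (z - of_real p)) holomorphic_on A" "(\<lambda>z. snc (z + of_real p)) holomorphic_on A"
    by (rule holomorphic_on_compose_gen[OF _ snc_holomorphic[of UNIV], unfolded o_def]; auto intro!: holomorphic_intros)+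
  then show ?thesis unfolding Phi_def by (intro holomorphic_intros)
qed

lemma norm_Phi_le:
  assumes "\<bar>Im z\<bar> \<le> Y"
  shows "cmod (Phi z) \<le> 32 * exp (2 * Y) * (1 + p)\<^sup>2 / (1 + cmod z)\<^sup>2"
proof -
  define K where "K = 2 * exp Y * (1 + p) / (1 + cmod z)"
  have K0: "K \<ge> 0" using p_pos by (simp add: K_def)
  have s: "cmod (snc (z + of_real c)) \<le> K" if c: "\<bar>c\<bar> = p" for c
  proof -
    have "cmod (snc (z + of_real c)) \<le> 2 * exp \<bar>Im z\<bar> / (1 + cmod (z + of_real c))"
      using norm_snc_le[of "z + of_real c"] by simp
    also have "\<dots> \<le> 2 * exp Y / ((1 + cmod z) / (1 + p))"
    proof (rule frac_le)
      have "cmod z \<le> cmod (z + of_real c) + p" using norm_triangle_ineq4[of "z + of_real c" "of_real c"] c by simp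
      then have "1 + cmod z \<le> (1 + p) * (1 + cmod (z + of_real c))"
      proof -
        have "p * cmod (z + of_real c) \<ge> 0" using p_pos by simp
        then have "1 + cmod z \<le> 1 + p + cmod (z + of_real c) + p * cmod (z + of_real c)"
          using \<open>cmod z \<le> _\<close> by linarith
        then show ?thesis by (simp add: algebra_simps)
      qed
      then show "(1 + cmod z) / (1 + p) \<le> 1 + cmod (z + of_real c)" using p_pos by (simp add: pos_divide_le_eq mult.commute)
      show "0 < (1 + cmod z) / (1 + p)" using p_pos by (simp add: add_pos_nonneg)
    qed (use assms in auto)
    also have "\<dots> = K" by (simp add: K_def)
    finally show ?thesis .
  qed
  have "cmod (snc (z - of_real p) + of_real \<sigma> * snc (z + of_real p)) \<le> cmod (snc (z + of_real (- p))) + cmod (of_real \<sigma> * snc (z + of_real p))"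
    using norm_triangle_ineq[of "snc (z - of_real p)" "of_real \<sigma> * snc (z + of_real p)"] by simp
  also have "\<dots> \<le> K + K" using s[of "-p"] s[of p] p_pos \<sigma> by (intro add_mono) (auto simp: norm_mult)
  finally have "cmod (Phi z) \<le> 2 * (2 * K)\<^sup>2"
    unfolding Phi_def norm_mult norm_power by (intro mult_mono power_mono) auto
  also have "\<dots> = 32 * exp (2 * Y) * (1 + p)\<^sup>2 / (1 + cmod z)\<^sup>2"
  proof -
    have "exp (2 * Y) = (exp Y)\<^sup>2" by (simp add: exp_double)
    then show ?thesis by (simp add: K_def power_mult_distrib power_divide)
  qed
  finally show ?thesis .
qed

definition phi :: "real \<Rightarrow> real" where "phi x = Re (Phi (of_real x))"

lemma Phi_of_real: "Phi (of_real x) = of_real (phi x)" and phi_nonneg: "phi x \<ge> 0"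
proof -
  have r: "snc (of_real y) \<in> \<real>" for y
    by (cases "y = 0") (auto simp: snc_def sin_of_real)
  obtain u v where uv: "snc (of_real (x - p)) = of_real u" "snc (of_real (x + p)) = of_real v"
    using r by (meson Reals_cases)
  have "Phi (of_real x) = of_real (2 * (u + \<sigma> * v)\<^sup>2)"
    unfolding Phi_def using uv by simp
  then show "Phi (of_real x) = of_real (phi x)" "phi x \<ge> 0" unfolding phi_def by simp_all
qed

definition bb :: real where "bb = sin (2 * p) / (2 * p)"

text \<open>The values at the two points agree because \<open>\<sigma>\<^sup>2 = 1\<close>; both
  signs of the height therefore carry the same weight.\<close>

lemma phi_at_p: "phi p = 2 * (1 + \<sigma> * bb)\<^sup>2" "phi (- p) = 2 * (1 + \<sigma> * bb)\<^sup>2"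
proof -
  have s: "snc (of_real (2 * p)) = of_real bb" "snc (of_real (- (2 * p))) = of_real bb"
    using p_pos by (auto simp: snc_def bb_def sin_of_real[symmetric])
  have s0: "snc 0 = 1" by (simp add: snc_def)
  have 1: "Phi (of_real p) = of_real (2 * (1 + \<sigma> * bb)\<^sup>2)"
    unfolding Phi_def using s(1) s0 by simp
  have sg: "\<sigma>\<^sup>2 = 1" using \<sigma> by auto
  have "Phi (of_real (- p)) = of_real (2 * (bb + \<sigma>)\<^sup>2)"
    unfolding Phi_def using s(2) s0 by simp
  also have "(bb + \<sigma>)\<^sup>2 = (1 + \<sigma> * bb)\<^sup>2" using \<sigma> by (auto simp: power2_eq_square algebra_simps)
  finally show "phi p = 2 * (1 + \<sigma> * bb)\<^sup>2" "phi (- p) = 2 * (1 + \<sigma> * bb)\<^sup>2"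
    using 1 by (simp_all add: phi_def)
qed

lemma continuous_phi: "continuous_on A phi"
proof -
  have "continuous_on A (\<lambda>x. Phi (of_real x))"
    by (rule continuous_on_compose2[OF holomorphic_on_imp_continuous_on[OF Phi_holomorphic[of UNIV]]]) (auto intro!: continuous_intros)
  then show ?thesis unfolding phi_def by (intro continuous_intros)
qed

lemma phi_measurable [measurable]: "phi \<in> borel_measurable borel"
  by (rule borel_measurable_continuous_onI[OF continuous_phi])

lemma phi_le: "phi x \<le> 32 * (1 + p)\<^sup>2 / (1 + \<bar>x\<bar>)\<^sup>2"
proof -
  have "phi x = cmod (Phi (of_real x))" unfolding Phi_of_real using phi_nonneg[of x] by simp
  then show ?thesis using norm_Phi_le[of "of_real x" 0] by simp
qed

lemma W_nonneg_formula: "0 \<le> v \<Longrightarrow> v \<le> 2 \<Longrightarrow> W v = (2 - v) * cos (p * v) + \<sigma> * sin (p * (2 - v)) / p"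
  by (auto simp: W_def)

lemma W_even: "W (- v) = W v" by (simp add: W_def)

lemma W_0: "W 0 = 2 * (1 + \<sigma> * bb)"
  using p_pos by (simp add: W_def bb_def mult.commute field_simps)

text \<open>Each of the two summands is at most \<open>2 - \<bar>v\<bar>\<close>, the sine term by
  \<open>\<bar>sin y\<bar> \<le> \<bar>y\<bar>\<close>. The linear vanishing at the ends of the
  support is what saves a logarithm in the prime sums.\<close>

lemma abs_W_le: "\<bar>W v\<bar> \<le> 2 * max 0 (2 - \<bar>v\<bar>)"
proof (cases "\<bar>v\<bar> < 2")
  case True
  have gen: "\<bar>a\<bar> \<le> c \<Longrightarrow> \<bar>b\<bar> \<le> c \<Longrightarrow> \<bar>a + b\<bar> \<le> 2 * c" for a b c :: real by linarith
  have "\<bar>(2 - \<bar>v\<bar>) * cos (p * v)\<bar> \<le> (2 - \<bar>v\<bar>) * 1" unfolding abs_mult using True by (intro mult_mono) auto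
  moreover have "\<bar>\<sigma> * sin (p * (2 - \<bar>v\<bar>)) / p\<bar> \<le> 2 - \<bar>v\<bar>"
  proof -
    have "\<bar>sin (p * (2 - \<bar>v\<bar>))\<bar> \<le> \<bar>p * (2 - \<bar>v\<bar>)\<bar>" by (rule abs_sin_x_le_abs_x)
    also have "\<dots> = p * (2 - \<bar>v\<bar>)" using p_pos True by simp
    finally have "\<bar>sin (p * (2 - \<bar>v\<bar>))\<bar> / p \<le> 2 - \<bar>v\<bar>" using p_pos by (simp add: pos_divide_le_eq mult.commute)
    then show ?thesis using p_pos \<sigma> by (auto simp: abs_mult)
  qed
  ultimately have "\<bar>(2 - \<bar>v\<bar>) * cos (p * v) + \<sigma> * sin (p * (2 - \<bar>v\<bar>)) / p\<bar> \<le> 2 * (2 - \<bar>v\<bar>)"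
    unfolding mult_1_right by (rule gen)
  then show ?thesis using True by (simp add: W_def)
qed (simp add: W_def)

lemma continuous_W: "continuous_on UNIV W"
proof -
  have "W = (\<lambda>v. (2 - min 2 \<bar>v\<bar>) * cos (p * v) + \<sigma> * sin (p * (2 - min 2 \<bar>v\<bar>)) / p)"
    by (auto simp: W_def fun_eq_iff min_def)
  moreover have "continuous_on UNIV (\<lambda>v. (2 - min 2 \<bar>v\<bar>) * cos (p * v) + \<sigma> * sin (p * (2 - min 2 \<bar>v\<bar>)) / p)"
    by (intro continuous_intros) (use p_pos in auto)
  ultimately show ?thesis by simp
qed

lemma W_measurable [measurable]: "W \<in> borel_measurable borel"
  by (rule borel_measurable_continuous_onI[OF continuous_W])

text \<open>Explicit antiderivatives show that the pieces of \<open>W\<close> transform to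
  \<open>2 A\<^sup>2\<close>, \<open>2 B\<^sup>2\<close> and \<open>4 \<sigma> A B\<close>, which
  complete the square \<open>2 (A + \<sigma> B)\<^sup>2\<close>. The antiderivatives divide by
  \<open>x - p\<close> and \<open>x + p\<close>, so two points are excluded; they form a null
  set.\<close>

lemma W_integral_cos:
  assumes x: "x \<noteq> p" "x \<noteq> - p"
  shows "((\<lambda>v. 2 * W v * cos (x * v)) has_integral phi x) {0..2}"
proof -
  have i1: "((\<lambda>v. (2 - v) * cos (\<alpha> * v)) has_integral ((1 - cos (2 * \<alpha>)) / \<alpha>\<^sup>2)) {0..2}" if "\<alpha> \<noteq> 0" for \<alpha> :: real
  proof -
    have "((\<lambda>v. (2 - v) * cos (\<alpha> * v)) has_integral (((2 - 2) * sin (\<alpha> * 2) / \<alpha> - cos (\<alpha> * 2) / \<alpha>\<^sup>2) - ((2 - 0) * sin (\<alpha> * 0) / \<alpha> - cos (\<alpha> * 0) / \<alpha>\<^sup>2))) {0..2}"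
    proof (rule fundamental_theorem_of_calculus)
      fix v :: real
      show "((\<lambda>v. (2 - v) * sin (\<alpha> * v) / \<alpha> - cos (\<alpha> * v) / \<alpha>\<^sup>2) has_vector_derivative (2 - v) * cos (\<alpha> * v)) (at v within {0..2})"
        unfolding has_real_derivative_iff_has_vector_derivative[symmetric]
        using that by (auto intro!: derivative_eq_intros simp: power2_eq_square field_simps)
    qed simp
    then show ?thesis by (simp add: diff_divide_distrib mult.commute)
  qed
  have px: "p\<^sup>2 - x\<^sup>2 \<noteq> 0" using x by (metis diff_eq_diff_eq power2_eq_iff right_minus_eq)
  have i2: "((\<lambda>v. sin (p * (2 - v)) * cos (x * v)) has_integral (p * (cos (2 * x) - cos (2 * p)) / (p\<^sup>2 - x\<^sup>2))) {0..2}"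
  proof -
    let ?G = "\<lambda>v. (p * (cos (p * (2 - v)) * cos (x * v)) - x * (sin (p * (2 - v)) * sin (x * v))) / (p\<^sup>2 - x\<^sup>2)"
    have "((\<lambda>v. sin (p * (2 - v)) * cos (x * v)) has_integral (?G 2 - ?G 0)) {0..2}"
    proof (rule fundamental_theorem_of_calculus)
      fix v :: real
      have "((\<lambda>v. p * (cos (p * (2 - v)) * cos (x * v)) - x * (sin (p * (2 - v)) * sin (x * v))) has_real_derivative
          (p\<^sup>2 - x\<^sup>2) * (sin (p * (2 - v)) * cos (x * v))) (at v within {0..2})"
        by (auto intro!: derivative_eq_intros simp: power2_eq_square algebra_simps)
      then have "(?G has_real_derivative ((p\<^sup>2 - x\<^sup>2) * (sin (p * (2 - v)) * cos (x * v))) / (p\<^sup>2 - x\<^sup>2)) (at v within {0..2})"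
        by (rule DERIV_cdivide)
      then show "(?G has_vector_derivative sin (p * (2 - v)) * cos (x * v)) (at v within {0..2})"
        unfolding has_real_derivative_iff_has_vector_derivative[symmetric] using px by simp
    qed simp
    then show ?thesis by (simp add: diff_divide_distrib right_diff_distrib mult.commute)
  qed
  have xm: "x - p \<noteq> 0" "x + p \<noteq> 0" using x by auto
  have "((\<lambda>v. ((2 - v) * cos ((x - p) * v) + (2 - v) * cos ((x + p) * v)) + (2 * \<sigma> / p) * (sin (p * (2 - v)) * cos (x * v))) has_integral
      (((1 - cos (2 * (x - p))) / (x - p)\<^sup>2 + (1 - cos (2 * (x + p))) / (x + p)\<^sup>2) + (2 * \<sigma> / p) * (p * (cos (2 * x) - cos (2 * p)) / (p\<^sup>2 - x\<^sup>2)))) {0..2}"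
    by (intro has_integral_add has_integral_mult_right i1 i2 xm)
  moreover have "((2 - v) * cos ((x - p) * v) + (2 - v) * cos ((x + p) * v)) + (2 * \<sigma> / p) * (sin (p * (2 - v)) * cos (x * v)) = 2 * W v * cos (x * v)" if "v \<in> {0..2}" for v
  proof -
    have "cos ((x - p) * v) + cos ((x + p) * v) = 2 * (cos (x * v) * cos (p * v))"
      by (simp add: left_diff_distrib distrib_right cos_add cos_diff)
    then have "(2 - v) * cos ((x - p) * v) + (2 - v) * cos ((x + p) * v) = (2 - v) * (2 * (cos (x * v) * cos (p * v)))"
      unfolding distrib_left[symmetric] by simp
    then show ?thesis using that by (simp add: W_nonneg_formula algebra_simps)
  qed
  ultimately have hi: "((\<lambda>v. 2 * W v * cos (x * v)) has_integral
      (((1 - cos (2 * (x - p))) / (x - p)\<^sup>2 + (1 - cos (2 * (x + p))) / (x + p)\<^sup>2) + (2 * \<sigma> / p) * (p * (cos (2 * x) - cos (2 * p)) / (p\<^sup>2 - x\<^sup>2)))) {0..2}"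
    by (rule has_integral_eq[rotated]) auto
  define A where "A = sin (x - p) / (x - p)"
  define B where "B = sin (x + p) / (x + p)"
  have c1: "(1 - cos (2 * y)) / y\<^sup>2 = 2 * (sin y / y)\<^sup>2" for y :: real
    by (simp add: cos_double_sin power_divide)
  have "cos (2 * x) - cos (2 * p) = - 2 * (sin (x + p) * sin (x - p))"
    using cos_diff_cos[of "2 * x" "2 * p"] sin_minus[of "x - p"] by (simp add: add_divide_distrib diff_divide_distrib)
  moreover have "p\<^sup>2 - x\<^sup>2 = - ((x + p) * (x - p))" by (simp add: power2_eq_square algebra_simps)
  ultimately have cb: "(cos (2 * x) - cos (2 * p)) / (p\<^sup>2 - x\<^sup>2) = 2 * (B * A)"
    by (simp add: A_def B_def)
  have g: "(2 * \<sigma> / p) * (p * X / Y) = 2 * \<sigma> * (X / Y)" for X Y using p_pos by simp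
  have "(2 * \<sigma> / p) * (p * (cos (2 * x) - cos (2 * p)) / (p\<^sup>2 - x\<^sup>2)) = 4 * \<sigma> * (A * B)"
    unfolding g cb by simp
  then have "((1 - cos (2 * (x - p))) / (x - p)\<^sup>2 + (1 - cos (2 * (x + p))) / (x + p)\<^sup>2) + (2 * \<sigma> / p) * (p * (cos (2 * x) - cos (2 * p)) / (p\<^sup>2 - x\<^sup>2)) = 2 * A\<^sup>2 + 2 * B\<^sup>2 + 4 * \<sigma> * (A * B)"
    unfolding c1 A_def[symmetric] B_def[symmetric] by simp
  also have "\<dots> = 2 * (A + \<sigma> * B)\<^sup>2" using \<sigma> by (auto simp: power2_eq_square algebra_simps)
  also have "\<dots> = phi x"
  proof -
    have "complex_of_real x - of_real p \<noteq> 0" "complex_of_real x + of_real p \<noteq> 0"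
      using xm by (simp_all flip: of_real_diff of_real_add)
    then have "snc (of_real x - of_real p) = of_real A" "snc (of_real x + of_real p) = of_real B"
      by (simp_all add: snc_def A_def B_def sin_of_real[symmetric])
    then have "Phi (of_real x) = of_real (2 * (A + \<sigma> * B)\<^sup>2)" by (simp add: Phi_def)
    then show ?thesis by (simp add: phi_def)
  qed
  finally show ?thesis using hi by simp
qed

lemma integrable_phi: "integrable lborel phi"
proof (rule Bochner_Integration.integrable_bound)
  show "integrable lborel (\<lambda>x. 32 * (1 + p)\<^sup>2 * decay x)" using integrable_decay by simp
  show "AE x in lborel. norm (phi x) \<le> norm (32 * (1 + p)\<^sup>2 * decay x)"
  proof (rule AE_I2)
    fix x :: real
    have "32 * (1 + p)\<^sup>2 * inverse ((1 + \<bar>x\<bar>)\<^sup>2) \<le> 32 * (1 + p)\<^sup>2 * decay x"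
      by (intro mult_left_mono inverse_square_le_decay) auto
    then show "norm (phi x) \<le> norm (32 * (1 + p)\<^sup>2 * decay x)"
      using phi_le[of x] phi_nonneg[of x] decay_nonneg[of x] by (simp add: divide_inverse abs_mult)
  qed
qed simp

lemma W_zero: "\<bar>v\<bar> \<ge> 2 \<Longrightarrow> W v = 0" by (simp add: W_def)

lemma integrable_W_times:
  fixes g :: "real \<Rightarrow> 'a :: {banach, second_countable_topology}"
  assumes "continuous_on UNIV g"
  shows "integrable lborel (\<lambda>v. W v *\<^sub>R g v)"
proof -
  have "integrable lborel (\<lambda>v. indicator {-2..2} v *\<^sub>R (W v *\<^sub>R g v))"
    by (rule borel_integrable_compact) (auto intro!: continuous_intros continuous_on_subset[OF continuous_W] continuous_on_subset[OF assms])
  moreover have "(\<lambda>v. indicator {-2..2} v *\<^sub>R (W v *\<^sub>R g v)) = (\<lambda>v. W v *\<^sub>R g v)"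
    by (auto simp: fun_eq_iff indicator_def intro!: W_zero)
  ultimately show ?thesis by simp
qed

lemma abs_W_le_4: "\<bar>W v\<bar> \<le> 4" using abs_W_le[of v] by (simp add: max_def split: if_splits)

lemma phi_eq_fourier_W:
  assumes x: "x \<noteq> p" "x \<noteq> - p"
  shows "(\<integral>v. W v *\<^sub>R iexp (v * x) \<partial>lborel) = of_real (phi x)"
proof -
  have h1: "((\<lambda>v. W v * cos (v * x)) has_integral phi x / 2) {0..2}"
    using has_integral_mult_right[OF W_integral_cos[OF x], of "1/2"] by (simp add: mult_ac)
  then have h2: "((\<lambda>v. W v * cos (v * x)) has_integral phi x / 2) {-2..0}"
    using has_integral_reflect_real[where f = "\<lambda>v. W v * cos (v * x)" and i = "phi x / 2" and a = 0 and b = 2] by (simp add: W_even)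
  have h: "((\<lambda>v. W v * cos (v * x)) has_integral phi x) {-2..2}"
    using has_integral_combine[OF _ _ h2 h1] by simp
  have ic: "integrable lborel (\<lambda>v. W v *\<^sub>R cos (v * x))" by (intro integrable_W_times continuous_intros)
  have ie: "integrable lborel (\<lambda>v. W v *\<^sub>R iexp (v * x))" by (intro integrable_W_times continuous_intros)
  have eqi: "(\<lambda>v. W v * cos (v * x)) = (\<lambda>v. indicator {-2..2} v *\<^sub>R (W v * cos (v * x)))"
    by (auto simp: fun_eq_iff indicator_def intro!: W_zero)
  have "(\<integral>v. W v * cos (v * x) \<partial>lborel) = (\<integral>v. indicator {-2..2} v *\<^sub>R (W v * cos (v * x)) \<partial>lborel)"
    using eqi by simp
  also have "\<dots> = phi x"
  proof -
    have "set_integrable lborel {-2..2} (\<lambda>v. W v * cos (v * x))"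
      unfolding set_integrable_def by (subst eqi[symmetric]) (use ic in simp)
    from set_borel_integral_eq_integral(2)[OF this] show ?thesis
      unfolding set_lebesgue_integral_def integral_unique[OF h] .
  qed
  finally have c: "(\<integral>v. W v * cos (v * x) \<partial>lborel) = phi x" .
  have "(\<integral>v. W v * sin (v * x) \<partial>lborel) = (\<integral>v. W (0 + (-1) * v) * sin ((0 + (-1) * v) * x) \<partial>lborel)"
    using lborel_integral_real_affine[of "-1" "\<lambda>v. W v * sin (v * x)" 0] by simp
  also have "\<dots> = - (\<integral>v. W v * sin (v * x) \<partial>lborel)" by (simp add: W_even)
  finally have s: "(\<integral>v. W v * sin (v * x) \<partial>lborel) = 0" by simp
  show ?thesis
  proof (rule complex_eqI)
    have "Re (\<integral>v. W v *\<^sub>R iexp (v * x) \<partial>lborel) = (\<integral>v. Re (W v *\<^sub>R iexp (v * x)) \<partial>lborel)"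
      by (rule integral_Re[OF ie, symmetric])
    also have "(\<lambda>v. Re (W v *\<^sub>R iexp (v * x))) = (\<lambda>v. W v * cos (v * x))" by (auto simp: Re_exp)
    finally show "Re (\<integral>v. W v *\<^sub>R iexp (v * x) \<partial>lborel) = Re (of_real (phi x))" using c by simp
    have "Im (\<integral>v. W v *\<^sub>R iexp (v * x) \<partial>lborel) = (\<integral>v. Im (W v *\<^sub>R iexp (v * x)) \<partial>lborel)"
      by (rule integral_Im[OF ie, symmetric])
    also have "(\<lambda>v. Im (W v *\<^sub>R iexp (v * x))) = (\<lambda>v. W v * sin (v * x))" by (auto simp: Im_exp)
    finally show "Im (\<integral>v. W v *\<^sub>R iexp (v * x) \<partial>lborel) = Im (of_real (phi x))" using s by simp
  qed
qed

text \<open>Fourier inversion with a Gaussian cutoff. The double integral of \<open>W v\<close>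
  against \<open>iexp ((v - l) * x)\<close> is not absolutely convergent, so the density
  \<open>?k (e * x)\<close> is inserted before Fubini; the transform of the Gaussian is again a
  Gaussian, concentrating at \<open>v = l\<close> as \<open>e\<close> tends to 0.\<close>

lemma phi_fourier:
  "(\<integral>x. phi x *\<^sub>R iexp (- (l * x)) \<partial>lborel) = of_real (2 * pi * W l)"
proof -
  let ?k = std_normal_density
  have integrable_k: "integrable lborel ?k" using integrable_std_normal_moment[of 0] by simp
  have integral_k: "(\<integral>x. ?k x \<partial>lborel) = 1" using integral_std_normal_moment_even[of 0] by simp
  have gauss: "(\<integral>x. (?k (e * x) * phi x) *\<^sub>R iexp (- (l * x)) \<partial>lborel) = of_real (sqrt (2 * pi)) * (\<integral>y. (?k y * W (l + e * y)) \<partial>lborel)" if e: "e > 0" for e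
  proof -
    define f where "f v x = W v *\<^sub>R (?k (e * x) *\<^sub>R iexp ((v - l) * x))" for v x
    have ik: "integrable lborel (\<lambda>x. ?k (e * x))"
      using lborel_integrable_real_affine[of ?k e 0] e integrable_k by simp
    have f_meas: "case_prod f \<in> borel_measurable (lborel \<Otimes>\<^sub>M lborel)" unfolding f_def by measurable
    have if1: "integrable lborel (\<lambda>x. f v x)" for v
    proof (rule Bochner_Integration.integrable_bound[OF Bochner_Integration.integrable_mult_right[OF ik, of "W v"]])
      show "AE x in lborel. norm (f v x) \<le> norm (W v * ?k (e * x))"
        by (rule AE_I2) (simp add: f_def abs_mult)
    qed (simp add: f_def)
    have "integrable (lborel \<Otimes>\<^sub>M lborel) (case_prod f)"
    proof (rule lborel_pair.Fubini_integrable[OF f_meas])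
      have "(\<integral>x. norm (f v x) \<partial>lborel) = W v *\<^sub>R (sgn (W v) * (\<integral>x. ?k (e * x) \<partial>lborel))" for v
      proof -
        have "(\<integral>x. norm (f v x) \<partial>lborel) = (\<integral>x. \<bar>W v\<bar> * ?k (e * x) \<partial>lborel)" by (simp add: f_def abs_mult)
        also have "\<dots> = \<bar>W v\<bar> * (\<integral>x. ?k (e * x) \<partial>lborel)" by simp
        also have "\<bar>W v\<bar> = W v * sgn (W v)" by (simp add: abs_sgn)
        finally show ?thesis by simp
      qed
      moreover have "integrable lborel (\<lambda>v. \<bar>W v *\<^sub>R 1\<bar> * (\<integral>x. ?k (e * x) \<partial>lborel))"
        by (intro Bochner_Integration.integrable_mult_left integrable_abs integrable_W_times continuous_intros)
      ultimately show "integrable lborel (\<lambda>v. \<integral>x. norm (case (v, x) of (v, x) \<Rightarrow> f v x) \<partial>lborel)"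
        by (simp add: abs_sgn mult_ac)
    qed (use if1 in simp)
    then have fub: "(\<integral>x. (\<integral>v. f v x \<partial>lborel) \<partial>lborel) = (\<integral>v. (\<integral>x. f v x \<partial>lborel) \<partial>lborel)"
      by (rule lborel_pair.Fubini_integral)
    have "(\<integral>x. (?k (e * x) * phi x) *\<^sub>R iexp (- (l * x)) \<partial>lborel) = (\<integral>x. (\<integral>v. f v x \<partial>lborel) \<partial>lborel)"
    proof (rule Bochner_Integration.integral_cong_AE)
      have "AE x in lborel. x \<notin> {p, - p}" by (intro AE_not_in finite_imp_null_set_lborel) auto
      then show "AE x in lborel. (?k (e * x) * phi x) *\<^sub>R iexp (- (l * x)) = (\<integral>v. f v x \<partial>lborel)"
      proof eventually_elim
        case (elim x)
        have "f v x = (?k (e * x) *\<^sub>R iexp (- (l * x))) * (W v *\<^sub>R iexp (v * x))" for v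
          by (simp add: f_def scaleR_conv_of_real algebra_simps exp_diff exp_minus field_simps)
        then have "(\<integral>v. f v x \<partial>lborel) = (\<integral>v. (?k (e * x) *\<^sub>R iexp (- (l * x))) * (W v *\<^sub>R iexp (v * x)) \<partial>lborel)"
          by (simp only:)
        also have "\<dots> = (?k (e * x) *\<^sub>R iexp (- (l * x))) * (\<integral>v. W v *\<^sub>R iexp (v * x) \<partial>lborel)"
          by (rule Bochner_Integration.integral_mult_right_zero)
        also have "\<dots> = (?k (e * x) *\<^sub>R iexp (- (l * x))) * of_real (phi x)" using phi_eq_fourier_W[of x] elim by auto
        finally show ?case by (simp add: scaleR_conv_of_real mult_ac)
      qed
      show "(\<lambda>x. \<integral>v. f v x \<partial>lborel) \<in> borel_measurable lborel" unfolding f_def by measurable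
    qed simp
    also have "\<dots> = (\<integral>v. (\<integral>x. f v x \<partial>lborel) \<partial>lborel)" by (rule fub)
    also have "\<dots> = (\<integral>v. complex_of_real (W v * (sqrt (2 * pi) / e * ?k ((v - l) / e))) \<partial>lborel)"
    proof (rule Bochner_Integration.integral_cong[OF refl])
      fix v
      have "(\<integral>x. ?k x *\<^sub>R iexp ((v - l) / e * x) \<partial>lborel) = char std_normal_distribution ((v - l) / e)"
        unfolding char_def by (simp add: integral_density)
      also have "\<dots> = of_real (exp (- (((v - l) / e)\<^sup>2) / 2))" by (simp add: char_std_normal_distribution)
      also have "\<dots> = of_real (sqrt (2 * pi) * ?k ((v - l) / e))" by (simp add: std_normal_density_def)
      finally have 1: "(\<integral>x. ?k x *\<^sub>R iexp ((v - l) / e * x) \<partial>lborel) = of_real (sqrt (2 * pi) * ?k ((v - l) / e))" .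
      have "(\<integral>x. ?k x *\<^sub>R iexp ((v - l) / e * x) \<partial>lborel) = e *\<^sub>R (\<integral>x. ?k (e * x) *\<^sub>R iexp ((v - l) * x) \<partial>lborel)"
        using lborel_integral_real_affine[of e "\<lambda>x. ?k x *\<^sub>R iexp ((v - l) / e * x)" 0] e by simp
      then have "(\<integral>x. ?k (e * x) *\<^sub>R iexp ((v - l) * x) \<partial>lborel) = of_real (sqrt (2 * pi) / e * ?k ((v - l) / e))"
        unfolding 1 using e by (simp add: scaleR_conv_of_real field_simps)
      then show "(\<integral>x. f v x \<partial>lborel) = of_real (W v * (sqrt (2 * pi) / e * ?k ((v - l) / e)))"
        by (simp add: f_def scaleR_conv_of_real)
    qed
    also have "\<dots> = of_real (\<integral>v. W v * (sqrt (2 * pi) / e * ?k ((v - l) / e)) \<partial>lborel)"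
      by (rule integral_complex_of_real)
    also have "(\<integral>v. W v * (sqrt (2 * pi) / e * ?k ((v - l) / e)) \<partial>lborel) = e * (\<integral>y. W (l + e * y) * (sqrt (2 * pi) / e * ?k y) \<partial>lborel)"
      using lborel_integral_real_affine[of e "\<lambda>v. W v * (sqrt (2 * pi) / e * ?k ((v - l) / e))" l] e by simp
    also have "(\<lambda>y. W (l + e * y) * (sqrt (2 * pi) / e * ?k y)) = (\<lambda>y. (sqrt (2 * pi) / e) * (?k y * W (l + e * y)))"
      by (simp add: mult_ac)
    also have "e * (\<integral>y. (sqrt (2 * pi) / e) * (?k y * W (l + e * y)) \<partial>lborel) = sqrt (2 * pi) * (\<integral>y. ?k y * W (l + e * y) \<partial>lborel)"
      using e by (simp only: Bochner_Integration.integral_mult_right_zero) simp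
    finally show ?thesis by simp
  qed
  define e where "e n = 1 / real (Suc n)" for n
  have e0: "e n > 0" for n by (simp add: e_def)
  have elim: "e \<longlonglongrightarrow> 0" unfolding e_def by real_asymp
  have kb: "?k x \<le> 1" "?k x \<ge> 0" for x
  proof -
    have "exp (- x\<^sup>2 / 2) \<le> 1" by simp
    moreover have "1 / sqrt (2 * pi) \<le> 1" using pi_gt3 by (simp add: real_le_rsqrt)
    ultimately have "1 / sqrt (2 * pi) * exp (- x\<^sup>2 / 2) \<le> 1 * 1" by (intro mult_mono) auto
    then show "?k x \<le> 1" "?k x \<ge> 0" by (simp_all add: std_normal_density_def)
  qed
  have kc: "(\<lambda>n. ?k (e n * x)) \<longlonglongrightarrow> ?k 0" for x
    unfolding std_normal_density_def by (auto intro!: tendsto_eq_intros elim)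
  have "(\<lambda>n. \<integral>x. (?k (e n * x) * phi x) *\<^sub>R iexp (- (l * x)) \<partial>lborel) \<longlonglongrightarrow> (\<integral>x. (?k 0 * phi x) *\<^sub>R iexp (- (l * x)) \<partial>lborel)"
  proof (rule integral_dominated_convergence[where w = phi])
    show "AE x in lborel. (\<lambda>n. (?k (e n * x) * phi x) *\<^sub>R iexp (- (l * x))) \<longlonglongrightarrow> (?k 0 * phi x) *\<^sub>R iexp (- (l * x))"
      by (intro AE_I2 tendsto_intros kc)
    show "AE x in lborel. norm ((?k (e n * x) * phi x) *\<^sub>R iexp (- (l * x))) \<le> phi x" for n
    proof (rule AE_I2)
      fix x
      have "?k (e n * x) * phi x \<le> 1 * phi x" by (intro mult_right_mono kb phi_nonneg)
      then show "norm ((?k (e n * x) * phi x) *\<^sub>R iexp (- (l * x))) \<le> phi x" using kb phi_nonneg[of x] by (simp add: abs_mult)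
    qed
  qed (use integrable_phi in auto)
  then have l1: "(\<lambda>n. of_real (sqrt (2 * pi)) * complex_of_real (\<integral>y. (?k y * W (l + e n * y)) \<partial>lborel)) \<longlonglongrightarrow> (\<integral>x. (?k 0 * phi x) *\<^sub>R iexp (- (l * x)) \<partial>lborel)"
    unfolding gauss[OF e0] by simp
  have "(\<lambda>n. \<integral>y. (?k y * W (l + e n * y)) \<partial>lborel) \<longlonglongrightarrow> (\<integral>y. (?k y * W l) \<partial>lborel)"
  proof (rule integral_dominated_convergence[where w = "\<lambda>y. ?k y * 4"])
    show "AE y in lborel. (\<lambda>n. ?k y * W (l + e n * y)) \<longlonglongrightarrow> ?k y * W l"
    proof (rule AE_I2)
      fix y
      have "(\<lambda>n. l + e n * y) \<longlonglongrightarrow> l + 0 * y" by (intro tendsto_intros elim)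
      then have "(\<lambda>n. W (l + e n * y)) \<longlonglongrightarrow> W l"
        using continuous_on_tendsto_compose[OF continuous_W, of "\<lambda>n. l + e n * y" l] by simp
      then show "(\<lambda>n. ?k y * W (l + e n * y)) \<longlonglongrightarrow> ?k y * W l" by (intro tendsto_intros)
    qed
    show "AE y in lborel. norm (?k y * W (l + e n * y)) \<le> ?k y * 4" for n
      by (intro AE_I2) (auto simp: abs_mult kb intro!: mult_left_mono abs_W_le_4)
    show "integrable lborel (\<lambda>y. ?k y * 4)" using integrable_k by simp
  qed auto
  also have "(\<integral>y. (?k y * W l) \<partial>lborel) = W l" using integral_k by simp
  finally have "(\<lambda>n. of_real (sqrt (2 * pi)) * complex_of_real (\<integral>y. (?k y * W (l + e n * y)) \<partial>lborel)) \<longlonglongrightarrow> of_real (sqrt (2 * pi)) * of_real (W l)"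
    by (intro tendsto_intros)
  with l1 have "(\<integral>x. (?k 0 * phi x) *\<^sub>R iexp (- (l * x)) \<partial>lborel) = of_real (sqrt (2 * pi)) * of_real (W l)"
    by (rule LIMSEQ_unique)
  also have "(\<integral>x. (?k 0 * phi x) *\<^sub>R iexp (- (l * x)) \<partial>lborel) = ?k 0 *\<^sub>R (\<integral>x. phi x *\<^sub>R iexp (- (l * x)) \<partial>lborel)"
    by (simp flip: scaleR_scaleR)
  finally have "of_real (?k 0) * (\<integral>x. phi x *\<^sub>R iexp (- (l * x)) \<partial>lborel) = of_real (sqrt (2 * pi)) * of_real (W l)"
    by (simp add: scaleR_conv_of_real)
  from arg_cong[OF this, of "\<lambda>z. of_real (sqrt (2 * pi)) * z"]
  have "of_real (sqrt (2 * pi) * ?k 0) * (\<integral>x. phi x *\<^sub>R iexp (- (l * x)) \<partial>lborel) = of_real (sqrt (2 * pi) * sqrt (2 * pi)) * of_real (W l)"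
    by (simp only: of_real_mult mult.assoc)
  moreover have "sqrt (2 * pi) * ?k 0 = 1" by (simp add: std_normal_density_def)
  moreover have "sqrt (2 * pi) * sqrt (2 * pi) = 2 * pi" by simp
  ultimately show ?thesis by (simp only: of_real_1 mult_1 of_real_mult)
qed

lemma integral_phi: "(\<integral>x. phi x \<partial>lborel) = 4 * pi * (1 + \<sigma> * bb)"
proof -
  have "complex_of_real (\<integral>x. phi x \<partial>lborel) = (\<integral>x. complex_of_real (phi x) \<partial>lborel)" by simp
  also have "\<dots> = (\<integral>x. phi x *\<^sub>R iexp (- (0 * x)) \<partial>lborel)" by (simp add: scaleR_conv_of_real)
  also have "\<dots> = of_real (2 * pi * W 0)" by (rule phi_fourier)
  finally have "(\<integral>x. phi x \<partial>lborel) = 2 * pi * W 0" by (simp only: of_real_eq_iff)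
  then show ?thesis by (simp add: W_0)
qed

end

section \<open>Prime sums and Poisson kernels\<close>

text \<open>Telescoping: with \<open>a\<close>, \<open>b\<close> the fourth roots of
  \<open>N + 1\<close> and \<open>N\<close>, factoring \<open>a ^ 4 - b ^ 4 = 1\<close> gives
  \<open>1 / a ^ 3 \<le> 4 * (a - b)\<close>.\<close>

lemma sum_powr_three_quarters: "(\<Sum>k=1..N. real k powr (-(3/4))) \<le> 4 * real N powr (1/4)"
proof (induction N)
  case (Suc N)
  define a b where "a = real (Suc N) powr (1/4)" and "b = real N powr (1/4)"
  have ab: "0 \<le> b" "b \<le> a" "a > 0" by (auto simp: a_def b_def intro!: powr_mono2)
  have a4: "a ^ 4 = real (Suc N)" and a3: "a ^ 3 = real (Suc N) powr (3/4)" unfolding a_def by (simp_all add: powr_power)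
  have b4: "b ^ 4 = real N" unfolding b_def by (cases "N = 0") (simp_all add: powr_power)
  have "a ^ 4 - b ^ 4 = (a - b) * (a ^ 3 + a\<^sup>2 * b + a * b\<^sup>2 + b ^ 3)"
    by (simp add: algebra_simps power_numeral_reduce)
  also have "\<dots> \<le> (a - b) * (4 * a ^ 3)"
  proof (intro mult_left_mono)
    have "a\<^sup>2 * b \<le> a\<^sup>2 * a" "a * b\<^sup>2 \<le> a * a\<^sup>2" "b ^ 3 \<le> a ^ 3" using ab by (auto intro!: mult_left_mono power_mono)
    then show "a ^ 3 + a\<^sup>2 * b + a * b\<^sup>2 + b ^ 3 \<le> 4 * a ^ 3" by (simp add: power_numeral_reduce)
  qed (use ab in simp)
  finally have "1 \<le> (a - b) * (4 * a ^ 3)" using a4 b4 by simp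
  also have "\<dots> = 4 * (a - b) * a ^ 3" by (simp only: mult_ac)
  finally have "1 / a ^ 3 \<le> 4 * (a - b)" using ab by (subst pos_divide_le_eq) auto
  moreover have "real (Suc N) powr (-(3/4)) = 1 / a ^ 3" unfolding a3 by (simp only: powr_minus inverse_eq_divide)
  ultimately have "real (Suc N) powr (-(3/4)) \<le> 4 * a - 4 * b" by (simp only: right_diff_distrib)
  then have "(\<Sum>k=1..N. real k powr (-(3/4))) + real (Suc N) powr (-(3/4)) \<le> 4 * a"
    using Suc.IH unfolding b_def by linarith
  then show ?case unfolding a_def by (subst sum.cl_ivl_Suc) simp
qed simp

lemma ln_le_4_powr: "x > 0 \<Longrightarrow> ln x \<le> 4 * x powr (1/4)" for x :: real
  using ln_le_minus_one[of "x powr (1/4)"] by (simp add: ln_powr)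

lemma power2_powr_quarter: "(x\<^sup>2) powr (1/4) = x powr (1/2)" if "x > 0" for x :: real
proof -
  have "x\<^sup>2 = x powr 2" using that by simp
  then have "(x\<^sup>2) powr (1/4) = x powr (2 * (1/4))" by (simp only: powr_powr)
  then show ?thesis by simp
qed

context test_function begin

text \<open>Bounding \<open>mangoldt n\<close> by \<open>2 * ln q\<close> cancels the
  \<open>ln q\<close> in the argument of \<open>W\<close>, and the product is at most
  \<open>4 * ln (q\<^sup>2 / n)\<close>. Replacing this by a fourth root keeps the sum up to
  \<open>q\<^sup>2\<close> of order \<open>q\<close>.\<close>

lemma prime_term_bound:
  fixes q n :: nat
  assumes q: "q \<ge> 3" and n: "n \<ge> 1" "n < q\<^sup>2"
  shows "mangoldt n * real n powr (-(1/2)) * \<bar>W (ln (real n) / ln (real q))\<bar> \<le> 16 * real q powr (1/2) * real n powr (-(3/4))"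
proof -
  define l where "l = ln (real q)"
  have l: "l > 0" using q by (simp add: l_def)
  have "ln (real n) < ln (real (q\<^sup>2))" using n q by (subst ln_less_cancel_iff) (auto simp del: of_nat_power)
  also have "\<dots> = 2 * l" using q by (simp add: l_def ln_realpow)
  finally have nl: "ln (real n) < 2 * l" .
  have ln0: "ln (real n) \<ge> 0" using n by simp
  have "\<bar>W (ln (real n) / l)\<bar> \<le> 2 * (2 - ln (real n) / l)"
    using abs_W_le[of "ln (real n) / l"] nl ln0 l by (simp add: max_def field_simps split: if_splits)
  moreover have "mangoldt n \<le> 2 * l" using mangoldt_le[of n] n nl by simp
  ultimately have "mangoldt n * \<bar>W (ln (real n) / l)\<bar> \<le> (2 * l) * (2 * (2 - ln (real n) / l))"
    using l by (intro mult_mono) auto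
  also have "\<dots> = 4 * (2 * l - ln (real n))" using l by (simp add: field_simps)
  also have "2 * l - ln (real n) = ln ((real q)\<^sup>2 / real n)" using q n by (simp add: l_def ln_div ln_realpow)
  also have "4 * ln ((real q)\<^sup>2 / real n) \<le> 4 * (4 * ((real q)\<^sup>2 / real n) powr (1/4))"
    using q n by (intro mult_left_mono ln_le_4_powr) auto
  also have "((real q)\<^sup>2 / real n) powr (1/4) = real q powr (1/2) * real n powr (-(1/4))"
  proof -
    have "((real q)\<^sup>2 / real n) powr (1/4) = ((real q)\<^sup>2) powr (1/4) / real n powr (1/4)" by (simp add: powr_divide)
    also have "((real q)\<^sup>2) powr (1/4) = real q powr (1/2)" using q by (intro power2_powr_quarter) simp
    also have "real q powr (1/2) / real n powr (1/4) = real q powr (1/2) * real n powr (-(1/4))"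
      by (simp only: powr_minus divide_inverse)
    finally show ?thesis .
  qed
  finally have "mangoldt n * \<bar>W (ln (real n) / l)\<bar> * real n powr (-(1/2)) \<le> 16 * (real q powr (1/2) * real n powr (-(1/4))) * real n powr (-(1/2))"
    by (intro mult_right_mono) auto
  moreover have "real n powr (-(1/4)) * real n powr (-(1/2)) = real n powr (-(3/4))" unfolding powr_add[symmetric] by simp
  ultimately show ?thesis unfolding l_def by (simp add: mult_ac)
qed

text \<open>The principal character contributes the sum over all \<open>n\<close>, at most
  \<open>64 * q\<close>. The progression \<open>n = 1 + k * q\<close> is sparse enough that its sum
  is at most 64 before the weight \<open>q - 1\<close>.\<close>

lemma prime_sum_bound:
  fixes q :: nat
  assumes q: "q \<ge> 3"
  shows "(\<Sum>n=1..<q\<^sup>2. mangoldt n * real n powr (-(1/2)) * \<bar>W (ln (real n) / ln (real q))\<bar> * ((if [n = 1] (mod q) then real (q - 1) else 0) + 1)) \<le> 128 * real q"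
proof -
  define A where "A n = mangoldt n * real n powr (-(1/2)) * \<bar>W (ln (real n) / ln (real q))\<bar>" for n
  define K where "K = 16 * real q powr (1/2)"
  have K0: "K \<ge> 0" by (simp add: K_def)
  have A0: "A n \<ge> 0" for n by (simp add: A_def mangoldt_nonneg)
  have A: "A n \<le> K * real n powr (-(3/4))" if "n \<ge> 1" "n < q\<^sup>2" for n
    using prime_term_bound[OF q that] by (simp add: A_def K_def)
  have qq: "real q powr (1/2) * real q powr (1/2) = real q" unfolding powr_add[symmetric] using q by simp
  have "(\<Sum>n=1..<q\<^sup>2. A n) \<le> (\<Sum>n=1..<q\<^sup>2. K * real n powr (-(3/4)))" by (intro sum_mono A) auto
  also have "\<dots> \<le> (\<Sum>n=1..q\<^sup>2. K * real n powr (-(3/4)))" using K0 by (intro sum_mono2) auto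
  also have "\<dots> = K * (\<Sum>n=1..q\<^sup>2. real n powr (-(3/4)))" by (simp add: sum_distrib_left)
  also have "\<dots> \<le> K * (4 * real (q\<^sup>2) powr (1/4))" by (intro mult_left_mono sum_powr_three_quarters K0)
  also have "real (q\<^sup>2) powr (1/4) = real q powr (1/2)" using power2_powr_quarter[of "real q"] q by simp
  also have "K * (4 * real q powr (1/2)) = 64 * (real q powr (1/2) * real q powr (1/2))" by (simp add: K_def)
  finally have 1: "(\<Sum>n=1..<q\<^sup>2. A n) \<le> 64 * real q" unfolding qq .
  let ?T = "{n\<in>{1..<q\<^sup>2}. [n = 1] (mod q)}"
  let ?I = "(\<lambda>k. 1 + k * q) ` {1..<q}"
  \<comment> \<open>The term \<open>n = 1\<close>, which would be the dominant one, is annihilated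
    by the von Mangoldt function; all others have \<open>1 \<le> k < q\<close>.\<close>
  have sub: "?T \<subseteq> insert 1 ?I"
  proof
    fix n assume n: "n \<in> ?T"
    then have m: "n mod q = 1" using q by (simp add: cong_def)
    then have e: "n = 1 + (n div q) * q" using div_mult_mod_eq[of n q] by simp
    have "n div q < q" using n by (simp add: less_mult_imp_div_less power2_eq_square)
    then show "n \<in> insert 1 ?I" using e by (cases "n div q = 0") auto
  qed
  have "(\<Sum>n\<in>?T. A n) \<le> (\<Sum>n\<in>insert 1 ?I. A n)" by (rule sum_mono2[OF _ sub]) (use A0 in auto)
  also have "\<dots> = (\<Sum>n\<in>?I. A n)" using q by (subst sum.insert) (auto simp: A_def)
  also have "\<dots> = (\<Sum>k=1..<q. A (1 + k * q))" using q by (subst sum.reindex) (auto simp: inj_on_def)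
  also have "\<dots> \<le> (\<Sum>k=1..<q. K * real q powr (-(3/4)) * real k powr (-(3/4)))"
  proof (rule sum_mono)
    fix k assume k: "k \<in> {1..<q}"
    have "1 + k * q \<le> 1 + (q - 1) * q" using k by (intro add_left_mono mult_right_mono) auto
    also have "\<dots> < q\<^sup>2" using q by (cases q) (auto simp: power2_eq_square)
    finally have "A (1 + k * q) \<le> K * real (1 + k * q) powr (-(3/4))" by (intro A) auto
    also have "\<dots> \<le> K * (real k * real q) powr (-(3/4))" using k q K0 by (intro mult_left_mono powr_mono2') auto
    also have "\<dots> = K * real q powr (-(3/4)) * real k powr (-(3/4))" by (simp add: powr_mult mult_ac)
    finally show "A (1 + k * q) \<le> K * real q powr (-(3/4)) * real k powr (-(3/4))" .
  qed
  also have "\<dots> \<le> (\<Sum>k=1..q. K * real q powr (-(3/4)) * real k powr (-(3/4)))" using K0 by (intro sum_mono2) auto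
  also have "\<dots> = K * real q powr (-(3/4)) * (\<Sum>k=1..q. real k powr (-(3/4)))" by (simp add: sum_distrib_left)
  also have "\<dots> \<le> K * real q powr (-(3/4)) * (4 * real q powr (1/4))" using K0 by (intro mult_left_mono sum_powr_three_quarters) auto
  also have "\<dots> = 64 * (real q powr (1/2) * real q powr (-(3/4)) * real q powr (1/4))" by (simp add: K_def)
  also have "real q powr (1/2) * real q powr (-(3/4)) * real q powr (1/4) = 1" unfolding powr_add[symmetric] using q by simp
  finally have 2: "(\<Sum>n\<in>?T. A n) \<le> 64" by simp
  have "(\<Sum>n=1..<q\<^sup>2. A n * ((if [n = 1] (mod q) then real (q - 1) else 0) + 1)) =
      (\<Sum>n=1..<q\<^sup>2. A n) + (\<Sum>n=1..<q\<^sup>2. if [n = 1] (mod q) then real (q - 1) * A n else 0)"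
    by (simp add: sum.distrib[symmetric]) (rule sum.cong, auto simp: algebra_simps)
  also have "(\<Sum>n=1..<q\<^sup>2. if [n = 1] (mod q) then real (q - 1) * A n else 0) = real (q - 1) * (\<Sum>n\<in>?T. A n)"
    unfolding sum_distrib_left by (rule sum.inter_filter[symmetric]) simp
  also have "\<dots> \<le> real (q - 1) * 64" by (intro mult_left_mono 2) auto
  also have "\<dots> \<le> 64 * real q" by simp
  finally show ?thesis using 1 by (simp add: A_def)
qed

end

section \<open>Poisson kernels of shrinking width\<close>

lemma poisson_kernel_integral:
  fixes h \<delta> \<gamma> :: real
  assumes h: "h > 0" and \<delta>: "\<delta> > 0"
  shows "set_integrable lborel {\<gamma>-\<delta>..\<gamma>+\<delta>} (\<lambda>y. h / (h\<^sup>2 + (y - \<gamma>)\<^sup>2))"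
    and "(LBINT y:{\<gamma>-\<delta>..\<gamma>+\<delta>}. h / (h\<^sup>2 + (y - \<gamma>)\<^sup>2)) = 2 * arctan (\<delta> / h)"
proof -
  have ne: "h\<^sup>2 + (y - \<gamma>)\<^sup>2 \<noteq> 0" for y using h by (simp add: sum_power2_eq_zero_iff)
  show i: "set_integrable lborel {\<gamma>-\<delta>..\<gamma>+\<delta>} (\<lambda>y. h / (h\<^sup>2 + (y - \<gamma>)\<^sup>2))"
    by (intro borel_integrable_atLeastAtMost' continuous_intros ballI ne)
  have "((\<lambda>y. h / (h\<^sup>2 + (y - \<gamma>)\<^sup>2)) has_integral (arctan ((\<gamma> + \<delta> - \<gamma>) / h) - arctan ((\<gamma> - \<delta> - \<gamma>) / h))) {\<gamma>-\<delta>..\<gamma>+\<delta>}"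
  proof (rule fundamental_theorem_of_calculus)
    fix y
    have "((\<lambda>y. arctan ((y - \<gamma>) / h)) has_real_derivative inverse (1 + ((y - \<gamma>) / h)\<^sup>2) * (1 / h)) (at y within {\<gamma>-\<delta>..\<gamma>+\<delta>})"
      using h by (auto intro!: derivative_eq_intros)
    also have "inverse (1 + ((y - \<gamma>) / h)\<^sup>2) * (1 / h) = h / (h\<^sup>2 + (y - \<gamma>)\<^sup>2)"
    proof -
      have "1 + ((y - \<gamma>) / h)\<^sup>2 = (h\<^sup>2 + (y - \<gamma>)\<^sup>2) / h\<^sup>2" using h by (simp add: power_divide add_divide_distrib)
      then show ?thesis using h by (simp add: power2_eq_square)
    qed
    finally show "((\<lambda>y. arctan ((y - \<gamma>) / h)) has_vector_derivative h / (h\<^sup>2 + (y - \<gamma>)\<^sup>2)) (at y within {\<gamma>-\<delta>..\<gamma>+\<delta>})"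
      by (simp only: has_real_derivative_iff_has_vector_derivative)
  qed (use \<delta> in simp)
  from integral_unique[OF this] show "(LBINT y:{\<gamma>-\<delta>..\<gamma>+\<delta>}. h / (h\<^sup>2 + (y - \<gamma>)\<^sup>2)) = 2 * arctan (\<delta> / h)"
    using set_borel_integral_eq_integral(2)[OF i] by (simp add: arctan_minus)
qed

text \<open>The kernel of width \<open>h\<close> has mass tending to \<open>pi\<close> on any fixed
  interval about \<open>\<gamma>\<close>. The interval is fixed first, short enough that
  \<open>w\<close> is nearly constant and the bounded error \<open>B\<close> costs little; only then
  does \<open>h\<close> tend to 0.\<close>

lemma poisson_kernel_lower_bound:
  fixes w :: "real \<Rightarrow> real" and u :: "real \<Rightarrow> real \<Rightarrow> real"
  assumes w: "continuous_on UNIV w" "\<And>y. w y \<ge> 0" and m: "m \<ge> 0" and r: "r > 0" and B: "B \<ge> 0"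
    and lower: "\<And>h y. 0 < h \<Longrightarrow> h < r \<Longrightarrow> \<bar>y - \<gamma>\<bar> < r \<Longrightarrow> u h y \<ge> m * (h / (h\<^sup>2 + (y - \<gamma>)\<^sup>2)) - B"
    and int: "\<And>h \<delta>. 0 < h \<Longrightarrow> h < r \<Longrightarrow> set_integrable lborel {\<gamma>-\<delta>..\<gamma>+\<delta>} (\<lambda>y. w y * u h y)"
    and \<epsilon>: "\<epsilon> > 0"
  shows "\<exists>\<delta>0>0. \<forall>\<delta>. 0 < \<delta> \<longrightarrow> \<delta> < \<delta>0 \<longrightarrow>
    (\<forall>\<^sub>F h in at_right 0. (LBINT y:{\<gamma>-\<delta>..\<gamma>+\<delta>}. w y * u h y) \<ge> pi * m * w \<gamma> - \<epsilon>)"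
proof -
  \<comment> \<open>Of the allowance \<open>\<epsilon>\<close>, one third goes to the variation of
    \<open>w\<close>, one third to \<open>B\<close> through the choice of \<open>\<delta>0\<close>,
    and the last to the limit in \<open>h\<close>.\<close>
  define \<eta> where "\<eta> = min 1 (\<epsilon> / (3 * (pi * m + 1)))"
  have pm: "pi * m \<ge> 0" using m by simp
  have \<eta>: "\<eta> > 0" "\<eta> \<le> 1" using \<epsilon> pm by (auto simp: \<eta>_def intro!: divide_pos_pos)
  have \<eta>m: "\<eta> * (pi * m) \<le> \<epsilon> / 3"
  proof -
    have "\<eta> * (pi * m) \<le> (\<epsilon> / (3 * (pi * m + 1))) * (pi * m + 1)" using pm \<epsilon> \<eta> by (intro mult_mono) (auto simp: \<eta>_def)
    also have "\<dots> = \<epsilon> / 3" using pm by (simp add: field_simps)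
    finally show ?thesis .
  qed
  have "isCont w \<gamma>" using w(1) by (simp add: continuous_on_eq_continuous_at)
  then obtain d where d: "d > 0" "\<And>y. \<bar>y - \<gamma>\<bar> < d \<Longrightarrow> \<bar>w y - w \<gamma>\<bar> < \<eta>"
    unfolding continuous_at_eps_delta using \<eta>(1) by (auto simp: dist_real_def)
  define K where "K = w \<gamma> + 1"
  have K: "K \<ge> 0" "K * B \<ge> 0" using w(2)[of \<gamma>] B by (auto simp: K_def)
  define \<delta>0 where "\<delta>0 = min r (min d (\<epsilon> / (6 * (K * B + 1))))"
  have \<delta>0: "\<delta>0 > 0" "\<delta>0 \<le> r" "\<delta>0 \<le> d" using r d \<epsilon> K by (auto simp: \<delta>0_def intro!: divide_pos_pos)
  show ?thesis
  proof (intro exI[of _ \<delta>0] conjI allI impI)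
    fix \<delta> assume \<delta>: "0 < \<delta>" "\<delta> < \<delta>0"
    have KB: "K * B * (2 * \<delta>) \<le> \<epsilon> / 3"
    proof -
      have "K * B * (2 * \<delta>) \<le> (K * B + 1) * (2 * (\<epsilon> / (6 * (K * B + 1))))"
        using \<delta> K by (intro mult_mono) (auto simp: \<delta>0_def)
      also have "\<dots> = \<epsilon> / 3" using K by (simp add: field_simps)
      finally show ?thesis .
    qed
    have "((\<lambda>h. arctan (\<delta> / h)) \<longlongrightarrow> pi / 2) (at_right 0)"
    proof (rule filterlim_compose[OF tendsto_arctan_at_top])
      show "LIM h at_right 0. \<delta> / h :> at_top" using \<delta>(1) by real_asymp
    qed
    then have "((\<lambda>h. (w \<gamma> - \<eta>) * m * (2 * arctan (\<delta> / h)) - K * B * (2 * \<delta>)) \<longlongrightarrow> (w \<gamma> - \<eta>) * m * (2 * (pi / 2)) - K * B * (2 * \<delta>)) (at_right 0)"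
      by (intro tendsto_intros)
    moreover have "(w \<gamma> - \<eta>) * m * (2 * (pi / 2)) - K * B * (2 * \<delta>) > pi * m * w \<gamma> - \<epsilon>"
    proof -
      have "(w \<gamma> - \<eta>) * m * (2 * (pi / 2)) = pi * m * w \<gamma> - \<eta> * (pi * m)" by (simp add: algebra_simps)
      then show ?thesis using KB \<eta>m \<epsilon> by linarith
    qed
    ultimately have "\<forall>\<^sub>F h in at_right 0. (w \<gamma> - \<eta>) * m * (2 * arctan (\<delta> / h)) - K * B * (2 * \<delta>) > pi * m * w \<gamma> - \<epsilon>"
      by (rule order_tendstoD(1))
    moreover have "\<forall>\<^sub>F h in at_right 0. h \<in> {0<..<r}" by (rule eventually_at_right_real[OF r])
    ultimately show "\<forall>\<^sub>F h in at_right 0. (LBINT y:{\<gamma>-\<delta>..\<gamma>+\<delta>}. w y * u h y) \<ge> pi * m * w \<gamma> - \<epsilon>"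
    proof eventually_elim
      case (elim h)
      let ?k = "\<lambda>y. h / (h\<^sup>2 + (y - \<gamma>)\<^sup>2)"
      have h: "0 < h" "h < r" using elim by auto
      have i0: "set_integrable lborel {\<gamma>-\<delta>..\<gamma>+\<delta>} (\<lambda>y. K * B)" by (intro borel_integrable_atLeastAtMost' continuous_intros)
      have i1: "set_integrable lborel {\<gamma>-\<delta>..\<gamma>+\<delta>} (\<lambda>y. (w \<gamma> - \<eta>) * m * ?k y)"
        using poisson_kernel_integral(1)[OF h(1) \<delta>(1), of \<gamma>] by (intro set_integrable_mult_right) auto
      have "(LBINT y:{\<gamma>-\<delta>..\<gamma>+\<delta>}. (w \<gamma> - \<eta>) * m * ?k y - K * B) \<le> (LBINT y:{\<gamma>-\<delta>..\<gamma>+\<delta>}. w y * u h y)"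
      proof (rule set_integral_mono[OF set_integral_diff(1)[OF i1 i0] int[OF h]])
        fix y assume "y \<in> {\<gamma>-\<delta>..\<gamma>+\<delta>}"
        then have y: "\<bar>y - \<gamma>\<bar> < \<delta>0" using \<delta> by auto
        have wy: "w \<gamma> - \<eta> \<le> w y" "w y \<le> K" using d(2)[of y] y \<delta>0 \<eta> by (auto simp: K_def abs_less_iff)
        have k0: "m * ?k y \<ge> 0" using m h by simp
        have "(w \<gamma> - \<eta>) * (m * ?k y) \<le> w y * (m * ?k y)" using wy k0 by (intro mult_right_mono)
        moreover have "w y * B \<le> K * B" using wy B by (intro mult_right_mono)
        moreover have "w y * (m * ?k y - B) \<le> w y * u h y"
          using lower[OF h, of y] y \<delta>0 w(2)[of y] by (intro mult_left_mono) auto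
        moreover have "w y * (m * ?k y - B) = w y * (m * ?k y) - w y * B" by (rule right_diff_distrib)
        ultimately show "(w \<gamma> - \<eta>) * m * ?k y - K * B \<le> w y * u h y" by (simp only: mult.assoc)
      qed
      also have "(LBINT y:{\<gamma>-\<delta>..\<gamma>+\<delta>}. (w \<gamma> - \<eta>) * m * ?k y - K * B) = (w \<gamma> - \<eta>) * m * (2 * arctan (\<delta> / h)) - K * B * (2 * \<delta>)"
      proof -
        have "(LBINT y:{\<gamma>-\<delta>..\<gamma>+\<delta>}. K * B) = K * B * (2 * \<delta>)" using \<delta> by (simp add: set_lebesgue_integral_def)
        then show ?thesis
          using set_integral_diff(2)[OF i1 i0] poisson_kernel_integral(2)[OF h(1) \<delta>(1), of \<gamma>]
          by (simp only: set_integral_mult_right)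
      qed
      finally show ?case using elim by linarith
    qed
  qed (use \<delta>0 in auto)
qed

section \<open>The explicit inequality\<close>

text \<open>One constant fixed for all moduli and characters, so that the error term depends on
  \<open>p\<close> alone. The threshold 1/4 is the real part of half the points on the critical
  line.\<close>

definition digamma_const :: real where
  "digamma_const = (SOME C. C > 0 \<and> (\<forall>z. Re z \<ge> 1/4 \<longrightarrow> cmod (Digamma z) \<le> C * (1 + sqrt (cmod z))))"

lemma digamma_const: "digamma_const > 0" "Re z \<ge> 1/4 \<Longrightarrow> cmod (Digamma z) \<le> digamma_const * (1 + sqrt (cmod z))"
proof -
  have "\<exists>C. C > 0 \<and> (\<forall>z. Re z \<ge> 1/4 \<longrightarrow> cmod (Digamma z) \<le> C * (1 + sqrt (cmod z)))"
    using Digamma_bound[of "1/4"] by auto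
  from someI_ex[OF this] show "digamma_const > 0" "Re z \<ge> 1/4 \<Longrightarrow> cmod (Digamma z) \<le> digamma_const * (1 + sqrt (cmod z))"
    unfolding digamma_const_def[symmetric] by blast+
qed

definition (in test_function) digamma_err :: real where
  "digamma_err = 32 * digamma_const * (1 + p)\<^sup>2 * (\<integral>y. decay y \<partial>lborel)"

locale explicit_formula = grh_char + test_function +
  assumes q_ge_3: "q \<ge> 3"
begin

abbreviation Lq :: real where "Lq \<equiv> ln (real q)"

lemma Lq_ge_1: "Lq \<ge> 1"
proof -
  have "exp 1 \<le> real q" using exp_le q_ge_3 by linarith
  then show ?thesis using q_ge_3 by (subst ln_ge_iff) auto
qed

lemma Lq_pos: "Lq > 0" using Lq_ge_1 by linarith

lemma integrable_phi_scaled: "integrable lborel (\<lambda>y. phi (Lq * y))"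
  using lborel_integrable_real_affine[OF integrable_phi, of Lq 0] Lq_pos by simp

lemma integral_phi_scaled: "(\<integral>y. phi (Lq * y) \<partial>lborel) = 4 * pi * (1 + \<sigma> * bb) / Lq"
  using lborel_integral_real_affine[of Lq phi 0] Lq_pos integral_phi by (simp add: field_simps)

lemma phi_scaled_fourier: "(\<integral>y. phi (Lq * y) *\<^sub>R iexp (- (l * y)) \<partial>lborel) = of_real (2 * pi / Lq * W (l / Lq))"
proof -
  have "of_real (2 * pi * W (l / Lq)) = (\<integral>x. phi x *\<^sub>R iexp (- (l / Lq * x)) \<partial>lborel)" by (rule phi_fourier[symmetric])
  also have "\<dots> = Lq *\<^sub>R (\<integral>y. phi (Lq * y) *\<^sub>R iexp (- (l * y)) \<partial>lborel)"
    using lborel_integral_real_affine[of Lq "\<lambda>x. phi x *\<^sub>R iexp (- (l / Lq * x))" 0] Lq_pos by simp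
  finally show ?thesis using Lq_pos by (simp add: scaleR_conv_of_real field_simps)
qed

text \<open>The test function as a holomorphic function of \<open>s\<close>, anchored at the line
  \<open>Re s = c\<close> where it takes the real values \<open>phi (Lq * y)\<close>.\<close>

definition shifted :: "real \<Rightarrow> complex \<Rightarrow> complex" where
  "shifted c s = Phi (of_real Lq * ((s - of_real c) / \<i>))"

text \<open>The factor \<open>exp (4 * Lq)\<close> is the price of moving up to two units off the
  anchor line. It serves only integrability for a fixed \<open>q\<close> and leaves no trace in the
  result.\<close>

definition shifted_const :: real where "shifted_const = 32 * exp (4 * Lq) * (1 + p)\<^sup>2"

lemma shifted_const_nonneg: "shifted_const \<ge> 0" by (simp add: shifted_const_def)

lemma shifted_line: "shifted c (of_real c + \<i> * of_real y) = of_real (phi (Lq * y))"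
  unfolding shifted_def using Phi_of_real[of "Lq * y"] by simp

lemma shifted_holomorphic: "shifted c holomorphic_on A"
  unfolding shifted_def
  by (rule holomorphic_on_compose_gen[OF _ Phi_holomorphic[of UNIV], unfolded o_def]) (auto intro!: holomorphic_intros)

lemma norm_shifted_le:
  assumes "0 \<le> c" "c \<le> Re s" "Re s \<le> 2"
  shows "cmod (shifted c s) \<le> shifted_const * inverse ((1 + \<bar>Im s\<bar>)\<^sup>2)"
proof -
  define z where "z = of_real Lq * ((s - of_real c) / \<i>)"
  have "Im z = - (Lq * (Re s - c))" by (simp add: z_def)
  then have "\<bar>Im z\<bar> = Lq * (Re s - c)" using Lq_pos assms by simp
  also have "\<dots> \<le> Lq * 2" using Lq_pos assms by (intro mult_left_mono) auto
  finally have "cmod (Phi z) \<le> 32 * exp (2 * (Lq * 2)) * (1 + p)\<^sup>2 / (1 + cmod z)\<^sup>2" by (rule norm_Phi_le)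
  also have "\<dots> \<le> 32 * exp (2 * (Lq * 2)) * (1 + p)\<^sup>2 / (1 + \<bar>Im s\<bar>)\<^sup>2"
  proof -
    have "\<bar>Im s\<bar> \<le> 1 * cmod (s - of_real c)" using abs_Im_le_cmod[of "s - of_real c"] by simp
    also have "\<dots> \<le> Lq * cmod (s - of_real c)" using Lq_ge_1 by (intro mult_right_mono) auto
    also have "\<dots> = cmod z" using Lq_pos by (simp add: z_def norm_mult norm_divide)
    finally show ?thesis by (intro divide_left_mono power_mono mult_nonneg_nonneg mult_pos_pos) (auto intro!: add_pos_nonneg zero_less_power)
  qed
  finally show ?thesis by (simp add: shifted_def z_def shifted_const_def divide_inverse)
qed

text \<open>The integral is moved to \<open>Re s = 2\<close>, where the von Mangoldt series
  converges absolutely and can be integrated term by term. Each term is then moved back to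
  \<open>Re s = c\<close>, where its integral is a Fourier transform of \<open>phi\<close> and
  vanishes for \<open>n \<ge> q\<^sup>2\<close>. The Riemann hypothesis makes the first move free of
  residues.\<close>

lemma prime_side:
  assumes h: "0 < h" "h < 1/4"
  defines "c \<equiv> 1/2 + h"
  shows "integrable lborel (\<lambda>y. of_real (phi (Lq * y)) * (deriv L (of_real c + \<i> * of_real y) / L (of_real c + \<i> * of_real y)))"
    and "(\<integral>y. of_real (phi (Lq * y)) * (deriv L (of_real c + \<i> * of_real y) / L (of_real c + \<i> * of_real y)) \<partial>lborel) =
      - (\<Sum>n=1..<q\<^sup>2. mangoldt n * \<psi> n * of_real (real n powr (-c) * (2 * pi / Lq * W (ln (real n) / Lq))))"
proof -
  let ?S = "{s. Re s > 1/2}"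
  have c: "1/2 < c" "c < 3/4" "0 \<le> c" "c \<le> 2" using h by (auto simp: c_def)
  obtain C where C: "C > 0" "\<And>s. 1/2 + h \<le> Re s \<Longrightarrow> Re s \<le> 4 \<Longrightarrow> cmod (deriv L s / L s) \<le> C * sqrt (1 + \<bar>Im s\<bar>)"
    using L_log_deriv_bound[of h] h by auto
  define f where "f s = shifted c s * (deriv L s / L s)" for s
  have Lh: "L holomorphic_on ?S" by (rule L_holomorphic) auto
  have f_hol: "f holomorphic_on ?S" unfolding f_def
    using L_nonzero by (intro holomorphic_intros shifted_holomorphic holomorphic_deriv[OF Lh] Lh convex_open_half_plane(2)) auto
  have f_bound: "cmod (f s) \<le> shifted_const * C * decay (Im s)" if s: "c \<le> Re s" "Re s \<le> 2" for s
  proof -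
    have "cmod (f s) \<le> (shifted_const * inverse ((1 + \<bar>Im s\<bar>)\<^sup>2)) * (C * sqrt (1 + \<bar>Im s\<bar>))"
      unfolding f_def norm_mult using s c C(2)[of s] shifted_const_nonneg
      by (intro mult_mono norm_shifted_le mult_nonneg_nonneg) (auto simp: c_def)
    also have "\<dots> = shifted_const * C * (sqrt (1 + \<bar>Im s\<bar>) * inverse ((1 + \<bar>Im s\<bar>)\<^sup>2))" by (simp only: mult_ac)
    also have "\<dots> = shifted_const * C * decay (Im s)" by (simp only: sqrt_times_inverse_square)
    finally show ?thesis .
  qed
  have inS: "s \<in> ?S" if "c \<le> Re s" "Re s \<le> 2" for s using that c by simp
  have f_shift: "(\<integral>y. f (of_real c + \<i> * of_real y) \<partial>lborel) = (\<integral>y. f (of_real 2 + \<i> * of_real y) \<partial>lborel)"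
    by (rule vertical_line_shift(1)[OF convex_open_half_plane(2,1) f_hol c(4)], erule (1) inS, erule (1) f_bound)
  have f_int: "integrable lborel (\<lambda>y. f (of_real d + \<i> * of_real y))" if "c \<le> d" "d \<le> 2" for d
    by (rule vertical_line_shift(2)[OF convex_open_half_plane(2,1) f_hol c(4)], erule (1) inS, erule (1) f_bound) (use that in auto)
  have fc: "f (of_real c + \<i> * of_real y) = of_real (phi (Lq * y)) * (deriv L (of_real c + \<i> * of_real y) / L (of_real c + \<i> * of_real y))" for y
    unfolding f_def shifted_line ..
  show "integrable lborel (\<lambda>y. of_real (phi (Lq * y)) * (deriv L (of_real c + \<i> * of_real y) / L (of_real c + \<i> * of_real y)))"
    using f_int[OF order_refl c(4)] unfolding fc .
  define a where "a n s = mangoldt n * \<psi> n / of_nat n powr s" for n s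
  define g where "g n s = shifted c s * a n s" for n s
  have a_bound: "cmod (a n s) \<le> ln (real n) * real n powr - Re s" for n s unfolding a_def by (rule norm_mangoldt_term)
  have g_hol: "g n holomorphic_on ?S" for n
  proof (cases "n = 0")
    case True
    then have "g n = (\<lambda>s. 0)" by (auto simp: g_def a_def)
    then show ?thesis by simp
  next
    case False
    then show ?thesis unfolding g_def a_def by (intro holomorphic_intros shifted_holomorphic) auto
  qed
  have g_bound: "cmod (g n s) \<le> shifted_const * ln (real n) * decay (Im s)" if s: "c \<le> Re s" "Re s \<le> 2" for n s
  proof (cases "n = 0")
    case True then show ?thesis by (simp add: g_def a_def)
  next
    case False
    have "real n powr - Re s \<le> real n powr 0" using False s c by (intro powr_mono) auto
    then have "ln (real n) * real n powr - Re s \<le> ln (real n) * 1" using False by (intro mult_left_mono) auto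
    then have "cmod (a n s) \<le> ln (real n)" using a_bound[of n s] by linarith
    then have "cmod (g n s) \<le> (shifted_const * inverse ((1 + \<bar>Im s\<bar>)\<^sup>2)) * ln (real n)"
      unfolding g_def norm_mult using s c shifted_const_nonneg by (intro mult_mono norm_shifted_le mult_nonneg_nonneg) auto
    also have "\<dots> = shifted_const * ln (real n) * inverse ((1 + \<bar>Im s\<bar>)\<^sup>2)" by (simp only: mult_ac)
    also have "\<dots> \<le> shifted_const * ln (real n) * decay (Im s)" using shifted_const_nonneg False by (intro mult_left_mono inverse_square_le_decay) auto
    finally show ?thesis .
  qed
  have g_shift: "(\<integral>y. g n (of_real c + \<i> * of_real y) \<partial>lborel) = (\<integral>y. g n (of_real 2 + \<i> * of_real y) \<partial>lborel)" for n
    by (rule vertical_line_shift(1)[OF convex_open_half_plane(2,1) g_hol c(4)], erule (1) inS, erule (1) g_bound)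
  have g_int: "integrable lborel (\<lambda>y. g n (of_real d + \<i> * of_real y))" if "c \<le> d" "d \<le> 2" for d n
    by (rule vertical_line_shift(2)[OF convex_open_half_plane(2,1) g_hol c(4)], erule (1) inS, erule (1) g_bound) (use that in auto)
  define T where "T n = mangoldt n * \<psi> n * of_real (real n powr (-c) * (2 * pi / Lq * W (ln (real n) / Lq)))" for n
  have g_val: "(\<integral>y. g n (of_real c + \<i> * of_real y) \<partial>lborel) = T n" for n
  proof (cases "n = 0")
    case True then show ?thesis by (simp add: g_def a_def T_def)
  next
    case False
    have "g n (of_real c + \<i> * of_real y) = (mangoldt n * \<psi> n * of_real (real n powr (-c))) * (phi (Lq * y) *\<^sub>R iexp (- (ln (real n) * y)))" for y
    proof -
      have "of_nat n powr (of_real c + \<i> * of_real y) = of_nat n powr of_real c * of_nat n powr (\<i> * of_real y)" by (rule powr_add)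
      also have "(of_nat n :: complex) powr of_real c = of_real (real n powr c)" using powr_of_real[of "real n" c] by simp
      also have "of_nat n powr (\<i> * of_real y) = iexp (ln (real n) * y)"
        using False by (simp add: powr_def Ln_of_nat mult_ac)
      finally have "inverse (of_nat n powr (of_real c + \<i> * of_real y)) = of_real (real n powr (-c)) * iexp (- (ln (real n) * y))"
        by (simp add: powr_minus exp_minus)
      then show ?thesis by (simp add: g_def a_def shifted_line divide_inverse scaleR_conv_of_real)
    qed
    then have "(\<integral>y. g n (of_real c + \<i> * of_real y) \<partial>lborel) = (\<integral>y. (mangoldt n * \<psi> n * of_real (real n powr (-c))) * (phi (Lq * y) *\<^sub>R iexp (- (ln (real n) * y))) \<partial>lborel)"
      by (simp only:)
    also have "\<dots> = (mangoldt n * \<psi> n * of_real (real n powr (-c))) * (\<integral>y. phi (Lq * y) *\<^sub>R iexp (- (ln (real n) * y)) \<partial>lborel)"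
      by (rule Bochner_Integration.integral_mult_right_zero)
    also have "\<dots> = T n" unfolding phi_scaled_fourier T_def by (simp only: of_real_mult mult.assoc)
    finally show ?thesis .
  qed
  have int2: "integrable lborel (\<lambda>y. g n (of_real 2 + \<i> * of_real y))" for n
    by (rule g_int[OF c(4) order_refl])
  have sums: "(\<lambda>n. \<integral>y. g n (of_real 2 + \<i> * of_real y) \<partial>lborel) sums (\<integral>y. (\<Sum>n. g n (of_real 2 + \<i> * of_real y)) \<partial>lborel)"
  proof (rule sums_integral[OF int2])
    have sm: "summable (\<lambda>n. ln (real n) * real n powr - 2)" using summable_log_powr[of 2] by simp
    have nb: "norm (g n (of_real 2 + \<i> * of_real y)) \<le> (shifted_const * decay y) * (ln (real n) * real n powr -2)" for n y
    proof -
      have "cmod (shifted c (of_real 2 + \<i> * of_real y)) \<le> shifted_const * inverse ((1 + \<bar>y\<bar>)\<^sup>2)"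
        using norm_shifted_le[of c "of_real 2 + \<i> * of_real y"] c by simp
      also have "\<dots> \<le> shifted_const * decay y" by (intro mult_left_mono inverse_square_le_decay shifted_const_nonneg)
      finally have "cmod (shifted c (of_real 2 + \<i> * of_real y)) \<le> shifted_const * decay y" .
      moreover have "cmod (a n (of_real 2 + \<i> * of_real y)) \<le> ln (real n) * real n powr -2"
        using a_bound[of n "of_real 2 + \<i> * of_real y"] by simp
      ultimately show ?thesis unfolding g_def norm_mult
        using shifted_const_nonneg decay_nonneg by (intro mult_mono mult_nonneg_nonneg) auto
    qed
    show "AE y in lborel. summable (\<lambda>n. norm (g n (of_real 2 + \<i> * of_real y)))"
      by (intro AE_I2 summable_comparison_test'[OF summable_mult[OF sm]]) (use nb in auto)
    show "summable (\<lambda>n. \<integral>y. norm (g n (of_real 2 + \<i> * of_real y)) \<partial>lborel)"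
    proof (rule summable_comparison_test'[OF summable_mult[OF sm, of "shifted_const * (\<integral>y. decay y \<partial>lborel)"]])
      fix n
      have "(\<integral>y. norm (g n (of_real 2 + \<i> * of_real y)) \<partial>lborel) \<le> (\<integral>y. (shifted_const * decay y) * (ln (real n) * real n powr -2) \<partial>lborel)"
        using integrable_decay by (intro integral_mono integrable_norm int2 nb Bochner_Integration.integrable_mult_left Bochner_Integration.integrable_mult_right)
      also have "\<dots> = shifted_const * (\<integral>y. decay y \<partial>lborel) * (ln (real n) * real n powr -2)" by simp
      finally show "norm (\<integral>y. norm (g n (of_real 2 + \<i> * of_real y)) \<partial>lborel) \<le> shifted_const * (\<integral>y. decay y \<partial>lborel) * (ln (real n) * real n powr -2)"
        by simp
    qed
  qed
  have inner: "(\<Sum>n. g n (of_real 2 + \<i> * of_real y)) = - f (of_real 2 + \<i> * of_real y)" for y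
  proof -
    have "(\<lambda>n. g n (of_real 2 + \<i> * of_real y)) sums (shifted c (of_real 2 + \<i> * of_real y) * Dlog (of_real 2 + \<i> * of_real y))"
      unfolding g_def a_def by (intro sums_mult Dlog_sums) simp
    moreover have "deriv L (of_real 2 + \<i> * of_real y) / L (of_real 2 + \<i> * of_real y) = - Dlog (of_real 2 + \<i> * of_real y)"
      by (rule deriv_L_over_L) simp
    ultimately show ?thesis unfolding f_def by (simp add: sums_iff)
  qed
  have "T sums (- (\<integral>y. f (of_real 2 + \<i> * of_real y) \<partial>lborel))"
    using sums unfolding inner g_shift[symmetric] g_val by simp
  \<comment> \<open>The support of \<open>W\<close> in \<open>[-2, 2]\<close> becomes
    \<open>ln n < 2 * ln q\<close>, which leaves a finite sum.\<close>
  moreover have "T sums (\<Sum>n\<in>{1..<q\<^sup>2}. T n)"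
  proof (rule sums_finite)
    fix n assume n: "n \<notin> {1..<q\<^sup>2}"
    show "T n = 0"
    proof (cases "n = 0")
      case False
      then have "q\<^sup>2 \<le> n" using n by simp
      then have "ln (real (q\<^sup>2)) \<le> ln (real n)" using q_ge_3 False by (subst ln_le_cancel_iff) (auto simp del: of_nat_power)
      moreover have "ln (real (q\<^sup>2)) = 2 * Lq" using q_ge_3 by (simp add: ln_realpow)
      ultimately have "2 \<le> ln (real n) / Lq" using Lq_pos by (simp add: le_divide_eq)
      then have "W (ln (real n) / Lq) = 0" by (intro W_zero) linarith
      then show ?thesis by (simp add: T_def)
    qed (simp add: T_def)
  qed simp
  ultimately have "- (\<integral>y. f (of_real 2 + \<i> * of_real y) \<partial>lborel) = (\<Sum>n\<in>{1..<q\<^sup>2}. T n)" by (rule sums_unique2)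
  then have "(\<integral>y. f (of_real c + \<i> * of_real y) \<partial>lborel) = - (\<Sum>n=1..<q\<^sup>2. T n)"
    unfolding f_shift by (metis minus_minus)
  then show "(\<integral>y. of_real (phi (Lq * y)) * (deriv L (of_real c + \<i> * of_real y) / L (of_real c + \<i> * of_real y)) \<partial>lborel) =
      - (\<Sum>n=1..<q\<^sup>2. mangoldt n * \<psi> n * of_real (real n powr (-c) * (2 * pi / Lq * W (ln (real n) / Lq))))"
    unfolding fc T_def .
qed

section \<open>The weighted integral of the logarithmic derivative of \<open>xi\<close>\<close>

abbreviation pt :: "real \<Rightarrow> real \<Rightarrow> complex" where "pt h y \<equiv> of_real (1/2 + h) + \<i> * of_real y"

lemma norm_Digamma_pt:
  assumes h: "0 < h" "h < 1/4"
  shows "cmod (Digamma ((pt h y + of_real par) / 2)) \<le> digamma_const * (1 + sqrt (1 + \<bar>y\<bar>))"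
proof -
  let ?z = "(pt h y + of_real par) / 2"
  have "cmod (pt h y + of_real par) \<le> \<bar>Re (pt h y + of_real par)\<bar> + \<bar>Im (pt h y + of_real par)\<bar>" by (rule cmod_le)
  then have "cmod ?z \<le> 1 + \<bar>y\<bar>" using h par_nonneg par_le by (simp add: norm_divide)
  then have "1 + sqrt (cmod ?z) \<le> 1 + sqrt (1 + \<bar>y\<bar>)" by simp
  then have "digamma_const * (1 + sqrt (cmod ?z)) \<le> digamma_const * (1 + sqrt (1 + \<bar>y\<bar>))"
    using digamma_const(1) by (intro mult_left_mono) auto
  moreover have "cmod (Digamma ?z) \<le> digamma_const * (1 + sqrt (cmod ?z))"
    using h par_nonneg by (intro digamma_const(2)) simp
  ultimately show ?thesis by linarith
qed

text \<open>Of the three parts of the logarithmic derivative, the conductor gives the main term and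
  the L-function the prime sum. The Digamma part, square-root growth against
  \<open>phi (Lq * y)\<close>, is integrated in the variable \<open>Lq * y\<close> and so gains
  \<open>1 / Lq\<close>.\<close>

lemma xi_integral:
  assumes h: "0 < h" "h < 1/4"
  shows "integrable lborel (\<lambda>y. phi (Lq * y) * Re (deriv xi (pt h y) / xi (pt h y)))"
    and "(\<integral>y. phi (Lq * y) * Re (deriv xi (pt h y) / xi (pt h y)) \<partial>lborel) \<le>
      ln (real q / pi) / 2 * (4 * pi * (1 + \<sigma> * bb) / Lq) + digamma_err / Lq
      - Re (\<Sum>n=1..<q\<^sup>2. mangoldt n * \<psi> n * of_real (real n powr (-(1/2 + h)) * (2 * pi / Lq * W (ln (real n) / Lq))))"
proof -
  define D where "D y = phi (Lq * y) * (Re (Digamma ((pt h y + of_real par) / 2)) / 2)" for y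
  define E where "E = 32 * digamma_const * (1 + p)\<^sup>2"
  have E0: "E \<ge> 0" using digamma_const(1) by (simp add: E_def)
  have D_le: "\<bar>D y\<bar> \<le> E * decay (Lq * y)" for y
  proof -
    have "\<bar>y\<bar> \<le> \<bar>Lq * y\<bar>" using Lq_ge_1 mult_right_mono[of 1 Lq "\<bar>y\<bar>"] by (simp add: abs_mult)
    then have "sqrt (1 + \<bar>y\<bar>) \<le> sqrt (1 + \<bar>Lq * y\<bar>)" by simp
    moreover have "1 \<le> sqrt (1 + \<bar>Lq * y\<bar>)" by simp
    ultimately have "1 + sqrt (1 + \<bar>y\<bar>) \<le> 2 * sqrt (1 + \<bar>Lq * y\<bar>)" by linarith
    then have "digamma_const * (1 + sqrt (1 + \<bar>y\<bar>)) \<le> digamma_const * (2 * sqrt (1 + \<bar>Lq * y\<bar>))"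
      using digamma_const(1) by (intro mult_left_mono) auto
    then have "\<bar>Re (Digamma ((pt h y + of_real par) / 2)) / 2\<bar> \<le> digamma_const * sqrt (1 + \<bar>Lq * y\<bar>)"
      using norm_Digamma_pt[OF h, of y] abs_Re_le_cmod[of "Digamma ((pt h y + of_real par) / 2)"] by simp
    then have "\<bar>D y\<bar> \<le> (32 * (1 + p)\<^sup>2 / (1 + \<bar>Lq * y\<bar>)\<^sup>2) * (digamma_const * sqrt (1 + \<bar>Lq * y\<bar>))"
    proof -
      assume a: "\<bar>Re (Digamma ((pt h y + of_real par) / 2)) / 2\<bar> \<le> digamma_const * sqrt (1 + \<bar>Lq * y\<bar>)"
      have "\<bar>D y\<bar> = phi (Lq * y) * \<bar>Re (Digamma ((pt h y + of_real par) / 2)) / 2\<bar>"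
        by (simp only: D_def abs_mult abs_of_nonneg[OF phi_nonneg])
      also have "\<dots> \<le> (32 * (1 + p)\<^sup>2 / (1 + \<bar>Lq * y\<bar>)\<^sup>2) * (digamma_const * sqrt (1 + \<bar>Lq * y\<bar>))"
        by (rule mult_mono[OF phi_le a]) auto
      finally show ?thesis .
    qed
    also have "\<dots> = E * (sqrt (1 + \<bar>Lq * y\<bar>) * inverse ((1 + \<bar>Lq * y\<bar>)\<^sup>2))"
      unfolding E_def by (simp only: divide_inverse mult_ac)
    also have "\<dots> = E * decay (Lq * y)" by (simp only: sqrt_times_inverse_square)
    finally show ?thesis .
  qed
  have idec: "integrable lborel (\<lambda>y. E * decay (Lq * y))"
    using lborel_integrable_real_affine[OF integrable_decay, of Lq 0] Lq_pos by simp
  have "continuous_on UNIV (\<lambda>y. Digamma ((pt h y + of_real par) / 2))"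
    by (rule continuous_on_compose2[OF continuous_on_Polygamma[of "{z. Re z > 0}"]])
      (use h par_nonneg in \<open>auto intro!: continuous_intros elim!: nonpos_Ints_cases\<close>)
  then have "continuous_on UNIV D"
    unfolding D_def by (intro continuous_intros continuous_on_compose2[OF continuous_phi[of UNIV]]) auto
  then have "D \<in> borel_measurable borel" by (rule borel_measurable_continuous_onI)
  then have iD: "integrable lborel D"
    by (intro Bochner_Integration.integrable_bound[OF idec]) (use D_le E0 decay_nonneg in \<open>auto intro!: AE_I2\<close>)
  have intD: "(\<integral>y. D y \<partial>lborel) \<le> digamma_err / Lq"
  proof -
    have "(\<integral>y. D y \<partial>lborel) \<le> (\<integral>y. E * decay (Lq * y) \<partial>lborel)"
      using D_le by (intro integral_mono iD idec) (simp add: abs_le_iff)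
    also have "\<dots> = E * (\<integral>y. decay (Lq * y) \<partial>lborel)" by simp
    also have "(\<integral>y. decay (Lq * y) \<partial>lborel) = (\<integral>y. decay y \<partial>lborel) / Lq"
      using lborel_integral_real_affine[of Lq decay 0] Lq_pos by (simp add: field_simps)
    finally show ?thesis by (simp add: E_def digamma_err_def)
  qed
  let ?P = "\<lambda>y. of_real (phi (Lq * y)) * (deriv L (pt h y) / L (pt h y))"
  note ps = prime_side[OF h]
  have eq: "phi (Lq * y) * Re (deriv xi (pt h y) / xi (pt h y)) = ln (real q / pi) / 2 * phi (Lq * y) + D y + Re (?P y)" for y
  proof -
    have "Re (deriv xi (pt h y) / xi (pt h y)) = ln (real q / pi) / 2 + Re (Digamma ((pt h y + of_real par) / 2)) / 2 + Re (deriv L (pt h y) / L (pt h y))"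
      using xi_log_deriv[of "pt h y"] h by simp
    moreover have "Re (?P y) = phi (Lq * y) * Re (deriv L (pt h y) / L (pt h y))" by (simp only: Re_complex_of_real Im_complex_of_real times_complex.sel mult_zero_left diff_0_right)
    ultimately show ?thesis unfolding D_def by (simp only: distrib_left mult_ac)
  qed
  have i1: "integrable lborel (\<lambda>y. ln (real q / pi) / 2 * phi (Lq * y))" using integrable_phi_scaled by simp
  have i3: "integrable lborel (\<lambda>y. Re (?P y))" by (rule integrable_Re[OF ps(1)])
  show "integrable lborel (\<lambda>y. phi (Lq * y) * Re (deriv xi (pt h y) / xi (pt h y)))"
    unfolding eq by (intro Bochner_Integration.integrable_add i1 iD i3)
  have "(\<integral>y. phi (Lq * y) * Re (deriv xi (pt h y) / xi (pt h y)) \<partial>lborel) =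
      (\<integral>y. ln (real q / pi) / 2 * phi (Lq * y) \<partial>lborel) + (\<integral>y. D y \<partial>lborel) + (\<integral>y. Re (?P y) \<partial>lborel)"
    unfolding eq by (simp only: Bochner_Integration.integral_add[OF Bochner_Integration.integrable_add[OF i1 iD] i3] Bochner_Integration.integral_add[OF i1 iD])
  also have "(\<integral>y. ln (real q / pi) / 2 * phi (Lq * y) \<partial>lborel) = ln (real q / pi) / 2 * (4 * pi * (1 + \<sigma> * bb) / Lq)"
    by (simp only: Bochner_Integration.integral_mult_right_zero integral_phi_scaled)
  also have "(\<integral>y. Re (?P y) \<partial>lborel) = Re (\<integral>y. ?P y \<partial>lborel)" by (rule integral_Re[OF ps(1)])
  also have "(\<integral>y. ?P y \<partial>lborel) = - (\<Sum>n=1..<q\<^sup>2. mangoldt n * \<psi> n * of_real (real n powr (-(1/2 + h)) * (2 * pi / Lq * W (ln (real n) / Lq))))"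
    by (rule ps(2))
  finally show "(\<integral>y. phi (Lq * y) * Re (deriv xi (pt h y) / xi (pt h y)) \<partial>lborel) \<le>
      ln (real q / pi) / 2 * (4 * pi * (1 + \<sigma> * bb) / Lq) + digamma_err / Lq
      - Re (\<Sum>n=1..<q\<^sup>2. mangoldt n * \<psi> n * of_real (real n powr (-(1/2 + h)) * (2 * pi / Lq * W (ln (real n) / Lq))))"
    using intD by (simp only: uminus_complex.sel)
qed

lemma zorder_L_nonneg: "zorder L (pt 0 \<gamma>) \<ge> 0"
proof -
  have ex: "\<exists>w\<in>{s. Re s > 0}. L w \<noteq> 0" using L_nonzero[of 2] by (intro bexI[of _ 2]) auto
  have "pt 0 \<gamma> \<in> {s. Re s > 0}" by simp
  from log_deriv_local[OF abel_series_holomorphic convex_open_half_plane(2,3) this ex] show ?thesis by (rule conjunct1)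
qed

text \<open>Near a point of the critical line the singular part of the logarithmic derivative is the
  Poisson kernel times the order; all else is bounded below. The hypothesis on \<open>q\<close> lets
  the conductor term be dropped.\<close>

lemma xi_log_deriv_near_zero:
  assumes q: "ln (real q / pi) \<ge> 0"
  shows "\<exists>r B. 0 < r \<and> r \<le> 1/4 \<and> B \<ge> 0 \<and> (\<forall>h y. 0 < h \<longrightarrow> h < r \<longrightarrow> \<bar>y - \<gamma>\<bar> < r \<longrightarrow>
     Re (deriv xi (pt h y) / xi (pt h y)) \<ge> real_of_int (zorder L (pt 0 \<gamma>)) * (h / (h\<^sup>2 + (y - \<gamma>)\<^sup>2)) - B)"
proof -
  define \<rho> where "\<rho> = pt 0 \<gamma>"
  define m where "m = zorder L \<rho>"
  have ex: "\<exists>w\<in>{s. Re s > 0}. L w \<noteq> 0" using L_nonzero[of 2] by (intro bexI[of _ 2]) auto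
  obtain r0 H where r0: "r0 > 0" "H holomorphic_on ball \<rho> r0"
    "\<And>w. w \<in> ball \<rho> r0 - {\<rho>} \<Longrightarrow> L w \<noteq> 0 \<and> deriv L w / L w = of_int m / (w - \<rho>) + H w"
    using log_deriv_local[OF abel_series_holomorphic convex_open_half_plane(2,3) _ ex, of \<rho>] unfolding m_def by (auto simp: \<rho>_def)
  have "compact (H ` cball \<rho> (r0 / 2))"
    using r0 by (intro compact_continuous_image continuous_on_subset[OF holomorphic_on_imp_continuous_on[OF r0(2)]]) auto
  from compact_imp_bounded[OF this] obtain B1 where "\<forall>x\<in>H ` cball \<rho> (r0 / 2). cmod x \<le> B1"
    unfolding bounded_iff by blast
  then have B1: "\<And>w. w \<in> cball \<rho> (r0 / 2) \<Longrightarrow> cmod (H w) \<le> B1" by blast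
  have B10: "B1 \<ge> 0" using B1[of \<rho>] r0(1) norm_ge_zero[of "H \<rho>"] by (simp only: mem_cball dist_self) linarith
  define r where "r = min (1/4) (r0 / 4)"
  define B where "B = B1 + digamma_const * (1 + sqrt (2 + \<bar>\<gamma>\<bar>)) / 2"
  have r: "0 < r" "r \<le> 1/4" "r \<le> r0 / 4" using r0 by (auto simp: r_def)
  have "B \<ge> 0" using B10 digamma_const(1) by (simp add: B_def)
  moreover have "Re (deriv xi (pt h y) / xi (pt h y)) \<ge> real_of_int m * (h / (h\<^sup>2 + (y - \<gamma>)\<^sup>2)) - B"
    if hy: "0 < h" "h < r" "\<bar>y - \<gamma>\<bar> < r" for h y
  proof -
    let ?w = "pt h y"
    have h4: "h < 1/4" using hy r by linarith
    have d: "?w - \<rho> = Complex h (y - \<gamma>)" by (simp add: \<rho>_def complex_eq_iff)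
    have "cmod (?w - \<rho>) \<le> \<bar>h\<bar> + \<bar>y - \<gamma>\<bar>" unfolding d using cmod_le[of "Complex h (y - \<gamma>)"] by simp
    then have dist: "cmod (?w - \<rho>) < r0 / 2" using hy r by linarith
    have ne: "?w \<noteq> \<rho>" using d hy by (auto simp: complex_eq_iff)
    have "?w \<in> ball \<rho> r0 - {\<rho>}" using dist ne r0(1) by (simp add: dist_norm norm_minus_commute)
    then have "deriv L ?w / L ?w = of_int m / (?w - \<rho>) + H ?w" using r0(3) by blast
    moreover have "Re (of_int m / (?w - \<rho>)) = real_of_int m * (h / (h\<^sup>2 + (y - \<gamma>)\<^sup>2))"
      unfolding d by (simp add: Re_divide)
    moreover have "cmod (H ?w) \<le> B1" using dist by (intro B1) (simp add: dist_norm norm_minus_commute)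
    then have "Re (H ?w) \<ge> - B1" using abs_Re_le_cmod[of "H ?w"] by linarith
    ultimately have 1: "Re (deriv L ?w / L ?w) \<ge> real_of_int m * (h / (h\<^sup>2 + (y - \<gamma>)\<^sup>2)) - B1" by simp
    have "digamma_const * (1 + sqrt (1 + \<bar>y\<bar>)) \<le> digamma_const * (1 + sqrt (2 + \<bar>\<gamma>\<bar>))"
      using digamma_const(1) hy r by (intro mult_left_mono) auto
    then have "Re (Digamma ((?w + of_real par) / 2)) \<ge> - (digamma_const * (1 + sqrt (2 + \<bar>\<gamma>\<bar>)))"
      using norm_Digamma_pt[OF hy(1) h4, of y] abs_Re_le_cmod[of "Digamma ((?w + of_real par) / 2)"] by linarith
    moreover have "Re (deriv xi ?w / xi ?w) = ln (real q / pi) / 2 + Re (Digamma ((?w + of_real par) / 2)) / 2 + Re (deriv L ?w / L ?w)"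
      using xi_log_deriv[of ?w] hy by simp
    ultimately show ?thesis using 1 q unfolding B_def by argo
  qed
  ultimately show ?thesis using r unfolding m_def \<rho>_def by blast
qed

text \<open>Positivity allows the integral to be cut down to small intervals about the two heights;
  all other zeros are discarded by sign, without being enumerated.\<close>

lemma zero_side:
  assumes q: "ln (real q / pi) \<ge> 1 + 2 * logsum" and \<epsilon>: "\<epsilon> > 0"
  shows "\<forall>\<^sub>F h in at_right 0. pi * (real_of_int (zorder L (pt 0 (p / Lq))) + real_of_int (zorder L (pt 0 (- (p / Lq))))) * phi p - \<epsilon>
     \<le> (\<integral>y. phi (Lq * y) * Re (deriv xi (pt h y) / xi (pt h y)) \<partial>lborel)"
proof -
  define \<gamma> where "\<gamma> = p / Lq"
  have \<gamma>: "\<gamma> > 0" using p_pos Lq_pos by (simp add: \<gamma>_def)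
  have q0: "ln (real q / pi) \<ge> 0" using q logsum_nonneg by linarith
  let ?f = "\<lambda>h y. phi (Lq * y) * Re (deriv xi (pt h y) / xi (pt h y))"
  have wc: "continuous_on UNIV (\<lambda>y. phi (Lq * y))"
    by (intro continuous_on_compose2[OF continuous_phi[of UNIV]] continuous_intros) auto
  have si: "set_integrable lborel A (?f h)" if "0 < h" "h < 1/4" "A \<in> sets borel" for A h
    unfolding set_integrable_def using that by (intro integrable_mult_indicator xi_integral(1)) auto
  have local: "\<exists>\<delta>0>0. \<forall>\<delta>. 0 < \<delta> \<longrightarrow> \<delta> < \<delta>0 \<longrightarrow>
    (\<forall>\<^sub>F h in at_right 0. (LBINT y:{g-\<delta>..g+\<delta>}. ?f h y) \<ge> pi * real_of_int (zorder L (pt 0 g)) * phi (Lq * g) - \<epsilon> / 2)" for g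
  proof -
    obtain r B where rB: "0 < r" "r \<le> 1/4" "B \<ge> 0"
      "\<And>h y. 0 < h \<Longrightarrow> h < r \<Longrightarrow> \<bar>y - g\<bar> < r \<Longrightarrow> Re (deriv xi (pt h y) / xi (pt h y)) \<ge> real_of_int (zorder L (pt 0 g)) * (h / (h\<^sup>2 + (y - g)\<^sup>2)) - B"
      using xi_log_deriv_near_zero[OF q0, of g] by auto
    have m0: "real_of_int (zorder L (pt 0 g)) \<ge> 0" using zorder_L_nonneg[of g] by linarith
    have int: "set_integrable lborel {g-\<delta>..g+\<delta>} (?f h)" if "0 < h" "h < r" for h \<delta>
      using that rB(2) by (intro si) auto
    have e2: "\<epsilon> / 2 > 0" using \<epsilon> by simp
    show ?thesis
      by (rule poisson_kernel_lower_bound[where w = "\<lambda>y. phi (Lq * y)" and u = "\<lambda>h y. Re (deriv xi (pt h y) / xi (pt h y))" and r = r and B = B, OF wc phi_nonneg m0 rB(1,3,4) int e2])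
  qed
  obtain d1 where d1: "d1 > 0" "\<And>\<delta>. 0 < \<delta> \<Longrightarrow> \<delta> < d1 \<Longrightarrow>
    (\<forall>\<^sub>F h in at_right 0. (LBINT y:{\<gamma>-\<delta>..\<gamma>+\<delta>}. ?f h y) \<ge> pi * real_of_int (zorder L (pt 0 \<gamma>)) * phi (Lq * \<gamma>) - \<epsilon> / 2)"
    using local[of \<gamma>] by blast
  obtain d2 where d2: "d2 > 0" "\<And>\<delta>. 0 < \<delta> \<Longrightarrow> \<delta> < d2 \<Longrightarrow>
    (\<forall>\<^sub>F h in at_right 0. (LBINT y:{-\<gamma>-\<delta>..-\<gamma>+\<delta>}. ?f h y) \<ge> pi * real_of_int (zorder L (pt 0 (-\<gamma>))) * phi (Lq * (-\<gamma>)) - \<epsilon> / 2)"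
    using local[of "-\<gamma>"] by blast
  \<comment> \<open>Being below \<open>\<gamma>\<close>, it keeps the intervals about
    \<open>\<gamma>\<close> and \<open>-\<gamma>\<close> disjoint, so that no mass is counted
    twice.\<close>
  define \<delta> where "\<delta> = min (min d1 d2) \<gamma> / 2"
  have \<delta>: "0 < \<delta>" "\<delta> < d1" "\<delta> < d2" "\<delta> < \<gamma>" using d1(1) d2(1) \<gamma> by (auto simp: \<delta>_def min_def)
  have ph: "phi (Lq * \<gamma>) = phi p" "phi (Lq * (-\<gamma>)) = phi p" using Lq_pos phi_at_p by (simp_all add: \<gamma>_def)
  have "\<forall>\<^sub>F h in at_right (0::real). h \<in> {0<..<1/4}" by (rule eventually_at_right_real) simp
  then show ?thesis using d1(2)[OF \<delta>(1,2)] d2(2)[OF \<delta>(1,3)]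
  proof eventually_elim
    case (elim h)
    have h: "0 < h" "h < 1/4" using elim(1) by auto
    let ?A = "{\<gamma>-\<delta>..\<gamma>+\<delta>}" and ?B = "{-\<gamma>-\<delta>..-\<gamma>+\<delta>}"
    have iA: "integrable lborel (\<lambda>y. indicator ?A y *\<^sub>R ?f h y)" and iB: "integrable lborel (\<lambda>y. indicator ?B y *\<^sub>R ?f h y)"
      using si[OF h, of ?A] si[OF h, of ?B] unfolding set_integrable_def by auto
    have "(LBINT y:?A. ?f h y) + (LBINT y:?B. ?f h y) = (\<integral>y. indicator ?A y *\<^sub>R ?f h y + indicator ?B y *\<^sub>R ?f h y \<partial>lborel)"
      unfolding set_lebesgue_integral_def by (rule Bochner_Integration.integral_add[OF iA iB, symmetric])
    also have "\<dots> \<le> (\<integral>y. ?f h y \<partial>lborel)"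
    proof (rule integral_mono[OF Bochner_Integration.integrable_add[OF iA iB] xi_integral(1)[OF h]])
      fix y
      have "?f h y \<ge> 0" using xi_log_deriv_nonneg[OF q, of "pt h y"] h by (intro mult_nonneg_nonneg phi_nonneg) auto
      moreover have "\<not> (y \<in> ?A \<and> y \<in> ?B)" using \<delta> by auto
      ultimately show "indicator ?A y *\<^sub>R ?f h y + indicator ?B y *\<^sub>R ?f h y \<le> ?f h y"
        by (cases "y \<in> ?A"; cases "y \<in> ?B") (simp_all only: indicator_simps scaleR_one scaleR_zero_left add_0_left add_0_right simp_thms order_refl)
    qed
    finally have "pi * real_of_int (zorder L (pt 0 \<gamma>)) * phi p - \<epsilon> / 2 + (pi * real_of_int (zorder L (pt 0 (-\<gamma>))) * phi p - \<epsilon> / 2) \<le> (\<integral>y. ?f h y \<partial>lborel)"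
      using elim(2,3) unfolding ph by linarith
    moreover have "pi * (real_of_int (zorder L (pt 0 \<gamma>)) + real_of_int (zorder L (pt 0 (-\<gamma>)))) * phi p - \<epsilon> =
      pi * real_of_int (zorder L (pt 0 \<gamma>)) * phi p - \<epsilon> / 2 + (pi * real_of_int (zorder L (pt 0 (-\<gamma>))) * phi p - \<epsilon> / 2)"
      by (simp add: algebra_simps)
    ultimately show ?case unfolding \<gamma>_def by (simp only:)
  qed
qed

text \<open>The offset \<open>h\<close> is kept on the right: the averaged prime sum is bounded
  uniformly in \<open>h > 0\<close>, and any sufficiently small \<open>h\<close> will do.\<close>

lemma explicit_inequality:
  assumes q: "ln (real q / pi) \<ge> 1 + 2 * logsum" and \<epsilon>: "\<epsilon> > 0"
  shows "\<forall>\<^sub>F h in at_right 0. pi * (real_of_int (zorder L (pt 0 (p / Lq))) + real_of_int (zorder L (pt 0 (- (p / Lq))))) * phi p - \<epsilon>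
     \<le> ln (real q / pi) / 2 * (4 * pi * (1 + \<sigma> * bb) / Lq) + digamma_err / Lq
      - Re (\<Sum>n=1..<q\<^sup>2. mangoldt n * \<psi> n * of_real (real n powr (-(1/2 + h)) * (2 * pi / Lq * W (ln (real n) / Lq))))"
proof -
  have "\<forall>\<^sub>F h in at_right (0::real). h \<in> {0<..<1/4}" by (rule eventually_at_right_real) simp
  with zero_side[OF q \<epsilon>] show ?thesis
  proof eventually_elim
    case (elim h)
    then show ?case using xi_integral(2)[of h] by (meson greaterThanLessThan_iff order_trans)
  qed
qed

end

section \<open>Averaging over characters\<close>

text \<open>Conjugating the local factorisation of \<open>f\<close> at \<open>z\<close> gives one of
  \<open>g\<close> at \<open>cnj z\<close> with the same exponent.\<close>

lemma zorder_cnj: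
  assumes f: "f holomorphic_on S" "open S" "connected S" "z \<in> S" "\<exists>w\<in>S. f w \<noteq> 0"
    and g: "\<And>w. cnj w \<in> S \<Longrightarrow> g w = cnj (f (cnj w))"
  shows "zorder g (cnj z) = zorder f z"
proof -
  define n k where "n = zorder f z" and "k = zor_poly f z"
  have n0: "n \<ge> 0" using zorder_exist_zero[OF f] by (auto simp: n_def split: if_splits)
  obtain r where r: "r > 0" "cball z r \<subseteq> S" "k holomorphic_on cball z r"
    "\<And>w. w \<in> cball z r \<Longrightarrow> f w = k w * (w - z) ^ nat n \<and> k w \<noteq> 0"
    using zorder_exist_zero[OF f] unfolding n_def k_def by blast
  have dc: "dist z (cnj w) = dist (cnj z) w" for w
    by (metis complex_cnj_cnj complex_cnj_diff complex_mod_cnj dist_norm)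
  have cb: "cnj w \<in> cball z r" if "w \<in> ball (cnj z) r" for w using that by (simp add: dc)
  have "zorder g (cnj z) = n"
  proof (rule zorder_eqI[of "ball (cnj z) r" "cnj z" "cnj \<circ> k \<circ> cnj"])
    show "cnj \<circ> k \<circ> cnj holomorphic_on ball (cnj z) r"
      by (intro holomorphic_on_compose_cnj_cnj holomorphic_on_subset[OF r(3)]) (use cb in auto)
    show "(cnj \<circ> k \<circ> cnj) (cnj z) \<noteq> 0" using r(1) r(4)[of z] by simp
    show "g w = (cnj \<circ> k \<circ> cnj) w * (w - cnj z) powi n" if "w \<in> ball (cnj z) r" for w
    proof -
      have "g w = cnj (k (cnj w) * (cnj w - z) ^ nat n)" using g[of w] r(4)[OF cb[OF that]] cb[OF that] r(2) by auto
      then show ?thesis using n0 by (simp add: power_int_def)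
    qed
  qed (use r in auto)
  then show ?thesis by (simp add: n_def)
qed

lemma (in nonprincipal_char) zorder_L_cnj:
  assumes "Re s > 0"
  shows "zorder (abel_series (\<lambda>n. cnj (\<psi> n))) (cnj s) = zorder L s"
proof (rule zorder_cnj[OF abel_series_holomorphic open_halfspace_Re_gt])
  show "\<exists>w\<in>{s. Re s > 0}. L w \<noteq> 0" using L_nonzero_Re_gt_1[of 2] by (intro bexI[of _ 2]) auto
  show "abel_series (\<lambda>n. cnj (\<psi> n)) w = cnj (L (cnj w))" if "cnj w \<in> {s. Re s > 0}" for w
    using abel_series_cnj[OF periodic_mean_zero, of w] that by simp
qed (use assms in \<open>auto intro!: convex_connected convex_halfspace_Re_gt\<close>)

text \<open>The order depends only on the germ, so the entire continuation may be replaced by the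
  Abel-summed series near a point of the right half-plane.\<close>

lemma (in nonprincipal_char) zorder_dirichlet_L_shift:
  assumes "Re (z + a) > 0"
  shows "zorder (\<lambda>s. dirichlet_L q \<psi> (s + a)) z = zorder L (z + a)"
proof -
  have "zorder (\<lambda>s. dirichlet_L q \<psi> (s + a)) z = zorder (dirichlet_L q \<psi>) (z + a)"
    using zorder_shift[of "\<lambda>s. dirichlet_L q \<psi> (s + a)" z] zorder_shift[of "dirichlet_L q \<psi>" "z + a"] by (simp add: add.assoc)
  also have "\<dots> = zorder L (z + a)"
  proof (rule zorder_cong)
    have "\<forall>\<^sub>F w in nhds (z + a). w \<in> {s. Re s > 0}" using assms by (intro eventually_nhds_in_open open_halfspace_Re_gt) auto
    then have "\<forall>\<^sub>F w in at (z + a). w \<in> {s. Re s > 0}" by (auto simp: eventually_at_filter elim: eventually_mono)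
    then show "\<forall>\<^sub>F w in at (z + a). dirichlet_L q \<psi> w = L w" by eventually_elim (simp add: dirichlet_L_eq)
  qed simp
  finally show ?thesis .
qed

lemma (in nonprincipal_char) zorder_dirichlet_L_ge:
  "zorder (\<lambda>s. dirichlet_L q \<psi> (s + a)) z \<ge> (if dirichlet_L q \<psi> (z + a) = 0 then 1 else 0)"
proof -
  let ?f = "\<lambda>s. dirichlet_L q \<psi> (s + a)"
  have "?f holomorphic_on UNIV"
    by (rule holomorphic_on_compose_gen[OF _ dirichlet_L_holomorphic, unfolded o_def]) (auto intro!: holomorphic_intros)
  moreover have "\<exists>w\<in>UNIV. ?f w \<noteq> 0"
    using L_nonzero_Re_gt_1[of 2] dirichlet_L_eq[of 2] by (intro bexI[of _ "2 - a"]) auto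
  ultimately have "if ?f z = 0 then zorder ?f z > 0 else zorder ?f z = 0"
    using zorder_exist_zero[of ?f UNIV z] open_UNIV connected_UNIV UNIV_I by blast
  then show ?thesis by (simp split: if_splits)
qed

lemma GRH_mod_grh_char:
  assumes "prime q" "GRH_mod q" "\<psi> \<in> nonprincipal_chars q"
  shows "grh_char q \<psi>"
proof -
  interpret nonprincipal_char q \<psi> using assms by (intro nonprincipal_charsD)
  show ?thesis
  proof
    fix s assume "0 < Re s" "Re s < 1" "L s = 0"
    then show "Re s = 1/2" using assms(2) char dirichlet_L_eq[of s] by (auto simp: GRH_mod_def)
  qed
qed

context test_function begin

text \<open>Summing over the characters first leaves the progression \<open>n \<equiv> 1\<close>
  with weight \<open>q - 1\<close>, less the principal character. Since \<open>h > 0\<close> only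
  shrinks the powers of \<open>n\<close>, the bound holds for all \<open>h\<close> at once.\<close>

lemma prime_sum_over_chars:
  assumes q: "prime q" "q \<ge> 3" and h: "h > 0"
  shows "cmod (\<Sum>\<psi>\<in>nonprincipal_chars q. \<Sum>n=1..<q\<^sup>2. mangoldt n * \<psi> n * of_real (real n powr (-(1/2 + h)) * (2 * pi / ln (real q) * W (ln (real n) / ln (real q)))))
     \<le> 256 * pi * real q / ln (real q)"
proof -
  define V where "V n = real n powr (-(1/2 + h)) * (2 * pi / ln (real q) * W (ln (real n) / ln (real q)))" for n
  have l: "ln (real q) > 0" using q by simp
  have "(\<Sum>\<psi>\<in>nonprincipal_chars q. \<Sum>n=1..<q\<^sup>2. mangoldt n * \<psi> n * of_real (V n)) =
      (\<Sum>n=1..<q\<^sup>2. \<Sum>\<psi>\<in>nonprincipal_chars q. mangoldt n * \<psi> n * of_real (V n))" by (rule sum.swap)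
  also have "\<dots> = (\<Sum>n=1..<q\<^sup>2. mangoldt n * of_real (V n) * (\<Sum>\<psi>\<in>nonprincipal_chars q. \<psi> n))"
    by (simp add: sum_distrib_left mult_ac)
  also have "cmod \<dots> \<le> (\<Sum>n=1..<q\<^sup>2. 2 * pi / ln (real q) * (mangoldt n * real n powr (-(1/2)) * \<bar>W (ln (real n) / ln (real q))\<bar> * ((if [n = 1] (mod q) then real (q - 1) else 0) + 1)))"
  proof (rule sum_norm_le)
    fix n assume n: "n \<in> {1..<q\<^sup>2}"
    have "cmod (\<Sum>\<psi>\<in>nonprincipal_chars q. \<psi> n) \<le> cmod (if [n = 1] (mod q) then of_nat (q - 1) else 0) + cmod (principal_char q n)"
      unfolding sum_nonprincipal_chars[OF q(1)] by (rule norm_triangle_ineq4)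
    also have "\<dots> \<le> (if [n = 1] (mod q) then real (q - 1) else 0) + 1" by (auto simp: principal_char_def)
    finally have 1: "cmod (\<Sum>\<psi>\<in>nonprincipal_chars q. \<psi> n) \<le> (if [n = 1] (mod q) then real (q - 1) else 0) + 1" .
    have "real n powr (-(1/2 + h)) \<le> real n powr (-(1/2))" using n h by (intro powr_mono) auto
    then have 2: "\<bar>V n\<bar> \<le> real n powr (-(1/2)) * (2 * pi / ln (real q) * \<bar>W (ln (real n) / ln (real q))\<bar>)"
      unfolding V_def abs_mult using l by (intro mult_mono) auto
    have "cmod (mangoldt n * of_real (V n) * (\<Sum>\<psi>\<in>nonprincipal_chars q. \<psi> n)) = mangoldt n * \<bar>V n\<bar> * cmod (\<Sum>\<psi>\<in>nonprincipal_chars q. \<psi> n)"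
      by (simp add: norm_mult)
    also have "\<dots> \<le> mangoldt n * (real n powr (-(1/2)) * (2 * pi / ln (real q) * \<bar>W (ln (real n) / ln (real q))\<bar>)) * ((if [n = 1] (mod q) then real (q - 1) else 0) + 1)"
      using l by (intro mult_mono mult_left_mono 1 2 mult_nonneg_nonneg mangoldt_nonneg) auto
    finally show "cmod (mangoldt n * of_real (V n) * (\<Sum>\<psi>\<in>nonprincipal_chars q. \<psi> n)) \<le>
      2 * pi / ln (real q) * (mangoldt n * real n powr (-(1/2)) * \<bar>W (ln (real n) / ln (real q))\<bar> * ((if [n = 1] (mod q) then real (q - 1) else 0) + 1))"
      by (simp only: mult_ac)
  qed
  also have "\<dots> = 2 * pi / ln (real q) * (\<Sum>n=1..<q\<^sup>2. mangoldt n * real n powr (-(1/2)) * \<bar>W (ln (real n) / ln (real q))\<bar> * ((if [n = 1] (mod q) then real (q - 1) else 0) + 1))"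
    by (rule sum_distrib_left[symmetric])
  also have "\<dots> \<le> 2 * pi / ln (real q) * (128 * real q)" using l by (intro mult_left_mono prime_sum_bound q) auto
  finally show ?thesis unfolding V_def by simp
qed

lemma digamma_err_nonneg: "digamma_err \<ge> 0"
  using digamma_const(1) decay_nonneg by (auto simp: digamma_err_def intro!: mult_nonneg_nonneg integral_nonneg)

text \<open>Summed over the characters, the explicit inequality compares
  \<open>4 pi (1 + \<beta>)\<^sup>2\<close> times the total order at one height with
  \<open>2 pi (1 + \<beta>)\<close> times the number of characters, where
  \<open>\<beta> = \<sigma> * bb\<close>; the quotient is the stated main term.\<close>

lemma sum_zorder_le:
  assumes q: "prime q" "q \<ge> 3" "GRH_mod q" "ln (real q / pi) \<ge> 1 + 2 * logsum" and \<beta>: "\<sigma> * bb \<ge> 0"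
  shows "(\<Sum>\<psi>\<in>nonprincipal_chars q. real_of_int (zorder (abel_series \<psi>) (of_real (1/2) + \<i> * of_real (p / ln (real q)))))
     \<le> (real q - 2) / (2 * (1 + \<sigma> * bb)) + (digamma_err + 256 * pi) * real q / ln (real q)"
proof -
  define N where "N = nonprincipal_chars q"
  define \<beta> where "\<beta> = \<sigma> * bb"
  have \<beta>0: "\<beta> \<ge> 0" using \<beta> by (simp add: \<beta>_def)
  define l where "l = ln (real q)"
  have l: "l > 0" using q by (simp add: l_def)
  have finN: "finite N" and cardN: "real (card N) = real q - 2"
    using finite_nonprincipal_chars[OF q(1)] card_nonprincipal_chars[OF q(1)] q(2) by (auto simp: N_def)
  define m where "m \<psi> g = real_of_int (zorder (abel_series \<psi>) (of_real (1/2) + \<i> * of_real g))" for \<psi> g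
  define M where "M = (\<Sum>\<psi>\<in>N. m \<psi> (p / l))"
  define P where "P h \<psi> = (\<Sum>n=1..<q\<^sup>2. mangoldt n * \<psi> n * of_real (real n powr (-(1/2 + h)) * (2 * pi / l * W (ln (real n) / l))))" for h and \<psi> :: "nat \<Rightarrow> complex"
  \<comment> \<open>Conjugation of characters exchanges the two heights, so the total at
    \<open>- p / l\<close> equals that at \<open>p / l\<close> and the sum of both is
    \<open>2 * M\<close>.\<close>
  have M': "(\<Sum>\<psi>\<in>N. m \<psi> (- (p / l))) = M"
    unfolding M_def
  proof (rule sum.reindex_bij_witness[where i = "\<lambda>\<psi> n. cnj (\<psi> n)" and j = "\<lambda>\<psi> n. cnj (\<psi> n)"])
    fix \<psi> assume "\<psi> \<in> N"
    then interpret nonprincipal_char q \<psi> unfolding N_def using q(1) by (intro nonprincipal_charsD)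
    show "(\<lambda>n. cnj (\<psi> n)) \<in> N" unfolding N_def
      by (rule nonprincipal_char.in_nonprincipal_chars[OF nonprincipal_char_cnj])
    then show "(\<lambda>n. cnj (\<psi> n)) \<in> N" .
    show "m (\<lambda>n. cnj (\<psi> n)) (p / l) = m \<psi> (- (p / l))"
      unfolding m_def using zorder_L_cnj[of "of_real (1/2) + \<i> * of_real (- (p / l))"] by simp
  qed auto
  have A: "ln (real q / pi) / 2 * (4 * pi * (1 + \<beta>) / l) \<le> 2 * pi * (1 + \<beta>)"
  proof -
    have "ln (real q / pi) \<le> l" using q(2) pi_gt3 by (simp add: l_def ln_div)
    then have "ln (real q / pi) / 2 * (4 * pi * (1 + \<beta>) / l) \<le> l / 2 * (4 * pi * (1 + \<beta>) / l)"
      using \<beta>0 l by (intro mult_right_mono) auto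
    also have "\<dots> = 2 * pi * (1 + \<beta>)" using l by simp
    finally show ?thesis .
  qed
  have key: "2 * pi * M * phi p \<le> ((real q - 2) * (2 * pi * (1 + \<beta>) + digamma_err / l) + 256 * pi * real q / l) + e" if e: "e > 0" for e
  proof -
    \<comment> \<open>The tolerance is shared evenly, as there are \<open>q - 2\<close> characters.
      Their finiteness also permits a single \<open>h\<close> for all of them.\<close>
    define \<epsilon> where "\<epsilon> = e / (real q - 2)"
    have q2: "real q - 2 > 0" using q(2) by simp
    have \<epsilon>: "\<epsilon> > 0" using e q2 by (simp add: \<epsilon>_def)
    have "\<forall>\<^sub>F h in at_right 0. \<forall>\<psi>\<in>N. pi * (m \<psi> (p / l) + m \<psi> (- (p / l))) * phi p - \<epsilon>
        \<le> ln (real q / pi) / 2 * (4 * pi * (1 + \<beta>) / l) + digamma_err / l - Re (P h \<psi>)"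
    proof (rule eventually_ball_finite[OF finN], rule ballI)
      fix \<psi> assume "\<psi> \<in> N"
      then have "grh_char q \<psi>" using q by (intro GRH_mod_grh_char) (auto simp: N_def)
      then interpret grh_char q \<psi> .
      interpret explicit_formula q \<psi> p \<sigma> by unfold_locales (rule q(2))
      show "\<forall>\<^sub>F h in at_right 0. pi * (m \<psi> (p / l) + m \<psi> (- (p / l))) * phi p - \<epsilon>
        \<le> ln (real q / pi) / 2 * (4 * pi * (1 + \<beta>) / l) + digamma_err / l - Re (P h \<psi>)"
        using explicit_inequality[OF q(4) \<epsilon>] unfolding m_def P_def l_def \<beta>_def by simp
    qed
    moreover have "\<forall>\<^sub>F h in at_right (0::real). h > 0" by (rule eventually_at_right_less)
    ultimately have "\<forall>\<^sub>F h in at_right 0. h > 0 \<and> (\<forall>\<psi>\<in>N. pi * (m \<psi> (p / l) + m \<psi> (- (p / l))) * phi p - \<epsilon>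
        \<le> ln (real q / pi) / 2 * (4 * pi * (1 + \<beta>) / l) + digamma_err / l - Re (P h \<psi>))"
      by eventually_elim auto
    from eventually_happens'[OF trivial_limit_at_right_real this]
    obtain h where h: "h > 0" "\<And>\<psi>. \<psi> \<in> N \<Longrightarrow> pi * (m \<psi> (p / l) + m \<psi> (- (p / l))) * phi p - \<epsilon>
        \<le> ln (real q / pi) / 2 * (4 * pi * (1 + \<beta>) / l) + digamma_err / l - Re (P h \<psi>)"
      by blast
    have "(\<Sum>\<psi>\<in>N. pi * (m \<psi> (p / l) + m \<psi> (- (p / l))) * phi p - \<epsilon>) \<le>
        (\<Sum>\<psi>\<in>N. ln (real q / pi) / 2 * (4 * pi * (1 + \<beta>) / l) + digamma_err / l - Re (P h \<psi>))"
      by (rule sum_mono[OF h(2)])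
    also have "\<dots> \<le> (\<Sum>\<psi>\<in>N. 2 * pi * (1 + \<beta>) + digamma_err / l - Re (P h \<psi>))"
      using A by (intro sum_mono) auto
    also have "\<dots> = (real q - 2) * (2 * pi * (1 + \<beta>) + digamma_err / l) - Re (\<Sum>\<psi>\<in>N. P h \<psi>)"
      by (simp add: sum_subtractf cardN)
    finally have "(\<Sum>\<psi>\<in>N. pi * (m \<psi> (p / l) + m \<psi> (- (p / l))) * phi p - \<epsilon>) \<le>
        (real q - 2) * (2 * pi * (1 + \<beta>) + digamma_err / l) - Re (\<Sum>\<psi>\<in>N. P h \<psi>)" .
    moreover have "- Re (\<Sum>\<psi>\<in>N. P h \<psi>) \<le> 256 * pi * real q / l"
      using prime_sum_over_chars[OF q(1,2) h(1)] abs_Re_le_cmod[of "\<Sum>\<psi>\<in>N. P h \<psi>"] unfolding P_def N_def l_def by linarith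
    ultimately have "(\<Sum>\<psi>\<in>N. pi * (m \<psi> (p / l) + m \<psi> (- (p / l))) * phi p - \<epsilon>) \<le>
        (real q - 2) * (2 * pi * (1 + \<beta>) + digamma_err / l) + 256 * pi * real q / l" by linarith
    moreover have "(\<Sum>\<psi>\<in>N. pi * (m \<psi> (p / l) + m \<psi> (- (p / l))) * phi p - \<epsilon>) = 2 * pi * M * phi p - e"
    proof -
      have "(\<Sum>\<psi>\<in>N. pi * (m \<psi> (p / l) + m \<psi> (- (p / l))) * phi p - \<epsilon>) = pi * (M + M) * phi p - real (card N) * \<epsilon>"
        unfolding sum_subtractf sum_distrib_right[symmetric] sum_distrib_left[symmetric] sum.distrib M' M_def[symmetric] by simp
      then show ?thesis using q2 by (simp add: cardN \<epsilon>_def)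
    qed
    ultimately show ?thesis by linarith
  qed
  define X where "X = (digamma_err + 256 * pi) * real q / l"
  have X0: "X \<ge> 0" using digamma_err_nonneg l by (simp add: X_def)
  \<comment> \<open>This is \<open>2 * pi * phi p\<close>. Since \<open>K \<ge> 1\<close>, dividing
    by it may be skipped for the error \<open>X\<close>, which keeps the error constant
    simple.\<close>
  define K where "K = 4 * pi * (1 + \<beta>)\<^sup>2"
  have K1: "K \<ge> 1"
  proof -
    have "1 \<le> (1 + \<beta>)\<^sup>2" using \<beta>0 by (simp add: one_le_power)
    moreover have "4 * pi \<ge> 1" using pi_gt3 by simp
    ultimately have "1 * 1 \<le> 4 * pi * (1 + \<beta>)\<^sup>2" by (intro mult_mono) auto
    then show ?thesis by (simp add: K_def)
  qed
  have "2 * pi * M * phi p \<le> (real q - 2) * (2 * pi * (1 + \<beta>) + digamma_err / l) + 256 * pi * real q / l"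
    by (rule field_le_epsilon[OF key])
  also have "\<dots> = (real q - 2) * (2 * pi * (1 + \<beta>)) + ((real q - 2) * (digamma_err / l) + 256 * pi * real q / l)"
    by (simp add: distrib_left)
  also have "(real q - 2) * (digamma_err / l) \<le> real q * (digamma_err / l)"
    using digamma_err_nonneg l by (intro mult_right_mono) auto
  also have "real q * (digamma_err / l) + 256 * pi * real q / l = X"
    using l by (simp add: X_def field_simps)
  finally have "K * M \<le> (real q - 2) * (2 * pi * (1 + \<beta>)) + X"
    unfolding phi_at_p \<beta>_def[symmetric] K_def by (simp add: mult_ac)
  also have "(real q - 2) * (2 * pi * (1 + \<beta>)) = K * ((real q - 2) / (2 * (1 + \<beta>)))"
    using \<beta>0 by (simp add: K_def power2_eq_square field_simps)
  also have "K * ((real q - 2) / (2 * (1 + \<beta>))) + X \<le> K * ((real q - 2) / (2 * (1 + \<beta>))) + K * X"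
    using mult_right_mono[OF K1 X0] by simp
  also have "\<dots> = K * ((real q - 2) / (2 * (1 + \<beta>)) + X)" by (rule distrib_left[symmetric])
  finally have "M \<le> (real q - 2) / (2 * (1 + \<beta>)) + X" using K1 by (subst (asm) mult_le_cancel_left_pos) auto
  then show ?thesis unfolding M_def m_def N_def l_def X_def \<beta>_def .
qed

end

theorem theorem1:
  shows "(\<forall>t::real. t > 0 \<longrightarrow> (\<exists>C::real. \<exists>Q::nat. \<forall>q::nat.
            prime q \<and> q \<ge> Q \<and> GRH_mod q \<longrightarrow>
            (1 / (real q - 2)) * (\<Sum>\<psi>\<in>nonprincipal_chars q.
                real_of_int (zorder (\<lambda>s. dirichlet_L q \<psi> (s + 2 * pi * \<i> * of_real t / of_real (ln (real q)))) (1/2)))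
            \<le> 1/2 * inverse (1 + \<bar>sin (4 * pi * t) / (4 * pi * t)\<bar>) + C / ln (real q)))
      \<and> (\<forall>t::real. \<forall>\<epsilon>::real. t > 0 \<longrightarrow> \<epsilon> > 0 \<longrightarrow> (\<exists>Q::nat. \<forall>q::nat.
            prime q \<and> q \<ge> Q \<and> GRH_mod q \<longrightarrow>
            real (card {\<psi>\<in>nonprincipal_chars q.
                dirichlet_L q \<psi> (1/2 + 2 * pi * \<i> * of_real t / of_real (ln (real q))) \<noteq> 0})
              / (real q - 2)
            \<ge> 1 - 1/2 * inverse (1 + \<bar>sin (4 * pi * t) / (4 * pi * t)\<bar>) - \<epsilon>))"
proof -
  define Z where "Z q t \<psi> = zorder (\<lambda>s. dirichlet_L q \<psi> (s + 2 * pi * \<i> * of_real t / of_real (ln (real q)))) (1/2)" for q \<psi> and t :: real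
  have avg: "\<exists>C::real. \<exists>Q::nat. \<forall>q::nat. prime q \<and> q \<ge> Q \<and> GRH_mod q \<longrightarrow>
      (1 / (real q - 2)) * (\<Sum>\<psi>\<in>nonprincipal_chars q. real_of_int (Z q t \<psi>))
        \<le> 1/2 * inverse (1 + \<bar>sin (4 * pi * t) / (4 * pi * t)\<bar>) + C / ln (real q)" if t: "t > 0" for t :: real
  proof -
    define p where "p = 2 * pi * t"
    \<comment> \<open>The sign of the sine, so that \<open>\<sigma> * bb\<close> is the absolute
      value in the statement; \<open>bb\<close> is taken at
      \<open>2 * p = 4 * pi * t\<close>.\<close>
    define \<sigma> :: real where "\<sigma> = (if sin (4 * pi * t) \<ge> 0 then 1 else -1)"
    have p: "p > 0" using t by (simp add: p_def)
    interpret test_function p \<sigma> using p by unfold_locales (auto simp: \<sigma>_def)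
    define \<beta> where "\<beta> = \<bar>sin (4 * pi * t) / (4 * pi * t)\<bar>"
    have "2 * p = 4 * pi * t" by (simp add: p_def)
    then have \<beta>: "\<sigma> * bb = \<beta>" unfolding bb_def \<beta>_def using t by (simp only: \<sigma>_def abs_divide) (simp add: mult.assoc)
    have \<beta>0: "\<beta> \<ge> 0" by (simp add: \<beta>_def)
    define D where "D = digamma_err + 256 * pi"
    have D0: "D \<ge> 0" using digamma_err_nonneg by (simp add: D_def)
    \<comment> \<open>Equivalent to \<open>ln (q / pi) \<ge> 1 + 2 * logsum\<close>, the balance
      behind positivity, together with \<open>q \<ge> 3\<close>.\<close>
    define Q where "Q = max 3 (nat \<lceil>pi * exp (1 + 2 * logsum)\<rceil>)"
    have "(1 / (real q - 2)) * (\<Sum>\<psi>\<in>nonprincipal_chars q. real_of_int (Z q t \<psi>)) \<le> 1/2 * inverse (1 + \<beta>) + 3 * D / ln (real q)"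
      if q: "prime q" "q \<ge> Q" "GRH_mod q" for q
    proof -
      have q3: "q \<ge> 3" using q(2) by (simp add: Q_def)
      have q2: "real q - 2 > 0" using q3 by simp
      have l: "ln (real q) > 0" using q3 by simp
      have "pi * exp (1 + 2 * logsum) \<le> real q" using q(2) unfolding Q_def by linarith
      then have "exp (1 + 2 * logsum) \<le> real q / pi" by (simp add: pos_le_divide_eq mult.commute)
      then have ql: "ln (real q / pi) \<ge> 1 + 2 * logsum" using q3 by (subst ln_ge_iff) auto
      have zeq: "Z q t \<psi> = zorder (abel_series \<psi>) (of_real (1/2) + \<i> * of_real (p / ln (real q)))" if "\<psi> \<in> nonprincipal_chars q" for \<psi>
      proof -
        interpret nonprincipal_char q \<psi> using q(1) that by (rule nonprincipal_charsD)
        have a: "2 * pi * \<i> * of_real t / of_real (ln (real q)) = \<i> * of_real (p / ln (real q))" by (simp add: p_def)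
        have "Re (1/2 + \<i> * of_real (p / ln (real q))) > 0" by simp
        from zorder_dirichlet_L_shift[OF this] show ?thesis unfolding Z_def a by simp
      qed
      have "(\<Sum>\<psi>\<in>nonprincipal_chars q. real_of_int (Z q t \<psi>)) \<le> (real q - 2) / (2 * (1 + \<beta>)) + D * real q / ln (real q)"
        using sum_zorder_le[OF q(1) q3 q(3) ql] \<beta>0 unfolding \<beta> D_def by (simp add: zeq)
      then have "(1 / (real q - 2)) * (\<Sum>\<psi>\<in>nonprincipal_chars q. real_of_int (Z q t \<psi>)) \<le> (1 / (real q - 2)) * ((real q - 2) / (2 * (1 + \<beta>)) + D * real q / ln (real q))"
        using q2 by (intro mult_left_mono) auto
      also have "\<dots> = 1/2 * inverse (1 + \<beta>) + (real q / (real q - 2)) * (D / ln (real q))"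
      proof -
        have "(1 / (real q - 2)) * ((real q - 2) / (2 * (1 + \<beta>))) = 1/2 * inverse (1 + \<beta>)"
          using q2 by (simp add: inverse_eq_divide)
        moreover have "(1 / (real q - 2)) * (D * real q / ln (real q)) = (real q / (real q - 2)) * (D / ln (real q))"
          by (simp add: mult.commute)
        ultimately show ?thesis by (simp only: distrib_left)
      qed
      \<comment> \<open>For \<open>q \<ge> 3\<close> the ratio \<open>q / (q - 2)\<close> is largest
        at 3, where it equals 3.\<close>
      also have "(real q / (real q - 2)) * (D / ln (real q)) \<le> 3 * (D / ln (real q))"
        using q2 q3 l D0 by (intro mult_right_mono) (auto simp: pos_divide_le_eq)
      finally show ?thesis by simp
    qed
    then show ?thesis unfolding \<beta>_def by (intro exI[of _ "3 * D"] exI[of _ Q]) blast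
  qed
  have proportion: "\<exists>Q::nat. \<forall>q::nat. prime q \<and> q \<ge> Q \<and> GRH_mod q \<longrightarrow>
      real (card {\<psi>\<in>nonprincipal_chars q. dirichlet_L q \<psi> (1/2 + 2 * pi * \<i> * of_real t / of_real (ln (real q))) \<noteq> 0}) / (real q - 2)
        \<ge> 1 - 1/2 * inverse (1 + \<bar>sin (4 * pi * t) / (4 * pi * t)\<bar>) - \<epsilon>" if t: "t > 0" and \<epsilon>: "\<epsilon> > 0" for t \<epsilon> :: real
  proof -
    define B where "B = 1/2 * inverse (1 + \<bar>sin (4 * pi * t) / (4 * pi * t)\<bar>)"
    obtain C Q where CQ: "\<And>q. prime q \<and> q \<ge> Q \<and> GRH_mod q \<Longrightarrow>
        (1 / (real q - 2)) * (\<Sum>\<psi>\<in>nonprincipal_chars q. real_of_int (Z q t \<psi>)) \<le> B + C / ln (real q)"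
      using avg[OF t] unfolding B_def by blast
    \<comment> \<open>From here on \<open>C / ln q\<close> is at most \<open>\<epsilon>\<close>; the
      absolute value makes the bound meaningful whatever the sign of \<open>C\<close>.\<close>
    define Q' where "Q' = max (max 3 Q) (nat \<lceil>exp (\<bar>C\<bar> / \<epsilon>)\<rceil>)"
    have "real (card {\<psi>\<in>nonprincipal_chars q. dirichlet_L q \<psi> (1/2 + 2 * pi * \<i> * of_real t / of_real (ln (real q))) \<noteq> 0}) / (real q - 2) \<ge> 1 - B - \<epsilon>"
      if q: "prime q" "q \<ge> Q'" "GRH_mod q" for q
    proof -
      let ?N = "nonprincipal_chars q" and ?a = "2 * pi * \<i> * of_real t / of_real (ln (real q))"
      let ?v = "\<lambda>\<psi>. dirichlet_L q \<psi> (1/2 + ?a)"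
      have q3: "q \<ge> 3" "q \<ge> Q" using q(2) by (auto simp: Q'_def)
      have q2: "real q - 2 > 0" using q3 by simp
      have l: "ln (real q) > 0" using q3 by simp
      have "exp (\<bar>C\<bar> / \<epsilon>) \<le> real q" using q(2) unfolding Q'_def by linarith
      then have "\<bar>C\<bar> / \<epsilon> \<le> ln (real q)" using q3 by (subst ln_ge_iff) auto
      then have "\<bar>C\<bar> / ln (real q) \<le> \<epsilon>" using \<epsilon> l by (simp add: pos_divide_le_eq mult.commute)
      moreover have "C / ln (real q) \<le> \<bar>C\<bar> / ln (real q)" using l by (intro divide_right_mono) auto
      ultimately have Ce: "C / ln (real q) \<le> \<epsilon>" by linarith
      have fin: "finite ?N" and card: "real (card ?N) = real q - 2"
        using finite_nonprincipal_chars[OF q(1)] card_nonprincipal_chars[OF q(1)] q3 by auto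
      have "real (card {\<psi>\<in>?N. ?v \<psi> = 0}) = (\<Sum>\<psi>\<in>?N. if ?v \<psi> = 0 then 1 else 0)"
        using fin by (simp add: sum.If_cases Int_def)
      \<comment> \<open>A character whose L-function vanishes at the point contributes at least 1 to
        the sum of orders, and the others contribute a nonnegative amount.\<close>
      also have "\<dots> \<le> (\<Sum>\<psi>\<in>?N. real_of_int (Z q t \<psi>))"
      proof (rule sum_mono)
        fix \<psi> assume "\<psi> \<in> ?N"
        then interpret nonprincipal_char q \<psi> using q(1) by (intro nonprincipal_charsD)
        have "(if ?v \<psi> = 0 then 1 else 0) \<le> Z q t \<psi>" unfolding Z_def by (rule zorder_dirichlet_L_ge)
        then have "real_of_int (if ?v \<psi> = 0 then 1 else 0) \<le> real_of_int (Z q t \<psi>)" by (simp only: of_int_le_iff)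
        then show "(if ?v \<psi> = 0 then 1 else 0) \<le> real_of_int (Z q t \<psi>)"
          by (simp only: if_distrib[of real_of_int] of_int_0 of_int_1)
      qed
      finally have z: "real (card {\<psi>\<in>?N. ?v \<psi> = 0}) \<le> (\<Sum>\<psi>\<in>?N. real_of_int (Z q t \<psi>))" .
      have "(\<Sum>\<psi>\<in>?N. real_of_int (Z q t \<psi>)) / (real q - 2) \<le> B + \<epsilon>"
        using CQ[of q] q q3 Ce by simp
      then have "real (card {\<psi>\<in>?N. ?v \<psi> = 0}) / (real q - 2) \<le> B + \<epsilon>"
        using divide_right_mono[OF z, of "real q - 2"] q2 by linarith
      moreover have "real (card {\<psi>\<in>?N. ?v \<psi> \<noteq> 0}) = (real q - 2) - real (card {\<psi>\<in>?N. ?v \<psi> = 0})"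
      proof -
        have "card ?N = card {\<psi>\<in>?N. ?v \<psi> = 0} + card {\<psi>\<in>?N. ?v \<psi> \<noteq> 0}"
          using fin by (subst card_Un_disjoint[symmetric]) (auto intro: arg_cong[of _ _ card])
        then show ?thesis using card by linarith
      qed
      then have "real (card {\<psi>\<in>?N. ?v \<psi> \<noteq> 0}) / (real q - 2) = 1 - real (card {\<psi>\<in>?N. ?v \<psi> = 0}) / (real q - 2)"
        using q2 by (simp add: diff_divide_distrib)
      ultimately show ?thesis by linarith
    qed
    then show ?thesis unfolding B_def by (intro exI[of _ Q']) blast
  qed
  show ?thesis using avg proportion unfolding Z_def by blast
qed

end
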